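(* Let $(K,v)$ be an arbitrary valued field with residue field $k$ and henselization $K^h$. Let $g\in K[x]$ be monic and square-free, such that $\mathrm{char}(k)\nmid\deg(g)$. Then the following procedure terminates in $\log(\deg(g))$ steps, and it returns True if and only if $g$ is irreducible in $K^h[x]$. Start with $\mu:=v$, $\phi:=x$, $n:=\deg(g)$. While $n>1$ do: 1. If $N_{\mu,\phi}(g)$ is one-sided, of slope $-\lambda$, replace $\mu$ by $[\mu;\phi,\lambda]$; otherwise return False. 2. (With the new $\mu$.) If $R_{\mu,\phi}(g)=\psi^m$ for some monic irreducible $\psi\in\kappa(\mu)[y]$, replace $\phi$ by the approximate root $\sqrt[m]{g}$; otherwise return False. 3. Replace $n$ by $m$. When the loop ends, return True.
   Context: **Setting.** $(K,v)$ is a valued field, residue field $k$, $\Gamma=v(K^* )$, $\Gamma_{\mathbb Q}=\Gamma\otimes\mathbb Q$; $K^h$ is a henselization of $(K,v)$. $\mathcal T$ is the set of valuations $\mu:K[x]\to\Gamma_{\mathbb Q}\cup\{\infty\}$ with $\mu|_K=v$, ordered pointwise; inner nodes are its non-maximal elements. **Key polynomials.** $\mathcal G_\mu=\bigoplus_\alpha\{f:\mu(f)\ge\alpha\}/\{f:\mu(f)>\alpha\}$; $\mathrm{in}_\mu f$ is the class of $f$ in degree $\mu(f)$. $h\mid_\mu f$ means $\mathrm{in}_\mu h\mid\mathrm{in}_\mu f$ in $\mathcal G_\mu$. $\mathrm{KP}(\mu)$ is the set of monic $\phi$ with $\mathrm{in}_\mu\phi$ a prime element and $\phi\nmid_\mu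 f$ for all nonzero $f$ with $\deg f<\deg\phi$. **Augmentations.** $[v;x,\lambda]$ is the valuation $\sum a_nx^n\mapsto\min\{v(a_n)+n\lambda\}$. For $\phi\in\mathrm{KP}(\mu)$, $\lambda>\mu(\phi)$, $[\mu;\phi,\lambda]$ is the valuation $\sum a_n\phi^n\mapsto\min\{\mu(a_n)+n\lambda\}$ ($\deg a_n<\deg\phi$); $\phi$ is then a key polynomial of minimal degree for $[\mu;\phi,\lambda]$ (and $x$ is one for $[v;x,\lambda]$). **Newton polygons.** For $g=\sum a_n\phi^n$ ($\deg a_n<\deg\phi$), $N_{\mu,\phi}(g)\subset\mathbb Q\times\Gamma_{\mathbb Q}$ is the lower convex hull of $\{(n,\mu(a_n)):a_n\ne0\}$; $N_{v,x}(g)$ is the lower convex hull of $\{(n,v(a_n)):a_n\neq0\}$ for $g=\sum a_nx^n$. It is one-sided of slope $-\lambda$ if it is a single segment of slope $-\lambda$ and positive length whose left endpoint has abscissa $0$. **Residual polynomial.** Let $\phi$ be a key polynomial of minimal degree for an inner node $\mu$, $e$ the least positive integer with $e\mu(\phi)$ in the group $\{\mu(a):a\neq0,\deg a<\deg\phi\}$, and $u$ a fixed (arbitrary) homogeneous unit of $\mathcal G_\mu$ of degree $e\mu(\phi)$. Let $\kappa(\mu)$ be the relative algebraic closure of $k$ in the residue field of $\mu$; $\kappa(\mu)^*$ is identified with the group of homogeneous units of degree $0$ of $\mathcal G_\mu$. For $h=\sum a_n\phi^n\ne0$ ($\deg a_n<\deg\phi$) let $S=\{n:\mu(a_n\phi^n)=\mu(h)\}$,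 $\ell_0=\min S$, $\ell=\max S$; then $S\subset\{\ell_j=\ell_0+je:0\le j\le d\}$ with $\ell=\ell_0+de$, and $R_{\mu,\phi}(h)=\sum_{j=0}^d\zeta_jy^j\in\kappa(\mu)[y]$, with $\zeta_j=(\mathrm{in}_\mu a_\ell)^{-1}u^{j-d}\,\mathrm{in}_\mu a_{\ell_j}$ if $\ell_j\in S$ and $\zeta_j=0$ otherwise. **Approximate root.** If $m\mid\deg g$ and $\mathrm{char}(K)\nmid m$, $\sqrt[m]{g}$ is the unique monic $Q\in K[x]$ of degree $\deg(g)/m$ such that in the $Q$-expansion $g=Q^m+a_{m-1}Q^{m-1}+\cdots+a_0$ ($\deg a_i<\deg Q$) one has $a_{m-1}=0$.
   Formalization: The bound "log(deg(g)) steps" is stated as at most 1 + log_2(deg(g)) executions of the loop body, since the literal bound fails: for the p-adic valuation on Q (p odd), g = (x-1)^2 - p needs two steps. *)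

theory Defs
  imports
    Complex_Main
    "HOL-Algebra.Algebraic_Closure_Type"
    "HOL-Library.Poly_Mapping"
begin

section \<open>Values\<close>

text \<open>Linearly ordered vector spaces over the rationals; \<open>\<Gamma>\<otimes>\<rat>\<close> is such a space, and it is
  pinned down as the one spanned by \<open>\<Gamma>\<close>, see \<open>divisible_hull_of_values\<close>.\<close>

class linordered_rat_vector = linordered_ab_group_add +
  fixes scaleQ :: "rat \<Rightarrow> 'a \<Rightarrow> 'a"  (infixr \<open>*\<^sub>Q\<close> 75)
  assumes scaleQ_add_right: "q *\<^sub>Q (x + y) = q *\<^sub>Q x + q *\<^sub>Q y"
    and scaleQ_add_left: "(q + r) *\<^sub>Q x = q *\<^sub>Q x + r *\<^sub>Q x"
    and scaleQ_scaleQ: "q *\<^sub>Q (r *\<^sub>Q x) = (q * r) *\<^sub>Q x"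
    and scaleQ_one: "1 *\<^sub>Q x = x"

datatype 'g extval = Fin (the_fin: 'g) | Infty

instantiation extval :: (linorder) linorder
begin

definition less_eq_extval :: "'a extval \<Rightarrow> 'a extval \<Rightarrow> bool" where
  "x \<le> y \<longleftrightarrow> (case y of Infty \<Rightarrow> True | Fin b \<Rightarrow> (case x of Infty \<Rightarrow> False | Fin a \<Rightarrow> a \<le> b))"

definition less_extval :: "'a extval \<Rightarrow> 'a extval \<Rightarrow> bool" where
  "x < y \<longleftrightarrow> (case x of Infty \<Rightarrow> False | Fin a \<Rightarrow> (case y of Infty \<Rightarrow> True | Fin b \<Rightarrow> a < b))"

instance
  by standard (auto simp: less_eq_extval_def less_extval_def split: extval.splits)

end

instantiation extval :: (comm_monoid_add) comm_monoid_add
begin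

definition zero_extval :: "'a extval" where
  "0 = Fin 0"

definition plus_extval :: "'a extval \<Rightarrow> 'a extval \<Rightarrow> 'a extval" where
  "x + y = (case x of Infty \<Rightarrow> Infty
            | Fin a \<Rightarrow> (case y of Infty \<Rightarrow> Infty | Fin b \<Rightarrow> Fin (a + b)))"

instance
  by standard (auto simp: zero_extval_def plus_extval_def add_ac split: extval.splits)

end


section \<open>Valuations\<close>

text \<open>The kernel \<open>{f. \<mu> f = Infty}\<close> is allowed to be nonzero; over a field it is automatically zero.\<close>

definition is_valuation :: "('r::comm_ring_1 \<Rightarrow> 'g::linordered_ab_group_add extval) \<Rightarrow> bool" where
  "is_valuation \<mu> \<longleftrightarrow> \<mu> 0 = Infty \<and> \<mu> 1 = 0 \<and>
     (\<forall>f h. \<mu> (f * h) = \<mu> f + \<mu> h) \<and> (\<forall>f h. min (\<mu> f) (\<mu> h) \<le> \<mu> (f + h))"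

definition divisible_hull_of_values ::
    "('a::field \<Rightarrow> 'g::linordered_rat_vector extval) \<Rightarrow> bool" where
  "divisible_hull_of_values v \<longleftrightarrow>
     (\<forall>\<gamma>. \<exists>n a. 0 < n \<and> a \<noteq> 0 \<and> v a = Fin (of_nat n *\<^sub>Q \<gamma>))"

definition val_tree ::
    "('a::field \<Rightarrow> 'g::linordered_rat_vector extval) \<Rightarrow> ('a poly \<Rightarrow> 'g extval) set" where
  "val_tree v = {\<mu>. is_valuation \<mu> \<and> (\<forall>a. \<mu> [:a:] = v a)}"

definition inner_node ::
    "('a::field \<Rightarrow> 'g::linordered_rat_vector extval) \<Rightarrow> ('a poly \<Rightarrow> 'g extval) \<Rightarrow> bool" where
  "inner_node v \<mu> \<longleftrightarrow> \<mu> \<in> val_tree v \<and> (\<exists>\<nu>\<in>val_tree v. \<mu> < \<nu>)"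

abbreviation subring_of :: "'r::comm_ring_1 set \<Rightarrow> 'r ring" where
  "subring_of S \<equiv> ring_of_type_algebra\<lparr>carrier := S\<rparr>"

definition val_ring :: "('f::field \<Rightarrow> 'g::linordered_ab_group_add extval) \<Rightarrow> 'f ring" where
  "val_ring w = subring_of {z. 0 \<le> w z}"

definition max_ideal :: "('f::field \<Rightarrow> 'g::linordered_ab_group_add extval) \<Rightarrow> 'f set" where
  "max_ideal w = {z. 0 < w z}"

definition residue_field :: "('f::field \<Rightarrow> 'g::linordered_ab_group_add extval) \<Rightarrow> 'f set ring" where
  "residue_field w = val_ring w Quot max_ideal w"

definition residue :: "('f::field \<Rightarrow> 'g::linordered_ab_group_add extval) \<Rightarrow> 'f \<Rightarrow> 'f set" where
  "residue w z = max_ideal w +>\<^bsub>val_ring w\<^esub> z"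

definition ring_char :: "('b, 'm) ring_scheme \<Rightarrow> nat" where
  "ring_char R = Gcd {n. [n] \<cdot>\<^bsub>R\<^esub> \<one>\<^bsub>R\<^esub> = \<zero>\<^bsub>R\<^esub>}"


section \<open>The graded algebra and key polynomials\<close>

text \<open>With \<open>P\<^sub>\<alpha> = {f. \<mu> f \<ge> \<alpha>}\<close> and \<open>Q\<^sub>\<alpha> = {f. \<mu> f > \<alpha>}\<close>, the graded algebra \<open>\<Oplus> P\<^sub>\<alpha>/Q\<^sub>\<alpha>\<close> is formed as
  \<open>(\<Oplus> P\<^sub>\<alpha>) / (\<Oplus> Q\<^sub>\<alpha>)\<close>. A family in \<open>\<Oplus> P\<^sub>\<alpha>\<close> is an element of the monoid algebra
  \<open>'g \<Rightarrow>\<^sub>0 'a poly\<close>, whose convolution product is the multiplication of the direct sum.\<close>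

definition filtration_sum ::
    "('a::field poly \<Rightarrow> 'g::linordered_ab_group_add extval) \<Rightarrow> ('g \<Rightarrow>\<^sub>0 'a poly) ring" where
  "filtration_sum \<mu> = subring_of {F. \<forall>\<alpha>. Fin \<alpha> \<le> \<mu> (Poly_Mapping.lookup F \<alpha>)}"

definition filtration_ideal ::
    "('a::field poly \<Rightarrow> 'g::linordered_ab_group_add extval) \<Rightarrow> ('g \<Rightarrow>\<^sub>0 'a poly) set" where
  "filtration_ideal \<mu> = {F. \<forall>\<alpha>. Fin \<alpha> < \<mu> (Poly_Mapping.lookup F \<alpha>)}"

definition graded_algebra ::
    "('a::field poly \<Rightarrow> 'g::linordered_ab_group_add extval) \<Rightarrow> ('g \<Rightarrow>\<^sub>0 'a poly) set ring" where
  "graded_algebra \<mu> = filtration_sum \<mu> Quot filtration_ideal \<mu>"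

definition graded_class ::
    "('a::field poly \<Rightarrow> 'g::linordered_ab_group_add extval) \<Rightarrow> 'g \<Rightarrow> 'a poly \<Rightarrow> ('g \<Rightarrow>\<^sub>0 'a poly) set" where
  "graded_class \<mu> \<alpha> f = filtration_ideal \<mu> +>\<^bsub>filtration_sum \<mu>\<^esub> Poly_Mapping.single \<alpha> f"

definition initial_form ::
    "('a::field poly \<Rightarrow> 'g::linordered_ab_group_add extval) \<Rightarrow> 'a poly \<Rightarrow> ('g \<Rightarrow>\<^sub>0 'a poly) set" where
  "initial_form \<mu> f =
     (case \<mu> f of Fin \<alpha> \<Rightarrow> graded_class \<mu> \<alpha> f | Infty \<Rightarrow> \<zero>\<^bsub>graded_algebra \<mu>\<^esub>)"

definition homogeneous_units ::
    "('a::field poly \<Rightarrow> 'g::linordered_ab_group_add extval) \<Rightarrow> 'g \<Rightarrow> ('g \<Rightarrow>\<^sub>0 'a poly) set set" where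
  "homogeneous_units \<mu> \<alpha> = {z \<in> Units (graded_algebra \<mu>). \<exists>f. Fin \<alpha> \<le> \<mu> f \<and> z = graded_class \<mu> \<alpha> f}"

definition val_dvd ::
    "('a::field poly \<Rightarrow> 'g::linordered_ab_group_add extval) \<Rightarrow> 'a poly \<Rightarrow> 'a poly \<Rightarrow> bool" where
  "val_dvd \<mu> h f \<longleftrightarrow> initial_form \<mu> h divides\<^bsub>graded_algebra \<mu>\<^esub> initial_form \<mu> f"

definition key_polys ::
    "('a::field poly \<Rightarrow> 'g::linordered_ab_group_add extval) \<Rightarrow> 'a poly set" where
  "key_polys \<mu> = {\<phi>. Polynomial.lead_coeff \<phi> = 1 \<and>
     ring_prime\<^bsub>graded_algebra \<mu>\<^esub> (initial_form \<mu> \<phi>) \<and>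
     (\<forall>f. f \<noteq> 0 \<and> Polynomial.degree f < Polynomial.degree \<phi> \<longrightarrow> \<not> val_dvd \<mu> \<phi> f)}"

definition min_key_polys ::
    "('a::field poly \<Rightarrow> 'g::linordered_ab_group_add extval) \<Rightarrow> 'a poly set" where
  "min_key_polys \<mu> =
     {\<phi> \<in> key_polys \<mu>. \<forall>\<chi>\<in>key_polys \<mu>. Polynomial.degree \<phi> \<le> Polynomial.degree \<chi>}"


section \<open>Expansions, augmentations and Newton polygons\<close>

text \<open>The \<open>n\<close>-th coefficient of the \<open>\<phi>\<close>-expansion of \<open>f\<close>, for nonconstant \<open>\<phi>\<close>.\<close>

definition expansion_coeff :: "'a::field poly \<Rightarrow> 'a poly \<Rightarrow> nat \<Rightarrow> 'a poly" where
  "expansion_coeff \<phi> f n = (f div \<phi> ^ n) mod \<phi>"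

text \<open>Coefficients of index above \<open>degree f\<close> vanish and so do not affect the minimum.\<close>

definition augment ::
    "('a::field poly \<Rightarrow> 'g::linordered_rat_vector extval) \<Rightarrow> 'a poly \<Rightarrow> 'g \<Rightarrow> 'a poly \<Rightarrow> 'g extval" where
  "augment \<mu> \<phi> lam f =
     Min ((\<lambda>n. \<mu> (expansion_coeff \<phi> f n) + Fin (of_nat n *\<^sub>Q lam)) ` {..Polynomial.degree f})"

text \<open>The starting point \<open>v\<close> of the procedure is not a valuation on polynomials. In
  \<open>[v; x, lam]\<close> and in the Newton polygon with respect to \<open>v, x\<close> it is applied only to the
  coefficients of \<open>x\<close>-expansions, which are constant polynomials (\<open>expansion_coeff_x\<close>,
  \<open>augment_ground\<close>); \<open>ground v\<close> is \<open>v\<close> read on these, its other values are never used.\<close>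

definition ground :: "('a::field \<Rightarrow> 'g extval) \<Rightarrow> 'a poly \<Rightarrow> 'g extval" where
  "ground v f = v (coeff f 0)"

lemma expansion_coeff_x: "expansion_coeff [:0, 1:] f n = [:coeff f n:]"
proof -
  have split: "pCons a p = [:a:] + p * [:0, 1:]" for a :: 'a and p
    by simp
  have quot: "pCons a p div [:0, 1:] = p" for a :: 'a and p
    unfolding split[of a p] by (subst div_mult_self1) (simp_all add: div_poly_less)
  have rest: "pCons a p mod [:0, 1:] = [:a:]" for a :: 'a and p
    unfolding split[of a p] by (subst mod_mult_self1) (simp add: mod_poly_less)
  show ?thesis
  proof (induction n arbitrary: f)
    case 0
    show ?case
      by (cases f) (simp add: expansion_coeff_def rest)
  next
    case (Suc n)
    obtain a p where f: "f = pCons a p" by (cases f)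
    then have "f div [:0, 1:] ^ Suc n = p div [:0, 1:] ^ n"
      by (simp only: power_Suc poly_div_mult_right quot)
    then show ?case
      using Suc.IH[of p] by (simp only: expansion_coeff_def f coeff_pCons_Suc)
  qed
qed

lemma augment_ground:
  "augment (ground v) [:0, 1:] lam f =
     Min ((\<lambda>n. v (coeff f n) + Fin (of_nat n *\<^sub>Q lam)) ` {..Polynomial.degree f})"
  by (simp add: augment_def ground_def expansion_coeff_x)

definition rat_convex_hull :: "(rat \<times> 'g::linordered_rat_vector) set \<Rightarrow> (rat \<times> 'g) set" where
  "rat_convex_hull C = {((\<Sum>p\<in>T. t p * fst p), (\<Sum>p\<in>T. t p *\<^sub>Q snd p)) | T t.
     finite T \<and> T \<subseteq> C \<and> (\<forall>p\<in>T. 0 \<le> t p) \<and> sum t T = 1}"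

definition lower_convex_hull :: "(rat \<times> 'g::linordered_rat_vector) set \<Rightarrow> (rat \<times> 'g) set" where
  "lower_convex_hull C =
     {(s, \<gamma>) \<in> rat_convex_hull C. \<forall>\<gamma>'. (s, \<gamma>') \<in> rat_convex_hull C \<longrightarrow> \<gamma> \<le> \<gamma>'}"

definition newton_polygon ::
    "('a::field poly \<Rightarrow> 'g::linordered_rat_vector extval) \<Rightarrow> 'a poly \<Rightarrow> 'a poly \<Rightarrow> (rat \<times> 'g) set" where
  "newton_polygon \<mu> \<phi> g = lower_convex_hull
     {(of_nat n, \<gamma>) | n \<gamma>. expansion_coeff \<phi> g n \<noteq> 0 \<and> \<mu> (expansion_coeff \<phi> g n) = Fin \<gamma>}"

definition one_sided :: "(rat \<times> 'g::linordered_rat_vector) set \<Rightarrow> 'g \<Rightarrow> bool" where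
  "one_sided N lam \<longleftrightarrow> (\<exists>\<gamma> len. 0 < len \<and> N = {(s, \<gamma> - s *\<^sub>Q lam) | s. 0 \<le> s \<and> s \<le> len})"


section \<open>Residual polynomials\<close>

text \<open>The extension of \<open>\<mu>\<close> to \<open>K(x)\<close>; meaningful when \<open>\<mu>\<close> has zero kernel, as inner nodes do.\<close>

definition fract_val ::
    "('a::field poly \<Rightarrow> 'g::linordered_ab_group_add extval) \<Rightarrow> 'a poly fract \<Rightarrow> 'g extval" where
  "fract_val \<mu> q = (THE \<gamma>. \<forall>f h. h \<noteq> 0 \<and> q = Fract f h \<longrightarrow> \<mu> f = \<gamma> + \<mu> h)"

definition base_residue_field ::
    "('a::field poly \<Rightarrow> 'g::linordered_ab_group_add extval) \<Rightarrow> 'a poly fract set set" where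
  "base_residue_field \<mu> = {residue (fract_val \<mu>) (Fract [:a:] 1) | a. 0 \<le> \<mu> [:a:]}"

definition kappa ::
    "('a::field poly \<Rightarrow> 'g::linordered_ab_group_add extval) \<Rightarrow> 'a poly fract set set" where
  "kappa \<mu> = {z \<in> carrier (residue_field (fract_val \<mu>)).
     (ring.algebraic (residue_field (fract_val \<mu>)) over base_residue_field \<mu>) z}"

definition kappa_polys ::
    "('a::field poly \<Rightarrow> 'g::linordered_ab_group_add extval) \<Rightarrow> 'a poly fract set list ring" where
  "kappa_polys \<mu> = univ_poly (residue_field (fract_val \<mu>)) (kappa \<mu>)"

text \<open>The canonical map from the degree-zero part of the graded algebra to the residue field, which
  identifies the homogeneous units of degree zero with the nonzero elements of \<open>kappa \<mu>\<close>.\<close>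

definition degree_zero_residue ::
    "('a::field poly \<Rightarrow> 'g::linordered_ab_group_add extval) \<Rightarrow> ('g \<Rightarrow>\<^sub>0 'a poly) set
      \<Rightarrow> 'a poly fract set" where
  "degree_zero_residue \<mu> z =
     the_elem ((\<lambda>f. residue (fract_val \<mu>) (Fract f 1)) ` {f. 0 \<le> \<mu> f \<and> z = graded_class \<mu> 0 f})"

definition rel_ramification ::
    "('a::field poly \<Rightarrow> 'g::linordered_rat_vector extval) \<Rightarrow> 'a poly \<Rightarrow> nat" where
  "rel_ramification \<mu> \<phi> = (LEAST e. 0 < e \<and>
     Fin (of_nat e *\<^sub>Q the_fin (\<mu> \<phi>)) \<in> \<mu> ` {a. a \<noteq> 0 \<and> Polynomial.degree a < Polynomial.degree \<phi>})"

definition unit_choice ::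
    "('a::field \<Rightarrow> 'g::linordered_rat_vector extval)
      \<Rightarrow> (('a poly \<Rightarrow> 'g extval) \<Rightarrow> 'a poly \<Rightarrow> ('g \<Rightarrow>\<^sub>0 'a poly) set) \<Rightarrow> bool" where
  "unit_choice v u \<longleftrightarrow> (\<forall>\<mu> \<phi>. inner_node v \<mu> \<and> \<phi> \<in> min_key_polys \<mu> \<longrightarrow>
     u \<mu> \<phi> \<in> homogeneous_units \<mu> (of_nat (rel_ramification \<mu> \<phi>) *\<^sub>Q the_fin (\<mu> \<phi>)))"

text \<open>Polynomials over \<open>kappa \<mu>\<close> are coefficient lists with the leading coefficient first,
  as in \<open>univ_poly\<close>.\<close>

definition residual_poly ::
    "('a::field poly \<Rightarrow> 'g::linordered_rat_vector extval) \<Rightarrow> 'a poly \<Rightarrow> ('g \<Rightarrow>\<^sub>0 'a poly) set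
      \<Rightarrow> 'a poly \<Rightarrow> 'a poly fract set list" where
  "residual_poly \<mu> \<phi> u h = (let
     G = graded_algebra \<mu>;
     a = expansion_coeff \<phi> h;
     e = rel_ramification \<mu> \<phi>;
     S = {n. \<mu> (a n * \<phi> ^ n) = \<mu> h};
     l0 = Min S; l = Max S; d = (l - l0) div e;
     \<zeta> = (\<lambda>j. if l0 + j * e \<in> S
              then inv\<^bsub>G\<^esub> (initial_form \<mu> (a l)) \<otimes>\<^bsub>G\<^esub> (u [^]\<^bsub>G\<^esub> (int j - int d))
                   \<otimes>\<^bsub>G\<^esub> initial_form \<mu> (a (l0 + j * e))
              else \<zero>\<^bsub>G\<^esub>)
   in map (\<lambda>j. degree_zero_residue \<mu> (\<zeta> j)) (rev [0..<Suc d]))"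

definition is_irreducible_power ::
    "('a::field poly \<Rightarrow> 'g::linordered_ab_group_add extval) \<Rightarrow> 'a poly fract set list \<Rightarrow> nat \<Rightarrow> bool" where
  "is_irreducible_power \<mu> R m \<longleftrightarrow> (\<exists>\<psi>\<in>carrier (kappa_polys \<mu>).
     ring_irreducible\<^bsub>kappa_polys \<mu>\<^esub> \<psi> \<and>
     Polynomials.lead_coeff \<psi> = \<one>\<^bsub>residue_field (fract_val \<mu>)\<^esub> \<and>
     R = \<psi> [^]\<^bsub>kappa_polys \<mu>\<^esub> m)"


section \<open>The procedure\<close>

definition approx_root :: "nat \<Rightarrow> 'a::field poly \<Rightarrow> 'a poly" where
  "approx_root m g = (THE Q. Polynomial.lead_coeff Q = 1 \<and>
     Polynomial.degree Q = Polynomial.degree g div m \<and> expansion_coeff Q g (m - 1) = 0)"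

text \<open>\<open>[\<mu>; \<phi>, lam]\<close> is defined, and \<open>\<phi>\<close> is a key polynomial of minimal degree for this inner node,
  as the definition of the residual polynomial requires.\<close>

definition augmentable ::
    "('a::field \<Rightarrow> 'g::linordered_rat_vector extval) \<Rightarrow> ('a poly \<Rightarrow> 'g extval) \<Rightarrow> 'a poly
      \<Rightarrow> 'g \<Rightarrow> bool" where
  "augmentable v \<mu> \<phi> lam \<longleftrightarrow>
     ((\<mu> = ground v \<and> \<phi> = [:0, 1:]) \<or> (\<mu> \<in> val_tree v \<and> \<phi> \<in> key_polys \<mu> \<and> \<mu> \<phi> < Fin lam)) \<and>
     inner_node v (augment \<mu> \<phi> lam) \<and> \<phi> \<in> min_key_polys (augment \<mu> \<phi> lam)"

text \<open>\<open>run v g u \<mu> \<phi> n s b\<close>: started in the state \<open>(\<mu>, \<phi>, n)\<close>, the loop halts after \<open>s\<close> executions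
  of its body (the last one possibly left by a return) and returns \<open>b\<close>. A state in which an
  operation to be performed is undefined admits no rule, so that having a run entails that all
  objects formed along the way are legitimate. Runs are deterministic: a one-sided polygon
  determines its slope, and a power of an irreducible polynomial determines the exponent.\<close>

inductive run ::
    "('a::field \<Rightarrow> 'g::linordered_rat_vector extval) \<Rightarrow> 'a poly
      \<Rightarrow> (('a poly \<Rightarrow> 'g extval) \<Rightarrow> 'a poly \<Rightarrow> ('g \<Rightarrow>\<^sub>0 'a poly) set)
      \<Rightarrow> ('a poly \<Rightarrow> 'g extval) \<Rightarrow> 'a poly \<Rightarrow> nat \<Rightarrow> nat \<Rightarrow> bool \<Rightarrow> bool"
  for v g u where
  loop_end:
    "\<not> n > 1 \<Longrightarrow> run v g u \<mu> \<phi> n 0 True"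
| not_one_sided:
    "n > 1 \<Longrightarrow> \<nexists>lam. one_sided (newton_polygon \<mu> \<phi> g) lam \<Longrightarrow> run v g u \<mu> \<phi> n 1 False"
| not_irreducible_power:
    "n > 1 \<Longrightarrow> one_sided (newton_polygon \<mu> \<phi> g) lam \<Longrightarrow> augmentable v \<mu> \<phi> lam \<Longrightarrow>
     \<mu>' = augment \<mu> \<phi> lam \<Longrightarrow>
     \<nexists>m. is_irreducible_power \<mu>' (residual_poly \<mu>' \<phi> (u \<mu>' \<phi>) g) m \<Longrightarrow>
     run v g u \<mu> \<phi> n 1 False"
| iterate:
    "n > 1 \<Longrightarrow> one_sided (newton_polygon \<mu> \<phi> g) lam \<Longrightarrow> augmentable v \<mu> \<phi> lam \<Longrightarrow>
     \<mu>' = augment \<mu> \<phi> lam \<Longrightarrow>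
     is_irreducible_power \<mu>' (residual_poly \<mu>' \<phi> (u \<mu>' \<phi>) g) m \<Longrightarrow>
     m dvd Polynomial.degree g \<Longrightarrow> \<not> CHAR('a) dvd m \<Longrightarrow>
     run v g u \<mu>' (approx_root m g) m s b \<Longrightarrow>
     run v g u \<mu> \<phi> n (Suc s) b"


section \<open>Henselizations\<close>

text \<open>The henselizations of \<open>(K, v)\<close> are the decomposition fields inside the separable closure,
  one for each extension \<open>w\<close> of \<open>v\<close> to the algebraic closure. Automorphisms of the separable
  closure over \<open>K\<close> are the restrictions of those of the algebraic closure.\<close>

definition extends_val ::
    "('a::field \<Rightarrow> 'g::linordered_ab_group_add extval) \<Rightarrow> ('a alg_closure \<Rightarrow> 'g extval) \<Rightarrow> bool" where
  "extends_val v w \<longleftrightarrow> is_valuation w \<and> (\<forall>a. w (to_ac a) = v a)"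

definition separable_closure :: "'a::field alg_closure set" where
  "separable_closure = {z. \<exists>p::'a poly. Factorial_Ring.irreducible p \<and>
     poly (map_poly to_ac p) z = 0 \<and> rsquarefree (map_poly to_ac p)}"

definition decomposition_group ::
    "('a::field alg_closure \<Rightarrow> 'g extval) \<Rightarrow> ('a alg_closure \<Rightarrow> 'a alg_closure) set" where
  "decomposition_group w = {\<sigma>. bij \<sigma> \<and> (\<forall>y z. \<sigma> (y + z) = \<sigma> y + \<sigma> z) \<and>
     (\<forall>y z. \<sigma> (y * z) = \<sigma> y * \<sigma> z) \<and> (\<forall>a. \<sigma> (to_ac a) = to_ac a) \<and> w \<circ> \<sigma> = w}"

definition henselization :: "('a::field alg_closure \<Rightarrow> 'g extval) \<Rightarrow> 'a alg_closure set" where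
  "henselization w = {z \<in> separable_closure. \<forall>\<sigma>\<in>decomposition_group w. \<sigma> z = z}"

definition polys_over :: "'b::field set \<Rightarrow> 'b poly ring" where
  "polys_over H = subring_of {p. \<forall>i. coeff p i \<in> H}"

end

(*
  Write nu_t f = w (f t) for a root t in the algebraic closure. A stage of the procedure is kept as a
  key polynomial phi together with a valuation V with kernel (phi) such that nu_t = V in degrees below
  deg phi for every root t of g. A one-sided Newton polygon gives phi the same value lam at all roots,
  and the residual polynomial R of g records, through the prime ideals
  I_t = {p. p = class of f for some f with nu_t f > M f}, how nu_t differs from M = [V; phi, lam]. If
  R = psi^m, any lift Q of psi is the next key polynomial, and Tschirnhausen's iteration moves a lift
  to the m-th approximate root without changing its residual polynomial. Unless the degree of phi
  grows, the approximate root would be phi itself, whence m < n after the first pass.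

  The loop ends with True iff the nu_t agree for all roots t of g: equal nu_t force a one-sided polygon
  and a power of an irreducible residual polynomial by comparing resultants, and at the end
  deg phi = deg g. Finally the nu_t agree iff the decomposition group permutes the roots transitively
  (extend isomorphisms preserving w by Zorn's lemma), i.e. iff g is irreducible over its fixed field.
*)

theory Submission imports Defs begin

section \<open>Values and valuations\<close>

text \<open>Factoring \<open>g\<close> over the henselization would need henselian theory at every
  pass. All conditions are therefore expressed by the functions nu_t, for one extension
  \<open>w\<close>; the henselization enters only at the end, through its Galois description.
  Working with \<open>V\<close> removes a special case: \<open>v\<close> is no valuation on K[x],
  but f |-> v(f(0)) is one, with kernel (x), so the first augmentation has the shape of all later
  ones. That [V; \<phi>, lam] is multiplicative rests on one inequality, \<open>carry\<close>; it
  replaces the condition lam > \<mu>(\<phi>), which makes no sense at the start. The hypothesis on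
  the residue characteristic acts in three places: v(m) = 0 allows Tschirnhausen's correction to be
  divided by m without loss of value; m \<noteq> 0 in K makes approximate roots unique; deg g
  \<noteq> 0 in K gives \<open>pderiv g \<noteq> 0\<close>, hence simple roots once g is irreducible
  over K. The logarithm has base 2 because m divides n, so m < n means 2m \<le> n. Only the first
  pass may keep n, since x need not be an approximate root of g; this is the summand 1 in the
  bound.\<close>

lemma extval_le [simp]:
  "x \<le> Infty" "Fin a \<le> Fin b \<longleftrightarrow> a \<le> b" "Infty \<le> x \<longleftrightarrow> x = Infty"
  by (auto simp: less_eq_extval_def split: extval.splits)

lemma extval_less [simp]:
  "\<not> Infty < x" "Fin a < Fin b \<longleftrightarrow> a < b" "x < Infty \<longleftrightarrow> x \<noteq> Infty"
  by (auto simp: less_extval_def split: extval.splits)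

lemma extval_add [simp]:
  "Fin a + Fin b = Fin (a + b)" "Infty + x = Infty" "x + Infty = Infty"
  by (auto simp: plus_extval_def split: extval.splits)

lemma Fin_zero [simp]: "Fin 0 = 0"
  by (simp add: zero_extval_def)

lemma Fin_eq_zero [simp]: "Fin a = 0 \<longleftrightarrow> a = 0" "0 = Fin a \<longleftrightarrow> 0 = a"
  by (auto simp: zero_extval_def simp del: Fin_zero)

lemma zero_cmp_Fin [simp]: "0 \<le> Fin a \<longleftrightarrow> 0 \<le> a" "0 < Fin a \<longleftrightarrow> 0 < a" "Fin a \<le> 0 \<longleftrightarrow> a \<le> 0"
    "Fin a < 0 \<longleftrightarrow> a < 0"
  by (auto simp: zero_extval_def simp del: Fin_zero)

lemma zero_neq_Infty [simp]: "0 \<noteq> Infty" "Infty \<noteq> 0"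
  by (auto simp: zero_extval_def simp del: Fin_zero)

lemma extval_add_eq_Infty [simp]: "x + y = Infty \<longleftrightarrow> x = Infty \<or> y = Infty"
  by (cases x; cases y) auto

instance extval :: (linordered_ab_group_add) ordered_comm_monoid_add
proof
  fix a b c :: "'a extval"
  assume "a \<le> b" then show "c + a \<le> c + b"
    by (cases a; cases b; cases c) auto
qed

lemma extval_add_less_mono1:
  fixes x y z t :: "'g::linordered_ab_group_add extval"
  assumes "x < y" "z \<le> t" "z \<noteq> Infty" shows "x + z < y + t"
  using assms by (cases x; cases y; cases z; cases t) (auto intro: add_less_le_mono)

lemma extval_add_less_mono2:
  fixes x y z t :: "'g::linordered_ab_group_add extval"
  assumes "x \<le> y" "z < t" "x \<noteq> Infty" shows "x + z < y + t"
  using assms by (cases x; cases y; cases z; cases t) (auto intro: add_le_less_mono)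

lemma extval_add_left_cancel_less [simp]:
  fixes y z :: "'g::linordered_ab_group_add extval"
  shows "Fin a + y < Fin a + z \<longleftrightarrow> y < z"  "Fin a + y \<le> Fin a + z \<longleftrightarrow> y \<le> z"
    "Fin a + y = Fin a + z \<longleftrightarrow> y = z"
  by (cases y; cases z; auto)+

lemma neq_InftyE: "x \<noteq> Infty \<Longrightarrow> (\<And>a. x = Fin a \<Longrightarrow> P) \<Longrightarrow> P"
  by (cases x) auto

lemma scaleQ_zero_right [simp]: "q *\<^sub>Q (0 :: 'g::linordered_rat_vector) = 0"
  using scaleQ_add_right[of q "0::'g" 0] by simp

lemma scaleQ_zero_left [simp]: "0 *\<^sub>Q (x :: 'g::linordered_rat_vector) = 0"
  using scaleQ_add_left[of 0 0 x] by simp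

lemma scaleQ_minus_right: "q *\<^sub>Q (- x) = - (q *\<^sub>Q (x :: 'g::linordered_rat_vector))"
  using scaleQ_add_right[of q x "- x"] by (metis add.right_inverse neg_eq_iff_add_eq_0 scaleQ_zero_right)

lemma scaleQ_minus_left: "(- q) *\<^sub>Q x = - (q *\<^sub>Q (x :: 'g::linordered_rat_vector))"
  using scaleQ_add_left[of q "- q" x] by (metis add.right_inverse neg_eq_iff_add_eq_0 scaleQ_zero_left)

lemma scaleQ_diff_right: "q *\<^sub>Q (x - y) = q *\<^sub>Q x - q *\<^sub>Q (y :: 'g::linordered_rat_vector)"
  by (metis diff_conv_add_uminus scaleQ_add_right scaleQ_minus_right)

lemma scaleQ_diff_left: "(q - r) *\<^sub>Q x = q *\<^sub>Q x - r *\<^sub>Q (x :: 'g::linordered_rat_vector)"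
  by (metis diff_conv_add_uminus scaleQ_add_left scaleQ_minus_left)

lemma scaleQ_of_nat_add:
  "of_nat (m + n) *\<^sub>Q x = of_nat m *\<^sub>Q x + of_nat n *\<^sub>Q (x :: 'g::linordered_rat_vector)"
  by (simp add: scaleQ_add_left)

lemma scaleQ_of_nat_strict_mono:
  "0 < n \<Longrightarrow> x < y \<Longrightarrow> of_nat n *\<^sub>Q x < of_nat n *\<^sub>Q (y :: 'g::linordered_rat_vector)"
proof (induction n rule: nat_induct)
  case (Suc n)
  then show ?case
    by (cases "n = 0") (simp_all add: scaleQ_add_left scaleQ_one add_strict_mono del: of_nat_Suc add: of_nat_Suc)
qed simp

lemma scaleQ_of_nat_mono: "x \<le> y \<Longrightarrow> of_nat n *\<^sub>Q x \<le> of_nat n *\<^sub>Q (y :: 'g::linordered_rat_vector)"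
  using scaleQ_of_nat_strict_mono[of n x y] by (cases "n = 0") (auto simp: order.order_iff_strict)

text \<open>The class has no axiom linking \<open>scaleQ\<close> with the order. For q = a / b the
  identity b (q x) = a x reduces the claim to natural multiples, which are repeated sums.\<close>

lemma scaleQ_pos: 
  assumes "0 < q" "0 < (x :: 'g::linordered_rat_vector)" shows "0 < q *\<^sub>Q x"
proof (rule ccontr)
  assume "\<not> 0 < q *\<^sub>Q x"
  then have le: "q *\<^sub>Q x \<le> 0" by simp
  obtain a b where ab: "quotient_of q = (a, b)" by fastforce
  then have b: "b > 0" and q: "q = of_int a / of_int b"
    using quotient_of_denom_pos quotient_of_div by auto
  with assms have a: "a > 0" by (simp add: zero_less_divide_iff)
  have "of_nat (nat b) *\<^sub>Q (q *\<^sub>Q x) = of_nat (nat a) *\<^sub>Q x"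
    using a b q by (simp add: scaleQ_scaleQ)
  moreover have "of_nat (nat b) *\<^sub>Q (q *\<^sub>Q x) \<le> 0"
    using scaleQ_of_nat_mono[OF le, of "nat b"] by simp
  moreover have "0 < of_nat (nat a) *\<^sub>Q x"
    using scaleQ_of_nat_strict_mono[of "nat a" 0 x] a assms by simp
  ultimately show False by simp
qed

lemma scaleQ_mono: "0 \<le> q \<Longrightarrow> x \<le> y \<Longrightarrow> q *\<^sub>Q x \<le> q *\<^sub>Q (y :: 'g::linordered_rat_vector)"
  using scaleQ_pos[of q "y - x"] by (cases "q = 0"; cases "x = y") (auto simp: scaleQ_diff_right intro: less_imp_le)

lemma scaleQ_of_nat_inject [simp]:
  "0 < n \<Longrightarrow> of_nat n *\<^sub>Q x = of_nat n *\<^sub>Q y \<longleftrightarrow> x = (y :: 'g::linordered_rat_vector)"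
  using scaleQ_of_nat_strict_mono[of n x y] scaleQ_of_nat_strict_mono[of n y x]
  by (metis less_irrefl neqE)

lemma scaleQ_of_nat_le_iff [simp]:
  "0 < n \<Longrightarrow> of_nat n *\<^sub>Q x \<le> of_nat n *\<^sub>Q y \<longleftrightarrow> x \<le> (y :: 'g::linordered_rat_vector)"
  by (meson leD linorder_le_less_linear scaleQ_of_nat_mono scaleQ_of_nat_strict_mono)

lemma scaleQ_sum_left: "(\<Sum>i\<in>I. f i) *\<^sub>Q x = (\<Sum>i\<in>I. f i *\<^sub>Q (x :: 'g::linordered_rat_vector))"
  by (induction I rule: infinite_finite_induct) (auto simp: scaleQ_add_left)

locale valuation =
  fixes \<mu> :: "'r::comm_ring_1 \<Rightarrow> 'g::linordered_ab_group_add extval"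
  assumes val: "is_valuation \<mu>"
begin

lemma val_zero [simp]: "\<mu> 0 = Infty"
  and val_one [simp]: "\<mu> 1 = 0"
  and val_mult: "\<mu> (f * h) = \<mu> f + \<mu> h"
  and val_add: "min (\<mu> f) (\<mu> h) \<le> \<mu> (f + h)"
  using val unfolding is_valuation_def by auto

lemma val_minus_one [simp]: "\<mu> (- 1) = 0"
proof -
  have "\<mu> (- 1) + \<mu> (- 1) = 0"
    using val_mult[of "- 1" "- 1"] by simp
  then show ?thesis
    by (cases "\<mu> (- 1)") (auto simp: double_zero)
qed

lemma val_minus [simp]: "\<mu> (- f) = \<mu> f"
  using val_mult[of "- 1" f] by simp

lemma val_diff: "min (\<mu> f) (\<mu> h) \<le> \<mu> (f - h)"
  using val_add[of f "- h"] by simp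

lemma val_diff_commute: "\<mu> (f - h) = \<mu> (h - f)"
  using val_minus[of "f - h"] by simp

lemma val_add_ge: "c \<le> \<mu> f \<Longrightarrow> c \<le> \<mu> h \<Longrightarrow> c \<le> \<mu> (f + h)"
  using val_add[of f h] by (meson min.boundedI order_trans)

lemma val_add_gr: "c < \<mu> f \<Longrightarrow> c < \<mu> h \<Longrightarrow> c < \<mu> (f + h)"
  using val_add[of f h] by (meson min_less_iff_conj order.strict_trans2)

lemma val_diff_ge: "c \<le> \<mu> f \<Longrightarrow> c \<le> \<mu> h \<Longrightarrow> c \<le> \<mu> (f - h)"
  using val_add_ge[of c f "- h"] by simp

lemma val_diff_gr: "c < \<mu> f \<Longrightarrow> c < \<mu> h \<Longrightarrow> c < \<mu> (f - h)"
  using val_add_gr[of c f "- h"] by simp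

lemma val_add_eq: 
  assumes "\<mu> f < \<mu> h" shows "\<mu> (f + h) = \<mu> f"
proof (rule antisym)
  show "\<mu> f \<le> \<mu> (f + h)" using assms by (intro val_add_ge) auto
  show "\<mu> (f + h) \<le> \<mu> f"
  proof (rule ccontr)
    assume "\<not> ?thesis"
    then have "\<mu> f < \<mu> ((f + h) - h)" using assms by (intro val_diff_gr) auto
    then show False by simp
  qed
qed

lemma val_eq_of_diff: "\<mu> f < \<mu> (f - h) \<Longrightarrow> \<mu> h = \<mu> f"
  using val_add_eq[of f "h - f"] val_diff_commute[of f h] by simp

lemma val_sum_ge: "(\<And>i. i \<in> I \<Longrightarrow> c \<le> \<mu> (f i)) \<Longrightarrow> c \<le> \<mu> (\<Sum>i\<in>I. f i)"
  by (induction I rule: infinite_finite_induct) (auto intro: val_add_ge)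

lemma val_sum_gr: "c \<noteq> Infty \<Longrightarrow> (\<And>i. i \<in> I \<Longrightarrow> c < \<mu> (f i)) \<Longrightarrow> c < \<mu> (\<Sum>i\<in>I. f i)"
  by (induction I rule: infinite_finite_induct) (auto intro: val_add_gr)

text \<open>The basic device for evaluating expansions at roots: one dominant finite term decides
  the value, so in particular the sum cannot vanish.\<close>

lemma val_sum_unique_min:
  assumes "finite I" "j \<in> I" "\<And>i. i \<in> I \<Longrightarrow> i \<noteq> j \<Longrightarrow> \<mu> (f j) < \<mu> (f i)" "\<mu> (f j) \<noteq> Infty"
  shows "\<mu> (\<Sum>i\<in>I. f i) = \<mu> (f j)"
proof -
  have "\<mu> (f j) < \<mu> (\<Sum>i\<in>I - {j}. f i)"
    using assms by (intro val_sum_gr) auto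
  then show ?thesis
    using assms val_add_eq[of "f j" "\<Sum>i\<in>I - {j}. f i"] by (simp add: sum.remove)
qed

lemma val_unit: "f * h = 1 \<Longrightarrow> \<mu> f + \<mu> h = 0"
  using val_mult[of f h] by simp

end

lemma valuation_power:
  fixes \<mu> :: "'r::comm_ring_1 \<Rightarrow> 'g::linordered_rat_vector extval"
  assumes "valuation \<mu>" "\<mu> f = Fin a"
  shows "\<mu> (f ^ n) = Fin (of_nat n *\<^sub>Q a)"
proof -
  interpret valuation \<mu> by fact
  show ?thesis using assms(2)
  by (induction n) (auto simp: val_mult scaleQ_add_left scaleQ_one)
qed

lemma (in valuation) val_power_0: "0 \<le> \<mu> f \<Longrightarrow> 0 \<le> \<mu> (f ^ n)"
  using add_mono[of 0 "\<mu> f" 0] by (induction n) (auto simp: val_mult)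

lemma field_valuation_finite:
  fixes v :: "'f::field \<Rightarrow> 'g::linordered_ab_group_add extval"
  assumes "is_valuation v" shows "v z = Infty \<longleftrightarrow> z = 0"
proof -
  interpret valuation v by unfold_locales fact
  show ?thesis
    using val_unit[of z "inverse z"] by (cases "z = 0") auto
qed

lemma field_valuation_inverse:
  fixes v :: "'f::field \<Rightarrow> 'g::linordered_ab_group_add extval"
  assumes "is_valuation v" "v z = Fin a" shows "v (inverse z) = Fin (- a)"
proof -
  interpret valuation v by unfold_locales fact
  have "z \<noteq> 0" using assms by auto
  then have "v z + v (inverse z) = 0"
    using val_unit[of z "inverse z"] by auto
  then show ?thesis
    using assms(2) by (cases "v (inverse z)") (auto simp: add_eq_0_iff)
qed


section \<open>Quotients of subrings and the graded algebra\<close>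

lemma ring_of_type_algebra_simps [simp]:
  "carrier ring_of_type_algebra = UNIV" "x \<otimes>\<^bsub>ring_of_type_algebra\<^esub> y = x * y"
  "x \<oplus>\<^bsub>ring_of_type_algebra\<^esub> y = x + y" "\<one>\<^bsub>ring_of_type_algebra\<^esub> = 1" "\<zero>\<^bsub>ring_of_type_algebra\<^esub> = 0"
  by (auto simp: ring_of_type_algebra_def)

text \<open>The graded algebra and the residue fields are both quotients of a subset of a ring type
  by a smaller subset. Here coset statements in the record-based ring become memberships of
  differences, once for both.\<close>

locale subring_quotient =
  fixes S I :: "'r::comm_ring_1 set"
  assumes one_mem: "1 \<in> S" and diff_mem: "\<And>x y. x \<in> S \<Longrightarrow> y \<in> S \<Longrightarrow> x - y \<in> S"
    and mult_mem: "\<And>x y. x \<in> S \<Longrightarrow> y \<in> S \<Longrightarrow> x * y \<in> S"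
    and ideal_subset: "I \<subseteq> S" and zero_ideal: "0 \<in> I"
    and diff_ideal: "\<And>x y. x \<in> I \<Longrightarrow> y \<in> I \<Longrightarrow> x - y \<in> I"
    and mult_ideal: "\<And>x y. x \<in> S \<Longrightarrow> y \<in> I \<Longrightarrow> x * y \<in> I"
begin

abbreviation "R \<equiv> subring_of S"
abbreviation "Q \<equiv> subring_of S Quot I"
definition "cls x = I +>\<^bsub>R\<^esub> x"

lemma zero_mem: "0 \<in> S" using zero_ideal ideal_subset by auto
lemma minus_mem: "x \<in> S \<Longrightarrow> - x \<in> S" using diff_mem[OF zero_mem] by simp
lemma add_mem: "x \<in> S \<Longrightarrow> y \<in> S \<Longrightarrow> x + y \<in> S" using diff_mem[of x "- y"] minus_mem by simp
lemma minus_ideal: "x \<in> I \<Longrightarrow> - x \<in> I" using diff_ideal[OF zero_ideal] by simp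
lemma add_ideal: "x \<in> I \<Longrightarrow> y \<in> I \<Longrightarrow> x + y \<in> I" using diff_ideal[of x "- y"] minus_ideal by simp
lemma sum_mem: "(\<And>k. k \<in> A \<Longrightarrow> f k \<in> S) \<Longrightarrow> (\<Sum>k\<in>A. f k) \<in> S"
  by (induction A rule: infinite_finite_induct) (auto intro: add_mem zero_mem)
lemma sum_ideal: "(\<And>k. k \<in> A \<Longrightarrow> f k \<in> I) \<Longrightarrow> (\<Sum>k\<in>A. f k) \<in> I"
  by (induction A rule: infinite_finite_induct) (auto intro: add_ideal zero_ideal)
lemma cring_R: "cring R"
proof (rule cringI)
  show "abelian_group R"
    by (rule abelian_groupI) (auto simp: add_mem zero_mem algebra_simps intro: minus_mem exI[of _ "- _"] bexI[of _ "- _"])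
  show "comm_monoid R"
    by (rule comm_monoidI) (auto simp: mult_mem one_mem algebra_simps)
qed (auto simp: algebra_simps)

sublocale R: cring R by (rule cring_R)

lemma ideal_R: "ideal I R"
proof (rule idealI)
  show "ring R" by (rule R.ring_axioms)
  show "subgroup I (add_monoid R)"
  proof (rule R.add.subgroupI)
    fix a assume a: "a \<in> I"
    have "\<ominus>\<^bsub>R\<^esub> a = - a"
      using a ideal_subset by (intro R.minus_equality) (auto simp: minus_mem)
    then show "\<ominus>\<^bsub>R\<^esub> a \<in> I"
      using a minus_ideal by simp
  qed (use ideal_subset zero_ideal in \<open>auto simp: add_ideal\<close>)
qed (auto simp: mult_ideal, metis mult.commute mult_ideal)

sublocale I: ideal I R by (rule ideal_R)

lemma cring_Q: "cring Q" by (rule I.quotient_is_cring[OF cring_R])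

sublocale Q: cring Q by (rule cring_Q)

lemma hom: "ring_hom_cring R Q cls"
  unfolding cls_def[abs_def] by (rule I.rcos_ring_hom_cring[OF cring_R])

lemma carrier_Q: "carrier Q = cls ` S"
  by (auto simp: FactRing_def A_RCOSETS_def' cls_def a_r_coset_def)

lemma cls_carrier [simp]: "x \<in> S \<Longrightarrow> cls x \<in> carrier Q"
  by (auto simp: carrier_Q)

sublocale cls: ring_hom_cring R Q cls by (rule hom)

lemma cls_mult [simp]: "x \<in> S \<Longrightarrow> y \<in> S \<Longrightarrow> cls x \<otimes>\<^bsub>Q\<^esub> cls y = cls (x * y)"
  using cls.hom_mult[of x y] by simp

lemma cls_add [simp]: "x \<in> S \<Longrightarrow> y \<in> S \<Longrightarrow> cls x \<oplus>\<^bsub>Q\<^esub> cls y = cls (x + y)"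
  using cls.hom_add[of x y] by simp

lemma cls_one: "\<one>\<^bsub>Q\<^esub> = cls 1"
  using cls.hom_one by simp

lemma cls_zero: "\<zero>\<^bsub>Q\<^esub> = cls 0"
  using cls.hom_zero by simp

lemma cls_eq_iff: 
  assumes "x \<in> S" "y \<in> S" shows "cls x = cls y \<longleftrightarrow> x - y \<in> I"
proof -
  have "\<ominus>\<^bsub>R\<^esub> y = - y"
    using assms by (intro R.minus_equality) (auto simp: minus_mem)
  then have "x \<ominus>\<^bsub>R\<^esub> y = x - y"
    by (simp add: a_minus_def)
  then show ?thesis
    unfolding cls_def
    using I.a_rcos_module_minus[OF R.ring_axioms, of y x] assms I.a_repr_independence'[of x y] I.a_rcos_self[of x]
    by auto
qed

lemma cls_eq_zero: "x \<in> S \<Longrightarrow> cls x = \<zero>\<^bsub>Q\<^esub> \<longleftrightarrow> x \<in> I"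
  using cls_eq_iff[of x 0] zero_mem by (simp add: cls_zero)

lemma cls_Unit: 
  assumes "x \<in> S" "y \<in> S" "x * y - 1 \<in> I"
  shows "cls x \<in> Units Q" "inv\<^bsub>Q\<^esub> cls x = cls y"
proof -
  have *: "cls x \<otimes>\<^bsub>Q\<^esub> cls y = \<one>\<^bsub>Q\<^esub>"
    using assms by (simp add: cls_one cls_eq_iff mult_mem one_mem)
  then have **: "cls y \<otimes>\<^bsub>Q\<^esub> cls x = \<one>\<^bsub>Q\<^esub>"
    using assms by (simp add: Q.m_comm)
  show "cls x \<in> Units Q"
    unfolding Units_def using * ** assms by (auto intro!: bexI[of _ "cls y"])
  show "inv\<^bsub>Q\<^esub> cls x = cls y"
    using Q.inv_unique'[OF _ _ * **] assms by simp
qed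

end

lemma poly_mapping_eq_sum_single:
  "F = (\<Sum>k\<in>Poly_Mapping.keys F. Poly_Mapping.single k (Poly_Mapping.lookup F k))"
  by (rule poly_mapping_eqI)
    (auto simp: lookup_sum lookup_single when_def in_keys_iff)

lemma poly_mapping_times_eq_sum:
  fixes F H :: "'g::comm_monoid_add \<Rightarrow>\<^sub>0 'b::comm_ring_1"
  shows "F * H = (\<Sum>k\<in>Poly_Mapping.keys F. \<Sum>l\<in>Poly_Mapping.keys H.
    Poly_Mapping.single (k + l) (Poly_Mapping.lookup F k * Poly_Mapping.lookup H l))"
  by (subst poly_mapping_eq_sum_single[of F], subst poly_mapping_eq_sum_single[of H])
    (simp add: sum_product mult_single)

lemma lookup_times:
  fixes F H :: "'g::comm_monoid_add \<Rightarrow>\<^sub>0 'b::comm_ring_1"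
  shows "Poly_Mapping.lookup (F * H) \<gamma> = (\<Sum>k\<in>Poly_Mapping.keys F. \<Sum>l\<in>Poly_Mapping.keys H.
    (Poly_Mapping.lookup F k * Poly_Mapping.lookup H l when k + l = \<gamma>))"
  by (subst poly_mapping_times_eq_sum) (simp add: lookup_sum lookup_single)

locale poly_valuation = valuation \<mu> for \<mu> :: "'a::field poly \<Rightarrow> 'g::linordered_ab_group_add extval"
begin

definition "FS = {F. \<forall>\<alpha>. Fin \<alpha> \<le> \<mu> (Poly_Mapping.lookup F \<alpha>)}"
definition "FI = {F. \<forall>\<alpha>. Fin \<alpha> < \<mu> (Poly_Mapping.lookup F \<alpha>)}"

lemma FS_D: "F \<in> FS \<Longrightarrow> Fin \<alpha> \<le> \<mu> (Poly_Mapping.lookup F \<alpha>)"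
  and FI_D: "F \<in> FI \<Longrightarrow> Fin \<alpha> < \<mu> (Poly_Mapping.lookup F \<alpha>)"
  by (auto simp: FS_def FI_def)

lemma single_FS [simp]: "Poly_Mapping.single \<alpha> f \<in> FS \<longleftrightarrow> Fin \<alpha> \<le> \<mu> f"
  and single_FI [simp]: "Poly_Mapping.single \<alpha> f \<in> FI \<longleftrightarrow> Fin \<alpha> < \<mu> f"
  by (auto simp: FS_def FI_def lookup_single when_def)

lemma FS_subring_quotient: "subring_quotient FS FI"
proof
  show "1 \<in> FS"
    by (auto simp: FS_def lookup_one when_def)
  show "FI \<subseteq> FS"
    by (auto simp: FS_def FI_def less_imp_le)
  show "0 \<in> FI" by (auto simp: FI_def)
  show "x - y \<in> FS" if "x \<in> FS" "y \<in> FS" for x y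
    using that by (auto simp: FS_def lookup_minus intro: val_diff_ge)
  show "x - y \<in> FI" if "x \<in> FI" "y \<in> FI" for x y
    using that by (auto simp: FI_def lookup_minus intro: val_diff_gr)
  show "x * y \<in> FS" if "x \<in> FS" "y \<in> FS" for x y
    unfolding FS_def mem_Collect_eq lookup_times
  proof (intro allI val_sum_ge)
    fix \<gamma> k l
    have "Fin (k + l) \<le> \<mu> (Poly_Mapping.lookup x k * Poly_Mapping.lookup y l)"
      using add_mono[OF FS_D[OF that(1), of k] FS_D[OF that(2), of l]] by (simp add: val_mult)
    then show "Fin \<gamma> \<le> \<mu> (Poly_Mapping.lookup x k * Poly_Mapping.lookup y l when k + l = \<gamma>)"
      by (auto simp: when_def)
  qed
  show "x * y \<in> FI" if "x \<in> FS" "y \<in> FI" for x y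
    unfolding FI_def mem_Collect_eq lookup_times
  proof (intro allI val_sum_gr)
    fix \<gamma> k l
    have "Fin (k + l) < \<mu> (Poly_Mapping.lookup x k * Poly_Mapping.lookup y l)"
      using extval_add_less_mono2[OF FS_D[OF that(1), of k] FI_D[OF that(2), of l]] by (simp add: val_mult)
    then show "Fin \<gamma> < \<mu> (Poly_Mapping.lookup x k * Poly_Mapping.lookup y l when k + l = \<gamma>)"
      by (auto simp: when_def)
  qed simp_all
qed

sublocale G: subring_quotient FS FI by (rule FS_subring_quotient)

lemma graded_algebra_eq: "graded_algebra \<mu> = subring_of FS Quot FI"
  by (simp add: graded_algebra_def filtration_sum_def filtration_ideal_def FS_def FI_def)

lemma graded_class_eq: "graded_class \<mu> \<alpha> f = G.cls (Poly_Mapping.single \<alpha> f)"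
  by (simp add: graded_class_def filtration_sum_def filtration_ideal_def G.cls_def flip: FS_def FI_def)

lemma initial_form_eq: "\<mu> f = Fin \<alpha> \<Longrightarrow> initial_form \<mu> f = graded_class \<mu> \<alpha> f"
  by (simp add: initial_form_def)

lemma graded_class_mult:
  "Fin \<alpha> \<le> \<mu> f \<Longrightarrow> Fin \<beta> \<le> \<mu> h \<Longrightarrow>
    graded_class \<mu> \<alpha> f \<otimes>\<^bsub>graded_algebra \<mu>\<^esub> graded_class \<mu> \<beta> h = graded_class \<mu> (\<alpha> + \<beta>) (f * h)"
  by (simp add: graded_algebra_eq graded_class_eq mult_single)

lemma graded_class_eq_iff:
  "Fin \<alpha> \<le> \<mu> f \<Longrightarrow> Fin \<alpha> \<le> \<mu> h \<Longrightarrow> graded_class \<mu> \<alpha> f = graded_class \<mu> \<alpha> h \<longleftrightarrow> Fin \<alpha> < \<mu> (f - h)"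
  by (simp add: graded_class_eq G.cls_eq_iff flip: single_diff)

lemma graded_one: "\<one>\<^bsub>graded_algebra \<mu>\<^esub> = graded_class \<mu> 0 1"
  by (simp add: graded_algebra_eq graded_class_eq G.cls_one)

lemma graded_zero: "\<zero>\<^bsub>graded_algebra \<mu>\<^esub> = graded_class \<mu> \<alpha> 0"
  by (simp add: graded_algebra_eq graded_class_eq G.cls_zero)

lemma graded_cring: "cring (graded_algebra \<mu>)"
  by (simp add: graded_algebra_eq G.cring_Q)

lemma graded_class_carrier: "Fin \<alpha> \<le> \<mu> f \<Longrightarrow> graded_class \<mu> \<alpha> f \<in> carrier (graded_algebra \<mu>)"
  by (simp add: graded_algebra_eq graded_class_eq)

lemma graded_class_Unit:
  assumes "\<mu> f = Fin \<alpha>" "\<mu> h = Fin (- \<alpha>)" "0 < \<mu> (f * h - 1)"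
  shows "graded_class \<mu> \<alpha> f \<in> Units (graded_algebra \<mu>)"
    "inv\<^bsub>graded_algebra \<mu>\<^esub> graded_class \<mu> \<alpha> f = graded_class \<mu> (- \<alpha>) h"
proof -
  have "Poly_Mapping.single \<alpha> f * Poly_Mapping.single (- \<alpha>) h - 1 \<in> FI"
    using assms(3) by (simp add: mult_single flip: single_diff single_one)
  then show "graded_class \<mu> \<alpha> f \<in> Units (graded_algebra \<mu>)"
    "inv\<^bsub>graded_algebra \<mu>\<^esub> graded_class \<mu> \<alpha> f = graded_class \<mu> (- \<alpha>) h"
    unfolding graded_algebra_eq graded_class_eq
    using assms G.cls_Unit[of "Poly_Mapping.single \<alpha> f" "Poly_Mapping.single (- \<alpha>) h"] by simp_all
qed

text \<open>An inverse may have components in many degrees, but only the one of degree - \<alpha>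
  meets \<open>f\<close> in degree 0, so it alone is an inverse. The lower bounds \<alpha> and -
  \<alpha> and the sum 0 force the exact values.\<close>

lemma graded_class_UnitE:
  assumes "graded_class \<mu> \<alpha> f \<in> Units (graded_algebra \<mu>)" "Fin \<alpha> \<le> \<mu> f"
  obtains h where "\<mu> f = Fin \<alpha>" "\<mu> h = Fin (- \<alpha>)" "0 < \<mu> (f * h - 1)"
proof -
  from assms obtain z where z: "z \<in> carrier (subring_of FS Quot FI)"
    "graded_class \<mu> \<alpha> f \<otimes>\<^bsub>subring_of FS Quot FI\<^esub> z = \<one>\<^bsub>subring_of FS Quot FI\<^esub>"
    unfolding graded_algebra_eq Units_def by auto
  then obtain H where H: "H \<in> FS" "z = G.cls H" by (auto simp: G.carrier_Q)
  have "G.cls (Poly_Mapping.single \<alpha> f * H) = G.cls 1"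
    using z H assms by (simp add: graded_class_eq G.cls_one)
  then have "Poly_Mapping.single \<alpha> f * H - 1 \<in> FI"
    using H assms by (subst (asm) G.cls_eq_iff) (auto simp: G.mult_mem G.one_mem)
  from FI_D[OF this, of 0]
  have "0 < \<mu> (Poly_Mapping.lookup (Poly_Mapping.single \<alpha> f * H) 0 - 1)"
    by (simp add: lookup_minus)
  also have "Poly_Mapping.lookup (Poly_Mapping.single \<alpha> f * H) 0 = f * Poly_Mapping.lookup H (- \<alpha>)"
  proof -
    have "Poly_Mapping.single \<alpha> f * H =
      (\<Sum>l\<in>Poly_Mapping.keys H. Poly_Mapping.single (\<alpha> + l) (f * Poly_Mapping.lookup H l))"
      by (subst poly_mapping_eq_sum_single[of H]) (simp add: sum_distrib_left mult_single)
    then show ?thesis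
      by (auto simp: lookup_sum lookup_single when_def add_eq_0_iff sum.delta in_keys_iff cong: sum.cong)
  qed
  finally have *: "0 < \<mu> (f * Poly_Mapping.lookup H (- \<alpha>) - 1)" .
  have 0: "\<mu> f + \<mu> (Poly_Mapping.lookup H (- \<alpha>)) = 0"
    using val_eq_of_diff[of 1 "f * Poly_Mapping.lookup H (- \<alpha>)"] *
    by (simp add: val_mult val_diff_commute[of 1])
  have 1: "Fin (- \<alpha>) \<le> \<mu> (Poly_Mapping.lookup H (- \<alpha>))"
    using FS_D[OF H(1)] .
  obtain b where b: "\<mu> f = Fin b" using 0 by (cases "\<mu> f") auto
  obtain c where c: "\<mu> (Poly_Mapping.lookup H (- \<alpha>)) = Fin c" using 0 by (cases "\<mu> (Poly_Mapping.lookup H (- \<alpha>))") auto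
  have "b + c = 0" "\<alpha> \<le> b" "- \<alpha> \<le> c" using 0 1 b c assms(2) by auto
  then have "b = \<alpha>" "c = - \<alpha>" by (auto simp: add_eq_0_iff)
  then show ?thesis using that[of "Poly_Mapping.lookup H (- \<alpha>)"] * b c by auto
qed

text \<open>The graded algebra is a domain because degrees are totally ordered. Let a, b be the
  lowest degrees of nonzero components. If k + l = a + b and (k, l) \<noteq> (a, b), then k < a or l
  < b, so in degree a + b one product has strictly smallest value.\<close>

lemma FI_prime:
  assumes "F \<in> FS" "H \<in> FS" "F * H \<in> FI" shows "F \<in> FI \<or> H \<in> FI"
proof (rule ccontr)
  assume *: "\<not> ?thesis"
  define A where "A Z = {\<alpha>. \<mu> (Poly_Mapping.lookup Z \<alpha>) = Fin \<alpha>}" for Z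
  have keys: "A Z \<subseteq> Poly_Mapping.keys Z" for Z
    by (auto simp: A_def in_keys_iff)
  have ex: "A Z \<noteq> {}" if "Z \<in> FS" "Z \<notin> FI" for Z
    using that FS_D[OF that(1)] unfolding A_def FI_def by (force simp: not_less intro: antisym)
  have fin: "finite (A Z)" for Z
    by (rule finite_subset[OF keys finite_keys])
  define a where "a = Min (A F)"
  define b where "b = Min (A H)"
  have ab: "a \<in> A F" "b \<in> A H"
    using * ex fin assms unfolding a_def b_def by (auto intro!: Min_in)
  have aless: "Fin \<alpha> < \<mu> (Poly_Mapping.lookup F \<alpha>)" if "\<alpha> < a" for \<alpha>
    using FS_D[OF assms(1), of \<alpha>] that Min_le[OF fin, of \<alpha> F] unfolding a_def A_def
    by (force simp: order.order_iff_strict)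
  have bless: "Fin \<alpha> < \<mu> (Poly_Mapping.lookup H \<alpha>)" if "\<alpha> < b" for \<alpha>
    using FS_D[OF assms(2), of \<alpha>] that Min_le[OF fin, of \<alpha> H] unfolding b_def A_def
    by (force simp: order.order_iff_strict)
  define t where "t = (\<lambda>(k, l). Poly_Mapping.lookup F k * Poly_Mapping.lookup H l when k + l = a + b)"
  have "\<mu> (\<Sum>p\<in>Poly_Mapping.keys F \<times> Poly_Mapping.keys H. t p) = \<mu> (t (a, b))"
  proof (rule val_sum_unique_min)
    show "(a, b) \<in> Poly_Mapping.keys F \<times> Poly_Mapping.keys H"
      using ab keys by auto
    have t: "\<mu> (t (a, b)) = Fin (a + b)"
      using ab by (simp add: t_def val_mult A_def)
    then show "\<mu> (t (a, b)) \<noteq> Infty" by simp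
    fix p assume p: "p \<in> Poly_Mapping.keys F \<times> Poly_Mapping.keys H" "p \<noteq> (a, b)"
    obtain k l where kl: "p = (k, l)" by (cases p)
    show "\<mu> (t (a, b)) < \<mu> (t p)"
    proof (cases "k + l = a + b")
      case True
      then consider "k < a" | "l < b" 
        using p kl by (metis add_less_le_mono linorder_less_linear add_le_less_mono order_less_irrefl order.order_iff_strict)
      then have "Fin (k + l) < \<mu> (Poly_Mapping.lookup F k * Poly_Mapping.lookup H l)"
      proof cases
        case 1
        from extval_add_less_mono1[OF aless[OF 1] FS_D[OF assms(2), of l]]
        show ?thesis by (simp add: val_mult)
      next
        case 2
        from extval_add_less_mono2[OF FS_D[OF assms(1), of k] bless[OF 2]]
        show ?thesis by (simp add: val_mult)
      qed
      then show ?thesis using True t kl by (simp add: t_def)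
    qed (use t kl in \<open>simp add: t_def\<close>)
  qed auto
  also have "(\<Sum>p\<in>Poly_Mapping.keys F \<times> Poly_Mapping.keys H. t p) = Poly_Mapping.lookup (F * H) (a + b)"
    by (simp add: t_def lookup_times sum.cartesian_product)
  also have "\<mu> (t (a, b)) = Fin (a + b)"
    using ab by (simp add: t_def val_mult A_def)
  finally show False using FI_D[OF assms(3), of "a + b"] by simp
qed

end


section \<open>Key polynomials from pairs of valuations\<close>

text \<open>The canonical map from the graded algebra of \<open>M\<close> to that of \<open>V\<close> has the initial form of \<open>\<phi>\<close>
  as generator of its kernel, and the graded algebra of \<open>V\<close> is a domain.\<close>

locale valuation_pair = M: poly_valuation M + V: poly_valuation V
  for M V :: "'a::field poly \<Rightarrow> 'g::linordered_ab_group_add extval" +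
  fixes \<phi> :: "'a poly"
  assumes le: "M f \<le> V f" and monic: "Polynomial.lead_coeff \<phi> = 1" and deg: "0 < Polynomial.degree \<phi>"
    and kernel: "V f = Infty \<longleftrightarrow> \<phi> dvd f" and finite_M: "f \<noteq> 0 \<Longrightarrow> M f \<noteq> Infty"
    and small: "Polynomial.degree f < Polynomial.degree \<phi> \<Longrightarrow> V f = M f"
begin

lemma V_mod: "V (f mod \<phi>) = V f"
proof (cases "\<phi> dvd f")
  case True
  then show ?thesis using kernel by (metis V.val_zero dvd_imp_mod_0)
next
  case False
  have "V (\<phi> * (f div \<phi>)) = Infty" by (simp add: kernel)
  moreover have "V (f mod \<phi>) \<noteq> Infty" using False kernel[of "f mod \<phi>"] by (simp add: dvd_mod_iff)
  ultimately have "V (f mod \<phi> + \<phi> * (f div \<phi>)) = V (f mod \<phi>)"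
    by (intro V.val_add_eq) simp
  then show ?thesis by simp
qed

lemma M_mod: "M (f mod \<phi>) = V f"
  using small[of "f mod \<phi>"] V_mod[of f] degree_mod_less'[of \<phi> f] deg monic
  by (metis Polynomial.degree_0 degree_mod_less neq0_conv)

text \<open>If M f = \<alpha> < V f, then \<open>f mod \<phi>\<close> has M-value V f > \<alpha>, so
  in degree \<alpha> the class of f is that of \<open>\<phi> * (f div \<phi>)\<close>. This is done
  in every degree of F; conversely \<phi> has infinite V-value.\<close>

lemma FI_iff_divides:
  assumes F: "F \<in> M.FS" and \<gamma>: "M \<phi> = Fin \<gamma>"
  shows "F \<in> V.FI \<longleftrightarrow>
    graded_class M \<gamma> \<phi> divides\<^bsub>graded_algebra M\<^esub> M.G.cls F"
proof
  let ?p = "Poly_Mapping.single \<gamma> \<phi>"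
  have FS: "M.FS \<subseteq> V.FS" and FI: "M.FI \<subseteq> V.FI"
    unfolding M.FS_def M.FI_def V.FS_def V.FI_def using le order_trans order.strict_trans2 by blast+
  have p: "?p \<in> V.FI" "?p \<in> M.FS"
    using kernel[of \<phi>] \<gamma> by auto
  {
    assume "graded_class M \<gamma> \<phi> divides\<^bsub>graded_algebra M\<^esub> M.G.cls F"
    then obtain z where z: "z \<in> carrier (graded_algebra M)"
      "M.G.cls F = graded_class M \<gamma> \<phi> \<otimes>\<^bsub>graded_algebra M\<^esub> z"
      unfolding factor_def by auto
    then obtain H where H: "H \<in> M.FS" "z = M.G.cls H" 
      by (auto simp: M.graded_algebra_eq M.G.carrier_Q)
    have "F - ?p * H \<in> M.FI"
      using z H F p M.G.mult_mem[of ?p H]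
      by (simp add: M.graded_algebra_eq M.graded_class_eq M.G.cls_eq_iff)
    then have "F - ?p * H \<in> V.FI" using FI by auto
    moreover have "?p * H \<in> V.FI" 
      using V.G.mult_ideal[of H ?p] p H FS by (auto simp: mult.commute)
    ultimately have "(F - ?p * H) + ?p * H \<in> V.FI" by (rule V.G.add_ideal)
    then show "F \<in> V.FI" by simp
  }
  {
    assume FV: "F \<in> V.FI"
    have "\<exists>h. Fin (\<alpha> - \<gamma>) \<le> M h \<and> Fin \<alpha> < M (Poly_Mapping.lookup F \<alpha> - \<phi> * h)" for \<alpha>
    proof (cases "Fin \<alpha> < M (Poly_Mapping.lookup F \<alpha>)")
      case True
      then show ?thesis by (intro exI[of _ 0]) auto
    next
      case False
      define f where "f = Poly_Mapping.lookup F \<alpha>"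
      have f: "M f = Fin \<alpha>" using False M.FS_D[OF F, of \<alpha>] by (auto simp: f_def)
      have "f - \<phi> * (f div \<phi>) = f mod \<phi>"
        by (simp add: minus_mult_div_eq_mod)
      then have *: "Fin \<alpha> < M (f - \<phi> * (f div \<phi>))"
        using V.FI_D[OF FV, of \<alpha>] M_mod[of f] by (simp add: f_def)
      have "M (\<phi> * (f div \<phi>)) = Fin \<alpha>"
        using M.val_eq_of_diff[of f "\<phi> * (f div \<phi>)"] * f by simp
      then have "Fin \<gamma> + M (f div \<phi>) = Fin \<alpha>" by (simp add: M.val_mult \<gamma>)
      then have "M (f div \<phi>) = Fin (\<alpha> - \<gamma>)"
        by (cases "M (f div \<phi>)") auto
      then show ?thesis using * by (intro exI[of _ "f div \<phi>"]) (simp add: f_def)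
    qed
    then obtain h where h: "\<And>\<alpha>. Fin (\<alpha> - \<gamma>) \<le> M (h \<alpha>)"
        "\<And>\<alpha>. Fin \<alpha> < M (Poly_Mapping.lookup F \<alpha> - \<phi> * h \<alpha>)"
      by metis
    define H where "H = (\<Sum>\<alpha>\<in>Poly_Mapping.keys F. Poly_Mapping.single (\<alpha> - \<gamma>) (h \<alpha>))"
    have H: "H \<in> M.FS" unfolding H_def using h(1) by (intro M.G.sum_mem) auto
    have "F - ?p * H =
      (\<Sum>\<alpha>\<in>Poly_Mapping.keys F. Poly_Mapping.single \<alpha> (Poly_Mapping.lookup F \<alpha> - \<phi> * h \<alpha>))"
      by (subst poly_mapping_eq_sum_single[of F])
        (simp add: H_def sum_distrib_left mult_single single_diff sum_subtractf)
    also have "\<dots> \<in> M.FI" using h(2) by (intro M.G.sum_ideal) auto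
    finally have "M.G.cls F = M.G.cls (?p * H)"
      using F H p by (subst M.G.cls_eq_iff) (auto intro: M.G.mult_mem)
    then have "M.G.cls F = graded_class M \<gamma> \<phi> \<otimes>\<^bsub>graded_algebra M\<^esub> M.G.cls H"
      unfolding M.graded_algebra_eq M.graded_class_eq by (simp only: M.G.cls_mult[OF p(2) H])
    moreover have "M.G.cls H \<in> carrier (graded_algebra M)"
      unfolding M.graded_algebra_eq by (rule M.G.cls_carrier[OF H])
    ultimately show "graded_class M \<gamma> \<phi> divides\<^bsub>graded_algebra M\<^esub> M.G.cls F"
      unfolding factor_def by (rule bexI)
  }
qed

lemma M_phi: obtains \<gamma> where "M \<phi> = Fin \<gamma>"
  using finite_M[of \<phi>] deg by (metis Polynomial.degree_0 less_irrefl neq_InftyE)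

lemma val_dvd_iff:
  assumes "f \<noteq> 0" shows "val_dvd M \<phi> f \<longleftrightarrow> M f < V f"
proof -
  obtain \<gamma> where \<gamma>: "M \<phi> = Fin \<gamma>" by (rule M_phi)
  obtain \<alpha> where \<alpha>: "M f = Fin \<alpha>" using finite_M[OF assms] by (cases "M f") auto
  have "M f < V f \<longleftrightarrow> Poly_Mapping.single \<alpha> f \<in> V.FI"
    using \<alpha> by simp
  then show ?thesis
    unfolding val_dvd_def M.initial_form_eq[OF \<gamma>] M.initial_form_eq[OF \<alpha>]
    using FI_iff_divides[of "Poly_Mapping.single \<alpha> f" \<gamma>] \<gamma> \<alpha> by (simp add: M.graded_class_eq)
qed

text \<open>By \<open>FI_iff_divides\<close>, divisibility by the initial form of \<phi> is
  vanishing in the graded algebra of V, a domain by \<open>FI_prime\<close>; hence primality. In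
  small degrees M = V, so nothing there is divisible.\<close>

lemma key_poly: "\<phi> \<in> key_polys M"
proof -
  obtain \<gamma> where \<gamma>: "M \<phi> = Fin \<gamma>" by (rule M_phi)
  let ?p = "graded_class M \<gamma> \<phi>" and ?G = "graded_algebra M"
  interpret cring ?G by (rule M.graded_cring)
  have pc: "?p \<in> carrier ?G" using \<gamma> by (intro M.graded_class_carrier) simp
  have FS: "M.FS \<subseteq> V.FS"
    unfolding M.FS_def V.FS_def using le order_trans by blast
  have one: "\<not> ?p divides\<^bsub>?G\<^esub> \<one>\<^bsub>?G\<^esub>"
    using FI_iff_divides[OF _ \<gamma>, of 1] M.G.one_mem V.FI_D[of 1 0]
    by (auto simp: M.graded_algebra_eq M.G.cls_one)
  have "Divisibility.prime ?G ?p"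
    unfolding Divisibility.prime_def
  proof (intro conjI ballI impI)
    show "?p \<notin> Units ?G"
      using one Units_r_inv_ex unfolding factor_def by (metis)
    fix a b assume ab: "a \<in> carrier ?G" "b \<in> carrier ?G" "?p divides\<^bsub>?G\<^esub> a \<otimes>\<^bsub>?G\<^esub> b"
    then obtain F H where FH: "a = M.G.cls F" "b = M.G.cls H" "F \<in> M.FS" "H \<in> M.FS"
      by (auto simp: M.graded_algebra_eq M.G.carrier_Q)
    then have "F * H \<in> V.FI"
      using ab FI_iff_divides[of "F * H" \<gamma>] \<gamma> by (simp add: M.G.mult_mem M.graded_algebra_eq)
    then show "?p divides\<^bsub>?G\<^esub> a \<or> ?p divides\<^bsub>?G\<^esub> b"
      using V.FI_prime[of F H] FS FH FI_iff_divides[OF _ \<gamma>] by auto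
  qed
  moreover have "?p \<noteq> \<zero>\<^bsub>?G\<^esub>"
    using \<gamma> by (simp add: M.graded_zero[of \<gamma>] M.graded_class_eq_iff)
  ultimately have "ring_prime\<^bsub>?G\<^esub> (initial_form M \<phi>)"
    by (simp add: ring_prime_def M.initial_form_eq[OF \<gamma>])
  then show ?thesis
    unfolding key_polys_def using monic val_dvd_iff small by auto
qed

end


section \<open>Expansions\<close>

context
  fixes \<phi> :: "'a::field poly"
  assumes deg: "0 < Polynomial.degree \<phi>"
begin

private lemma nz: "\<phi> \<noteq> 0" using deg by auto

lemma expansion_coeff_add: "expansion_coeff \<phi> (f + h) n = expansion_coeff \<phi> f n + expansion_coeff \<phi> h n"
  by (simp add: expansion_coeff_def poly_div_add_left poly_mod_add_left)

lemma expansion_coeff_0 [simp]: "expansion_coeff \<phi> 0 n = 0"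
  by (simp add: expansion_coeff_def)

lemma expansion_coeff_minus: "expansion_coeff \<phi> (- f) n = - expansion_coeff \<phi> f n"
  using expansion_coeff_add[of f "- f" n] by (simp add: add_eq_0_iff)

lemma expansion_coeff_diff: "expansion_coeff \<phi> (f - h) n = expansion_coeff \<phi> f n - expansion_coeff \<phi> h n"
  using expansion_coeff_add[of f "- h" n] by (simp add: expansion_coeff_minus)

lemma expansion_coeff_sum: "expansion_coeff \<phi> (\<Sum>i\<in>I. f i) n = (\<Sum>i\<in>I. expansion_coeff \<phi> (f i) n)"
  by (induction I rule: infinite_finite_induct) (auto simp: expansion_coeff_add)

lemma expansion_coeff_small: "Polynomial.degree (expansion_coeff \<phi> f n) < Polynomial.degree \<phi>"
  using degree_mod_less[OF nz, of "f div \<phi> ^ n"] deg by (auto simp: expansion_coeff_def)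

lemma expansion_coeff_at_0: "expansion_coeff \<phi> f 0 = f mod \<phi>"
  by (simp add: expansion_coeff_def)

lemma expansion_coeff_Suc: "expansion_coeff \<phi> f (Suc n) = expansion_coeff \<phi> (f div \<phi>) n"
  by (simp add: expansion_coeff_def poly_div_mult_right)

lemma expansion_coeff_of_small:
  "Polynomial.degree a < Polynomial.degree \<phi> \<Longrightarrow> expansion_coeff \<phi> a n = (if n = 0 then a else 0)"
  by (cases n) (simp_all add: expansion_coeff_at_0 expansion_coeff_Suc mod_poly_less div_poly_less)

lemma expansion_coeff_times: "expansion_coeff \<phi> (\<phi> * f) n = (if n = 0 then 0 else expansion_coeff \<phi> f (n - 1))"
  using nz by (cases n) (simp_all add: expansion_coeff_at_0 expansion_coeff_Suc)

lemma expansion_coeff_times_power: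
  "expansion_coeff \<phi> (f * \<phi> ^ i) n = (if n < i then 0 else expansion_coeff \<phi> f (n - i))"
proof (induction i arbitrary: n)
  case (Suc i)
  have "f * \<phi> ^ Suc i = \<phi> * (f * \<phi> ^ i)" by simp
  then show ?case using Suc[of "n - 1"]
    by (simp only: expansion_coeff_times) (auto simp: less_Suc_eq_0_disj intro: arg_cong)
qed simp

lemma expansion_coeff_monomial:
  "Polynomial.degree a < Polynomial.degree \<phi> \<Longrightarrow>
    expansion_coeff \<phi> (a * \<phi> ^ i) n = (if n = i then a else 0)"
  by (auto simp: expansion_coeff_times_power expansion_coeff_of_small)

lemma expansion_coeff_eq_0: "Polynomial.degree f < n * Polynomial.degree \<phi> \<Longrightarrow> expansion_coeff \<phi> f n = 0"
  by (simp add: expansion_coeff_def div_poly_less degree_power_eq nz)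

lemma expansion_coeff_eq_0': "Polynomial.degree f < n \<Longrightarrow> expansion_coeff \<phi> f n = 0"
  using deg by (intro expansion_coeff_eq_0) (metis One_nat_def Suc_leI mult_le_mono2 nat_mult_1_right order_less_le_trans)

lemma expansion:
  "Polynomial.degree f < Suc N * Polynomial.degree \<phi> \<Longrightarrow> f = (\<Sum>n\<le>N. expansion_coeff \<phi> f n * \<phi> ^ n)"
proof (induction N arbitrary: f)
  case 0
  then show ?case by (simp add: expansion_coeff_at_0 mod_poly_less)
next
  case (Suc N)
  have "Polynomial.degree (f div \<phi>) < Suc N * Polynomial.degree \<phi>"
  proof (cases "f div \<phi> = 0")
    case False
    have "Polynomial.degree (f div \<phi> * \<phi> + f mod \<phi>) = Polynomial.degree (f div \<phi>) + Polynomial.degree \<phi>"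
      using False nz degree_mod_less[OF nz, of f] deg by (subst degree_add_eq_left) (auto simp: degree_mult_eq)
    then show ?thesis using Suc.prems by simp
  qed (use deg in simp)
  from Suc.IH[OF this]
  have "f = f mod \<phi> + (\<Sum>n\<le>N. expansion_coeff \<phi> (f div \<phi>) n * \<phi> ^ n) * \<phi>"
    by (metis add.commute div_mult_mod_eq)
  moreover have "(\<Sum>n\<le>N. expansion_coeff \<phi> f (Suc n) * \<phi> ^ Suc n) = (\<Sum>n\<le>N. expansion_coeff \<phi> (f div \<phi>) n * \<phi> ^ n) * \<phi>"
    unfolding sum_distrib_right by (intro sum.cong) (simp_all add: expansion_coeff_Suc)
  ultimately show ?case
    by (simp only: sum.atMost_Suc_shift expansion_coeff_at_0 power_0 mult_1_right)
qed

lemma expansion_degree: "f = (\<Sum>n\<le>Polynomial.degree f. expansion_coeff \<phi> f n * \<phi> ^ n)"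
  using deg by (intro expansion) (metis Suc_leI lessI mult_le_mono2 nat_mult_1_right order_less_le_trans One_nat_def)

lemma expansion_coeff_monic:
  assumes "Polynomial.lead_coeff \<phi> = 1" "Polynomial.lead_coeff f = 1"
    "Polynomial.degree f = r * Polynomial.degree \<phi>"
  shows "expansion_coeff \<phi> f r = 1"
proof -
  have dr: "Polynomial.degree (\<phi> ^ r) = r * Polynomial.degree \<phi>"
    by (simp add: degree_power_eq nz)
  have lc: "Polynomial.lead_coeff (\<phi> ^ r) = 1"
    using assms(1) by (simp add: lead_coeff_power)
  \<comment> \<open>Both polynomials are monic of the same degree, so their difference has too small
    a degree to contribute to the quotient.\<close>
  have "(f - \<phi> ^ r) div \<phi> ^ r = 0"
  proof (cases "r = 0")
    case True
    then have "f = 1" using assms by (auto elim!: degree_eq_zeroE)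
    then show ?thesis using True by simp
  next
    case False
    have "Polynomial.degree (f - \<phi> ^ r) \<le> Polynomial.degree (\<phi> ^ r)"
      using assms(3) dr by (intro degree_diff_le) auto
    moreover have "coeff (f - \<phi> ^ r) (Polynomial.degree (\<phi> ^ r)) = 0"
      using assms(2,3) lc dr by simp
    ultimately have "f - \<phi> ^ r = 0 \<or> Polynomial.degree (f - \<phi> ^ r) < Polynomial.degree (\<phi> ^ r)"
      by (intro eq_zero_or_degree_less)
    then show ?thesis by (auto simp: div_poly_less)
  qed
  then have "f div \<phi> ^ r = 1"
    using poly_div_add_left[of "f - \<phi> ^ r" "\<phi> ^ r" "\<phi> ^ r"] nz by simp
  then show ?thesis using deg by (simp add: expansion_coeff_def mod_poly_less)
qed

end

text \<open>Euclid's algorithm, from (a, b) to (b mod a, a). The measure is the degree shifted by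
  one, so that zero ranks below the nonzero constants.\<close>

lemma bezout_poly:
  fixes a b :: "'a::field poly"
  shows "\<exists>d r s. d = r * a + s * b \<and> d dvd a \<and> d dvd b"
proof (induction "if a = 0 then 0 else Suc (Polynomial.degree a)" arbitrary: a b rule: less_induct)
  case less
  show ?case
  proof (cases "a = 0")
    case True
    then show ?thesis by (intro exI[of _ b] exI[of _ 0] exI[of _ 1]) auto
  next
    case False
    have "(if b mod a = 0 then 0 else Suc (Polynomial.degree (b mod a))) < (if a = 0 then 0 else Suc (Polynomial.degree a))"
      using False degree_mod_less[OF False, of b] by auto
    from less.hyps[OF this, of a] obtain d r s where d: "d = r * (b mod a) + s * a" "d dvd b mod a" "d dvd a"
      by blast
    have "b mod a = b - (b div a) * a" by (simp add: minus_div_mult_eq_mod)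
    then have "d = (s - r * (b div a)) * a + r * b"
      by (simp only: d(1) \<open>b mod a = b - (b div a) * a\<close>) (simp add: algebra_simps)
    moreover have "d dvd b" using d by (simp add: dvd_mod_iff)
    ultimately show ?thesis using d by blast
  qed
qed


section \<open>Augmented valuations\<close>

lemma Infty_eq_extval_add [simp]: "Infty = x + y \<longleftrightarrow> x = Infty \<or> y = Infty"
  by (metis extval_add_eq_Infty)

text \<open>For a key polynomial \<open>\<phi>\<close> of \<open>\<mu>\<close>, the function \<open>V f = \<mu> (f mod \<phi>)\<close> is a valuation with kernel
  generated by \<open>\<phi>\<close>, and \<open>[\<mu>; \<phi>, lam]\<close> depends on \<open>V\<close> only. This treats the first
  augmentation \<open>[v; x, lam]\<close> and the later ones alike.\<close>

locale key_stage = V: poly_valuation V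
  for V :: "'a::field poly \<Rightarrow> 'g::linordered_rat_vector extval" +
  fixes \<phi> :: "'a poly"
  assumes monic: "Polynomial.lead_coeff \<phi> = 1" and deg: "0 < Polynomial.degree \<phi>"
    and kernel: "V f = Infty \<longleftrightarrow> \<phi> dvd f"
begin

abbreviation "small a \<equiv> Polynomial.degree a < Polynomial.degree \<phi>"
abbreviation "cf \<equiv> expansion_coeff \<phi>"

lemmas cf_simps = expansion_coeff_add[OF deg] expansion_coeff_diff[OF deg] expansion_coeff_sum[OF deg]

lemma cf_small [simp]: "small (cf f n)" by (rule expansion_coeff_small[OF deg])

lemma cf_zero [simp]: "cf 0 n = 0" by (rule expansion_coeff_0[OF deg])

lemma nz [simp]: "\<phi> \<noteq> 0" using deg by auto

lemma small_finite: "small a \<Longrightarrow> V a = Infty \<longleftrightarrow> a = 0"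
  using kernel[of a] dvd_imp_degree_le[of \<phi> a] by auto

lemma small_finiteE: "small a \<Longrightarrow> a \<noteq> 0 \<Longrightarrow> (\<And>\<alpha>. V a = Fin \<alpha> \<Longrightarrow> P) \<Longrightarrow> P"
  using small_finite[of a] by (cases "V a") auto

lemma V_mod: "V (f mod \<phi>) = V f"
proof (cases "\<phi> dvd f")
  case True
  then show ?thesis using kernel by (metis V.val_zero dvd_imp_mod_0)
next
  case False
  have "V (\<phi> * (f div \<phi>)) = Infty" by (simp add: kernel)
  moreover have "V (f mod \<phi>) \<noteq> Infty" using False kernel[of "f mod \<phi>"] by (simp add: dvd_mod_iff)
  ultimately have "V (f mod \<phi> + \<phi> * (f div \<phi>)) = V (f mod \<phi>)"
    by (intro V.val_add_eq) simp
  then show ?thesis by simp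
qed

lemma mod_small [simp]: "small (f mod \<phi>)"
  using cf_small[of f 0] by (simp add: expansion_coeff_at_0[OF deg])

lemma div_small: "small a \<Longrightarrow> small b \<Longrightarrow> small ((a * b) div \<phi>)"
proof (cases "(a * b) div \<phi> = 0")
  case False
  assume "small a" "small b"
  then have "Polynomial.degree (a * b) < Polynomial.degree \<phi> + Polynomial.degree \<phi>"
    using degree_mult_le[of a b] by linarith
  moreover have "Polynomial.degree ((a * b) div \<phi> * \<phi> + (a * b) mod \<phi>) = Polynomial.degree ((a * b) div \<phi>) + Polynomial.degree \<phi>"
    using False mod_small[of "a * b"] by (subst degree_add_eq_left) (auto simp: degree_mult_eq simp del: mod_small)
  ultimately show ?thesis by simp
qed (use deg in auto)

lemma cf_mult_small:
  assumes "small a" "small b"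
  shows "cf (a * b) n = (if n = 0 then (a * b) mod \<phi> else if n = 1 then (a * b) div \<phi> else 0)"
proof -
  have "a * b = (a * b) mod \<phi> + ((a * b) div \<phi>) * \<phi> ^ 1" by simp
  then have "cf (a * b) n = cf ((a * b) mod \<phi>) n + cf (((a * b) div \<phi>) * \<phi> ^ 1) n"
    by (metis cf_simps(1))
  then show ?thesis
    using expansion_coeff_monomial[OF deg div_small[OF assms], of 1 n]
    by (auto simp: expansion_coeff_of_small[OF deg])
qed

text \<open>The kernel of V is prime, so \<phi> is irreducible: a common divisor d of a and \<phi>
  is constant or a multiple of \<phi>, and the latter would give a infinite value. Bezout's
  identity, divided by d, is then the inverse.\<close>

lemma small_inverse:
  assumes "small a" "a \<noteq> 0"
  obtains b where "small b" "b \<noteq> 0" "(a * b) mod \<phi> = 1"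
proof -
  obtain d r s where d: "d = r * a + s * \<phi>" "d dvd a" "d dvd \<phi>"
    using bezout_poly[of a \<phi>] by blast
  obtain k where k: "\<phi> = d * k" using d by auto
  have "V d + V k = Infty" using kernel[of "d * k"] k by (simp add: V.val_mult)
  then have "\<phi> dvd d \<or> \<phi> dvd k" by (simp add: kernel)
  moreover have "\<not> \<phi> dvd d"
    using d assms kernel small_finite by (meson dvd_trans)
  ultimately have "\<phi> dvd k" by simp
  then have "Polynomial.degree \<phi> \<le> Polynomial.degree k" 
    using k by (intro dvd_imp_degree_le) auto
  moreover have "d \<noteq> 0" "k \<noteq> 0" using k nz by auto
  ultimately have "Polynomial.degree d = 0"
    using degree_mult_eq[of d k] k by simp
  then obtain c where c: "d = [:c:]" by (auto elim: degree_eq_zeroE)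
  have "c \<noteq> 0" using c k nz by auto
  define b where "b = (smult (inverse c) r) mod \<phi>"
  have "(a * b) mod \<phi> = (smult (inverse c) (r * a)) mod \<phi>"
    unfolding b_def by (simp add: mod_mult_right_eq mult.commute)
  also have "smult (inverse c) (r * a) = 1 - smult (inverse c) s * \<phi>"
  proof -
    have "smult (inverse c) (r * a) + smult (inverse c) s * \<phi> = smult (inverse c) d"
      unfolding d(1) by (simp add: smult_add_right)
    also have "\<dots> = 1" using c \<open>c \<noteq> 0\<close> by (simp add: one_pCons)
    finally show ?thesis by (simp add: eq_diff_eq)
  qed
  also have "(1 - smult (inverse c) s * \<phi>) mod \<phi> = 1"
    using deg by (metis mod_mult_self3 mod_diff_right_eq diff_zero mod_mult_self2_is_0 mod_poly_less degree_1)
  finally have 1: "(a * b) mod \<phi> = 1" .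
  then have "b \<noteq> 0" by auto
  moreover have "small b" by (simp add: b_def)
  ultimately show ?thesis using that 1 by blast
qed

end

text \<open>Multiplying two digits of \<phi>-expansions leaves the remainder
  \<open>(a * b) mod \<phi>\<close>, of value V a + V b, and carries the quotient to the next power
  of \<phi>. \<open>carry\<close> says that the carried term has strictly larger value, so initial
  forms multiply without carrying.\<close>

locale augmentation = key_stage V \<phi>
  for V :: "'a::field poly \<Rightarrow> 'g::linordered_rat_vector extval" and \<phi> +
  fixes lam :: 'g
  assumes carry: "Polynomial.degree a < Polynomial.degree \<phi> \<Longrightarrow> Polynomial.degree b < Polynomial.degree \<phi> \<Longrightarrow>
    a \<noteq> 0 \<Longrightarrow> b \<noteq> 0 \<Longrightarrow> V a + V b < V ((a * b) div \<phi>) + Fin lam"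
begin

abbreviation "M \<equiv> augment V \<phi> lam"
definition "tm f n = V (cf f n) + Fin (of_nat n *\<^sub>Q lam)"

lemma tm_beyond: "Polynomial.degree f < n \<Longrightarrow> tm f n = Infty"
  by (simp add: tm_def expansion_coeff_eq_0'[OF deg])

lemma M_eq: "M f = Min (tm f ` {..Polynomial.degree f})"
  by (simp add: augment_def tm_def[abs_def])

lemma M_le: "M f \<le> tm f n"
  by (cases "n \<le> Polynomial.degree f") (auto simp: M_eq tm_beyond intro: Min_le)

lemma M_attained: obtains n where "n \<le> Polynomial.degree f" "M f = tm f n"
proof -
  have "M f \<in> tm f ` {..Polynomial.degree f}"
    unfolding M_eq by (rule Min_in) auto
  then show ?thesis using that by auto
qed

lemma le_M: "c \<le> M f \<longleftrightarrow> (\<forall>n. c \<le> tm f n)"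
  using M_le M_attained[of f] order_trans by metis

lemma less_M: "c < M f \<longleftrightarrow> (\<forall>n. c < tm f n)"
proof 
  assume "c < M f" then show "\<forall>n. c < tm f n" using M_le order.strict_trans2 by blast
next
  assume "\<forall>n. c < tm f n" then show "c < M f" using M_attained[of f] by metis
qed

lemma M_finite: "M f = Infty \<longleftrightarrow> f = 0"
proof
  assume "M f = Infty"
  then have *: "tm f n = Infty" for n using M_le[of f n] by simp
  have "cf f n = 0" for n
    using *[of n] small_finite[OF cf_small, of f n] by (simp add: tm_def)
  then show "f = 0" using expansion_degree[OF deg, of f] by simp
next
  assume "f = 0" then show "M f = Infty" by (simp add: M_eq tm_def)
qed

lemma M_zero [simp]: "M 0 = Infty" by (simp add: M_finite)

lemma tm_add: "min (tm f n) (tm h n) \<le> tm (f + h) n"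
proof (cases "V (cf f n) \<le> V (cf h n)")
  case True
  then have "V (cf f n) \<le> V (cf (f + h) n)"
    using V.val_add[of "cf f n" "cf h n"] by (simp add: cf_simps min_def)
  then show ?thesis unfolding tm_def by (intro min.coboundedI1 add_right_mono)
next
  case False
  then have "V (cf h n) \<le> V (cf (f + h) n)"
    using V.val_add[of "cf f n" "cf h n"] by (simp add: cf_simps min_def)
  then show ?thesis unfolding tm_def by (intro min.coboundedI2 add_right_mono)
qed

lemma M_add: "min (M f) (M h) \<le> M (f + h)"
  unfolding le_M using tm_add M_le by (meson min.coboundedI1 min.coboundedI2 min.mono order_trans)

lemma M_small: 
  assumes "small a" shows "M a = V a"
proof (rule antisym)
  have t: "tm a n = (if n = 0 then V a else Infty)" for n
    using assms by (auto simp: tm_def expansion_coeff_of_small[OF deg])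
  show "M a \<le> V a" using M_le[of a 0] t by simp
  show "V a \<le> M a" unfolding le_M using t by simp
qed

lemma M_one: "M 1 = 0"
  using M_small[of 1] deg by simp

lemma tm_times_power:
  "tm (f * \<phi> ^ i) n = (if n < i then Infty else tm f (n - i) + Fin (of_nat i *\<^sub>Q lam))"
proof (cases "n < i")
  case False
  then have "of_nat n *\<^sub>Q lam = of_nat (n - i) *\<^sub>Q lam + of_nat i *\<^sub>Q lam"
    using scaleQ_of_nat_add[of "n - i" i lam] by simp
  then show ?thesis using False
    by (simp add: tm_def expansion_coeff_times_power[OF deg] add.assoc)
qed (simp add: tm_def expansion_coeff_times_power[OF deg])

lemma M_times_power: "M (f * \<phi> ^ i) = M f + Fin (of_nat i *\<^sub>Q lam)"
proof (rule antisym)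
  obtain n where n: "M f = tm f n" by (rule M_attained)
  show "M (f * \<phi> ^ i) \<le> M f + Fin (of_nat i *\<^sub>Q lam)"
    using M_le[of "f * \<phi> ^ i" "n + i"] n by (simp add: tm_times_power)
  show "M f + Fin (of_nat i *\<^sub>Q lam) \<le> M (f * \<phi> ^ i)"
    unfolding le_M by (auto simp: tm_times_power intro: add_right_mono M_le)
qed

lemma M_phi: "M \<phi> = Fin lam"
  using M_times_power[of 1 1] by (simp add: M_one scaleQ_one)

lemma small_mult:
  assumes "small a" "small b"
  shows "V a + V b \<le> M (a * b)" "M (a * b - (a * b) mod \<phi>) = V ((a * b) div \<phi>) + Fin lam"
proof -
  have "a * b - (a * b) mod \<phi> = ((a * b) div \<phi>) * \<phi> ^ 1"
    by (simp add: minus_mod_eq_div_mult)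
  then show *: "M (a * b - (a * b) mod \<phi>) = V ((a * b) div \<phi>) + Fin lam"
    using M_times_power[of "(a * b) div \<phi>" 1] M_small[OF div_small[OF assms]] by (simp add: scaleQ_one)
  show "V a + V b \<le> M (a * b)"
  proof (cases "a = 0 \<or> b = 0")
    case False
    then have "V a + V b < M (a * b - (a * b) mod \<phi>)" using carry assms * by simp
    moreover have "M ((a * b) mod \<phi>) = V a + V b"
      by (simp add: M_small V_mod V.val_mult)
    ultimately have "V a + V b \<le> min (M (a * b - (a * b) mod \<phi>)) (M ((a * b) mod \<phi>))"
      by simp
    also have "\<dots> \<le> M ((a * b - (a * b) mod \<phi>) + (a * b) mod \<phi>)" by (rule M_add)
    finally show ?thesis by simp
  qed auto
qed

text \<open>The degree of the initial form of f in the variable given by \<phi>. Its additivity on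
  products goes together with the multiplicativity of M, and it later separates algebraic from
  transcendental residues.\<close>

definition "lastix f = Max {n. n \<le> Polynomial.degree f \<and> tm f n = M f}"

lemma lastix_props:
  assumes "f \<noteq> 0"
  shows "tm f (lastix f) = M f" "\<And>n. lastix f < n \<Longrightarrow> M f < tm f n"
proof -
  let ?S = "{n. n \<le> Polynomial.degree f \<and> tm f n = M f}"
  have ne: "?S \<noteq> {}" using M_attained[of f] by (metis (mono_tags, lifting) empty_iff mem_Collect_eq)
  have fin: "finite ?S" by simp
  show "tm f (lastix f) = M f" using Max_in[OF fin ne] unfolding lastix_def by auto
  fix n assume n: "lastix f < n"
  then have "n \<notin> ?S" using Max_ge[OF fin, of n] unfolding lastix_def by (meson leD)
  moreover have "tm f n = Infty" if "\<not> n \<le> Polynomial.degree f" using that by (simp add: tm_beyond)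
  moreover have "M f \<noteq> Infty" using assms by (simp add: M_finite)
  ultimately show "M f < tm f n" using M_le[of f n] by (cases "n \<le> Polynomial.degree f") auto
qed

lemma lastix_unique:
  assumes "f \<noteq> 0" "tm f n = M f" "\<And>k. n < k \<Longrightarrow> M f < tm f k" shows "lastix f = n"
  using lastix_props[OF assms(1)] assms by (metis linorder_less_linear order_less_irrefl)

lemma cf_mult:
  "cf (f * h) n = (\<Sum>p\<in>{..Polynomial.degree f} \<times> {..Polynomial.degree h}.
     cf (cf f (fst p) * cf h (snd p) * \<phi> ^ (fst p + snd p)) n)"
proof -
  have "f * h = (\<Sum>i\<le>Polynomial.degree f. \<Sum>j\<le>Polynomial.degree h. cf f i * cf h j * \<phi> ^ (i + j))"
    by (subst expansion_degree[OF deg, of f], subst expansion_degree[OF deg, of h])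
      (simp add: sum_product power_add ac_simps)
  also have "\<dots> = (\<Sum>p\<in>{..Polynomial.degree f} \<times> {..Polynomial.degree h}. cf f (fst p) * cf h (snd p) * \<phi> ^ (fst p + snd p))"
    by (simp add: sum.cartesian_product case_prod_beta)
  finally show ?thesis by (metis (no_types, lifting) cf_simps(3) sum.cong)
qed

lemma tm_shift: "tm f i + tm h j = V (cf f i) + V (cf h j) + Fin (of_nat (i + j) *\<^sub>Q lam)"
  unfolding tm_def by (cases "V (cf f i)"; cases "V (cf h j)") (simp_all add: scaleQ_add_left ac_simps)

text \<open>In the position i + j the product of two digits has exactly the sum of the values; its
  carry, in the next position, is strictly above that sum, and all other positions are
  empty.\<close>

lemma tm_product:
  shows "tm (cf f i * cf h j * \<phi> ^ (i + j)) (i + j) = tm f i + tm h j"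
    and "n \<noteq> i + j \<Longrightarrow> tm f i + tm h j < tm (cf f i * cf h j * \<phi> ^ (i + j)) n \<or> tm (cf f i * cf h j * \<phi> ^ (i + j)) n = Infty"
proof -
  show "tm (cf f i * cf h j * \<phi> ^ (i + j)) (i + j) = tm f i + tm h j"
    unfolding tm_times_power tm_shift by (simp add: tm_def cf_mult_small V_mod V.val_mult)
  show "tm f i + tm h j < tm (cf f i * cf h j * \<phi> ^ (i + j)) n \<or> tm (cf f i * cf h j * \<phi> ^ (i + j)) n = Infty"
    if "n \<noteq> i + j"
  proof (cases "n = Suc (i + j) \<and> cf f i \<noteq> 0 \<and> cf h j \<noteq> 0")
    case True
    then have "V (cf f i) + V (cf h j) < V ((cf f i * cf h j) div \<phi>) + Fin lam"
      using carry by simp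
    from extval_add_less_mono1[OF this order_refl, of "Fin (of_nat (i + j) *\<^sub>Q lam)"]
    show ?thesis using True
      unfolding tm_times_power tm_shift by (simp add: tm_def cf_mult_small scaleQ_one)
  next
    case False
    then show ?thesis using that
      unfolding tm_times_power by (auto simp: tm_def cf_mult_small)
  qed
qed

text \<open>Gauss's lemma: in position \<open>lastix f + lastix h\<close> exactly one pair of digits
  attains M f + M h. Any other pair summing to that position exceeds one of the two last indices,
  and carries are strictly larger.\<close>

lemma M_mult_lastix:
  assumes "f \<noteq> 0" "h \<noteq> 0"
  shows "M (f * h) = M f + M h" "lastix (f * h) = lastix f + lastix h"
proof -
  let ?I = "{..Polynomial.degree f} \<times> {..Polynomial.degree h}"
  let ?P = "\<lambda>p. cf f (fst p) * cf h (snd p) * \<phi> ^ (fst p + snd p)"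
  have fin: "M f \<noteq> Infty" "M h \<noteq> Infty" using assms by (auto simp: M_finite)
  have tmle: "M f + M h \<le> tm (?P p) n" for p n
  proof -
    have "M f + M h \<le> tm f (fst p) + tm h (snd p)" by (intro add_mono M_le)
    moreover have "tm f (fst p) + tm h (snd p) \<le> tm (?P p) n"
    proof (cases "n = fst p + snd p")
      case False
      then have "tm f (fst p) + tm h (snd p) < tm (?P p) n \<or> tm (?P p) n = Infty"
        by (rule tm_product(2))
      then show ?thesis by (elim disjE) (simp_all add: less_imp_le)
    qed (simp add: tm_product(1))
    ultimately show ?thesis by (rule order_trans)
  qed
  have tmless: "M f + M h < tm (?P p) n" if "lastix f + lastix h \<le> n" "p \<noteq> (lastix f, lastix h) \<or> n \<noteq> lastix f + lastix h" for p n
  proof (cases "n = fst p + snd p")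
    case True
    have "lastix f < fst p \<or> lastix h < snd p"
    proof (rule ccontr)
      assume "\<not> ?thesis"
      then have "fst p = lastix f" "snd p = lastix h" using that(1) True by linarith+
      then show False using that(2) True by (metis prod.collapse)
    qed
    then have "M f + M h < tm f (fst p) + tm h (snd p)"
      using extval_add_less_mono1[OF lastix_props(2)[OF assms(1)] M_le] 
        extval_add_less_mono2[OF M_le lastix_props(2)[OF assms(2)]] fin by auto
    then show ?thesis using tm_product(1)[where i = "fst p" and j = "snd p" and f = f and h = h] True by simp
  next
    case False
    have "M f + M h \<le> tm f (fst p) + tm h (snd p)" by (intro add_mono M_le)
    moreover have "tm f (fst p) + tm h (snd p) < tm (?P p) n \<or> tm (?P p) n = Infty"
      using False by (rule tm_product(2))
    ultimately show ?thesis using fin by (elim disjE) (auto intro: order.strict_trans1)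
  qed
  \<comment> \<open>Moving the finite shift n lam to the other side turns estimates for
    \<open>tm\<close> at a fixed n into estimates for V, where the ultrametric inequality for sums
    applies.\<close>
  have tm_alt: "c < tm g n \<longleftrightarrow> c + Fin (- (of_nat n *\<^sub>Q lam)) < V (cf g n)" if "c \<noteq> Infty" for c g n
    using that unfolding tm_def by (cases c; cases "V (cf g n)") (auto simp: diff_less_eq)
  have tm_alt': "c \<le> tm g n \<longleftrightarrow> c + Fin (- (of_nat n *\<^sub>Q lam)) \<le> V (cf g n)" if "c \<noteq> Infty" for c g n
    using that unfolding tm_def by (cases c; cases "V (cf g n)") (auto simp: diff_le_eq)
  have le: "M f + M h \<le> tm (f * h) n" for n
  proof -
    have "M f + M h + Fin (- (of_nat n *\<^sub>Q lam)) \<le> V (\<Sum>p\<in>?I. cf (?P p) n)"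
      using tmle[of _ n] tm_alt'[of "M f + M h" _ n] fin by (intro V.val_sum_ge) simp
    then show ?thesis
      using tm_alt'[of "M f + M h" "f * h" n] fin by (simp only: cf_mult[of f h n]) simp
  qed
  have less: "M f + M h < tm (f * h) n" if "lastix f + lastix h < n" for n
  proof -
    have "M f + M h + Fin (- (of_nat n *\<^sub>Q lam)) < V (\<Sum>p\<in>?I. cf (?P p) n)"
      using tmless[of n] tm_alt[of "M f + M h" _ n] that fin by (intro V.val_sum_gr) simp_all
    then show ?thesis
      using tm_alt[of "M f + M h" "f * h" n] fin by (simp only: cf_mult[of f h n]) simp
  qed
  have eq: "tm (f * h) (lastix f + lastix h) = M f + M h"
  proof -
    let ?n = "lastix f + lastix h"
    have t: "tm (?P (lastix f, lastix h)) ?n = M f + M h"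
      using tm_product(1)[where i = "lastix f" and j = "lastix h" and f = f and h = h] lastix_props[OF assms(1)] lastix_props[OF assms(2)] by simp
    have "V (cf (f * h) ?n) = V (cf (?P (lastix f, lastix h)) ?n)"
      unfolding cf_mult[of f h ?n]
    proof (rule V.val_sum_unique_min)
      show "(lastix f, lastix h) \<in> ?I"
        using lastix_props(1)[OF assms(1)] lastix_props(1)[OF assms(2)] fin
        by (auto intro!: leI dest: tm_beyond)
      show "V (cf (?P (lastix f, lastix h)) ?n) \<noteq> Infty"
        using t fin by (auto simp: tm_def)
      fix p assume "p \<in> ?I" "p \<noteq> (lastix f, lastix h)"
      then have "tm (?P (lastix f, lastix h)) ?n < tm (?P p) ?n" using tmless[of ?n p] t by simp
      then show "V (cf (?P (lastix f, lastix h)) ?n) < V (cf (?P p) ?n)"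
        unfolding tm_def by (cases "V (cf (?P (lastix f, lastix h)) ?n)"; cases "V (cf (?P p) ?n)") auto
    qed auto
    then show ?thesis using t by (simp add: tm_def)
  qed
  show M: "M (f * h) = M f + M h"
    using le M_le[of "f * h" "lastix f + lastix h"] eq by (intro antisym) (auto simp: le_M)
  show "lastix (f * h) = lastix f + lastix h"
    using assms eq M less by (intro lastix_unique) auto
qed

lemma M_valuation: "is_valuation M"
  unfolding is_valuation_def
proof (intro conjI allI)
  fix f h
  show "M (f * h) = M f + M h"
    using M_mult_lastix(1)[of f h] by (cases "f = 0 \<or> h = 0") (auto simp: M_finite)
qed (auto simp: M_one M_add)

sublocale M: poly_valuation M
  by unfold_locales (rule M_valuation)

lemma M_le_V: "M f \<le> V f"
proof -
  have "tm f 0 = V f" by (simp add: tm_def expansion_coeff_at_0[OF deg] V_mod)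
  then show ?thesis using M_le[of f 0] by simp
qed

sublocale pair: valuation_pair M V \<phi>
  by unfold_locales (auto simp: M_le_V monic deg kernel M_finite M_small)

text \<open>An inverse modulo \<phi> is also one in the graded algebra: \<open>a * b - 1\<close> is
  the carried term, positive by \<open>carry\<close>.\<close>

lemma small_inverse_M:
  assumes "small a" "a \<noteq> 0"
  obtains b \<alpha> where "small b" "b \<noteq> 0" "V a = Fin \<alpha>" "V b = Fin (- \<alpha>)" "0 < M (a * b - 1)" "(a * b) mod \<phi> = 1"
proof -
  obtain b where b: "small b" "b \<noteq> 0" "(a * b) mod \<phi> = 1" using small_inverse[OF assms] by blast
  have 0: "V a + V b = 0"
    using b(3) V_mod[of "a * b"] by (simp add: V.val_mult)
  obtain \<alpha> where \<alpha>: "V a = Fin \<alpha>" using small_finiteE[OF assms] by blast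
  then have "V b = Fin (- \<alpha>)" using 0 by (cases "V b") (auto simp: add_eq_0_iff)
  moreover have "0 < M (a * b - 1)"
    using small_mult(2)[OF assms(1) b(1)] carry[OF assms(1) b(1) assms(2) b(2)] 0 b(3) by simp
  ultimately show ?thesis using that b \<alpha> by blast
qed

text \<open>Below the degree of \<phi> every nonzero polynomial has a unit as initial form, and a
  unit is not prime.\<close>

lemma no_smaller_key_poly:
  assumes "\<chi> \<in> key_polys M" shows "Polynomial.degree \<phi> \<le> Polynomial.degree \<chi>"
proof (rule ccontr)
  assume "\<not> ?thesis"
  then have \<chi>: "small \<chi>" "\<chi> \<noteq> 0" using assms by (auto simp: key_polys_def)
  obtain b \<alpha> where b: "small b" "V \<chi> = Fin \<alpha>" "V b = Fin (- \<alpha>)" "0 < M (\<chi> * b - 1)"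
    using small_inverse_M[OF \<chi>] by metis
  then have "initial_form M \<chi> \<in> Units (graded_algebra M)"
    using M.graded_class_Unit(1)[of \<chi> \<alpha> b] M.initial_form_eq[of \<chi> \<alpha>] M_small \<chi> by simp
  then show False using assms by (auto simp: key_polys_def ring_prime_def Divisibility.prime_def)
qed

lemma min_key_poly: "\<phi> \<in> min_key_polys M"
  using pair.key_poly no_smaller_key_poly by (auto simp: min_key_polys_def)

text \<open>V itself is the larger element of the tree: M \<le> V everywhere, while at \<phi> the
  values are lam and \<open>Infty\<close>.\<close>

lemma inner_nodeI:
  assumes "\<And>a. V [:a:] = v a" "is_valuation v"
  shows "inner_node v M"
proof -
  have "M [:a:] = v a" for a using M_small[of "[:a:]"] deg assms by simp
  moreover have "M < V"
  proof -
    have "\<not> V \<phi> \<le> M \<phi>" using M_phi kernel[of \<phi>] by simp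
    then have "\<not> V \<le> M" by (auto dest: le_funD)
    moreover have "M \<le> V" by (intro le_funI M_le_V)
    ultimately show ?thesis by (simp add: less_le_not_le)
  qed
  ultimately show ?thesis
    unfolding inner_node_def val_tree_def using M_valuation V.val assms by auto
qed

end


section \<open>Evaluation in the algebraic closure\<close>

definition evac :: "'a::field poly \<Rightarrow> 'a alg_closure \<Rightarrow> 'a alg_closure" where
  "evac f t = poly (map_poly to_ac f) t"

lemma map_poly_to_ac_add [simp]: "map_poly to_ac (f + h) = map_poly to_ac f + map_poly to_ac h"
  by (simp add: poly_eq_iff coeff_map_poly)

lemma map_poly_to_ac_minus [simp]: "map_poly to_ac (- f) = - map_poly to_ac f"
  by (simp add: poly_eq_iff coeff_map_poly)

lemma map_poly_to_ac_mult [simp]: "map_poly to_ac (f * h) = map_poly to_ac f * map_poly to_ac h"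
  by (simp add: poly_eq_iff coeff_map_poly coeff_mult to_ac_sum)

lemma map_poly_to_ac_eq_0 [simp]: "map_poly to_ac f = 0 \<longleftrightarrow> f = 0"
  by (auto simp: poly_eq_iff coeff_map_poly)

lemma degree_map_poly_to_ac [simp]: "Polynomial.degree (map_poly to_ac f) = Polynomial.degree f"
  by (intro degree_map_poly) auto

lemma lead_coeff_map_poly_to_ac [simp]:
  "Polynomial.lead_coeff (map_poly to_ac f) = to_ac (Polynomial.lead_coeff f)"
  by (simp add: coeff_map_poly)

lemma evac_0 [simp]: "evac 0 t = 0"
  and evac_1 [simp]: "evac 1 t = 1"
  and evac_pCons: "evac (pCons a f) t = to_ac a + t * evac f t"
  and evac_const [simp]: "evac [:a:] t = to_ac a"
  and evac_add [simp]: "evac (f + h) t = evac f t + evac h t"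
  and evac_minus [simp]: "evac (- f) t = - evac f t"
  and evac_mult [simp]: "evac (f * h) t = evac f t * evac h t"
  by (auto simp: evac_def map_poly_pCons)

lemma evac_diff [simp]: "evac (f - h) t = evac f t - evac h t"
  using evac_add[of f "- h" t] by simp

lemma evac_power [simp]: "evac (f ^ n) t = evac f t ^ n"
  by (induction n) auto

lemma evac_sum: "evac (\<Sum>i\<in>I. f i) t = (\<Sum>i\<in>I. evac (f i) t)"
  by (induction I rule: infinite_finite_induct) auto

lemma evac_pcompose: "evac (pcompose p q) t = evac p (evac q t)"
  by (induction p) (auto simp: pcompose_pCons evac_pCons)

lemma evac_dvd: "f dvd h \<Longrightarrow> evac f t = 0 \<Longrightarrow> evac h t = 0"
  by (auto simp: dvd_def)

lemma evac_root_exists: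
  assumes "0 < Polynomial.degree f" obtains t where "evac f t = 0"
proof -
  have "\<exists>t. poly (map_poly to_ac f) t = 0"
    using assms by (intro alg_closed_imp_poly_has_root) simp
  then show ?thesis using that by (auto simp: evac_def)
qed


section \<open>Residue fields\<close>

locale field_valuation = valuation v for v :: "'f::field \<Rightarrow> 'g::linordered_ab_group_add extval"
begin

sublocale subring_quotient "{z. 0 \<le> v z}" "{z. 0 < v z}"
proof
  fix x y
  show "x \<in> {z. 0 \<le> v z} \<Longrightarrow> y \<in> {z. 0 \<le> v z} \<Longrightarrow> x * y \<in> {z. 0 \<le> v z}"
    using add_mono[of 0 "v x" 0 "v y"] by (simp add: val_mult)
  show "x \<in> {z. 0 \<le> v z} \<Longrightarrow> y \<in> {z. 0 < v z} \<Longrightarrow> x * y \<in> {z. 0 < v z}"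
    using extval_add_less_mono2[of 0 "v x" 0 "v y"] by (simp add: val_mult)
qed (auto intro: val_diff_ge val_diff_gr less_imp_le)

lemma residue_field_eq: "residue_field v = Q"
  by (simp add: residue_field_def val_ring_def max_ideal_def)

lemma residue_eq: "residue v z = cls z"
  by (simp add: residue_def val_ring_def max_ideal_def cls_def)

lemma field_Q: "field Q"
proof (rule Q.cring_fieldI2)
  show "\<zero>\<^bsub>Q\<^esub> \<noteq> \<one>\<^bsub>Q\<^esub>"
    using cls_eq_zero[of 1] by (auto simp: cls_one)
  fix a assume "a \<in> carrier Q" "a \<noteq> \<zero>\<^bsub>Q\<^esub>"
  then obtain z where z: "a = cls z" "0 \<le> v z"
    unfolding carrier_Q by blast
  moreover have "\<not> 0 < v z"
    using cls_eq_zero[of z] z \<open>a \<noteq> \<zero>\<^bsub>Q\<^esub>\<close> by simp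
  ultimately have z: "a = cls z" "0 \<le> v z" "\<not> 0 < v z" by auto
  then have vz: "v z = Fin 0" by simp
  then have "v (inverse z) = Fin 0" using field_valuation_inverse[OF val vz] by simp
  moreover have "z \<noteq> 0" using vz by auto
  ultimately show "\<exists>b\<in>carrier Q. a \<otimes>\<^bsub>Q\<^esub> b = \<one>\<^bsub>Q\<^esub>"
    using z vz by (intro bexI[of _ "cls (inverse z)"]) (auto simp: cls_one)
qed

end

locale finite_poly_valuation = poly_valuation +
  assumes finite: "\<mu> f = Infty \<longleftrightarrow> f = 0"
begin

lemma fract_val_Fract:
  assumes "h \<noteq> 0" "\<mu> h = Fin b" shows "fract_val \<mu> (Fract f h) = \<mu> f + Fin (- b)"
  unfolding fract_val_def
proof (rule the_equality)
  have *: "\<mu> f = \<mu> f + Fin (- b) + \<mu> h" using assms by (simp add: add.assoc)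
  show "\<forall>f' h'. h' \<noteq> 0 \<and> Fract f h = Fract f' h' \<longrightarrow> \<mu> f' = \<mu> f + Fin (- b) + \<mu> h'"
  proof (intro allI impI)
    fix f' h' assume h': "h' \<noteq> 0 \<and> Fract f h = Fract f' h'"
    then have "f * h' = f' * h" using eq_fract(1)[of h h' f f'] assms(1) by blast
    then have eq: "\<mu> f + \<mu> h' = \<mu> f' + Fin b" using val_mult assms by metis
    obtain c where c: "\<mu> h' = Fin c" using finite[of h'] h' by (cases "\<mu> h'") auto
    show "\<mu> f' = \<mu> f + Fin (- b) + \<mu> h'"
      using eq c by (cases "\<mu> f"; cases "\<mu> f'") (auto simp: algebra_simps)
  qed
  fix \<gamma> assume "\<forall>f' h'. h' \<noteq> 0 \<and> Fract f h = Fract f' h' \<longrightarrow> \<mu> f' = \<gamma> + \<mu> h'"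
  then have "\<mu> f = \<gamma> + Fin b" using assms by auto
  then show "\<gamma> = \<mu> f + Fin (- b)" by (cases \<gamma>; cases "\<mu> f") auto
qed

lemma finiteE: "f \<noteq> 0 \<Longrightarrow> (\<And>a. \<mu> f = Fin a \<Longrightarrow> P) \<Longrightarrow> P"
  using finite[of f] by (cases "\<mu> f") auto

lemma fract_val_poly [simp]: "fract_val \<mu> (Fract f 1) = \<mu> f"
  using fract_val_Fract[of 1 0 f] by simp

lemma fract_val_valuation: "is_valuation (fract_val \<mu>)"
  unfolding is_valuation_def
proof (intro conjI allI)
  show "fract_val \<mu> 0 = Infty" "fract_val \<mu> 1 = 0"
    by (simp_all add: Zero_fract_def One_fract_def)
  fix x y :: "'a poly fract"
  obtain a b where x: "x = Fract a b" "b \<noteq> 0" by (cases x)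
  obtain c d where y: "y = Fract c d" "d \<noteq> 0" by (cases y)
  note xy = x y
  obtain \<beta> where \<beta>: "\<mu> b = Fin \<beta>" using xy(2) by (rule finiteE)
  obtain \<delta> where \<delta>: "\<mu> d = Fin \<delta>" using xy(4) by (rule finiteE)
  have bd: "\<mu> (b * d) = Fin (\<beta> + \<delta>)" using \<beta> \<delta> by (simp add: val_mult)
  have "fract_val \<mu> (x * y) = \<mu> a + \<mu> c + Fin (- (\<beta> + \<delta>))"
    using xy fract_val_Fract[OF _ bd, of "a * c"] by (simp add: val_mult)
  also have "\<dots> = fract_val \<mu> x + fract_val \<mu> y"
    using xy fract_val_Fract[OF _ \<beta>, of a] fract_val_Fract[OF _ \<delta>, of c]
    by (cases "\<mu> a"; cases "\<mu> c") (auto simp: algebra_simps)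
  finally show "fract_val \<mu> (x * y) = fract_val \<mu> x + fract_val \<mu> y" .
  have "min (\<mu> (a * d)) (\<mu> (c * b)) \<le> \<mu> (a * d + c * b)" by (rule val_add)
  then have "min (\<mu> (a * d)) (\<mu> (c * b)) + Fin (- (\<beta> + \<delta>)) \<le> \<mu> (a * d + c * b) + Fin (- (\<beta> + \<delta>))"
    by (rule add_right_mono)
  also have "\<mu> (a * d + c * b) + Fin (- (\<beta> + \<delta>)) = fract_val \<mu> (x + y)"
    using xy fract_val_Fract[OF _ bd, of "a * d + c * b"] by simp
  also have "min (\<mu> (a * d)) (\<mu> (c * b)) + Fin (- (\<beta> + \<delta>)) = min (fract_val \<mu> x) (fract_val \<mu> y)"
    using xy fract_val_Fract[OF _ \<beta>, of a] fract_val_Fract[OF _ \<delta>, of c] \<beta> \<delta>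
    by (cases "\<mu> a"; cases "\<mu> c") (auto simp: val_mult min_def algebra_simps)
  finally show "min (fract_val \<mu> x) (fract_val \<mu> y) \<le> fract_val \<mu> (x + y)" .
qed

sublocale W: field_valuation "fract_val \<mu>"
  by unfold_locales (rule fract_val_valuation)

abbreviation "F \<equiv> residue_field (fract_val \<mu>)"
definition "\<beta> f = residue (fract_val \<mu>) (Fract f 1)"

lemma \<beta>_eq: "\<beta> f = W.cls (Fract f 1)"
  by (simp add: \<beta>_def W.residue_eq)

lemma F_field: "field F"
  using W.field_Q by (simp add: W.residue_field_eq)

sublocale F: field F by (rule F_field)

lemma \<beta>_carrier [simp]: "0 \<le> \<mu> f \<Longrightarrow> \<beta> f \<in> carrier F"
  by (simp add: \<beta>_eq W.residue_field_eq)

lemma \<beta>_mult: "0 \<le> \<mu> f \<Longrightarrow> 0 \<le> \<mu> h \<Longrightarrow> \<beta> f \<otimes>\<^bsub>F\<^esub> \<beta> h = \<beta> (f * h)"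
  by (simp add: \<beta>_eq W.residue_field_eq)

lemma \<beta>_add: "0 \<le> \<mu> f \<Longrightarrow> 0 \<le> \<mu> h \<Longrightarrow> \<beta> f \<oplus>\<^bsub>F\<^esub> \<beta> h = \<beta> (f + h)"
  by (simp add: \<beta>_eq W.residue_field_eq)

lemma \<beta>_one: "\<beta> 1 = \<one>\<^bsub>F\<^esub>"
  by (simp add: \<beta>_eq W.residue_field_eq W.cls_one One_fract_def)

lemma \<beta>_zero: "\<beta> 0 = \<zero>\<^bsub>F\<^esub>"
  by (simp add: \<beta>_eq W.residue_field_eq W.cls_zero Zero_fract_def)

lemma \<beta>_eq_iff: "0 \<le> \<mu> f \<Longrightarrow> 0 \<le> \<mu> h \<Longrightarrow> \<beta> f = \<beta> h \<longleftrightarrow> 0 < \<mu> (f - h)"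
  by (simp add: \<beta>_eq W.cls_eq_iff)

lemma \<beta>_eq_zero: "0 \<le> \<mu> f \<Longrightarrow> \<beta> f = \<zero>\<^bsub>F\<^esub> \<longleftrightarrow> 0 < \<mu> f"
  using \<beta>_eq_iff[of f 0] by (simp add: \<beta>_zero)

lemma \<beta>_pow: "0 \<le> \<mu> f \<Longrightarrow> \<beta> f [^]\<^bsub>F\<^esub> (n::nat) = \<beta> (f ^ n)"
  by (induction n) (auto simp: \<beta>_one \<beta>_mult val_power_0 mult.commute)

lemma \<beta>_minus: "0 \<le> \<mu> f \<Longrightarrow> \<ominus>\<^bsub>F\<^esub> \<beta> f = \<beta> (- f)"
  by (rule F.minus_equality) (auto simp: \<beta>_add \<beta>_zero)

lemma \<beta>_inv: 
  assumes "0 \<le> \<mu> f" "0 \<le> \<mu> h" "0 < \<mu> (f * h - 1)" shows "inv\<^bsub>F\<^esub> \<beta> f = \<beta> h"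
proof -
  have "0 \<le> \<mu> (f * h)" using add_mono[OF assms(1,2)] by (simp add: val_mult)
  then have "\<beta> f \<otimes>\<^bsub>F\<^esub> \<beta> h = \<one>\<^bsub>F\<^esub>"
    using assms by (simp add: \<beta>_mult \<beta>_eq_iff flip: \<beta>_one)
  then show ?thesis
    using assms by (intro F.comm_inv_char) auto
qed

lemma mult_nonneg: "0 \<le> \<mu> f \<Longrightarrow> 0 \<le> \<mu> h \<Longrightarrow> 0 \<le> \<mu> (f * h)"
  using add_mono[of 0 "\<mu> f" 0 "\<mu> h"] by (simp add: val_mult)

lemma sum_nonneg: "(\<And>j. j \<in> J \<Longrightarrow> 0 \<le> \<mu> (c j)) \<Longrightarrow> 0 \<le> \<mu> (\<Sum>j\<in>J. c j)"
  by (rule val_sum_ge)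

lemma eval_\<beta>:
  assumes "\<And>j. j < n \<Longrightarrow> 0 \<le> \<mu> (c j)" "0 \<le> \<mu> t"
  shows "F.eval (map (\<lambda>j. \<beta> (c j)) (rev [0..<n])) (\<beta> t) = \<beta> (\<Sum>j<n. c j * t ^ j)"
  using assms(1)
proof (induction n)
  case 0
  then show ?case by (simp add: \<beta>_zero)
next
  case (Suc n)
  have *: "0 \<le> \<mu> (\<Sum>j<n. c j * t ^ j)"
    using Suc.prems assms(2) by (intro sum_nonneg mult_nonneg val_power_0) auto
  have "0 \<le> \<mu> (c n * t ^ n)" using Suc.prems assms(2) by (intro mult_nonneg val_power_0) auto
  then show ?case
    using Suc * assms(2) by (simp add: \<beta>_pow \<beta>_mult \<beta>_add val_power_0 add.commute)
qed

text \<open>Two representatives of a class of degree zero differ by an element of positive value, so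
  all have the same residue and \<open>the_elem\<close> is applied to a singleton.\<close>

lemma degree_zero_residue_class:
  assumes "0 \<le> \<mu> f" shows "degree_zero_residue \<mu> (graded_class \<mu> 0 f) = \<beta> f"
proof -
  have "{h. 0 \<le> \<mu> h \<and> graded_class \<mu> 0 f = graded_class \<mu> 0 h} = {h. 0 \<le> \<mu> h \<and> \<beta> h = \<beta> f}"
    using assms by (intro Collect_cong conj_cong refl) (simp add: graded_class_eq_iff \<beta>_eq_iff val_diff_commute[of f])
  then have "(\<lambda>h. residue (fract_val \<mu>) (Fract h 1)) ` {h. 0 \<le> \<mu> h \<and> graded_class \<mu> 0 f = graded_class \<mu> 0 h} = {\<beta> f}"
    using assms by (auto simp flip: \<beta>_def)
  then show ?thesis by (simp add: degree_zero_residue_def)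
qed

end


section \<open>The field of algebraic residues\<close>

context key_stage
begin

text \<open>As in \<open>small_inverse\<close>, primality of the kernel makes \<phi> irreducible; it
  is the minimal polynomial of each of its roots.\<close>

lemma evac_phi_root:
  assumes "evac \<phi> t = 0" shows "evac f t = 0 \<longleftrightarrow> \<phi> dvd f"
proof
  assume f: "evac f t = 0"
  obtain d r s where d: "d = r * f + s * \<phi>" "d dvd f" "d dvd \<phi>"
    using bezout_poly[of f \<phi>] by blast
  have dt: "evac d t = 0" using f assms d(1) by simp
  obtain k where k: "\<phi> = d * k" using d by auto
  have "V d + V k = Infty" using kernel[of "d * k"] k by (simp add: V.val_mult)
  then consider "\<phi> dvd d" | "\<phi> dvd k" by (auto simp: kernel)
  then show "\<phi> dvd f"
  proof cases
    case 1 then show ?thesis using d(2) by (rule dvd_trans)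
  next
    case 2
    have "d \<noteq> 0" "k \<noteq> 0" using k nz by auto
    moreover have "Polynomial.degree \<phi> \<le> Polynomial.degree k"
      using 2 \<open>k \<noteq> 0\<close> by (rule dvd_imp_degree_le)
    ultimately have "Polynomial.degree d = 0"
      using degree_mult_eq[of d k] k by simp
    then obtain c where "d = [:c:]" by (auto elim: degree_eq_zeroE)
    then show ?thesis using dt \<open>d \<noteq> 0\<close> by simp
  qed
qed (use assms evac_dvd in blast)

end

locale valued_augmentation = augmentation V \<phi> lam
  for V :: "'a::field poly \<Rightarrow> 'g::linordered_rat_vector extval" and \<phi> lam +
  fixes v :: "'a \<Rightarrow> 'g extval"
  assumes v_val: "is_valuation v" and v_hull: "divisible_hull_of_values v" and V_const: "V [:a:] = v a"
begin

sublocale v: valuation v by unfold_locales (rule v_val)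

lemma v_finite: "v a = Infty \<longleftrightarrow> a = 0"
  by (rule field_valuation_finite[OF v_val])

sublocale M: finite_poly_valuation M
  by unfold_locales (rule M_finite)

abbreviation "\<beta> \<equiv> M.\<beta>"
abbreviation "F \<equiv> residue_field (fract_val M)"
abbreviation "k0 \<equiv> base_residue_field M"

lemma small_const [simp]: "small [:a:]" using deg by simp

lemma M_const: "M [:a:] = v a"
  using M_small[OF small_const] V_const by simp

lemma k0_eq: "k0 = \<beta> ` {[:a:] | a. 0 \<le> v a}"
  unfolding base_residue_field_def M.\<beta>_def[symmetric] M_const by auto

text \<open>A concrete description of \<open>kappa M\<close>, to which it is proved equal in
  \<open>kappa_eq\<close>. In this form field operations are computed by reduction modulo
  \<phi>.\<close>

definition "\<kappa> = \<beta> ` {a. small a \<and> 0 \<le> V a}"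

lemma \<kappa>I: "small a \<Longrightarrow> 0 \<le> V a \<Longrightarrow> \<beta> a \<in> \<kappa>"
  by (auto simp: \<kappa>_def)

lemma \<beta>_mod_mult:
  assumes "small a" "small b" "0 \<le> V a" "0 \<le> V b"
  shows "0 < M (a * b - (a * b) mod \<phi>)" "\<beta> (a * b) = \<beta> ((a * b) mod \<phi>)"
proof -
  have 0: "0 \<le> V a + V b" using add_mono[OF assms(3,4)] by simp
  show 1: "0 < M (a * b - (a * b) mod \<phi>)"
    using small_mult(2)[OF assms(1,2)] carry[OF assms(1,2)] 0 by (cases "a = 0 \<or> b = 0") auto
  have "0 \<le> M ((a * b) mod \<phi>)" by (simp add: M_small V_mod V.val_mult 0)
  moreover have "0 \<le> M (a * b)" using small_mult(1)[OF assms(1,2)] 0 by simp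
  ultimately show "\<beta> (a * b) = \<beta> ((a * b) mod \<phi>)" using 1 by (simp add: M.\<beta>_eq_iff)
qed

lemma \<kappa>_subfield: "subfield \<kappa> F"
proof (rule M.F.subfieldI'[OF M.F.subringI])
  show "\<kappa> \<subseteq> carrier F" by (auto simp: \<kappa>_def M_small)
  show "\<one>\<^bsub>F\<^esub> \<in> \<kappa>" using deg by (auto simp: M.\<beta>_one[symmetric] intro: \<kappa>I)
  fix x assume x: "x \<in> \<kappa>"
  then show "\<ominus>\<^bsub>F\<^esub> x \<in> \<kappa>"
    by (auto simp: \<kappa>_def M.\<beta>_minus M_small)
  fix y assume y: "y \<in> \<kappa>"
  obtain a b where ab: "x = \<beta> a" "small a" "0 \<le> V a" "y = \<beta> b" "small b" "0 \<le> V b"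
    using x y by (auto simp: \<kappa>_def)
  have "x \<otimes>\<^bsub>F\<^esub> y = \<beta> ((a * b) mod \<phi>)"
    using ab by (simp add: M.\<beta>_mult M_small \<beta>_mod_mult(2))
  then show "x \<otimes>\<^bsub>F\<^esub> y \<in> \<kappa>"
    using ab add_mono[OF ab(3,6)] by (auto intro!: \<kappa>I simp: V_mod V.val_mult)
  have "x \<oplus>\<^bsub>F\<^esub> y = \<beta> (a + b)"
    using ab by (simp add: M.\<beta>_add M_small)
  then show "x \<oplus>\<^bsub>F\<^esub> y \<in> \<kappa>"
    using ab by (auto intro!: \<kappa>I degree_add_less V.val_add_ge)
next
  fix z assume z: "z \<in> \<kappa> - {\<zero>\<^bsub>F\<^esub>}"
  then obtain a where a: "z = \<beta> a" "small a" "0 \<le> V a" by (auto simp: \<kappa>_def)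
  then have "\<not> 0 < V a" using z M.\<beta>_eq_zero[of a] M_small by auto
  then have "V a = 0" "a \<noteq> 0" using a by auto
  obtain b \<alpha> where b: "small b" "V a = Fin \<alpha>" "V b = Fin (- \<alpha>)" "0 < M (a * b - 1)"
    using small_inverse_M[OF a(2) \<open>a \<noteq> 0\<close>] by metis
  then have "V b = 0" using \<open>V a = 0\<close> by simp
  then have "inv\<^bsub>F\<^esub> z = \<beta> b"
    unfolding a(1) using b a by (intro M.\<beta>_inv) (auto simp: M_small)
  then show "inv\<^bsub>F\<^esub> z \<in> \<kappa>" using b \<open>V b = 0\<close> by (auto intro: \<kappa>I)
qed

lemma k0_subfield: "subfield k0 F"
proof (rule M.F.subfieldI'[OF M.F.subringI])
  show "k0 \<subseteq> carrier F" by (auto simp: k0_eq M_const)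
  show "\<one>\<^bsub>F\<^esub> \<in> k0"
    unfolding k0_eq M.\<beta>_one[symmetric] by (rule image_eqI[of _ _ "[:1:]"]) (auto simp: one_pCons)
  fix x assume x: "x \<in> k0"
  then obtain a where a: "x = \<beta> [:a:]" "0 \<le> v a" by (auto simp: k0_eq)
  then show "\<ominus>\<^bsub>F\<^esub> x \<in> k0"
    by (auto simp: k0_eq M.\<beta>_minus M_const intro!: image_eqI[of _ _ "[:- a:]"])
  fix y assume y: "y \<in> k0"
  then obtain b where b: "y = \<beta> [:b:]" "0 \<le> v b" by (auto simp: k0_eq)
  show "x \<otimes>\<^bsub>F\<^esub> y \<in> k0"
    using a b add_mono[OF a(2) b(2)] by (auto simp: k0_eq M.\<beta>_mult M_const v.val_mult intro!: image_eqI[of _ _ "[:a * b:]"])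
  show "x \<oplus>\<^bsub>F\<^esub> y \<in> k0"
    using a b by (auto simp: k0_eq M.\<beta>_add M_const intro!: image_eqI[of _ _ "[:a + b:]"] v.val_add_ge)
next
  fix z assume z: "z \<in> k0 - {\<zero>\<^bsub>F\<^esub>}"
  then obtain a where a: "z = \<beta> [:a:]" "0 \<le> v a" by (auto simp: k0_eq)
  then have "\<not> 0 < v a" using z M.\<beta>_eq_zero[of "[:a:]"] M_const by auto
  then have va: "v a = Fin 0" using a by auto
  then have "a \<noteq> 0" by auto
  have vi: "v (inverse a) = 0" using field_valuation_inverse[OF v_val va] by simp
  have "inv\<^bsub>F\<^esub> z = \<beta> [:inverse a:]"
    unfolding a(1) using va vi \<open>a \<noteq> 0\<close> by (intro M.\<beta>_inv) (auto simp: M_const one_pCons)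
  then show "inv\<^bsub>F\<^esub> z \<in> k0" using vi by (auto simp: k0_eq)
qed

lemma eval_expression:
  assumes "p \<in> carrier (univ_poly F K)" "K \<subseteq> \<beta> ` A"
  obtains c where "\<And>j. j < length p \<Longrightarrow> c j \<in> A" "p = map (\<lambda>j. \<beta> (c j)) (rev [0..<length p])"
proof -
  have set: "set p \<subseteq> K" using assms(1) by (auto simp: univ_poly_carrier[symmetric] polynomial_def)
  have "\<exists>a\<in>A. M.F.coeff p j = \<beta> a" if "j < length p" for j
  proof -
    have "M.F.coeff p j \<in> set p" using M.F.coeff_nth[OF that] that by simp
    then show ?thesis using set assms(2) by blast
  qed
  then obtain c where c: "\<And>j. j < length p \<Longrightarrow> c j \<in> A \<and> M.F.coeff p j = \<beta> (c j)"
    by metis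
  have "p = map (M.F.coeff p) (rev [0..<length p])" by (rule M.F.coeff_list[symmetric])
  also have "\<dots> = map (\<lambda>j. \<beta> (c j)) (rev [0..<length p])"
    using c by (intro map_cong) auto
  finally show ?thesis using c that by blast
qed

lemma expression_carrier:
  assumes "\<And>j. j \<le> n \<Longrightarrow> \<beta> (c j) \<in> K" "\<beta> (c n) \<noteq> \<zero>\<^bsub>F\<^esub>"
  shows "map (\<lambda>j. \<beta> (c j)) (rev [0..<Suc n]) \<in> carrier (univ_poly F K)"
  using assms by (auto simp: univ_poly_carrier[symmetric] polynomial_def)

text \<open>At a root t of \<phi>, the element a(t) is algebraic over K. A normalized algebraic
  relation for it holds modulo \<phi> for a; since reducing powers of a modulo \<phi> changes them
  only by positive value, it descends to a relation for the residue.\<close>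

lemma small_algebraic:
  assumes "small a" "0 \<le> V a"
  shows "(M.F.algebraic over k0) (\<beta> a)"
proof -
  obtain t where t: "evac \<phi> t = 0" using evac_root_exists[OF deg] by blast
  obtain q where q: "q \<noteq> 0" "evac q (evac a t) = 0"
    using alg_closure_algebraic[of "evac a t"] by (auto simp: evac_def)
  let ?A = "v ` (coeff q ` {..Polynomial.degree q})"
  have "Min ?A \<in> ?A" by (intro Min_in) auto
  then obtain i where i: "i \<le> Polynomial.degree q" "v (coeff q i) = Min ?A"
    by (metis (no_types, lifting) atMost_iff imageE)
  have le: "v (coeff q i) \<le> v (coeff q j)" for j
    by (cases "j \<le> Polynomial.degree q") (auto simp: i(2) coeff_eq_0 not_le)
  have "v (Polynomial.lead_coeff q) \<noteq> Infty" using q v_finite by simp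
  then obtain \<gamma> where \<gamma>: "v (coeff q i) = Fin \<gamma>" using le by (cases "v (coeff q i)") auto
  \<comment> \<open>Division by a coefficient of least value makes all coefficients integral and one
    of them a unit.\<close>
  define r where "r = smult (inverse (coeff q i)) q"
  have cr: "coeff r j = inverse (coeff q i) * coeff q j" for j by (simp add: r_def)
  have r0: "0 \<le> v (coeff r j)" for j
    using le[of j] field_valuation_inverse[OF v_val \<gamma>] \<gamma>
    by (cases "v (coeff q j)") (auto simp: cr v.val_mult)
  have ri: "v (coeff r i) = 0"
    using field_valuation_inverse[OF v_val \<gamma>] \<gamma> by (simp add: cr v.val_mult)
  \<comment> \<open>Coefficients beyond N have zero residue. Truncating there gives a nonzero
    leading residue, as coefficient lists of polynomials require.\<close>
  define N where "N = Max {j. j \<le> Polynomial.degree q \<and> v (coeff r j) = 0}"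
  have fin: "finite {j. j \<le> Polynomial.degree q \<and> v (coeff r j) = 0}" by simp
  have N: "v (coeff r N) = 0" "N \<le> Polynomial.degree q"
  proof -
    have "N \<in> {j. j \<le> Polynomial.degree q \<and> v (coeff r j) = 0}"
      unfolding N_def by (rule Max_in[OF fin]) (use i(1) ri in blast)
    then show "v (coeff r N) = 0" "N \<le> Polynomial.degree q" by simp_all
  qed
  have N': "0 < v (coeff r j)" if "N < j" for j
  proof (cases "j \<le> Polynomial.degree q")
    case True
    then have "v (coeff r j) \<noteq> 0" using that Max_ge[OF fin, of j] unfolding N_def
      by (metis (mono_tags, lifting) leD mem_Collect_eq)
    then show ?thesis using r0[of j] by (simp add: order.order_iff_strict)
  qed (simp add: cr coeff_eq_0 not_le)
  define p where "p = map (\<lambda>j. \<beta> [:coeff r j:]) (rev [0..<Suc N])"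
  have "p \<in> carrier (univ_poly F k0)"
    unfolding p_def using r0 N by (intro expression_carrier) (auto simp: k0_eq M.\<beta>_eq_zero M_const)
  moreover have "p \<noteq> []" by (simp add: p_def)
  moreover have "M.F.eval p (\<beta> a) = \<zero>\<^bsub>F\<^esub>"
  proof -
    define D where "D = Polynomial.degree q"
    have a0: "0 \<le> M a" using assms M_small by simp
    \<comment> \<open>modulo higher value, powers of \<open>a\<close> may be reduced modulo \<open>\<phi>\<close>\<close>
    have pow: "0 \<le> M (a ^ j) \<and> 0 < M (a ^ j - a ^ j mod \<phi>)" for j
    proof (induction j)
      case 0 then show ?case using deg by (simp add: mod_poly_less M_one)
    next
      case (Suc j)
      define b where "b = a ^ j mod \<phi>"
      have b: "0 \<le> V b" using Suc M_le_V[of "a ^ j"] order_trans unfolding b_def V_mod by blast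
      have "a ^ Suc j - a ^ Suc j mod \<phi> = a * (a ^ j - b) + (a * b - (a * b) mod \<phi>)"
        unfolding b_def by (simp add: algebra_simps mod_mult_right_eq)
      moreover have "0 < M (a * (a ^ j - b))"
        using extval_add_less_mono2[OF a0, of 0 "M (a ^ j - b)"] Suc by (simp add: b_def M.val_mult)
      moreover have "0 < M (a * b - (a * b) mod \<phi>)"
        using \<beta>_mod_mult(1)[of a b] assms b by (simp add: b_def)
      ultimately show ?case using Suc a0 M.val_add_gr M.mult_nonneg by simp
    qed
    have ev: "M.F.eval p (\<beta> a) = \<beta> (\<Sum>j<Suc N. [:coeff r j:] * a ^ j)"
      unfolding p_def using r0 a0 by (intro M.eval_\<beta>) (auto simp: M_const)
    have "pcompose q a = (\<Sum>j\<le>D. [:coeff q j:] * a ^ j)"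
      unfolding D_def pcompose_altdef poly_altdef by (simp add: degree_map_poly coeff_map_poly)
    then have "(\<Sum>j\<le>D. [:coeff r j:] * a ^ j) = smult (inverse (coeff q i)) (pcompose q a)"
      using sum_distrib_left[of "[:inverse (coeff q i):]" "\<lambda>j. [:coeff q j:] * a ^ j" "{..D}"]
      by (simp add: cr mult.commute)
    \<comment> \<open>The composition vanishes at the root t of \<phi>, whose minimal polynomial is
      \<phi>.\<close>
    moreover have "\<phi> dvd pcompose q a"
      using evac_phi_root[OF t, of "pcompose q a"] q by (simp add: evac_pcompose)
    ultimately have "\<phi> dvd (\<Sum>j\<le>D. [:coeff r j:] * a ^ j)" by (simp add: dvd_smult)
    moreover have "\<phi> dvd (\<Sum>j\<le>D. [:coeff r j:] * a ^ j) - (\<Sum>j\<le>D. [:coeff r j:] * (a ^ j mod \<phi>))"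
      unfolding sum_subtractf[symmetric] right_diff_distrib[symmetric]
      by (intro dvd_sum dvd_mult dvd_minus_mod)
    moreover have "\<phi> dvd x \<Longrightarrow> \<phi> dvd x - y \<Longrightarrow> \<phi> dvd y" for x y
      using dvd_diff[of \<phi> x "x - y"] by simp
    ultimately have "\<phi> dvd (\<Sum>j\<le>D. [:coeff r j:] * (a ^ j mod \<phi>))" by blast
    then have "(\<Sum>j\<le>D. [:coeff r j:] * (a ^ j mod \<phi>)) mod \<phi> = 0"
      by (rule dvd_imp_mod_0)
    moreover have "small (\<Sum>j\<le>D. [:coeff r j:] * (a ^ j mod \<phi>))"
    proof (rule degree_sum_less)
      show "Polynomial.degree ([:coeff r j:] * (a ^ j mod \<phi>)) < Polynomial.degree \<phi>" for j
        using mod_small[of "a ^ j"] degree_smult_le[of "coeff r j" "a ^ j mod \<phi>"] by (simp del: mod_small)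
    qed (rule deg)
    ultimately have zero: "(\<Sum>j\<le>D. [:coeff r j:] * (a ^ j mod \<phi>)) = 0" by (simp add: mod_poly_less)
    have "(\<Sum>j<Suc N. [:coeff r j:] * a ^ j) =
      (\<Sum>j\<le>D. [:coeff r j:] * a ^ j) - (\<Sum>j\<in>{N<..D}. [:coeff r j:] * a ^ j)"
    proof -
      have "{..D} = {..<Suc N} \<union> {N<..D}" using N(2) by (auto simp: D_def)
      moreover have "{..<Suc N} \<inter> {N<..D} = {}" by auto
      ultimately have "(\<Sum>j\<le>D. [:coeff r j:] * a ^ j) = (\<Sum>j<Suc N. [:coeff r j:] * a ^ j) + (\<Sum>j\<in>{N<..D}. [:coeff r j:] * a ^ j)"
        by (simp only: sum.union_disjoint finite_greaterThanAtMost finite_lessThan)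
      then show ?thesis by simp
    qed
    also have "(\<Sum>j\<le>D. [:coeff r j:] * a ^ j) = (\<Sum>j\<le>D. [:coeff r j:] * (a ^ j - a ^ j mod \<phi>))"
      using zero by (simp add: right_diff_distrib sum_subtractf del: mult_pCons_left)
    finally have eq: "(\<Sum>j<Suc N. [:coeff r j:] * a ^ j) =
      (\<Sum>j\<le>D. [:coeff r j:] * (a ^ j - a ^ j mod \<phi>)) - (\<Sum>j\<in>{N<..D}. [:coeff r j:] * a ^ j)" .
    have "0 < M (\<Sum>j<Suc N. [:coeff r j:] * a ^ j)"
      unfolding eq
    proof (intro M.val_diff_gr M.val_sum_gr)
      fix j show "0 < M ([:coeff r j:] * (a ^ j - a ^ j mod \<phi>))"
        using extval_add_less_mono2[OF r0[of j], of 0] pow[of j] by (simp add: M.val_mult M_const del: mult_pCons_left)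
    next
      fix j assume "j \<in> {N<..D}"
      then show "0 < M ([:coeff r j:] * a ^ j)"
        using extval_add_less_mono1[OF N'[of j], of 0] pow[of j] by (simp add: M.val_mult M_const del: mult_pCons_left)
    qed simp_all
    then show ?thesis unfolding ev by (subst M.\<beta>_eq_zero) (auto intro: less_imp_le)
  qed
  ultimately show ?thesis by (rule M.F.algebraicI)
qed

end


section \<open>Degree of initial forms in \<phi>, and algebraic residues\<close>

context valued_augmentation
begin

lemma lastix_one: "f \<noteq> 0 \<Longrightarrow> (\<And>n. 0 < n \<Longrightarrow> M f < tm f n) \<Longrightarrow> lastix f = 0"
  using lastix_props(1)[of f] by (metis less_irrefl neq0_conv)

lemma lastix_small: "small a \<Longrightarrow> a \<noteq> 0 \<Longrightarrow> lastix a = 0"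
  by (rule lastix_one) (auto simp: tm_def expansion_coeff_of_small[OF deg] M_finite)

lemma lastix_const: "a \<noteq> 0 \<Longrightarrow> lastix [:a:] = 0"
  using lastix_small[of "[:a:]"] deg by simp

lemma lastix_power: "f \<noteq> 0 \<Longrightarrow> lastix (f ^ n) = n * lastix f"
  using lastix_small[of 1] deg by (induction n) (auto simp: M_mult_lastix)

lemma lastix_zero_unit: "f \<noteq> 0 \<Longrightarrow> h \<noteq> 0 \<Longrightarrow> 0 < M (f * h - 1) \<Longrightarrow> lastix f = 0"
proof -
  assume fh: "f \<noteq> 0" "h \<noteq> 0" "0 < M (f * h - 1)"
  have M: "M (f * h) = 0"
    using M.val_eq_of_diff[of 1 "f * h"] fh(3) by (simp add: M_one M.val_diff_commute[of 1])
  have "lastix (f * h) = 0"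
  proof (rule lastix_one)
    fix n :: nat assume "0 < n"
    then have "cf (f * h - 1) n = cf (f * h) n"
      using deg by (simp add: cf_simps expansion_coeff_of_small[OF deg])
    then have "tm (f * h) n = tm (f * h - 1) n" by (simp add: tm_def)
    then show "M (f * h) < tm (f * h) n" using fh(3) M by (simp add: less_M)
  qed (use fh in simp)
  then show ?thesis using M_mult_lastix(2)[OF fh(1,2)] by simp
qed

lemma lastix_zero_mod:
  assumes "f \<noteq> 0" "lastix f = 0"
  shows "M f < M (f - f mod \<phi>)" "V (f mod \<phi>) = M f"
proof -
  show less: "M f < M (f - f mod \<phi>)"
    unfolding less_M
  proof
    fix n
    show "M f < tm (f - f mod \<phi>) n"
    proof (cases "n = 0")
      case True
      then show ?thesis using assms(1) by (simp add: tm_def cf_simps expansion_coeff_at_0[OF deg] M_finite)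
    next
      case False
      then have "tm (f - f mod \<phi>) n = tm f n"
        by (simp add: tm_def cf_simps expansion_coeff_of_small[OF deg])
      then show ?thesis using lastix_props(2)[OF assms(1), of n] assms(2) False by simp
    qed
  qed
  show "V (f mod \<phi>) = M f"
    using M.val_eq_of_diff[OF less] by (simp add: M_small)
qed

lemma lastix_zero_\<kappa>:
  assumes "0 \<le> M f" "f \<noteq> 0" "lastix f = 0"
  shows "\<beta> f \<in> \<kappa>"
proof -
  have "\<beta> f = \<beta> (f mod \<phi>)"
    using lastix_zero_mod[OF assms(2,3)] assms(1)
    by (subst M.\<beta>_eq_iff) (auto intro: order.strict_trans1 simp: M_small)
  then show ?thesis
    using lastix_zero_mod(2)[OF assms(2,3)] assms(1) by (auto intro!: \<kappa>I)
qed

text \<open>At index \<open>lastix h\<close> the digit of \<open>a * h\<close> comes from the digit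
  of h in the same place; digits at other places reach it only through carries, which have larger
  value.\<close>

lemma lastix_leading_term:
  assumes "small a" "a \<noteq> 0" "h \<noteq> 0"
  shows "M a + M h < V (cf (a * h) (lastix h) - (a * cf h (lastix h)) mod \<phi>) + Fin (of_nat (lastix h) *\<^sub>Q lam)"
proof -
  let ?l = "lastix h" and ?J = "{..Polynomial.degree h}"
  have l: "?l \<in> ?J"
  proof (rule ccontr)
    assume "?l \<notin> ?J"
    then have "tm h ?l = Infty" by (intro tm_beyond) simp
    then show False using lastix_props(1)[OF assms(3)] assms(3) M_finite[of h] by simp
  qed
  have "a * h = (\<Sum>j\<in>?J. a * cf h j * \<phi> ^ j)"
    by (subst expansion_degree[OF deg, of h]) (simp add: sum_distrib_left ac_simps)
  then have "cf (a * h) ?l = (\<Sum>j\<in>?J. cf (a * cf h j * \<phi> ^ j) ?l)"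
    by (metis (no_types, lifting) cf_simps(3) sum.cong)
  also have "\<dots> = cf (a * cf h ?l * \<phi> ^ ?l) ?l + (\<Sum>j\<in>?J - {?l}. cf (a * cf h j * \<phi> ^ j) ?l)"
    using l by (simp add: sum.remove)
  also have "cf (a * cf h ?l * \<phi> ^ ?l) ?l = (a * cf h ?l) mod \<phi>"
    using assms by (simp add: expansion_coeff_times_power[OF deg] cf_mult_small)
  finally have eq: "cf (a * h) ?l - (a * cf h ?l) mod \<phi> = (\<Sum>j\<in>?J - {?l}. cf (a * cf h j * \<phi> ^ j) ?l)"
    by simp
  have fin: "M a + M h \<noteq> Infty" using assms M_finite by simp
  have "M a + M h + Fin (- (of_nat ?l *\<^sub>Q lam)) < V (\<Sum>j\<in>?J - {?l}. cf (a * cf h j * \<phi> ^ j) ?l)"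
  proof (rule V.val_sum_gr)
    fix j assume j: "j \<in> ?J - {?l}"
    have "tm a 0 = M a" using assms by (simp add: tm_def expansion_coeff_of_small[OF deg] M_small)
    then have le: "M a + M h \<le> tm a 0 + tm h j" by (auto intro: add_mono M_le)
    moreover have "tm a 0 + tm h j < tm (a * cf h j * \<phi> ^ j) ?l \<or> tm (a * cf h j * \<phi> ^ j) ?l = Infty"
      using tm_product(2)[where f = a and i = 0 and h = h and j = j and n = ?l] j assms
      by (auto simp: expansion_coeff_of_small[OF deg])
    ultimately have "M a + M h < tm (a * cf h j * \<phi> ^ j) ?l"
      using fin by (elim disjE) (auto intro: order.strict_trans1)
    then show "M a + M h + Fin (- (of_nat ?l *\<^sub>Q lam)) < V (cf (a * cf h j * \<phi> ^ j) ?l)"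
      using fin by (cases "M a + M h"; cases "V (cf (a * cf h j * \<phi> ^ j) ?l)") (auto simp: tm_def diff_less_eq)
  qed (use fin in simp)
  then show ?thesis
    unfolding eq using fin
    by (cases "M a + M h"; cases "V (\<Sum>j\<in>?J - {?l}. cf (a * cf h j * \<phi> ^ j) ?l)") (auto simp: diff_less_eq)
qed

lemma M_normalize:
  assumes "f \<noteq> 0" obtains c where "c \<noteq> 0" "M (f * c) = 0"
proof -
  obtain \<gamma> where \<gamma>: "M f = Fin \<gamma>" using assms by (rule M.finiteE)
  obtain n b where n: "0 < n" "b \<noteq> 0" "v b = Fin (of_nat n *\<^sub>Q \<gamma>)"
    using v_hull unfolding divisible_hull_of_values_def by blast
  \<comment> \<open>Some positive multiple n \<gamma> is a value v b of a constant, so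
    \<open>f * c\<close> is f to the power n divided by b.\<close>
  define c where "c = f ^ (n - 1) * [:inverse b:]"
  have "f * c = f ^ n * [:inverse b:]" unfolding c_def using n(1) by (cases n) simp_all
  then have "M (f * c) = M (f ^ n) + v (inverse b)" by (simp only: M.val_mult M_const)
  then have "M (f * c) = 0"
    using valuation_power[OF M.valuation_axioms \<gamma>, of n] field_valuation_inverse[OF v_val n(3)] by simp
  then show ?thesis using that[of c] assms n by (simp add: c_def)
qed

lemma residue_quotient:
  assumes "z \<in> carrier F" "z \<noteq> \<zero>\<^bsub>F\<^esub>"
  obtains f h where "M f = 0" "M h = 0" "\<beta> h \<otimes>\<^bsub>F\<^esub> z = \<beta> f"
proof -
  obtain q where q: "z = M.W.cls q" "0 \<le> fract_val M q"
    using assms(1) by (auto simp: M.W.residue_field_eq M.W.carrier_Q)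
  moreover have "\<not> 0 < fract_val M q"
    using M.W.cls_eq_zero[of q] q assms(2) by (simp add: M.W.residue_field_eq)
  ultimately have q0: "fract_val M q = 0" by simp
  obtain f h where fh: "q = Fract f h" "h \<noteq> 0" by (cases q)
  obtain c where c: "c \<noteq> 0" "M (h * c) = 0" using M_normalize[OF fh(2)] by blast
  have q': "q * Fract (h * c) 1 = Fract (f * c) 1"
    using fh c by (simp add: eq_fract ac_simps)
  have "M (f * c) = fract_val M (q * Fract (h * c) 1)" unfolding q' by simp
  also have "\<dots> = 0" using q0 c by (simp only: M.W.val_mult M.fract_val_poly) simp
  finally have f0: "M (f * c) = 0" .
  have "\<beta> (h * c) \<otimes>\<^bsub>F\<^esub> z = \<beta> (f * c)"
    using q q' c by (simp add: M.\<beta>_eq M.W.residue_field_eq mult.commute[of "Fract (h * c) 1"])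
  then show ?thesis using that[OF f0 c(2)] by blast
qed

text \<open>Multiply a relation p(z) = 0 of degree s by the s-th power of h. If
  \<open>lastix f\<close> exceeded \<open>lastix h\<close>, the top term would be alone in reaching
  value 0 at index s \<open>lastix f\<close>, so the sum would have value 0, although its residue
  vanishes.\<close>

lemma algebraic_lastix_le:
  assumes z: "z \<in> carrier F" "(M.F.algebraic over k0) z"
    and fh: "M f = 0" "M h = 0" "\<beta> h \<otimes>\<^bsub>F\<^esub> z = \<beta> f"
  shows "lastix f \<le> lastix h"
proof (rule ccontr)
  assume "\<not> ?thesis"
  then have less: "lastix h < lastix f" by simp
  have nz: "f \<noteq> 0" "h \<noteq> 0" using fh by auto
  obtain p where p: "p \<in> carrier (univ_poly F k0)" "p \<noteq> []" "M.F.eval p z = \<zero>\<^bsub>F\<^esub>"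
    using M.F.algebraicE[OF subfieldE(1)[OF k0_subfield] z] by blast
  obtain c' where c': "\<And>j. j < length p \<Longrightarrow> c' j \<in> {[:a:] | a. 0 \<le> v a}"
      "p = map (\<lambda>j. \<beta> (c' j)) (rev [0..<length p])"
    using eval_expression[OF p(1), of "{[:a:] | a. 0 \<le> v a}"] k0_eq by blast
  define c where "c j = coeff (c' j) 0" for j
  have c: "c' j = [:c j:]" "0 \<le> v (c j)" if "j < length p" for j
    using c'(1)[OF that] by (auto simp: c_def)
  define s where "s = length p - 1"
  have s: "length p = Suc s" using p(2) by (cases p) (auto simp: s_def)
  have pc: "p = map (\<lambda>j. \<beta> [:c j:]) (rev [0..<Suc s])"
    by (subst c'(2)) (auto simp: s c intro!: map_cong)
  have lead: "v (c s) = 0"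
  proof -
    have "Polynomials.lead_coeff p \<noteq> \<zero>\<^bsub>F\<^esub>"
      using p by (auto simp: univ_poly_carrier[symmetric] polynomial_def)
    then have "\<beta> [:c s:] \<noteq> \<zero>\<^bsub>F\<^esub>" by (subst (asm) pc) simp
    then show ?thesis using c(2)[of s] s by (simp add: M.\<beta>_eq_zero M_const)
  qed
  \<comment> \<open>The homogenized partial sum of p: its residue is the truncation of p at z times
    the residue of \<open>h ^ (n - 1)\<close>.\<close>
  define S where "S n = (\<Sum>j<n. [:c j:] * f ^ j * h ^ (n - 1 - j))" for n
  have S0: "0 \<le> M ([:c j:] * f ^ j * h ^ k)" if "j \<le> s" for j k
    using that c(2)[of j] s fh by (intro M.mult_nonneg M.val_power_0) (auto simp: M_const)
  have SM: "0 \<le> M (S n)" if "n \<le> Suc s" for n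
    unfolding S_def using that S0 by (intro M.val_sum_ge) auto
  have ev: "\<beta> (h ^ (n - 1)) \<otimes>\<^bsub>F\<^esub> M.F.eval (map (\<lambda>j. \<beta> [:c j:]) (rev [0..<n])) z = \<beta> (S n)"
    if "n \<le> Suc s" for n
    using that
  proof (induction n)
    case 0
    then show ?case using fh by (simp add: S_def M.\<beta>_zero M.val_power_0)
  next
    case (Suc n)
    let ?e = "M.F.eval (map (\<lambda>j. \<beta> [:c j:]) (rev [0..<n])) z"
    have hc: "\<beta> h \<in> carrier F" "\<beta> (h ^ k) \<in> carrier F" "\<beta> (f ^ k) \<in> carrier F" for k
      using fh by (auto intro!: M.\<beta>_carrier M.val_power_0)
    have cc: "\<beta> [:c j:] \<in> carrier F" if "j \<le> n" for j
      using c(2)[of j] s Suc.prems that by (simp add: M_const)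
    have ec: "?e \<in> carrier F" using cc z by (intro M.F.eval_in_carrier) auto
    have pow: "\<beta> (h ^ n) \<otimes>\<^bsub>F\<^esub> z [^]\<^bsub>F\<^esub> n = \<beta> (f ^ n)"
    proof -
      have "(\<beta> h \<otimes>\<^bsub>F\<^esub> z) [^]\<^bsub>F\<^esub> n = \<beta> h [^]\<^bsub>F\<^esub> n \<otimes>\<^bsub>F\<^esub> z [^]\<^bsub>F\<^esub> n"
        by (rule M.F.nat_pow_distrib[OF hc(1) z(1)])
      then show ?thesis using fh M.\<beta>_pow[of f n] M.\<beta>_pow[of h n] by simp
    qed
    have Sn: "S (Suc n) = [:c n:] * f ^ n + h * S n"
    proof -
      have "S (Suc n) = [:c n:] * f ^ n + (\<Sum>j<n. [:c j:] * f ^ j * h ^ (n - j))"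
        by (simp add: S_def)
      also have "(\<Sum>j<n. [:c j:] * f ^ j * h ^ (n - j)) = h * S n"
        unfolding S_def sum_distrib_left
      proof (intro sum.cong refl)
        fix j assume "j \<in> {..<n}"
        then have "n - j = Suc (n - 1 - j)" by auto
        then show "[:c j:] * f ^ j * h ^ (n - j) = h * ([:c j:] * f ^ j * h ^ (n - 1 - j))"
          by (simp add: ac_simps)
      qed
      finally show ?thesis .
    qed
    have "\<beta> (h ^ n) \<otimes>\<^bsub>F\<^esub> (\<beta> [:c n:] \<otimes>\<^bsub>F\<^esub> z [^]\<^bsub>F\<^esub> n \<oplus>\<^bsub>F\<^esub> ?e) =
        \<beta> [:c n:] \<otimes>\<^bsub>F\<^esub> (\<beta> (h ^ n) \<otimes>\<^bsub>F\<^esub> z [^]\<^bsub>F\<^esub> n) \<oplus>\<^bsub>F\<^esub> \<beta> (h ^ n) \<otimes>\<^bsub>F\<^esub> ?e"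
      using hc cc[of n] ec z by (simp add: M.F.r_distr M.F.m_lcomm)
    also have "\<beta> (h ^ n) \<otimes>\<^bsub>F\<^esub> ?e = \<beta> (h * S n)"
    proof (cases n)
      case 0
      then show ?thesis using fh by (simp add: S_def M.\<beta>_zero)
    next
      case (Suc k)
      have "\<beta> (h ^ n) = \<beta> h \<otimes>\<^bsub>F\<^esub> \<beta> (h ^ (n - 1))"
        using Suc fh by (simp add: M.\<beta>_mult M.val_power_0)
      then have "\<beta> (h ^ n) \<otimes>\<^bsub>F\<^esub> ?e = \<beta> h \<otimes>\<^bsub>F\<^esub> \<beta> (S n)"
        using Suc.IH Suc.prems hc ec by (simp add: M.F.m_assoc)
      then show ?thesis using fh SM[of n] Suc.prems by (simp add: M.\<beta>_mult)
    qed
    also have "\<beta> [:c n:] \<otimes>\<^bsub>F\<^esub> (\<beta> (h ^ n) \<otimes>\<^bsub>F\<^esub> z [^]\<^bsub>F\<^esub> n) = \<beta> ([:c n:] * f ^ n)"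
      unfolding pow using c(2)[of n] s Suc.prems fh by (intro M.\<beta>_mult) (auto simp: M_const M.val_power_0)
    also have "\<beta> ([:c n:] * f ^ n) \<oplus>\<^bsub>F\<^esub> \<beta> (h * S n) = \<beta> (S (Suc n))"
      unfolding Sn using S0[of n 0] SM[of n] Suc.prems fh
      by (intro M.\<beta>_add) (auto intro!: M.mult_nonneg simp del: mult_pCons_left)
    finally show ?case by simp
  qed
  have "\<beta> (S (Suc s)) = \<zero>\<^bsub>F\<^esub>"
    using ev[of "Suc s"] p(3) pc fh by (simp add: M.val_power_0 del: upt_Suc)
  then have pos: "0 < M (S (Suc s))" using SM[of "Suc s"] by (simp add: M.\<beta>_eq_zero)
  let ?N = "s * lastix f"
  have t: "S (Suc s) = [:c s:] * f ^ s + (\<Sum>j<s. [:c j:] * f ^ j * h ^ (s - j))"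
    by (simp add: S_def)
  have cs: "c s \<noteq> 0" using lead by auto
  have "tm ([:c s:] * f ^ s) ?N = M ([:c s:] * f ^ s)"
    using lastix_props(1)[of "[:c s:] * f ^ s"] cs nz
    by (simp add: M_mult_lastix lastix_const lastix_power del: mult_pCons_left)
  also have "\<dots> = 0"
    using lead valuation_power[OF M.valuation_axioms, of f 0 s] fh(1)
    by (simp add: M.val_mult M_const del: mult_pCons_left)
  finally have t1: "tm ([:c s:] * f ^ s) ?N = 0" .
  \<comment> \<open>Each of these terms has its last index below N, so at N it lies strictly above
    its own value, which is nonnegative.\<close>
  have t2: "0 < tm (\<Sum>j<s. [:c j:] * f ^ j * h ^ (s - j)) ?N"
  proof -
    have tj: "0 < tm ([:c j:] * f ^ j * h ^ (s - j)) ?N" if "j < s" for j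
    proof (cases "c j = 0")
      case False
      let ?f = "[:c j:] * f ^ j * h ^ (s - j)"
      have "lastix ?f = j * lastix f + (s - j) * lastix h"
        using False nz by (simp add: M_mult_lastix lastix_const lastix_power del: mult_pCons_left)
      also have "\<dots> < j * lastix f + (s - j) * lastix f"
        using less that by simp
      also have "\<dots> = ?N" using that by (simp add: add_mult_distrib[symmetric])
      finally have "M ?f < tm ?f ?N"
        using False nz by (intro lastix_props(2)) (auto simp del: mult_pCons_left)
      then show ?thesis using S0[of j "s - j"] that by (auto intro: order.strict_trans1 simp del: mult_pCons_left)
    qed (simp add: tm_def)
    have alt: "0 < tm x ?N \<longleftrightarrow> Fin (- (of_nat ?N *\<^sub>Q lam)) < V (cf x ?N)" for x
      by (cases "V (cf x ?N)") (auto simp: tm_def diff_less_eq[of 0, simplified])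
    show ?thesis
      unfolding alt cf_simps using tj unfolding alt by (intro V.val_sum_gr) auto
  qed
  have "tm (S (Suc s)) ?N = 0"
  proof -
    have "tm ([:c s:] * f ^ s) ?N < tm (\<Sum>j<s. [:c j:] * f ^ j * h ^ (s - j)) ?N"
      using t1 t2 by simp
    then have "V (cf ([:c s:] * f ^ s) ?N) < V (cf (\<Sum>j<s. [:c j:] * f ^ j * h ^ (s - j)) ?N)"
      unfolding tm_def by (cases "V (cf ([:c s:] * f ^ s) ?N)"; cases "V (cf (\<Sum>j<s. [:c j:] * f ^ j * h ^ (s - j)) ?N)") auto
    from V.val_add_eq[OF this] show ?thesis
      using t1 unfolding t tm_def cf_simps by simp
  qed
  then show False using pos M_le[of "S (Suc s)" ?N] by simp
qed

end


context valued_augmentation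
begin

text \<open>For algebraic z = f / h, \<open>algebraic_lastix_le\<close> applied to z and to its
  inverse gives f and h the same last index l. Subtracting the quotient of their digits at l, an
  element of \<kappa>, cancels the leading term; the difference is again algebraic with denominator
  h, so it can only be zero.\<close>

lemma kappa_eq: "kappa M = \<kappa>"
proof
  show "\<kappa> \<subseteq> kappa M"
    using small_algebraic by (auto simp: kappa_def \<kappa>_def M_small)
  show "kappa M \<subseteq> \<kappa>"
  proof
    let ?A = "{z \<in> carrier F. (M.F.algebraic over k0) z}"
    have A: "subfield ?A F" by (rule M.F.subfield_of_algebraics[OF k0_subfield])
    note As = subfieldE(1)[OF A]
    fix z assume "z \<in> kappa M"
    then have z: "z \<in> carrier F" "(M.F.algebraic over k0) z" by (auto simp: kappa_def)
    have lastix_eq: "lastix f = lastix h"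
      if y: "y \<in> carrier F" "(M.F.algebraic over k0) y" and fh: "M f = 0" "M h = 0" "\<beta> h \<otimes>\<^bsub>F\<^esub> y = \<beta> f" for y f h
    proof (rule antisym)
      show "lastix f \<le> lastix h" by (rule algebraic_lastix_le[OF y fh])
      have bf: "\<beta> f \<in> carrier F" "\<beta> f \<noteq> \<zero>\<^bsub>F\<^esub>" and bh: "\<beta> h \<in> carrier F"
        using fh M.\<beta>_eq_zero[of f] by auto
      then have y0: "y \<noteq> \<zero>\<^bsub>F\<^esub>" using fh(3) M.F.r_null[OF bh] by metis
      then have "y \<in> Units F" using y M.F.field_Units by simp
      then have inv: "inv\<^bsub>F\<^esub> y \<in> carrier F" "y \<otimes>\<^bsub>F\<^esub> inv\<^bsub>F\<^esub> y = \<one>\<^bsub>F\<^esub>" by auto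
      have "inv\<^bsub>F\<^esub> y \<in> ?A"
        using M.F.subfield_m_inv(1)[OF A, of y] y y0 by simp
      moreover have "\<beta> f \<otimes>\<^bsub>F\<^esub> inv\<^bsub>F\<^esub> y = \<beta> h"
        using inv y bh by (simp add: fh(3)[symmetric] M.F.m_assoc)
      ultimately show "lastix h \<le> lastix f"
        using fh by (intro algebraic_lastix_le[of "inv\<^bsub>F\<^esub> y"]) auto
    qed
    show "z \<in> \<kappa>"
    proof (cases "z = \<zero>\<^bsub>F\<^esub>")
      case True
      then show ?thesis using subringE(2)[OF subfieldE(1)[OF \<kappa>_subfield]] by simp
    next
      case False
      obtain f h where fh: "M f = 0" "M h = 0" "\<beta> h \<otimes>\<^bsub>F\<^esub> z = \<beta> f"
        using residue_quotient[OF z(1) False] by blast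
      have nz: "f \<noteq> 0" "h \<noteq> 0" using fh by auto
      define l where "l = lastix h"
      have l: "lastix f = l" using lastix_eq[OF z fh] by (simp add: l_def)
      have tf: "tm f l = 0" and th: "tm h l = 0"
        using lastix_props(1)[OF nz(1)] lastix_props(1)[OF nz(2)] fh l by (auto simp: l_def)
      have "cf h l \<noteq> 0" using th by (auto simp: tm_def)
      obtain b \<alpha> where b: "small b" "b \<noteq> 0" "V (cf h l) = Fin \<alpha>" "V b = Fin (- \<alpha>)" "(cf h l * b) mod \<phi> = 1"
        using small_inverse_M[OF cf_small \<open>cf h l \<noteq> 0\<close>] by metis
      \<comment> \<open>The quotient of the two leading digits in the field of polynomials modulo
        \<phi>.\<close>
      define a where "a = (cf f l * b) mod \<phi>"
      have Vf: "V (cf f l) = Fin \<alpha>"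
        using tf th b(3) by (cases "V (cf f l)") (auto simp: tm_def eq_neg_iff_add_eq_0[symmetric])
      then have Va: "V a = 0" using b by (simp add: a_def V_mod V.val_mult)
      have a: "small a" "a \<noteq> 0" "M a = 0" using Va by (auto simp: a_def M_small)
      have alg_a: "\<beta> a \<in> ?A" using small_algebraic[OF a(1)] Va a(3) by simp
      define f' where "f' = f - a * h"
      have f'0: "0 \<le> M f'" unfolding f'_def using fh a M.val_mult[of a h] by (intro M.val_diff_ge) auto
      have bc: "\<beta> h \<in> carrier F" "\<beta> a \<in> carrier F" "\<beta> f \<in> carrier F" using fh a by auto
      have y: "z \<ominus>\<^bsub>F\<^esub> \<beta> a \<in> ?A"
        unfolding a_minus_def using z alg_a subringE(5,7)[OF As] by blast
      have "\<beta> h \<otimes>\<^bsub>F\<^esub> (z \<ominus>\<^bsub>F\<^esub> \<beta> a) = \<beta> h \<otimes>\<^bsub>F\<^esub> z \<oplus>\<^bsub>F\<^esub> \<ominus>\<^bsub>F\<^esub> (\<beta> h \<otimes>\<^bsub>F\<^esub> \<beta> a)"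
        using bc z by (simp add: a_minus_def M.F.r_distr M.F.r_minus)
      also have "\<dots> = \<beta> f'"
        using fh a M.val_mult[of a h] by (simp add: M.\<beta>_mult M.\<beta>_minus M.\<beta>_add f'_def mult.commute)
      finally have y': "\<beta> h \<otimes>\<^bsub>F\<^esub> (z \<ominus>\<^bsub>F\<^esub> \<beta> a) = \<beta> f'" .
      \<comment> \<open>The leading digits cancel up to carries, so f' no longer attains value 0 at
        l.\<close>
      have tf': "0 < tm f' l"
      proof -
        have "(a * cf h l) mod \<phi> = (cf f l * ((cf h l * b) mod \<phi>)) mod \<phi>"
          unfolding a_def by (simp add: mod_mult_left_eq mod_mult_right_eq ac_simps)
        also have "\<dots> = cf f l" unfolding b(5) by (simp add: mod_poly_less)
        finally have "cf f' l = - (cf (a * h) l - (a * cf h l) mod \<phi>)" by (simp add: f'_def cf_simps)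
        then have "tm f' l = V (cf (a * h) l - (a * cf h l) mod \<phi>) + Fin (of_nat l *\<^sub>Q lam)"
          unfolding tm_def by (simp only: V.val_minus)
        then show ?thesis using lastix_leading_term[OF a(1,2) nz(2)] a fh by (simp add: l_def)
      qed
      have "0 < M f'"
      proof (rule ccontr)
        assume "\<not> 0 < M f'"
        then have f'M: "M f' = 0" using f'0 by simp
        then have "f' \<noteq> 0" by auto
        have "lastix f' = l" using lastix_eq[OF _ _ f'M fh(2) y'] y by (simp add: l_def)
        then show False using lastix_props(1)[OF \<open>f' \<noteq> 0\<close>] f'M tf' by simp
      qed
      then have "\<beta> h \<otimes>\<^bsub>F\<^esub> (z \<ominus>\<^bsub>F\<^esub> \<beta> a) = \<zero>\<^bsub>F\<^esub>" using y' f'0 M.\<beta>_eq_zero by simp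
      moreover have "\<beta> h \<noteq> \<zero>\<^bsub>F\<^esub>" using fh M.\<beta>_eq_zero[of h] by simp
      ultimately have "z \<ominus>\<^bsub>F\<^esub> \<beta> a = \<zero>\<^bsub>F\<^esub>"
        using bc z by (metis M.F.integral M.F.minus_closed)
      then have "z = \<beta> a" using z bc by simp
      then show ?thesis using a Va by (auto intro: \<kappa>I)
    qed
  qed
qed

end


section \<open>Residual polynomials and roots\<close>

text \<open>\<open>u1\<close> represents the homogeneous unit chosen for the residual polynomial and
  \<open>u2\<close> its inverse. Polynomial representatives allow computing with residues instead of
  classes of the graded algebra.\<close>

locale residual_stage = valued_augmentation V \<phi> lam v
  for V :: "'a::field poly \<Rightarrow> 'g::linordered_rat_vector extval" and \<phi> lam v +
  fixes w :: "'a alg_closure \<Rightarrow> 'g extval" and u1 u2 :: "'a poly"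
  assumes w_ext: "extends_val v w"
    and u1: "M u1 = Fin (of_nat (rel_ramification M \<phi>) *\<^sub>Q lam)"
    and u2: "M u2 = Fin (- (of_nat (rel_ramification M \<phi>) *\<^sub>Q lam))"
    and u12: "0 < M (u1 * u2 - 1)"
begin

sublocale w: valuation w
  using w_ext by unfold_locales (simp add: extends_val_def)

lemma w_to_ac: "w (to_ac a) = v a"
  using w_ext by (simp add: extends_val_def)

abbreviation "e \<equiv> rel_ramification M \<phi>"

text \<open>Divisibility of values by a positive integer into those of constants makes the defining
  set of e nonempty. If i lam is a value of a small polynomial, so is (i mod e) lam, after
  multiplication by powers of an inverse of value - e lam; minimality of e forces i mod e =
  0.\<close>

lemma e_props:
  shows e_pos: "0 < e"
    and e_dvd: "\<And>a i. small a \<Longrightarrow> V a = Fin (of_nat i *\<^sub>Q lam) \<Longrightarrow> e dvd i"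
proof -
  define P where "P k \<longleftrightarrow> 0 < k \<and> (\<exists>a. small a \<and> V a = Fin (of_nat k *\<^sub>Q lam))" for k :: nat
  have eq: "Fin x \<in> M ` {a. a \<noteq> 0 \<and> small a} \<longleftrightarrow> (\<exists>a. small a \<and> V a = Fin x)" for x
  proof
    assume "Fin x \<in> M ` {a. a \<noteq> 0 \<and> small a}"
    then obtain a where "small a" "M a = Fin x" by auto
    then show "\<exists>a. small a \<and> V a = Fin x" by (intro exI[of _ a]) (simp add: M_small)
  next
    assume "\<exists>a. small a \<and> V a = Fin x"
    then obtain a where "small a" "V a = Fin x" by blast
    moreover from this have "a \<noteq> 0" by auto
    ultimately show "Fin x \<in> M ` {a. a \<noteq> 0 \<and> small a}" by (intro image_eqI[of _ _ a]) (simp_all add: M_small)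
  qed
  have rr: "e = (LEAST k. P k)"
    unfolding rel_ramification_def M_phi extval.sel P_def eq ..
  obtain n b where n: "0 < n" "b \<noteq> 0" "v b = Fin (of_nat n *\<^sub>Q lam)"
    using v_hull unfolding divisible_hull_of_values_def by blast
  then have "P n" using V_const[of b] small_const[of b] by (auto simp: P_def intro!: exI[of _ "[:b:]"])
  then have Pe: "P e" unfolding rr by (rule LeastI)
  then show "0 < e" by (simp add: P_def)
  obtain a0 where a0: "small a0" "V a0 = Fin (of_nat e *\<^sub>Q lam)" using Pe by (auto simp: P_def)
  then have "a0 \<noteq> 0" by auto
  obtain b0 where b0: "small b0" "V b0 = Fin (- (of_nat e *\<^sub>Q lam))"
    using small_inverse_M[OF a0(1) \<open>a0 \<noteq> 0\<close>] a0(2) by (metis extval.inject)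
  fix a i assume a: "small a" "V a = Fin (of_nat i *\<^sub>Q lam)"
  define q r where "q = i div e" and "r = i mod e"
  have i: "i = q * e + r" unfolding q_def r_def by (rule div_mult_mod_eq[symmetric])
  have "V ((a * b0 ^ q) mod \<phi>) = Fin (of_nat i *\<^sub>Q lam - of_nat q *\<^sub>Q (of_nat e *\<^sub>Q lam))"
    using a(2) valuation_power[OF V.valuation_axioms b0(2), of q]
    by (simp add: V_mod V.val_mult scaleQ_minus_right)
  also have "of_nat i *\<^sub>Q lam - of_nat q *\<^sub>Q (of_nat e *\<^sub>Q lam) = of_nat r *\<^sub>Q lam"
    by (subst i) (simp add: scaleQ_add_left scaleQ_scaleQ)
  finally have "V ((a * b0 ^ q) mod \<phi>) = Fin (of_nat r *\<^sub>Q lam)" .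
  then have "0 < r \<Longrightarrow> P r" unfolding P_def by (auto intro!: exI[of _ "(a * b0 ^ q) mod \<phi>"])
  moreover have "r < e" using \<open>0 < e\<close> by (simp add: r_def)
  ultimately have "r = 0" using not_less_Least[of r P] unfolding rr by blast
  then show "e dvd i" by (simp add: i)
qed

definition "elam = of_nat e *\<^sub>Q lam"

lemma Mu: "M u1 = Fin elam" "M u2 = Fin (- elam)"
  using u1 u2 by (auto simp: elam_def)

lemma u_nz: "u1 \<noteq> 0" "u2 \<noteq> 0"
  using Mu by auto

lemma u_lastix: "lastix u1 = 0" "lastix u2 = 0"
  using lastix_zero_unit[of u1 u2] lastix_zero_unit[of u2 u1] u_nz u12 by (auto simp: mult.commute)

lemma Mu_pow: "M (u1 ^ n) = Fin (of_nat n *\<^sub>Q elam)" "M (u2 ^ n) = Fin (- (of_nat n *\<^sub>Q elam))"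
  using valuation_power[OF M.valuation_axioms] Mu by (auto simp: scaleQ_minus_right)

lemma phi_pow: "M (\<phi> ^ n) = Fin (of_nat n *\<^sub>Q lam)"
  using valuation_power[OF M.valuation_axioms M_phi] .

text \<open>A power of \<phi> divided by the chosen unit, of value zero. Its residue takes the place
  of the variable y.\<close>

definition "T = \<phi> ^ e * u2"
definition "\<xi> = \<beta> T"
abbreviation "ev p \<equiv> M.F.eval p \<xi>"
abbreviation "KX \<equiv> univ_poly F \<kappa>"

lemma MT: "M T = 0"
  by (simp add: T_def M.val_mult Mu phi_pow elam_def)

lemma \<xi>_carrier: "\<xi> \<in> carrier F"
  by (simp add: \<xi>_def MT)

lemma \<kappa>_subset: "\<kappa> \<subseteq> \<beta> ` {a. small a \<and> 0 \<le> V a}"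
  by (simp add: \<kappa>_def)

sublocale KX: principal_domain KX
  by (rule M.F.univ_poly_is_principal[OF \<kappa>_subfield])

lemma ev_hom: "(\<lambda>p. ev p) \<in> ring_hom KX F"
  by (rule M.F.eval_is_hom[OF subfieldE(1)[OF \<kappa>_subfield] \<xi>_carrier])

lemma ev_mult: "p \<in> carrier KX \<Longrightarrow> q \<in> carrier KX \<Longrightarrow> ev (p \<otimes>\<^bsub>KX\<^esub> q) = ev p \<otimes>\<^bsub>F\<^esub> ev q"
  using ring_hom_mult[OF ev_hom] by simp

lemma ev_add: "p \<in> carrier KX \<Longrightarrow> q \<in> carrier KX \<Longrightarrow> ev (p \<oplus>\<^bsub>KX\<^esub> q) = ev p \<oplus>\<^bsub>F\<^esub> ev q"
  using ring_hom_add[OF ev_hom] by simp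

lemma ev_one: "ev \<one>\<^bsub>KX\<^esub> = \<one>\<^bsub>F\<^esub>"
  using ring_hom_one[OF ev_hom] by simp

lemma ev_expression:
  assumes "\<And>j. j < n \<Longrightarrow> 0 \<le> M (c j)"
  shows "ev (map (\<lambda>j. \<beta> (c j)) (rev [0..<n])) = \<beta> (\<Sum>j<n. c j * T ^ j)"
  unfolding \<xi>_def using assms MT by (intro M.eval_\<beta>) auto

lemma ev_lift:
  assumes "p \<in> carrier KX" obtains f where "0 \<le> M f" "\<beta> f = ev p"
proof -
  obtain c where c: "\<And>j. j < length p \<Longrightarrow> c j \<in> {a. small a \<and> 0 \<le> V a}"
    "p = map (\<lambda>j. \<beta> (c j)) (rev [0..<length p])"
    using eval_expression[OF assms \<kappa>_subset] by blast
  have "ev p = \<beta> (\<Sum>j<length p. c j * T ^ j)"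
    by (subst c(2), rule ev_expression) (use c(1) M_small in auto)
  moreover have "0 \<le> M (\<Sum>j<length p. c j * T ^ j)"
    using c(1) MT by (intro M.val_sum_ge M.mult_nonneg M.val_power_0) (auto simp: M_small)
  ultimately show ?thesis using that by simp
qed

text \<open>Under this condition, errors of positive M-value remain negligible after evaluation at
  t.\<close>

definition "dominates t \<longleftrightarrow> (\<forall>f. M f \<le> w (evac f t))"

lemma dominatesD: "dominates t \<Longrightarrow> M f \<le> w (evac f t)"
  by (simp add: dominates_def)

lemma dominatesI:
  assumes "\<And>a. small a \<Longrightarrow> V a \<le> w (evac a t)" "Fin lam \<le> w (evac \<phi> t)"
  shows "dominates t"
  unfolding dominates_def
proof
  fix f
  have pow: "Fin (of_nat n *\<^sub>Q lam) \<le> w (evac \<phi> t ^ n)" for n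
  proof (induction n)
    case (Suc n)
    then show ?case using add_mono[OF assms(2) Suc] by (simp add: w.val_mult scaleQ_add_left scaleQ_one)
  qed simp
  have "evac f t = (\<Sum>n\<le>Polynomial.degree f. evac (cf f n) t * evac \<phi> t ^ n)"
    by (subst expansion_degree[OF deg, of f]) (simp add: evac_sum)
  also have "M f \<le> w \<dots>"
  proof (rule w.val_sum_ge)
    fix n
    show "M f \<le> w (evac (cf f n) t * evac \<phi> t ^ n)"
      using M_le[of f n] add_mono[OF assms(1)[OF cf_small, of f n] pow[of n]] by (simp add: w.val_mult tm_def)
  qed
  finally show "M f \<le> w (evac f t)" .
qed

text \<open>Evaluation at t cannot lower the value of a or of its inverse b, while both pairs of
  values sum to 0; hence neither value changes.\<close>

lemma dominates_unit:
  assumes "dominates t" "0 < M (a * b - 1)" shows "w (evac a t) = M a"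
proof -
  have "M (a * b) = 0"
    using M.val_eq_of_diff[of 1 "a * b"] assms(2) by (simp add: M_one M.val_diff_commute[of 1])
  then have 1: "M a + M b = 0" by (simp add: M.val_mult)
  have "0 < w (evac a t * evac b t - 1)"
    using dominatesD[OF assms(1), of "a * b - 1"] assms(2) by simp
  then have "w (evac a t * evac b t) = 0"
    using w.val_eq_of_diff[of 1 "evac a t * evac b t"] by (simp add: w.val_diff_commute[of 1])
  then have 2: "w (evac a t) + w (evac b t) = 0" by (simp add: w.val_mult)
  show ?thesis
    using 1 2 dominatesD[OF assms(1), of a] dominatesD[OF assms(1), of b]
    by (cases "M a"; cases "M b"; cases "w (evac a t)"; cases "w (evac b t)")
      (auto simp: add_eq_0_iff)
qed

lemma dominates_u: "dominates t \<Longrightarrow> w (evac u2 t) = Fin (- elam)"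
  using dominates_unit[of t u2 u1] u12 Mu by (simp add: mult.commute)

definition "ker_at t = {p \<in> carrier KX. \<exists>f. 0 \<le> M f \<and> \<beta> f = ev p \<and> 0 < w (evac f t)}"

text \<open>Two lifts of the same residue differ by positive M-value, which stays positive at t, so
  any lift may be used to test membership.\<close>

lemma ker_at_iff:
  assumes "dominates t" "p \<in> carrier KX" "0 \<le> M f" "\<beta> f = ev p"
  shows "p \<in> ker_at t \<longleftrightarrow> 0 < w (evac f t)"
proof
  assume "p \<in> ker_at t"
  then obtain h where h: "0 \<le> M h" "\<beta> h = ev p" "0 < w (evac h t)" by (auto simp: ker_at_def)
  then have "0 < M (f - h)" using assms(3,4) by (simp add: M.\<beta>_eq_iff[symmetric])
  then have "0 < w (evac (f - h) t)" using dominatesD[OF assms(1)] by (rule order.strict_trans2)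
  from w.val_add_gr[OF this h(3)] show "0 < w (evac f t)" by simp
qed (use assms in \<open>auto simp: ker_at_def\<close>)

lemma ker_at_ideal:
  assumes "dominates t" shows "ideal (ker_at t) KX"
proof (rule idealI)
  show "ring KX" by (rule KX.ring_axioms)
  have mult: "x \<otimes>\<^bsub>KX\<^esub> a \<in> ker_at t" if a: "a \<in> ker_at t" and x: "x \<in> carrier KX" for a x
  proof -
    have ac: "a \<in> carrier KX" using a by (simp add: ker_at_def)
    obtain f where f: "0 \<le> M f" "\<beta> f = ev a" by (rule ev_lift[OF ac])
    obtain h where h: "0 \<le> M h" "\<beta> h = ev x" by (rule ev_lift[OF x])
    have "0 < w (evac f t)" using ker_at_iff[OF assms ac f] a by simp
    moreover have "0 \<le> w (evac h t)" using dominatesD[OF assms, of h] h by (auto intro: order_trans)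
    ultimately have "0 < w (evac (h * f) t)"
      using extval_add_less_mono2[of 0 "w (evac h t)" 0 "w (evac f t)"] by (simp add: w.val_mult)
    moreover have "\<beta> (h * f) = ev (x \<otimes>\<^bsub>KX\<^esub> a)" using f h x ac by (simp add: ev_mult M.\<beta>_mult[symmetric])
    moreover have "0 \<le> M (h * f)" using f h by (simp add: M.mult_nonneg)
    ultimately show ?thesis using ker_at_iff[OF assms KX.m_closed[OF x ac]] by blast
  qed
  show "subgroup (ker_at t) (add_monoid KX)"
  proof (rule KX.add.subgroupI)
    show "ker_at t \<subseteq> carrier KX" by (auto simp: ker_at_def)
    have "\<zero>\<^bsub>KX\<^esub> \<in> ker_at t" unfolding ker_at_def
      by (auto intro!: exI[of _ 0] simp: M.\<beta>_zero univ_poly_zero)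
    then show "ker_at t \<noteq> {}" by auto
    fix a assume a: "a \<in> ker_at t"
    then have ac: "a \<in> carrier KX" by (simp add: ker_at_def)
    have "\<ominus>\<^bsub>KX\<^esub> a = (\<ominus>\<^bsub>KX\<^esub> \<one>\<^bsub>KX\<^esub>) \<otimes>\<^bsub>KX\<^esub> a" using ac by (simp add: KX.l_minus)
    then show "\<ominus>\<^bsub>KX\<^esub> a \<in> ker_at t" using mult[OF a] by simp
    fix b assume b: "b \<in> ker_at t"
    then have bc: "b \<in> carrier KX" by (simp add: ker_at_def)
    obtain f where f: "0 \<le> M f" "\<beta> f = ev a" by (rule ev_lift[OF ac])
    obtain h where h: "0 \<le> M h" "\<beta> h = ev b" by (rule ev_lift[OF bc])
    have "0 < w (evac (f + h) t)"
      using ker_at_iff[OF assms ac f] ker_at_iff[OF assms bc h] a b by (simp add: w.val_add_gr)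
    moreover have "\<beta> (f + h) = ev (a \<oplus>\<^bsub>KX\<^esub> b)" using f h ac bc by (simp add: ev_add M.\<beta>_add[symmetric])
    moreover have "0 \<le> M (f + h)" using f h by (simp add: M.val_add_ge)
    ultimately show "a \<oplus>\<^bsub>KX\<^esub> b \<in> ker_at t" using ker_at_iff[OF assms KX.a_closed[OF ac bc]] by blast
  qed
  fix a x assume ax: "a \<in> ker_at t" "x \<in> carrier KX"
  show "x \<otimes>\<^bsub>KX\<^esub> a \<in> ker_at t" by (rule mult[OF ax])
  then show "a \<otimes>\<^bsub>KX\<^esub> x \<in> ker_at t" using ax KX.m_comm[of a x] by (simp add: ker_at_def)
qed

lemma one_notin_ker_at: 
  assumes "dominates t" shows "\<one>\<^bsub>KX\<^esub> \<notin> ker_at t"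
  using ker_at_iff[OF assms, of "\<one>\<^bsub>KX\<^esub>" 1] by (simp add: M.\<beta>_one ev_one)

lemma ker_at_prime:
  assumes "dominates t" "p \<in> carrier KX" "q \<in> carrier KX" "p \<otimes>\<^bsub>KX\<^esub> q \<in> ker_at t"
  shows "p \<in> ker_at t \<or> q \<in> ker_at t"
proof -
  obtain f where f: "0 \<le> M f" "\<beta> f = ev p" by (rule ev_lift[OF assms(2)])
  obtain h where h: "0 \<le> M h" "\<beta> h = ev q" by (rule ev_lift[OF assms(3)])
  have "\<beta> (f * h) = ev (p \<otimes>\<^bsub>KX\<^esub> q)" using f h assms by (simp add: ev_mult M.\<beta>_mult[symmetric])
  moreover have "0 \<le> M (f * h)" using f h by (simp add: M.mult_nonneg)
  ultimately have "0 < w (evac (f * h) t)"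
    using ker_at_iff[OF assms(1) KX.m_closed[OF assms(2,3)], of "f * h"] assms(4) by blast
  then have "0 < w (evac f t) + w (evac h t)" by (simp add: w.val_mult)
  then have "0 < w (evac f t) \<or> 0 < w (evac h t)"
    using add_mono[of "w (evac f t)" 0 "w (evac h t)" 0] by (metis add.left_neutral leD leI)
  then show ?thesis using ker_at_iff[OF assms(1,2) f] ker_at_iff[OF assms(1,3) h] by blast
qed

lemma ker_at_pow:
  assumes "dominates t" "p \<in> carrier KX" "p [^]\<^bsub>KX\<^esub> (n::nat) \<in> ker_at t" shows "p \<in> ker_at t"
  using assms(3)
proof (induction n)
  case 0 then show ?case using one_notin_ker_at[OF assms(1)] by simp
next
  case (Suc n)
  then show ?case using ker_at_prime[OF assms(1), of "p [^]\<^bsub>KX\<^esub> n" p] assms(2) by auto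
qed

text \<open>An irreducible polynomial generates a maximal ideal. Hence two roots with a common
  irreducible element in their ideals have the same ideal, and this is how information passes
  between roots.\<close>

lemma ker_at_eq_PIdl:
  assumes "dominates t" "\<psi> \<in> carrier KX" "ring_irreducible\<^bsub>KX\<^esub> \<psi>" "\<psi> \<in> ker_at t"
  shows "ker_at t = PIdl\<^bsub>KX\<^esub> \<psi>"
proof -
  interpret max: maximalideal "PIdl\<^bsub>KX\<^esub> \<psi>" KX
    by (rule KX.irreducible_imp_maximalideal[OF assms(2,3)])
  have "PIdl\<^bsub>KX\<^esub> \<psi> \<subseteq> ker_at t"
    by (rule KX.cgenideal_minimal[OF ker_at_ideal[OF assms(1)] assms(4)])
  then have "ker_at t = PIdl\<^bsub>KX\<^esub> \<psi> \<or> ker_at t = carrier KX"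
    using max.I_maximal[OF ker_at_ideal[OF assms(1)]] by (auto simp: ker_at_def)
  then show ?thesis using one_notin_ker_at[OF assms(1)] by auto
qed

lemma ker_at_length:
  assumes "dominates t" "\<psi> \<in> carrier KX" "ring_irreducible\<^bsub>KX\<^esub> \<psi>" "\<psi> \<in> ker_at t" "p \<in> ker_at t" "p \<noteq> []"
  shows "length \<psi> \<le> length p"
proof -
  have "p \<in> PIdl\<^bsub>KX\<^esub> \<psi>" using ker_at_eq_PIdl[OF assms(1-4)] assms(5) by simp
  then obtain q where q: "q \<in> carrier KX" "p = q \<otimes>\<^bsub>KX\<^esub> \<psi>" by (auto simp: cgenideal_def)
  have nz: "q \<noteq> []" "\<psi> \<noteq> []"
    using q assms(2,3,6) KX.l_null[of \<psi>] KX.r_null[of q] by (auto simp: univ_poly_zero)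
  have "Polynomials.degree p = Polynomials.degree q + Polynomials.degree \<psi>"
    using M.F.poly_mult_degree_eq[OF subfieldE(1)[OF \<kappa>_subfield], of q \<psi>] q assms(2) nz
    by (simp add: univ_poly_mult univ_poly_carrier)
  then show ?thesis using assms(6) by (cases p; cases \<psi>) auto
qed

end


section \<open>Residual polynomials of monic polynomials, and lifting\<close>

context residual_stage
begin

text \<open>\<open>p\<close> is the residual polynomial of a monic \<open>f\<close> whose Newton polygon lies on or above the line of
  slope \<open>- lam\<close> through the point of its leading coefficient. The factor \<open>u2 ^ d\<close>, the inverse of the
  chosen unit, makes \<open>f\<close> homogeneous of degree zero.\<close>

definition "rel f d p \<longleftrightarrow> Polynomial.lead_coeff f = 1 \<and> Polynomial.degree f = d * e * Polynomial.degree \<phi> \<and>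
  M f = Fin (of_nat d *\<^sub>Q elam) \<and> p \<in> carrier KX \<and> \<beta> (u2 ^ d * f) = ev p"

lemma relD:
  assumes "rel f d p"
  shows "Polynomial.lead_coeff f = 1" "Polynomial.degree f = d * e * Polynomial.degree \<phi>"
    "M f = Fin (of_nat d *\<^sub>Q elam)" "p \<in> carrier KX" "\<beta> (u2 ^ d * f) = ev p" "M (u2 ^ d * f) = 0" "f \<noteq> 0"
  using assms by (auto simp: rel_def M.val_mult Mu_pow)

text \<open>\<open>u2 ^ d * f\<close> lifts the residue belonging to p, and the value of
  \<open>u2\<close> at t is known from \<open>dominates_u\<close>, so positivity at t translates
  into an excess of f over M f.\<close>

lemma rel_root:
  assumes "rel f d p" "dominates t" shows "p \<in> ker_at t \<longleftrightarrow> M f < w (evac f t)"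
proof -
  note f = relD[OF assms(1)]
  have "p \<in> ker_at t \<longleftrightarrow> 0 < w (evac (u2 ^ d * f) t)"
    using f by (intro ker_at_iff[OF assms(2)]) auto
  also have "w (evac (u2 ^ d * f) t) = Fin (- (of_nat d *\<^sub>Q elam)) + w (evac f t)"
    using valuation_power[OF w.valuation_axioms dominates_u[OF assms(2)], of d]
    by (simp add: w.val_mult scaleQ_minus_right)
  also have "0 < \<dots> \<longleftrightarrow> M f < w (evac f t)"
    unfolding f(3) by (cases "w (evac f t)") (auto simp: algebra_simps)
  finally show ?thesis .
qed

lemma rel_mult:
  assumes "rel f d p" "rel h c q" shows "rel (f * h) (d + c) (p \<otimes>\<^bsub>KX\<^esub> q)"
proof -
  note f = relD[OF assms(1)] and h = relD[OF assms(2)]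
  have "\<beta> (u2 ^ (d + c) * (f * h)) = \<beta> ((u2 ^ d * f) * (u2 ^ c * h))"
    by (simp add: power_add ac_simps)
  also have "\<dots> = ev (p \<otimes>\<^bsub>KX\<^esub> q)" using f h by (simp add: M.\<beta>_mult[symmetric] ev_mult)
  finally have "\<beta> (u2 ^ (d + c) * (f * h)) = ev (p \<otimes>\<^bsub>KX\<^esub> q)" .
  moreover have "Polynomial.lead_coeff (f * h) = 1"
    unfolding lead_coeff_mult f(1) h(1) by simp
  ultimately show ?thesis
    using f(2-4,7) h(2-4,7) unfolding rel_def
    by (auto simp: degree_mult_eq M.val_mult scaleQ_add_left add_mult_distrib)
qed

lemma rel_one: "rel 1 0 \<one>\<^bsub>KX\<^esub>"
  by (simp add: rel_def M_one M.\<beta>_one ev_one)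

lemma rel_power: "rel f d p \<Longrightarrow> rel (f ^ m) (m * d) (p [^]\<^bsub>KX\<^esub> (m::nat))"
proof (induction m)
  case 0 then show ?case using rel_one by simp
next
  case (Suc m)
  then show ?case using rel_mult[OF Suc.IH[OF Suc.prems] Suc.prems] by (simp add: mult.commute add.commute)
qed

lemma rel_diff:
  assumes "rel f d p" "rel h d p" shows "M f < M (f - h)"
proof -
  note f = relD[OF assms(1)] and h = relD[OF assms(2)]
  have "0 < M (u2 ^ d * f - u2 ^ d * h)"
    using f h M.\<beta>_eq_iff[of "u2 ^ d * f" "u2 ^ d * h"] by simp
  also have "u2 ^ d * f - u2 ^ d * h = u2 ^ d * (f - h)" by (simp add: algebra_simps)
  finally show ?thesis
    unfolding M.val_mult Mu_pow f(3) by (cases "M (f - h)") (auto simp: algebra_simps)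
qed

lemma rel_close:
  assumes "rel f d p" "Polynomial.lead_coeff h = 1" "Polynomial.degree h = Polynomial.degree f" "M f < M (f - h)"
  shows "rel h d p"
proof -
  note f = relD[OF assms(1)]
  have Mh: "M h = M f" by (rule M.val_eq_of_diff[OF assms(4)])
  have "0 < M (u2 ^ d * (f - h))"
    using assms(4) unfolding M.val_mult Mu_pow f(3) by (cases "M (f - h)") (auto simp: algebra_simps)
  then have "\<beta> (u2 ^ d * f) = \<beta> (u2 ^ d * h)"
    using f Mh by (subst M.\<beta>_eq_iff) (auto simp: M.val_mult Mu_pow right_diff_distrib)
  then show ?thesis using f assms Mh by (simp add: rel_def)
qed

lemma sum_T_power:
  "(\<Sum>j<Suc d. (u2 ^ (d - j) * c j) * T ^ j) = u2 ^ d * (\<Sum>j<Suc d. c j * \<phi> ^ (e * j))"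
  unfolding sum_distrib_left
proof (intro sum.cong refl)
  fix j assume "j \<in> {..<Suc d}"
  then have "u2 ^ d = u2 ^ (d - j) * u2 ^ j" by (simp add: power_add[symmetric])
  moreover have "T ^ j = \<phi> ^ (e * j) * u2 ^ j" by (simp add: T_def power_mult_distrib power_mult)
  ultimately show "u2 ^ (d - j) * c j * T ^ j = u2 ^ d * (c j * \<phi> ^ (e * j))" by (simp add: ac_simps)
qed

lemma u2_small_\<kappa>:
  assumes "small a" "Fin (of_nat k *\<^sub>Q elam) \<le> V a"
  shows "0 \<le> M (u2 ^ k * a)" "\<beta> (u2 ^ k * a) \<in> \<kappa>"
proof -
  show 0: "0 \<le> M (u2 ^ k * a)"
    using assms by (cases "V a") (auto simp: M.val_mult Mu_pow M_small)
  show "\<beta> (u2 ^ k * a) \<in> \<kappa>"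
  proof (cases "a = 0")
    case True
    then show ?thesis using \<kappa>I[of 0] deg by simp
  next
    case False
    then have "lastix (u2 ^ k * a) = 0"
      using assms u_nz by (simp add: M_mult_lastix lastix_power u_lastix lastix_small)
    then show ?thesis using 0 False u_nz by (intro lastix_zero_\<kappa>) auto
  qed
qed

lemma cf_sum_phi_powers:
  assumes "\<And>j. j < n \<Longrightarrow> small (c j)"
  shows "cf (\<Sum>j<n. c j * \<phi> ^ (a + e * j)) i = (if \<exists>j<n. i = a + e * j then c ((i - a) div e) else 0)"
proof -
  have "cf (\<Sum>j<n. c j * \<phi> ^ (a + e * j)) i = (\<Sum>j<n. if i = a + e * j then c j else 0)"
    unfolding cf_simps using assms by (intro sum.cong) (auto simp: expansion_coeff_monomial[OF deg])
  also have "\<dots> = (if \<exists>j<n. i = a + e * j then c ((i - a) div e) else 0)"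
  proof (cases "\<exists>j<n. i = a + e * j")
    case True
    then obtain k where k: "k < n" "i = a + e * k" by blast
    have "(\<Sum>j<n. if i = a + e * j then c j else 0) = (\<Sum>j<n. if j = k then c j else 0)"
      using k e_pos by (intro sum.cong) auto
    then show ?thesis using k e_pos True by simp
  qed auto
  finally show ?thesis .
qed

text \<open>The coefficient list produced by \<open>residual_poly\<close> for a monic f with a left
  end at abscissa 0, as \<open>residual_poly_eq\<close> shows.\<close>

definition "resp f d = map (\<lambda>j. \<beta> (u2 ^ (d - j) * cf f (e * j))) (rev [0..<Suc d])"

lemma tm_ge_cf:
  assumes "M f = Fin (of_nat d *\<^sub>Q elam)" "j \<le> d"
  shows "Fin (of_nat (d - j) *\<^sub>Q elam) \<le> V (cf f (e * j))"
    "tm f (e * j) = M f \<longleftrightarrow> V (cf f (e * j)) = Fin (of_nat (d - j) *\<^sub>Q elam)"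
proof -
  have eq: "of_nat d *\<^sub>Q elam = of_nat (d - j) *\<^sub>Q elam + of_nat (e * j) *\<^sub>Q lam"
    using scaleQ_of_nat_add[of "d - j" j elam] assms(2)
    by (simp add: elam_def scaleQ_scaleQ mult.commute)
  show "Fin (of_nat (d - j) *\<^sub>Q elam) \<le> V (cf f (e * j))"
    using M_le[of f "e * j"] assms(1) unfolding eq tm_def by (cases "V (cf f (e * j))") auto
  show "tm f (e * j) = M f \<longleftrightarrow> V (cf f (e * j)) = Fin (of_nat (d - j) *\<^sub>Q elam)"
    using assms(1) unfolding eq tm_def by (cases "V (cf f (e * j))") auto
qed

text \<open>If the term with index i attains M f, its digit has value (d e - i) lam, so e divides i
  by \<open>e_dvd\<close>. Keeping only the indices divisible by e therefore alters f by larger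
  value, and what remains is a polynomial in T.\<close>

lemma rel_resp:
  assumes "Polynomial.lead_coeff f = 1" "Polynomial.degree f = d * e * Polynomial.degree \<phi>" "M f = Fin (of_nat d *\<^sub>Q elam)"
  shows "rel f d (resp f d)"
proof -
  have lead: "cf f (e * d) = 1"
    using expansion_coeff_monic[OF deg monic assms(1), of "e * d"] assms(2) by (simp add: mult.commute)
  have c: "0 \<le> M (u2 ^ (d - j) * cf f (e * j))" "\<beta> (u2 ^ (d - j) * cf f (e * j)) \<in> \<kappa>" if "j \<le> d" for j
    using u2_small_\<kappa>[OF cf_small tm_ge_cf(1)[OF assms(3) that]] by auto
  have carr: "resp f d \<in> carrier KX"
    unfolding resp_def using c lead by (intro expression_carrier) (auto simp: M.\<beta>_one)
  define f' where "f' = (\<Sum>j<Suc d. cf f (e * j) * \<phi> ^ (0 + e * j))"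
  have "ev (resp f d) = \<beta> (\<Sum>j<Suc d. (u2 ^ (d - j) * cf f (e * j)) * T ^ j)"
    unfolding resp_def using c by (intro ev_expression) auto
  also have "\<dots> = \<beta> (u2 ^ d * f')" unfolding sum_T_power f'_def by simp
  finally have ev: "ev (resp f d) = \<beta> (u2 ^ d * f')" .
  have less: "M f < M (f - f')"
    unfolding less_M
  proof
    fix i
    have cfi: "cf (f - f') i = (if \<exists>j<Suc d. i = 0 + e * j then 0 else cf f i)"
      unfolding cf_simps(2) f'_def cf_sum_phi_powers[OF cf_small] using e_pos by auto
    show "M f < tm (f - f') i"
    proof (cases "(\<exists>j<Suc d. i = 0 + e * j) \<or> cf f i = 0")
      case True
      then have "cf (f - f') i = 0" using cfi by auto
      then show ?thesis using assms(3) by (simp add: tm_def)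
    next
      case False
      then have eq: "tm (f - f') i = tm f i" using cfi by (auto simp: tm_def)
      have "tm f i \<noteq> M f"
      proof
        assume t: "tm f i = M f"
        have "i \<le> d * e"
        proof (rule ccontr)
          assume "\<not> i \<le> d * e"
          then have "Polynomial.degree f < i * Polynomial.degree \<phi>" using assms(2) deg by simp
          then show False using False expansion_coeff_eq_0[OF deg] by auto
        qed
        then have "of_nat d *\<^sub>Q elam = of_nat (d * e - i) *\<^sub>Q lam + of_nat i *\<^sub>Q lam"
          using scaleQ_of_nat_add[of "d * e - i" i lam] by (simp add: elam_def scaleQ_scaleQ)
        then have "V (cf f i) = Fin (of_nat (d * e - i) *\<^sub>Q lam)"
          using t assms(3) by (cases "V (cf f i)") (auto simp: tm_def)
        then have "e dvd d * e - i" by (rule e_dvd[OF cf_small])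
        then have "e dvd i" using \<open>i \<le> d * e\<close> by (metis dvd_diffD1 dvd_triv_right)
        then obtain j where "i = e * j" by auto
        moreover from this have "j < Suc d" using \<open>i \<le> d * e\<close> e_pos by (simp add: mult.commute less_Suc_eq_le)
        ultimately show False using False by auto
      qed
      then show ?thesis using M_le[of f i] eq by (simp add: order.order_iff_strict)
    qed
  qed
  have Mf': "M f' = M f" by (rule M.val_eq_of_diff[OF less])
  have "0 < M (u2 ^ d * (f - f'))"
    using less unfolding M.val_mult Mu_pow assms(3) by (cases "M (f - f')") (auto simp: algebra_simps)
  then have "\<beta> (u2 ^ d * f) = \<beta> (u2 ^ d * f')"
    using assms(3) Mf' by (subst M.\<beta>_eq_iff) (auto simp: M.val_mult Mu_pow right_diff_distrib)
  then show ?thesis using assms carr ev by (simp add: rel_def)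
qed

lemma u1_u2_power: "0 < M (u1 ^ k * u2 ^ k - 1)"
proof -
  have "\<beta> (u1 * u2) = \<beta> 1"
    using u12 by (subst M.\<beta>_eq_iff) (auto simp: M.val_mult Mu M_one)
  then have "\<beta> ((u1 * u2) ^ k) = \<beta> 1"
    using M.\<beta>_pow[of "u1 * u2" k] by (simp add: M.val_mult Mu M.\<beta>_one)
  then show ?thesis
    by (subst (asm) M.\<beta>_eq_iff) (auto simp: M.val_mult Mu_pow M_one power_mult_distrib)
qed

text \<open>The digit at e j is a representative of the j-th coefficient times
  \<open>u1 ^ (d - j)\<close>, reduced modulo \<phi>; this compensates for
  \<open>u2 ^ (d - j)\<close> in the residual polynomial. The top digit is replaced by 1 to make the
  lift monic.\<close>

lemma rel_lift:
  assumes "p \<in> carrier KX" "p \<noteq> []" "Polynomials.lead_coeff p = \<one>\<^bsub>F\<^esub>"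
  obtains f where "rel f (length p - 1) p"
proof -
  obtain c where c: "\<And>j. j < length p \<Longrightarrow> c j \<in> {a. small a \<and> 0 \<le> V a}"
    "p = map (\<lambda>j. \<beta> (c j)) (rev [0..<length p])"
    using eval_expression[OF assms(1) \<kappa>_subset] by blast
  define d where "d = length p - 1"
  have d: "length p = Suc d" using assms(2) by (cases p) (auto simp: d_def)
  have pc: "p = map (\<lambda>j. \<beta> (c j)) (rev [0..<Suc d])" using c(2) d by simp
  have cd: "\<beta> (c d) = \<one>\<^bsub>F\<^esub>" using assms(3) by (subst (asm) pc) simp
  define b where "b j = (if j < d then (c j * u1 ^ (d - j)) mod \<phi> else 1)" for j
  have sb: "small (b j)" for j using deg by (simp add: b_def)
  have b: "Fin (of_nat (d - j) *\<^sub>Q elam) \<le> V (b j) \<and> \<beta> (u2 ^ (d - j) * b j) = \<beta> (c j)" if "j \<le> d" for j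
  proof (cases "j < d \<and> c j \<noteq> 0")
    case True
    have cj: "small (c j)" "0 \<le> V (c j)" using c(1)[of j] True d by auto
    let ?k = "d - j"
    have nz: "c j * u1 ^ ?k \<noteq> 0" using True u_nz by simp
    have lx: "lastix (c j * u1 ^ ?k) = 0"
      using True cj u_nz by (simp add: M_mult_lastix lastix_power u_lastix lastix_small)
    note bl = lastix_zero_mod[OF nz lx]
    have bj: "b j = (c j * u1 ^ ?k) mod \<phi>" using True by (simp add: b_def)
    have Mc: "M (c j * u1 ^ ?k) = V (c j) + Fin (of_nat ?k *\<^sub>Q elam)"
      using cj by (simp add: M.val_mult Mu_pow M_small)
    have Vb: "V (b j) = V (c j) + Fin (of_nat ?k *\<^sub>Q elam)" using bl(2) Mc bj by simp
    have "0 < M (u2 ^ ?k * (c j * u1 ^ ?k - b j))"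
    proof -
      have "Fin (of_nat ?k *\<^sub>Q elam) \<le> V (c j) + Fin (of_nat ?k *\<^sub>Q elam)"
        using add_right_mono[OF cj(2), of "Fin (of_nat ?k *\<^sub>Q elam)"] by simp
      also have "\<dots> < M (c j * u1 ^ ?k - b j)" using bl(1) by (simp add: Mc bj)
      finally show ?thesis
        unfolding M.val_mult Mu_pow by (cases "M (c j * u1 ^ ?k - b j)") (auto simp: algebra_simps)
    qed
    moreover have "0 < M (c j * (u1 ^ ?k * u2 ^ ?k - 1))"
      using extval_add_less_mono2[OF cj(2) u1_u2_power[of ?k]] cj by (simp add: M.val_mult M_small)
    ultimately have "0 < M (c j * (u1 ^ ?k * u2 ^ ?k - 1) - u2 ^ ?k * (c j * u1 ^ ?k - b j))"
      by (rule M.val_diff_gr[rotated])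
    also have "c j * (u1 ^ ?k * u2 ^ ?k - 1) - u2 ^ ?k * (c j * u1 ^ ?k - b j) = u2 ^ ?k * b j - c j"
      by (simp add: algebra_simps)
    finally have "0 < M (u2 ^ ?k * b j - c j)" .
    moreover have "0 \<le> M (u2 ^ ?k * b j)"
      using Vb cj sb[of j] by (cases "V (c j)") (auto simp: M.val_mult Mu_pow M_small)
    ultimately have "\<beta> (u2 ^ ?k * b j) = \<beta> (c j)" using cj by (simp add: M.\<beta>_eq_iff M_small)
    moreover have "Fin (of_nat ?k *\<^sub>Q elam) \<le> V (b j)"
      using Vb cj(2) by (cases "V (c j)") auto
    ultimately show ?thesis by simp
  next
    case False
    then show ?thesis using that cd by (auto simp: b_def M.\<beta>_one)
  qed
  define f where "f = (\<Sum>j<Suc d. b j * \<phi> ^ (0 + e * j))"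
  have lt: "Polynomial.degree (\<Sum>j<d. b j * \<phi> ^ (e * j)) < Polynomial.degree (\<phi> ^ (e * d))" if "d > 0"
  proof (rule degree_sum_less)
    have dp: "Polynomial.degree (\<phi> ^ n) = n * Polynomial.degree \<phi>" for n by (simp add: degree_power_eq)
    fix j assume "j \<in> {..<d}"
    then have "Suc (e * j) \<le> e * d" using e_pos by (metis Suc_leI lessThan_iff mult_less_mono2)
    then have "Suc (e * j) * Polynomial.degree \<phi> \<le> e * d * Polynomial.degree \<phi>" by (rule mult_le_mono1)
    moreover have "Polynomial.degree (b j * \<phi> ^ (e * j)) < Suc (e * j) * Polynomial.degree \<phi>"
      using degree_mult_le[of "b j" "\<phi> ^ (e * j)"] sb[of j] dp[of "e * j"] by simp
    ultimately show "Polynomial.degree (b j * \<phi> ^ (e * j)) < Polynomial.degree (\<phi> ^ (e * d))"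
      by (simp add: dp)
  qed (use that e_pos deg in \<open>simp add: degree_power_eq\<close>)
  have feq: "f = \<phi> ^ (e * d) + (\<Sum>j<d. b j * \<phi> ^ (e * j))" by (simp add: f_def b_def)
  have "Polynomial.degree f = d * e * Polynomial.degree \<phi> \<and> Polynomial.lead_coeff f = 1"
  proof (cases "d = 0")
    case True
    then show ?thesis using feq by simp
  next
    case False
    then have l: "Polynomial.degree (\<Sum>j<d. b j * \<phi> ^ (e * j)) < Polynomial.degree (\<phi> ^ (e * d))" using lt by simp
    have df: "Polynomial.degree f = Polynomial.degree (\<phi> ^ (e * d))"
      unfolding feq by (rule degree_add_eq_left[OF l])
    have "Polynomial.lead_coeff f = Polynomial.lead_coeff (\<phi> ^ (e * d))"
      unfolding df unfolding feq coeff_add coeff_eq_0[OF l] by simp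
    also have "\<dots> = 1" by (simp only: lead_coeff_power monic power_one)
    finally show ?thesis using df by (simp add: degree_power_eq mult.commute)
  qed
  then have degf: "Polynomial.degree f = d * e * Polynomial.degree \<phi>" and lcf: "Polynomial.lead_coeff f = 1"
    by auto
  have Mf: "M f = Fin (of_nat d *\<^sub>Q elam)"
  proof (rule antisym)
    have cff: "cf f i = (if \<exists>j<Suc d. i = 0 + e * j then b ((i - 0) div e) else 0)" for i
      unfolding f_def by (rule cf_sum_phi_powers[OF sb])
    have "cf f (e * d) = 1" using e_pos by (auto simp: cff b_def)
    then show "M f \<le> Fin (of_nat d *\<^sub>Q elam)"
      using M_le[of f "e * d"] by (simp add: tm_def elam_def scaleQ_scaleQ mult.commute)
    show "Fin (of_nat d *\<^sub>Q elam) \<le> M f"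
      unfolding le_M
    proof
      fix i show "Fin (of_nat d *\<^sub>Q elam) \<le> tm f i"
      proof (cases "\<exists>j<Suc d. i = 0 + e * j")
        case True
        then obtain j where "j < Suc d" "i = 0 + e * j" by blast
        then have j: "j \<le> d" "i = e * j" by auto
        have "of_nat d *\<^sub>Q elam = of_nat (d - j) *\<^sub>Q elam + of_nat i *\<^sub>Q lam"
          using scaleQ_of_nat_add[of "d - j" j elam] j by (simp add: elam_def scaleQ_scaleQ mult.commute)
        moreover have "cf f i = b j" using j e_pos True by (simp add: cff)
        ultimately show ?thesis using b[OF j(1)] by (cases "V (b j)") (auto simp: tm_def)
      next
        case False
        then have "cf f i = 0" unfolding cff by (rule if_not_P)
        then show ?thesis by (simp add: tm_def)
      qed
    qed
  qed
  have "ev p = \<beta> (u2 ^ d * f)"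
  proof -
    have "p = map (\<lambda>j. \<beta> (u2 ^ (d - j) * b j)) (rev [0..<Suc d])"
      by (subst pc, rule map_cong) (use b in auto)
    then have "ev p = \<beta> (\<Sum>j<Suc d. (u2 ^ (d - j) * b j) * T ^ j)"
      using b u2_small_\<kappa>(1)[OF sb] by (simp only:, intro ev_expression) auto
    then show ?thesis unfolding sum_T_power f_def by simp
  qed
  then have "rel f d p" using lcf degf Mf assms(1) by (simp add: rel_def)
  then show ?thesis using that by (simp add: d_def)
qed

end


section \<open>Values at roots of polynomials of small degree, and the residual polynomial of
  \<open>g\<close>\<close>

context residual_stage
begin

lemma u2_\<kappa>:
  assumes "y \<noteq> 0 \<Longrightarrow> lastix y = 0" "0 \<le> M (u2 ^ k * y)"
  shows "\<beta> (u2 ^ k * y) \<in> \<kappa>"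
proof (cases "y = 0")
  case True
  then show ?thesis using \<kappa>I[of 0] deg by simp
next
  case False
  then have "lastix (u2 ^ k * y) = 0"
    using assms u_nz by (simp add: M_mult_lastix lastix_power u_lastix)
  then show ?thesis using assms False u_nz by (intro lastix_zero_\<kappa>) auto
qed

text \<open>The factor of \<open>in f\<close> prime to \<open>in \<phi>\<close> is, up to a unit, a polynomial in \<open>\<xi>\<close> over \<open>\<kappa>\<close> of
  degree less than that of \<open>\<psi>\<close>, which therefore does not vanish at \<open>t\<close>.\<close>

lemma small_degree_value:
  assumes t: "dominates t" "w (evac \<phi> t) = Fin lam"
    and \<psi>: "\<psi> \<in> carrier KX" "ring_irreducible\<^bsub>KX\<^esub> \<psi>" "\<psi> \<in> ker_at t"
    and f: "f \<noteq> 0" "Polynomial.degree f < (length \<psi> - 1) * e * Polynomial.degree \<phi>"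
  shows "w (evac f t) = M f"
proof -
  define l where "l = lastix f"
  have tl: "tm f l = M f" using lastix_props(1)[OF f(1)] by (simp add: l_def)
  obtain \<gamma> where \<gamma>: "M f = Fin \<gamma>" using f(1) by (rule M.finiteE)
  define al where "al = cf f l"
  have al: "small al" "al \<noteq> 0" using tl \<gamma> by (auto simp: al_def tm_def)
  obtain bl \<alpha> where bl: "small bl" "bl \<noteq> 0" "V al = Fin \<alpha>" "V bl = Fin (- \<alpha>)" "0 < M (al * bl - 1)"
    using small_inverse_M[OF al] by metis
  have \<gamma>l: "\<gamma> = \<alpha> + of_nat l *\<^sub>Q lam" using tl \<gamma> bl(3) by (simp add: al_def tm_def)
  \<comment> \<open>Dividing the digit at i by the digit at l gives a small polynomial of value (l -
    i) lam.\<close>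
  have dvd: "e dvd l - i" if il: "i \<le> l" "tm f i = M f" for i
  proof -
    obtain \<delta> where \<delta>: "V (cf f i) = Fin \<delta>" using il(2) \<gamma> by (cases "V (cf f i)") (auto simp: tm_def)
    have "of_nat l *\<^sub>Q lam = of_nat (l - i) *\<^sub>Q lam + of_nat i *\<^sub>Q lam"
      using scaleQ_of_nat_add[of "l - i" i lam] il(1) by simp
    then have "\<delta> - \<alpha> = of_nat (l - i) *\<^sub>Q lam"
      using il(2) \<gamma> \<gamma>l \<delta> by (simp add: tm_def algebra_simps)
    then have "V ((cf f i * bl) mod \<phi>) = Fin (of_nat (l - i) *\<^sub>Q lam)"
      using \<delta> bl by (simp add: V_mod V.val_mult)
    then show ?thesis by (rule e_dvd[OF mod_small])
  qed
  define l0 where "l0 = (LEAST i. i \<le> l \<and> tm f i = M f)"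
  have l0: "l0 \<le> l" "tm f l0 = M f"
    using LeastI[of "\<lambda>i. i \<le> l \<and> tm f i = M f" l] tl by (auto simp: l0_def)
  obtain d where d: "l - l0 = e * d" using dvd[OF l0] by auto
  then have ld: "l = l0 + e * d" using l0 by simp
  define c where "c j = cf f (l0 + e * j)" for j
  \<comment> \<open>The part of f on the lattice of indices that may attain M f; it has the same
    initial form as f.\<close>
  define fS where "fS = (\<Sum>j<Suc d. c j * \<phi> ^ (l0 + e * j))"
  have less: "M f < M (f - fS)"
    unfolding less_M
  proof
    fix i
    have cfi: "cf (f - fS) i = (if \<exists>j<Suc d. i = l0 + e * j then 0 else cf f i)"
      unfolding cf_simps(2) fS_def c_def cf_sum_phi_powers[OF cf_small] using e_pos by auto
    show "M f < tm (f - fS) i"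
    proof (cases "\<exists>j<Suc d. i = l0 + e * j")
      case True
      then have "cf (f - fS) i = 0" using cfi by auto
      then show ?thesis using \<gamma> by (simp add: tm_def)
    next
      case False
      then have eq: "tm (f - fS) i = tm f i" using cfi by (auto simp: tm_def)
      show ?thesis
      proof (cases "l < i")
        case True
        then show ?thesis using lastix_props(2)[OF f(1)] eq by (simp add: l_def)
      next
        case il: False
        have "tm f i \<noteq> M f"
        proof
          assume t: "tm f i = M f"
          then have "l0 \<le> i" unfolding l0_def using il by (intro Least_le) simp
          obtain k where "l - i = e * k" using dvd[of i] t il by auto
          then have "i = l0 + e * d - e * k" using ld il by simp
          also have "\<dots> = l0 + e * (d - k)"
          proof -
            have "e * k \<le> e * d" using \<open>l - i = e * k\<close> \<open>l0 \<le> i\<close> d il by linarith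
            then show ?thesis by (simp add: diff_mult_distrib2)
          qed
          finally have "i = l0 + e * (d - k)" .
          moreover have "d - k < Suc d" by simp
          ultimately show False using False by blast
        qed
        then show ?thesis using M_le[of f i] eq by (simp add: order.order_iff_strict)
      qed
    qed
  qed
  have MfS: "M fS = M f" by (rule M.val_eq_of_diff[OF less])
  define y where "y j = bl * c j" for j
  have y0: "0 \<le> M (u2 ^ (d - j) * y j)" if "j \<le> d" for j
  proof -
    have "of_nat (d - j) *\<^sub>Q elam + of_nat (l0 + e * j) *\<^sub>Q lam = of_nat ((d - j) * e + (l0 + e * j)) *\<^sub>Q lam"
      unfolding elam_def by (simp add: scaleQ_add_left scaleQ_scaleQ)
    also have "(d - j) * e + (l0 + e * j) = l"
      using that ld by (simp add: algebra_simps diff_mult_distrib)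
    finally have eq: "of_nat l *\<^sub>Q lam = of_nat (d - j) *\<^sub>Q elam + of_nat (l0 + e * j) *\<^sub>Q lam" by simp
    have "M f \<le> V (c j) + Fin (of_nat (l0 + e * j) *\<^sub>Q lam)"
      using M_le[of f "l0 + e * j"] by (simp add: tm_def c_def)
    then have "Fin \<alpha> + Fin (of_nat (d - j) *\<^sub>Q elam) \<le> V (c j)"
      unfolding \<gamma> \<gamma>l eq by (cases "V (c j)") (auto simp: add.assoc[symmetric])
    then show ?thesis
      using bl(1,4) by (cases "V (c j)") (auto simp: y_def M.val_mult Mu_pow M_small c_def algebra_simps)
  qed
  have y\<kappa>: "\<beta> (u2 ^ (d - j) * y j) \<in> \<kappa>" if "j \<le> d" for j
  proof (rule u2_\<kappa>[OF _ y0[OF that]])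
    assume "y j \<noteq> 0"
    then show "lastix (y j) = 0"
      using bl(1) by (auto simp: y_def M_mult_lastix lastix_small c_def)
  qed
  define p where "p = map (\<lambda>j. \<beta> (u2 ^ (d - j) * y j)) (rev [0..<Suc d])"
  have yd: "\<beta> (u2 ^ (d - d) * y d) = \<one>\<^bsub>F\<^esub>"
  proof -
    have "y d = bl * al" by (simp add: y_def c_def al_def ld)
    moreover have "M (bl * al) = 0" using bl al by (simp add: M.val_mult M_small)
    ultimately show ?thesis
      using bl(5) by (simp add: M.\<beta>_eq_iff M_one mult.commute flip: M.\<beta>_one)
  qed
  have pc: "p \<in> carrier KX"
    unfolding p_def using y\<kappa> yd by (intro expression_carrier) simp_all
  \<comment> \<open>The degree bound on f bounds its last index, so p has smaller degree than
    \<psi>. As p is monic, it cannot lie in the ideal generated by \<psi>.\<close>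
  have "Polynomial.degree f < ((length \<psi> - 1) * e) * Polynomial.degree \<phi>" using f(2) .
  moreover have "l * Polynomial.degree \<phi> \<le> Polynomial.degree f"
    using al(2) expansion_coeff_eq_0[OF deg, of f l] by (force simp: al_def not_less[symmetric])
  ultimately have "l < (length \<psi> - 1) * e"
    by (metis le_less_trans mult_less_cancel2)
  then have "e * d < e * (length \<psi> - 1)"
    using ld mult.commute[of e "length \<psi> - 1"] by linarith
  then have "d < length \<psi> - 1" by simp
  then have "length p < length \<psi>" by (simp add: p_def)
  then have "p \<notin> ker_at t"
    using ker_at_length[OF t(1) \<psi>, of p] by (auto simp: p_def)
  define G where "G = (\<Sum>j<Suc d. (u2 ^ (d - j) * y j) * T ^ j)"
  have G0: "0 \<le> M G"
    unfolding G_def using y0 MT by (intro M.val_sum_ge M.mult_nonneg[OF _ M.val_power_0]) auto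
  have "ev p = \<beta> G" unfolding p_def G_def using y0 by (intro ev_expression) simp
  then have "\<not> 0 < w (evac G t)" using ker_at_iff[OF t(1) pc G0] \<open>p \<notin> ker_at t\<close> by simp
  then have wG: "w (evac G t) = 0" and MG: "M G = 0"
    using G0 dominatesD[OF t(1), of G] by auto
  \<comment> \<open>All factors other than fS have the same value at t as under M: \<phi> by
    hypothesis, u2 and bl as units, and G because its residue p does not vanish at t. So fS does
    too.\<close>
  have GfS: "\<phi> ^ l0 * G = u2 ^ d * (bl * fS)"
    unfolding G_def sum_T_power y_def fS_def
    by (simp add: sum_distrib_left power_add ac_simps del: sum.lessThan_Suc)
  have wbl: "w (evac bl t) = Fin (- \<alpha>)"
    using dominates_unit[OF t(1), of bl al] bl by (simp add: M_small mult.commute)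
  have wS: "w (evac fS t) = M fS"
  proof -
    have "w (evac (\<phi> ^ l0 * G) t) = M (\<phi> ^ l0 * G)"
      using valuation_power[OF w.valuation_axioms t(2), of l0] wG MG
      by (simp add: w.val_mult M.val_mult phi_pow)
    then have "Fin (- (of_nat d *\<^sub>Q elam)) + (Fin (- \<alpha>) + w (evac fS t)) =
        Fin (- (of_nat d *\<^sub>Q elam)) + (Fin (- \<alpha>) + M fS)"
      unfolding GfS using valuation_power[OF w.valuation_axioms dominates_u[OF t(1)], of d] wbl bl
      by (simp add: w.val_mult M.val_mult Mu_pow M_small scaleQ_minus_right)
    then show ?thesis by (simp only: extval_add_left_cancel_less)
  qed
  have "w (evac fS t) < w (evac (f - fS) t)"
    using dominatesD[OF t(1), of "f - fS"] less unfolding wS MfS by (rule order.strict_trans2[rotated])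
  from w.val_add_eq[OF this] show ?thesis using wS MfS by simp
qed

lemma graded_pow:
  assumes "Fin \<alpha> \<le> M f"
  shows "graded_class M \<alpha> f [^]\<^bsub>graded_algebra M\<^esub> (n::nat) = graded_class M (of_nat n *\<^sub>Q \<alpha>) (f ^ n)"
proof (induction n)
  case 0 then show ?case by (simp add: M.graded_one)
next
  case (Suc n)
  have "Fin (of_nat n *\<^sub>Q \<alpha>) \<le> M (f ^ n)"
  proof (induction n)
    case (Suc n)
    then show ?case using add_mono[OF assms Suc] by (simp add: M.val_mult scaleQ_add_left scaleQ_one)
  qed (simp add: M_one)
  then show ?case using Suc assms by (simp add: M.graded_class_mult scaleQ_add_left scaleQ_one add.commute mult.commute)
qed

text \<open>Since g is monic and its left end lies at abscissa 0, the extreme indices are 0 and d e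
  and the normalizing factor is 1. What is left is the power j - d of the unit, represented by
  \<open>u2 ^ (d - j)\<close>.\<close>

lemma residual_poly_eq:
  assumes g: "Polynomial.lead_coeff g = 1" "Polynomial.degree g = d * e * Polynomial.degree \<phi>"
    "M g = Fin (of_nat d *\<^sub>Q elam)" "V (cf g 0) = M g"
  shows "residual_poly M \<phi> (graded_class M elam u1) g = resp g d"
proof -
  let ?G = "graded_algebra M"
  interpret G: cring ?G by (rule M.graded_cring)
  define S where "S = {n. M (cf g n * \<phi> ^ n) = M g}"
  have S: "S = {n. tm g n = M g}"
    unfolding S_def M_times_power M_small[OF cf_small] by (simp add: tm_def)
  have lead: "cf g (d * e) = 1"
    using expansion_coeff_monic[OF deg monic g(1), of "d * e"] g(2) by simp
  have S_le: "n \<le> d * e" if "n \<in> S" for n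
  proof (rule ccontr)
    assume "\<not> n \<le> d * e"
    then have "Polynomial.degree g < n * Polynomial.degree \<phi>" using g(2) deg by simp
    then have "tm g n = Infty" using expansion_coeff_eq_0[OF deg] by (simp add: tm_def)
    then show False using that g(3) by (simp add: S)
  qed
  have fin: "finite S" using S_le by (meson finite_nat_set_iff_bounded_le)
  have S0: "0 \<in> S" using g(4) by (simp add: S tm_def)
  have Sd: "d * e \<in> S" using lead g(3) by (simp add: S tm_def elam_def scaleQ_scaleQ)
  have Min: "Min S = 0" using Min_le[OF fin S0] by simp
  have Max: "Max S = d * e" using fin Sd S_le by (intro Max_eqI) auto
  have inv1: "inv\<^bsub>?G\<^esub> initial_form M 1 = \<one>\<^bsub>?G\<^esub>"
    using M.initial_form_eq[of 1 0] M_one by (simp add: M.graded_one[symmetric])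
  have u_pow: "graded_class M elam u1 [^]\<^bsub>?G\<^esub> (int j - int d) = graded_class M (- (of_nat (d - j) *\<^sub>Q elam)) (u2 ^ (d - j))"
    if "j \<le> d" for j
  proof (cases "j = d")
    case True
    then show ?thesis by (simp add: int_pow_def2 M.graded_one)
  next
    case False
    then have "int j - int d < 0" "nat (- (int j - int d)) = d - j" using that by auto
    then have "graded_class M elam u1 [^]\<^bsub>?G\<^esub> (int j - int d) = inv\<^bsub>?G\<^esub> (graded_class M elam u1 [^]\<^bsub>?G\<^esub> (d - j))"
      by (simp add: int_pow_def2)
    also have "\<dots> = inv\<^bsub>?G\<^esub> (graded_class M (of_nat (d - j) *\<^sub>Q elam) (u1 ^ (d - j)))"
      using Mu by (simp add: graded_pow)
    also have "\<dots> = graded_class M (- (of_nat (d - j) *\<^sub>Q elam)) (u2 ^ (d - j))"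
      using u1_u2_power[of "d - j"] by (intro M.graded_class_Unit(2)) (auto simp: Mu_pow)
    finally show ?thesis .
  qed
  have coeff: "degree_zero_residue M (if 0 + j * e \<in> S
      then inv\<^bsub>?G\<^esub> (initial_form M (cf g (d * e))) \<otimes>\<^bsub>?G\<^esub> (graded_class M elam u1 [^]\<^bsub>?G\<^esub> (int j - int d))
        \<otimes>\<^bsub>?G\<^esub> initial_form M (cf g (0 + j * e))
      else \<zero>\<^bsub>?G\<^esub>) = \<beta> (u2 ^ (d - j) * cf g (e * j))" if j: "j \<le> d" for j
  proof (cases "j * e \<in> S")
    case True
    then have V: "V (cf g (e * j)) = Fin (of_nat (d - j) *\<^sub>Q elam)"
      using tm_ge_cf(2)[OF g(3) j] by (simp add: S mult.commute)
    let ?a = "of_nat (d - j) *\<^sub>Q elam"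
    have in_cf: "initial_form M (cf g (j * e)) = graded_class M ?a (cf g (e * j))"
      using M.initial_form_eq[of "cf g (e * j)"] V by (simp add: M_small mult.commute)
    have "\<one>\<^bsub>?G\<^esub> \<otimes>\<^bsub>?G\<^esub> graded_class M (- ?a) (u2 ^ (d - j)) \<otimes>\<^bsub>?G\<^esub> graded_class M ?a (cf g (e * j)) =
        graded_class M 0 (u2 ^ (d - j) * cf g (e * j))"
      using V M.graded_class_carrier[of "- ?a" "u2 ^ (d - j)"]
      by (simp add: Mu_pow M_small M.graded_class_mult)
    moreover have "0 \<le> M (u2 ^ (d - j) * cf g (e * j))" using V by (simp add: M.val_mult Mu_pow M_small)
    ultimately show ?thesis
      using True by (simp add: lead inv1 u_pow[OF j] in_cf M.degree_zero_residue_class)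
  next
    case False
    \<comment> \<open>Off the polygon the definition inserts zero; this agrees with
      \<open>resp\<close>, since the corresponding element has positive value and zero
      residue.\<close>
    then have V: "Fin (of_nat (d - j) *\<^sub>Q elam) < V (cf g (e * j))"
      using tm_ge_cf[OF g(3) j] by (auto simp: S mult.commute order.order_iff_strict)
    then have "0 < M (u2 ^ (d - j) * cf g (e * j))"
      by (cases "V (cf g (e * j))") (auto simp: M.val_mult Mu_pow M_small)
    then have "\<beta> (u2 ^ (d - j) * cf g (e * j)) = \<beta> 0"
      by (subst M.\<beta>_eq_iff) auto
    then show ?thesis
      using False M.degree_zero_residue_class[of 0] by (simp add: M.graded_zero[of 0])
  qed
  have "residual_poly M \<phi> (graded_class M elam u1) g =
    map (\<lambda>j. degree_zero_residue M (if 0 + j * e \<in> S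
      then inv\<^bsub>?G\<^esub> (initial_form M (cf g (d * e))) \<otimes>\<^bsub>?G\<^esub> (graded_class M elam u1 [^]\<^bsub>?G\<^esub> (int j - int d))
        \<otimes>\<^bsub>?G\<^esub> initial_form M (cf g (0 + j * e))
      else \<zero>\<^bsub>?G\<^esub>)) (rev [0..<Suc d])"
    unfolding residual_poly_def Let_def S_def[symmetric] Min Max using e_pos by simp
  also have "\<dots> = resp g d"
    unfolding resp_def by (rule map_cong[OF refl], rule coeff) auto
  finally show ?thesis .
qed

end


section \<open>Approximate roots\<close>

lemma monic_power_coeff:
  fixes P :: "'a::field poly"
  assumes "Polynomial.lead_coeff P = 1"
  shows "Polynomial.degree (P ^ n) = n * Polynomial.degree P" "coeff (P ^ n) (n * Polynomial.degree P) = 1"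
proof -
  have nz: "P \<noteq> 0" using assms by auto
  then show d: "Polynomial.degree (P ^ n) = n * Polynomial.degree P" by (simp add: degree_power_eq)
  have "Polynomial.lead_coeff (P ^ n) = 1" by (simp only: lead_coeff_power assms power_one)
  then show "coeff (P ^ n) (n * Polynomial.degree P) = 1" by (simp only: d)
qed

text \<open>The leading digit of g is 1 and the next one vanishes, so after removing the m-th power
  of P only digits of index at most m - 2 remain.\<close>

lemma approx_remainder:
  fixes P :: "'a::field poly"
  assumes P: "Polynomial.lead_coeff P = 1" "Polynomial.degree P = D" "0 < D"
    and g: "Polynomial.lead_coeff g = 1" "Polynomial.degree g = m * D" and m: "0 < m"
    and 0: "expansion_coeff P g (m - 1) = 0"
  shows "g - P ^ m = 0 \<or> Polynomial.degree (g - P ^ m) < (m - 1) * D"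
proof (cases "m = 1")
  case True
  have dP: "0 < Polynomial.degree P" using P by simp
  have "g = (\<Sum>n\<le>1. expansion_coeff P g n * P ^ n)"
    using g P True by (intro expansion[OF dP]) simp
  also have "\<dots> = P"
    using 0 True expansion_coeff_monic[OF dP P(1) g(1), of 1] g(2) P(2) by simp
  finally show ?thesis using True by simp
next
  case False
  have dP: "0 < Polynomial.degree P" using P by simp
  obtain k where k: "m = Suc (Suc k)" using m False by (metis One_nat_def Suc_pred not0_implies_Suc gr_implies_not0 old.nat.exhaust)
  have "g = (\<Sum>n\<le>m. expansion_coeff P g n * P ^ n)"
    using g P by (intro expansion[OF dP]) simp
  also have "\<dots> = (\<Sum>n\<le>k. expansion_coeff P g n * P ^ n) + P ^ m"
    using 0 k expansion_coeff_monic[OF dP P(1) g(1), of m] g(2) P(2) by simp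
  finally have eq: "g - P ^ m = (\<Sum>n\<le>k. expansion_coeff P g n * P ^ n)" by (simp add: algebra_simps)
  have "Polynomial.degree (\<Sum>n\<le>k. expansion_coeff P g n * P ^ n) < (m - 1) * D"
  proof (rule degree_sum_less)
    fix n assume "n \<in> {..k}"
    then have "Suc n * D \<le> (m - 1) * D" using k by (intro mult_le_mono1) auto
    then show "Polynomial.degree (expansion_coeff P g n * P ^ n) < (m - 1) * D"
      using degree_mult_le[of "expansion_coeff P g n" "P ^ n"] expansion_coeff_small[OF dP, of g n]
        monic_power_coeff(1)[OF P(1), of n] P(2) by simp
  qed (use k P(3) in simp)
  then show ?thesis unfolding eq by simp
qed

text \<open>The difference of the m-th powers factors as (P - Q) S, where S is a sum of m monic
  polynomials of degree (m - 1) D. As m \<noteq> 0 in the field, S keeps that degree, which is too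
  large for a difference of two remainders.\<close>

lemma approx_root_unique:
  fixes P Q :: "'a::field poly"
  assumes P: "Polynomial.lead_coeff P = 1" "Polynomial.degree P = D" "expansion_coeff P g (m - 1) = 0"
    and Q: "Polynomial.lead_coeff Q = 1" "Polynomial.degree Q = D" "expansion_coeff Q g (m - 1) = 0"
    and D: "0 < D" and g: "Polynomial.lead_coeff g = 1" "Polynomial.degree g = m * D" and m: "of_nat m \<noteq> (0::'a)"
  shows "P = Q"
proof (rule ccontr)
  assume "P \<noteq> Q"
  have m0: "0 < m" using m by (cases m) auto
  have dP: "Polynomial.degree (P ^ i) = i * D" "coeff (P ^ i) (i * D) = 1" for i
    using monic_power_coeff[OF P(1), of i] P(2) by auto
  have dQ: "Polynomial.degree (Q ^ i) = i * D" "coeff (Q ^ i) (i * D) = 1" for i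
    using monic_power_coeff[OF Q(1), of i] Q(2) by auto
  define S where "S = (\<Sum>i<m. Q ^ (m - Suc i) * P ^ i)"
  have deg_term: "Polynomial.degree (Q ^ (m - Suc i) * P ^ i) = (m - 1) * D \<and> coeff (Q ^ (m - Suc i) * P ^ i) ((m - 1) * D) = 1"
    if "i < m" for i
  proof -
    have sum: "(m - Suc i) * D + i * D = (m - 1) * D"
      using that by (simp add: add_mult_distrib[symmetric])
    have nz: "Q ^ (m - Suc i) \<noteq> 0" "P ^ i \<noteq> 0" using P(1) Q(1) by auto
    have d: "Polynomial.degree (Q ^ (m - Suc i) * P ^ i) = (m - 1) * D"
      using nz sum dQ(1)[of "m - Suc i"] dP(1)[of i] by (simp add: degree_mult_eq)
    have "Polynomial.lead_coeff (Q ^ (m - Suc i) * P ^ i) = 1"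
      by (simp only: lead_coeff_mult lead_coeff_power P(1) Q(1) power_one mult_1)
    then show ?thesis using d by simp
  qed
  have "coeff S ((m - 1) * D) = of_nat m"
    unfolding S_def coeff_sum using deg_term by simp
  then have S: "S \<noteq> 0" "(m - 1) * D \<le> Polynomial.degree S"
    using m by (auto intro: le_degree)
  have PQ: "P ^ m - Q ^ m = (P - Q) * S"
    unfolding S_def by (rule power_diff_sumr2)
  have "P ^ m - Q ^ m = (g - Q ^ m) - (g - P ^ m)" by simp
  then have "P ^ m - Q ^ m = 0 \<or> Polynomial.degree (P ^ m - Q ^ m) < (m - 1) * D"
    using approx_remainder[OF P(1,2) D g m0 P(3)] approx_remainder[OF Q(1,2) D g m0 Q(3)]
    by (metis degree_diff_less degree_minus diff_0 diff_zero)
  moreover have "P ^ m - Q ^ m \<noteq> 0" using PQ S \<open>P \<noteq> Q\<close> by simp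
  moreover have "(m - 1) * D \<le> Polynomial.degree (P ^ m - Q ^ m)"
    using PQ S \<open>P \<noteq> Q\<close> by (simp add: degree_mult_eq)
  ultimately show False by simp
qed

lemma approx_root_eqI:
  fixes Q :: "'a::field poly"
  assumes "Polynomial.lead_coeff Q = 1" "Polynomial.degree Q = D" "expansion_coeff Q g (m - 1) = 0"
    "0 < D" "Polynomial.lead_coeff g = 1" "Polynomial.degree g = m * D" "of_nat m \<noteq> (0::'a)"
  shows "approx_root m g = Q"
  unfolding approx_root_def
proof (rule the_equality)
  have "0 < m" using assms(7) by (cases m) auto
  then have D: "Polynomial.degree g div m = D" using assms(6) by simp
  then show "Polynomial.lead_coeff Q = 1 \<and> Polynomial.degree Q = Polynomial.degree g div m \<and> expansion_coeff Q g (m - 1) = 0"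
    using assms by simp
  fix P assume "Polynomial.lead_coeff P = 1 \<and> Polynomial.degree P = Polynomial.degree g div m \<and> expansion_coeff P g (m - 1) = 0"
  then show "P = Q" using assms D by (intro approx_root_unique[of P D g m Q]) auto
qed

lemma binomial_remainder:
  fixes P c :: "'a::field poly"
  assumes "Polynomial.degree P = D" "Polynomial.degree c = t" "t \<le> D" "2 \<le> m"
  shows "Polynomial.degree ((P + c) ^ m - P ^ m - of_nat m * c * P ^ (m - 1)) \<le> 2 * t + (m - 2) * D"
proof -
  obtain k where k: "m = Suc (Suc k)" using assms(4) by (metis add_2_eq_Suc le_Suc_ex)
  have "(P + c) ^ m = (\<Sum>i\<le>m. of_nat (m choose i) * c ^ i * P ^ (m - i))"
    by (subst add.commute) (rule binomial_ring)
  also have "\<dots> = P ^ m + of_nat m * c * P ^ (m - 1) + (\<Sum>i\<le>k. of_nat (m choose (i + 2)) * c ^ (i + 2) * P ^ (m - (i + 2)))"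
    unfolding k by (simp only: sum.atMost_Suc_shift) simp
  finally have "(P + c) ^ m - P ^ m - of_nat m * c * P ^ (m - 1) = (\<Sum>i\<le>k. of_nat (m choose (i + 2)) * c ^ (i + 2) * P ^ (m - (i + 2)))"
    by (simp add: algebra_simps)
  also have "Polynomial.degree \<dots> \<le> 2 * t + (m - 2) * D"
  proof (rule degree_sum_le)
    fix i assume i: "i \<in> {..k}"
    have "Polynomial.degree (of_nat (m choose (i + 2)) * c ^ (i + 2) * P ^ (m - (i + 2))) \<le> 0 + (i + 2) * t + (m - (i + 2)) * D"
      using assms(1,2) degree_power_le[of c "i + 2"] degree_power_le[of P "m - (i + 2)"]
      by (intro order_trans[OF degree_mult_le] add_mono) (auto simp: mult.commute simp del: power_Suc)
    also have "\<dots> \<le> 2 * t + (i * D + (m - (i + 2)) * D)"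
      using assms(3) by (simp add: add_mult_distrib)
    also have "i * D + (m - (i + 2)) * D = (m - 2) * D"
      using i k by (simp add: add_mult_distrib[symmetric])
    finally show "Polynomial.degree (of_nat (m choose (i + 2)) * c ^ (i + 2) * P ^ (m - (i + 2))) \<le> 2 * t + (m - 2) * D" .
  qed simp
  finally show ?thesis .
qed

text \<open>Tschirnhausen's substitution lowers the degree of the coefficient in question.\<close>

lemma approx_root_iterate:
  fixes g :: "'a::field poly"
  assumes "P \<in> S" and S: "\<And>P. P \<in> S \<Longrightarrow> Polynomial.lead_coeff P = 1 \<and> Polynomial.degree P = D"
    and step: "\<And>P. P \<in> S \<Longrightarrow> P + smult (inverse (of_nat m)) (expansion_coeff P g (m - 1)) \<in> S"
    and D: "0 < D" and g: "Polynomial.lead_coeff g = 1" "Polynomial.degree g = m * D" and m: "of_nat m \<noteq> (0::'a)"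
  shows "\<exists>Q\<in>S. expansion_coeff Q g (m - 1) = 0"
  using \<open>P \<in> S\<close>
proof (induction "Polynomial.degree (expansion_coeff P g (m - 1))" arbitrary: P rule: less_induct)
  case less
  let ?b = "expansion_coeff P g (m - 1)"
  define c where "c = smult (inverse (of_nat m)) ?b"
  define Q where "Q = P + c"
  note P = S[OF less.prems]
  have Q: "Q \<in> S" unfolding Q_def c_def by (rule step[OF less.prems])
  note Q' = S[OF Q]
  have dP: "0 < Polynomial.degree P" and dQ: "0 < Polynomial.degree Q" using P Q' D by auto
  have m0: "0 < m" using m by (cases m) auto
  have em: "expansion_coeff P g m = 1"
    by (rule expansion_coeff_monic[OF dP conjunct1[OF P] g(1)]) (use g P in simp)
  show ?case
  proof (cases "expansion_coeff Q g (m - 1) = 0")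
    case True
    then show ?thesis using Q by blast
  next
    case False
    define t where "t = Polynomial.degree ?b"
    have t: "t < D" using expansion_coeff_small[OF dP, of g "m - 1"] P by (simp add: t_def)
    have tc: "Polynomial.degree c = t" using m by (simp add: c_def t_def)
    \<comment> \<open>For m = 1 the correction gives Q = g at once, whose digit of index 0
      vanishes.\<close>
    have m2: "2 \<le> m"
    proof (rule ccontr)
      assume "\<not> 2 \<le> m"
      then have m1: "m = 1" using m0 by simp
      have "g = (\<Sum>n\<le>1. expansion_coeff P g n * P ^ n)"
        using g P m1 D by (intro expansion[OF dP]) simp
      also have "\<dots> = ?b + P"
        using m1 em by simp
      finally have "g = Q" using m1 by (simp add: Q_def c_def add.commute)
      then show False using False m1 dQ by (simp add: expansion_coeff_def)
    qed
    obtain k where k: "m = Suc (Suc k)" using m2 by (metis add_2_eq_Suc le_Suc_ex)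
    have "g = (\<Sum>n\<le>m. expansion_coeff P g n * P ^ n)"
      using g P D by (intro expansion[OF dP]) simp
    also have "\<dots> = (\<Sum>n\<le>k. expansion_coeff P g n * P ^ n) + ?b * P ^ (m - 1) + P ^ m"
      using k em by simp
    finally have gP: "g = (\<Sum>n\<le>k. expansion_coeff P g n * P ^ n) + ?b * P ^ (m - 1) + P ^ m" .
    have mc: "of_nat m * c = ?b" using m by (simp add: c_def of_nat_poly)
    define r where "r = g - Q ^ m"
    have r: "r = (\<Sum>n\<le>k. expansion_coeff P g n * P ^ n) - (Q ^ m - P ^ m - of_nat m * c * P ^ (m - 1))"
      unfolding r_def mc by (subst gP) (simp add: algebra_simps)
    have d1: "Polynomial.degree (\<Sum>n\<le>k. expansion_coeff P g n * P ^ n) < (m - 1) * D"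
    proof (rule degree_sum_less)
      fix n assume "n \<in> {..k}"
      then have "Suc n * D \<le> (m - 1) * D" using k by (intro mult_le_mono1) auto
      then show "Polynomial.degree (expansion_coeff P g n * P ^ n) < (m - 1) * D"
        using degree_mult_le[of "expansion_coeff P g n" "P ^ n"] expansion_coeff_small[OF dP, of g n]
          monic_power_coeff(1)[OF conjunct1[OF P], of n] P by simp
    qed (use k D in simp)
    have d2: "Polynomial.degree (Q ^ m - P ^ m - of_nat m * c * P ^ (m - 1)) \<le> 2 * t + (m - 2) * D"
      unfolding Q_def using P tc t m2 by (intro binomial_remainder) auto
    have dr: "Polynomial.degree r < (m - 1) * D \<or> Polynomial.degree r \<le> 2 * t + (m - 2) * D"
    proof -
      have "Polynomial.degree r \<le> max (Polynomial.degree (\<Sum>n\<le>k. expansion_coeff P g n * P ^ n))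
        (Polynomial.degree (Q ^ m - P ^ m - of_nat m * c * P ^ (m - 1)))"
        unfolding r by (rule degree_diff_le_max)
      then show ?thesis using d1 d2 by linarith
    qed
    let ?Y = "Q ^ (m - 1)"
    have dY: "Polynomial.degree ?Y = (m - 1) * D" and Y0: "?Y \<noteq> 0" using monic_power_coeff(1)[OF conjunct1[OF Q'], of "m - 1"] Q' dQ by auto
    have gY: "g = r + Q * ?Y" unfolding r_def k by simp
    have "g div ?Y = r div ?Y + Q"
      by (subst gY) (use Y0 in simp)
    then have eQ: "expansion_coeff Q g (m - 1) = (r div ?Y) mod Q" by (simp add: expansion_coeff_def)
    then have q0: "r div ?Y \<noteq> 0" using False by auto
    have "Polynomial.degree (r div ?Y * ?Y + r mod ?Y) = Polynomial.degree (r div ?Y) + (m - 1) * D"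
    proof (cases "r mod ?Y = 0")
      case True
      then show ?thesis using q0 Y0 dY by (simp add: degree_mult_eq)
    next
      case False
      then have "Polynomial.degree (r mod ?Y) < Polynomial.degree (r div ?Y * ?Y)"
        using degree_mod_less'[OF Y0 False] q0 Y0 by (simp add: degree_mult_eq)
      then show ?thesis using q0 Y0 dY by (simp add: degree_add_eq_left degree_mult_eq)
    qed
    then have "Polynomial.degree r = Polynomial.degree (r div ?Y) + (m - 1) * D" by (simp only: div_mult_mod_eq)
    then have "Polynomial.degree (r div ?Y) + (m - 1) * D \<le> 2 * t + (m - 2) * D" using dr by linarith
    moreover have "(m - 1) * D = D + (m - 2) * D" using k by simp
    \<comment> \<open>The linear term of the binomial expansion cancels the old coefficient, of
      degree t; the quadratic rest leaves degree at most 2t - D, below t because t < D.\<close>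
    ultimately have "Polynomial.degree (r div ?Y) + D \<le> 2 * t" by linarith
    then have lt: "Polynomial.degree (r div ?Y) < t" using t by linarith
    then have "expansion_coeff Q g (m - 1) = r div ?Y"
      unfolding eQ using Q' t by (intro mod_poly_less) simp
    then show ?thesis using less.hyps[OF _ Q] lt by (simp add: t_def)
  qed
qed


section \<open>Passing to the next key polynomial\<close>

text \<open>The last assumption replaces knowledge about the factorization over the henselization: it says
  that all roots of a polynomial with one-sided Newton polygon induce \<open>V\<close> in small degrees.\<close>

locale rooted_stage = residual_stage V \<phi> lam v w u1 u2
  for V :: "'a::field poly \<Rightarrow> 'g::linordered_rat_vector extval" and \<phi> lam v w u1 u2 +
  assumes roots: "Polynomial.lead_coeff f = 1 \<Longrightarrow> Polynomial.degree f = r * Polynomial.degree \<phi> \<Longrightarrow>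
    M f = Fin (of_nat r *\<^sub>Q lam) \<Longrightarrow> evac f t = 0 \<Longrightarrow> Polynomial.degree a < Polynomial.degree \<phi> \<Longrightarrow>
    w (evac a t) = V a"
begin

lemma w_finite: "w z = Infty \<longleftrightarrow> z = 0"
  by (rule field_valuation_finite[OF w.val])

lemma evac_expansion:
  assumes "Polynomial.degree f < Suc N * Polynomial.degree \<phi>"
  shows "evac f t = (\<Sum>n\<le>N. evac (cf f n) t * evac \<phi> t ^ n)"
  by (subst expansion[OF deg assms]) (simp add: evac_sum)

text \<open>If \<phi> had value below lam at t, the term of index r, whose digit is 1, would be
  strictly dominant and f could not vanish at t.\<close>

lemma root_slope_ge:
  assumes f: "Polynomial.lead_coeff f = 1" "Polynomial.degree f = r * Polynomial.degree \<phi>"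
    "M f = Fin (of_nat r *\<^sub>Q lam)" "evac f t = 0"
  shows "Fin lam \<le> w (evac \<phi> t)"
proof (rule ccontr)
  assume "\<not> ?thesis"
  then obtain x where x: "w (evac \<phi> t) = Fin x" "x < lam" by (cases "w (evac \<phi> t)") auto
  have pow: "w (evac \<phi> t ^ n) = Fin (of_nat n *\<^sub>Q x)" for n
    using valuation_power[OF w.valuation_axioms x(1)] .
  have cr: "cf f r = 1" using expansion_coeff_monic[OF deg monic f(1,2)] .
  have eq: "evac f t = (\<Sum>n\<le>r. evac (cf f n) t * evac \<phi> t ^ n)"
    using f(2) deg by (intro evac_expansion) simp
  have "w (\<Sum>n\<le>r. evac (cf f n) t * evac \<phi> t ^ n) = w (evac (cf f r) t * evac \<phi> t ^ r)"
  proof (rule w.val_sum_unique_min)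
    fix n assume n: "n \<in> {..r}" "n \<noteq> r"
    have V: "w (evac (cf f n) t) = V (cf f n)" by (rule roots[OF f cf_small])
    have "of_nat r *\<^sub>Q lam = of_nat (r - n) *\<^sub>Q lam + of_nat n *\<^sub>Q lam"
      using scaleQ_of_nat_add[of "r - n" n lam] n by simp
    then have "Fin (of_nat (r - n) *\<^sub>Q lam) \<le> V (cf f n)"
      using M_le[of f n] f(3) by (cases "V (cf f n)") (auto simp: tm_def)
    moreover have "of_nat (r - n) *\<^sub>Q x < of_nat (r - n) *\<^sub>Q lam"
      using n x by (intro scaleQ_of_nat_strict_mono) auto
    ultimately have "Fin (of_nat (r - n) *\<^sub>Q x) < V (cf f n)" by (metis extval_less(2) order.strict_trans2)
    moreover have "of_nat r *\<^sub>Q x = of_nat (r - n) *\<^sub>Q x + of_nat n *\<^sub>Q x"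
      using scaleQ_of_nat_add[of "r - n" n x] n by simp
    ultimately show "w (evac (cf f r) t * evac \<phi> t ^ r) < w (evac (cf f n) t * evac \<phi> t ^ n)"
      by (cases "V (cf f n)") (auto simp: w.val_mult cr pow V)
  qed (auto simp: w.val_mult cr pow)
  then show False using eq f(4) by (simp add: w.val_mult cr pow)
qed

lemma root_dominates:
  assumes "Polynomial.lead_coeff f = 1" "Polynomial.degree f = r * Polynomial.degree \<phi>"
    "M f = Fin (of_nat r *\<^sub>Q lam)" "evac f t = 0"
  shows "dominates t"
  using roots[OF assms] root_slope_ge[OF assms] by (intro dominatesI) auto

text \<open>If \<phi> had value above lam at t, the constant digit, which attains M f, would be
  strictly dominant.\<close>

lemma root_slope_eq:
  assumes f: "Polynomial.lead_coeff f = 1" "Polynomial.degree f = r * Polynomial.degree \<phi>"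
    "M f = Fin (of_nat r *\<^sub>Q lam)" "evac f t = 0" and f0: "V (cf f 0) = M f"
  shows "w (evac \<phi> t) = Fin lam"
proof (rule ccontr)
  assume "\<not> ?thesis"
  then have less: "Fin lam < w (evac \<phi> t)" using root_slope_ge[OF f] by simp
  have pow: "Fin (of_nat n *\<^sub>Q lam) \<le> w (evac \<phi> t ^ n)" for n
  proof (induction n)
    case (Suc n)
    then show ?case using add_mono[OF less_imp_le[OF less] Suc] by (simp add: w.val_mult scaleQ_add_left scaleQ_one)
  qed simp
  have pow': "Fin (of_nat n *\<^sub>Q lam) < w (evac \<phi> t ^ n)" if n: "0 < n" for n
  proof -
    obtain k where k: "n = Suc k" using n by (cases n) auto
    show ?thesis unfolding k
      using extval_add_less_mono1[OF less pow[of k]] by (simp add: w.val_mult scaleQ_add_left scaleQ_one)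
  qed
  have eq: "evac f t = (\<Sum>n\<le>r. evac (cf f n) t * evac \<phi> t ^ n)"
    using f(2) deg by (intro evac_expansion) simp
  have V: "w (evac (cf f n) t) = V (cf f n)" for n by (rule roots[OF f cf_small])
  have "w (\<Sum>n\<le>r. evac (cf f n) t * evac \<phi> t ^ n) = w (evac (cf f 0) t * evac \<phi> t ^ 0)"
  proof (rule w.val_sum_unique_min)
    fix n assume n: "n \<in> {..r}" "n \<noteq> 0"
    have "M f \<le> V (cf f n) + Fin (of_nat n *\<^sub>Q lam)" using M_le[of f n] by (simp add: tm_def)
    also have "V (cf f n) + Fin (of_nat n *\<^sub>Q lam) < V (cf f n) + w (evac \<phi> t ^ n)" if "V (cf f n) \<noteq> Infty"
      using pow'[of n] n that by (intro extval_add_less_mono2) auto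
    finally have "M f < V (cf f n) + w (evac \<phi> t ^ n)" using f(3) by (cases "V (cf f n) = Infty") auto
    then show "w (evac (cf f 0) t * evac \<phi> t ^ 0) < w (evac (cf f n) t * evac \<phi> t ^ n)"
      by (simp add: w.val_mult V f0)
  qed (auto simp: w.val_mult V f0 f(3))
  then show False using eq f(4) V f0 f(3) by (simp add: w.val_mult)
qed

lemma rel_M: "rel f d p \<Longrightarrow> Polynomial.degree f = (d * e) * Polynomial.degree \<phi> \<and> M f = Fin (of_nat (d * e) *\<^sub>Q lam)"
  using relD[of f d p] by (simp add: elam_def scaleQ_scaleQ)

lemma rel_root_props:
  assumes "rel f d p" "evac f t = 0"
  shows "dominates t" "p \<in> ker_at t" "\<And>a. small a \<Longrightarrow> w (evac a t) = V a"
proof -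
  note f = relD[OF assms(1)] and f' = rel_M[OF assms(1)]
  show t: "dominates t"
    using f f' assms(2) by (intro root_dominates[of f "d * e"]) auto
  show "p \<in> ker_at t"
    using rel_root[OF assms(1) t] f(3) assms(2) by simp
  show "\<And>a. small a \<Longrightarrow> w (evac a t) = V a"
    using f f' assms(2) by (intro roots[of f "d * e" t]) auto
qed

text \<open>The list is the polynomial y, lifted by T. At t the value of T is e times the excess of
  the value of \<phi> over lam.\<close>

lemma var_ker_at:
  assumes "dominates t" "Fin lam \<le> w (evac \<phi> t)"
  shows "[\<one>\<^bsub>F\<^esub>, \<zero>\<^bsub>F\<^esub>] \<in> ker_at t \<longleftrightarrow> w (evac \<phi> t) \<noteq> Fin lam"
proof -
  have c: "[\<one>\<^bsub>F\<^esub>, \<zero>\<^bsub>F\<^esub>] \<in> carrier KX"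
    using M.F.var_closed(1)[OF subfieldE(1)[OF \<kappa>_subfield]] by (simp add: var_def)
  have "ev [\<one>\<^bsub>F\<^esub>, \<zero>\<^bsub>F\<^esub>] = \<beta> T" using \<xi>_carrier by (simp add: \<xi>_def[symmetric])
  then have "[\<one>\<^bsub>F\<^esub>, \<zero>\<^bsub>F\<^esub>] \<in> ker_at t \<longleftrightarrow> 0 < w (evac T t)"
    using MT by (intro ker_at_iff[OF assms(1) c]) auto
  also have "\<dots> \<longleftrightarrow> w (evac \<phi> t) \<noteq> Fin lam"
  proof (cases "w (evac \<phi> t)")
    case (Fin x)
    then have "lam \<le> x" using assms(2) by simp
    have "w (evac T t) = Fin (of_nat e *\<^sub>Q x - of_nat e *\<^sub>Q lam)"
      using valuation_power[OF w.valuation_axioms Fin, of e] dominates_u[OF assms(1)]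
      by (simp add: T_def w.val_mult elam_def)
    then show ?thesis
      using Fin \<open>lam \<le> x\<close> scaleQ_of_nat_strict_mono[OF e_pos, of lam x] by (auto simp: order.order_iff_strict)
  next
    case Infty
    then have "evac \<phi> t = 0" by (simp add: w_finite)
    then have "evac T t = 0" using e_pos by (simp add: T_def)
    then show ?thesis using Infty by simp
  qed
  finally show ?thesis .
qed

end


text \<open>Q is any monic lift of \<psi>, not yet the approximate root. The root t0 certifies that
  y is not in the ideal of \<psi>, because \<phi> has value exactly lam there; by equality of ideals
  this holds at every root of \<psi> (\<open>slope_of_ker\<close>).\<close>

locale next_stage = rooted_stage V \<phi> lam v w u1 u2
  for V :: "'a::field poly \<Rightarrow> 'g::linordered_rat_vector extval" and \<phi> lam v w u1 u2 +
  fixes \<psi> and t0 Q d0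
  assumes \<psi>: "\<psi> \<in> carrier KX" "ring_irreducible\<^bsub>KX\<^esub> \<psi>"
    and d0: "length \<psi> = Suc d0"
    and t0: "dominates t0" "w (evac \<phi> t0) = Fin lam" "\<psi> \<in> ker_at t0"
    and Q: "rel Q d0 \<psi>"
begin

lemma d0_pos: "0 < d0"
  using M.F.pirreducible_degree[OF \<kappa>_subfield \<psi>] d0 by simp

lemma slope_of_ker:
  assumes "dominates t" "\<psi> \<in> ker_at t" shows "w (evac \<phi> t) = Fin lam"
proof -
  have eq: "ker_at t = ker_at t0"
    using ker_at_eq_PIdl[OF assms(1) \<psi> assms(2)] ker_at_eq_PIdl[OF t0(1) \<psi> t0(3)] by simp
  have "Fin lam \<le> w (evac \<phi> t)"
    using dominatesD[OF assms(1), of \<phi>] M_phi by simp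
  then show ?thesis
    using var_ker_at[OF assms(1)] var_ker_at[OF t0(1)] t0(2) eq by auto
qed

lemmas Q_props = relD[OF Q]

lemma Q_deg: "Polynomial.degree Q = d0 * e * Polynomial.degree \<phi>" "0 < Polynomial.degree Q"
  using Q_props(2) d0_pos e_pos deg by auto

lemma value_below_Q:
  assumes "dominates t" "\<psi> \<in> ker_at t" "Polynomial.degree f < Polynomial.degree Q"
  shows "w (evac f t) = M f"
proof (cases "f = 0")
  case False
  then show ?thesis
    using small_degree_value[OF assms(1) slope_of_ker[OF assms(1,2)] \<psi> assms(2) False] assms(3) Q_deg d0
    by simp
qed simp

definition "\<rho> = (SOME t. evac Q t = 0)"

lemma \<rho>: "evac Q \<rho> = 0"
proof -
  obtain t where "evac Q t = 0" using evac_root_exists[OF Q_deg(2)] by blast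
  then show ?thesis unfolding \<rho>_def by (rule someI)
qed

lemma \<rho>_props: "dominates \<rho>" "\<psi> \<in> ker_at \<rho>"
  using rel_root_props[OF Q \<rho>] by auto

text \<open>The V of the next stage. It coincides with the function nu_\<rho> at a root \<rho> of Q,
  which is why it is a valuation; its kernel is generated by Q.\<close>

definition "VQ f = M (f mod Q)"

lemma mod_Q_small: "Polynomial.degree (f mod Q) < Polynomial.degree Q"
  using degree_mod_less[of Q f] Q_deg(2) by (cases "f mod Q = 0") (auto simp: Q_props(7))

lemma VQ_eq: "VQ f = w (evac f \<rho>)"
proof -
  have "evac f \<rho> = evac (f div Q * Q + f mod Q) \<rho>" by (simp only: div_mult_mod_eq)
  also have "\<dots> = evac (f mod Q) \<rho>" by (simp only: evac_add evac_mult \<rho> mult_zero_right add_0_left)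
  finally show ?thesis unfolding VQ_def using value_below_Q[OF \<rho>_props mod_Q_small, of f] by simp
qed

lemma VQ_small: "Polynomial.degree f < Polynomial.degree Q \<Longrightarrow> VQ f = M f"
  by (simp add: VQ_def mod_poly_less)

lemma VQ_valuation: "is_valuation VQ"
  unfolding is_valuation_def VQ_eq by (simp add: w.val_mult w.val_add)

lemma VQ_const: "VQ [:a:] = v a"
  by (simp add: VQ_eq w_to_ac)

lemma VQ_kernel: "VQ f = Infty \<longleftrightarrow> Q dvd f"
  by (simp add: VQ_def M_finite mod_eq_0_iff_dvd)

sublocale nx: key_stage VQ Q
  by unfold_locales (use VQ_valuation Q_props Q_deg VQ_kernel in auto)

lemma next_pair: "valuation_pair M VQ Q"
  by unfold_locales
    (use dominatesD[OF \<rho>_props(1)] Q_props Q_deg VQ_kernel VQ_small M_finite in \<open>auto simp: VQ_eq\<close>)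

lemma next_key_poly: "Q \<in> key_polys M"
  by (rule valuation_pair.key_poly[OF next_pair])

text \<open>The remainder r of \<open>a * b\<close> has the same M-value as the product, so the
  carried term c Q has at least that value. Replacing M Q by the larger \<tau> makes the inequality
  strict.\<close>

lemma next_augmentation:
  assumes "M Q < Fin \<tau>" shows "augmentation VQ Q \<tau>"
proof
  fix a b :: "'a poly" assume ab: "Polynomial.degree a < Polynomial.degree Q" "Polynomial.degree b < Polynomial.degree Q" "a \<noteq> 0" "b \<noteq> 0"
  define c where "c = (a * b) div Q"
  define r where "r = (a * b) mod Q"
  have fin: "M (a * b) \<noteq> Infty" using ab by (simp add: M_finite)
  have VQab: "VQ a + VQ b = M (a * b)" using ab by (simp add: VQ_small M.val_mult)
  have "M r = VQ (a * b)" by (simp add: VQ_def r_def)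
  also have "\<dots> = M (a * b)" using VQab nx.V.val_mult[of a b] by simp
  finally have "M (a * b) \<le> M (a * b - r)" by (intro M.val_diff_ge) auto
  also have "a * b - r = c * Q" by (simp add: c_def r_def minus_mod_eq_div_mult)
  finally have le: "M (a * b) \<le> M c + M Q" by (simp add: M.val_mult)
  have "VQ c = M c" unfolding c_def by (rule VQ_small[OF nx.div_small[OF ab(1,2)]])
  moreover have "M c + M Q < M c + Fin \<tau>" if "M c \<noteq> Infty"
    using assms that by (intro extval_add_less_mono2) auto
  ultimately show "VQ a + VQ b < VQ ((a * b) div Q) + Fin \<tau>"
    using le fin VQab unfolding c_def[symmetric] by (cases "M c = Infty") (auto intro: order.strict_trans1)
qed

text \<open>For slope \<tau> all digits lie on or above the line through the leading one. Lowering
  the slope to M Q < \<tau> leaves only the r-th power of Q in the initial form, so f has the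
  residual polynomial of that power.\<close>

lemma Q_adic_dominant:
  assumes \<tau>: "M Q < Fin \<tau>" and f: "Polynomial.lead_coeff f = 1" "Polynomial.degree f = r * Polynomial.degree Q"
    and le: "\<And>i. Fin (of_nat r *\<^sub>Q \<tau>) \<le> M (expansion_coeff Q f i) + Fin (of_nat i *\<^sub>Q \<tau>)"
  shows "rel f (r * d0) (\<psi> [^]\<^bsub>KX\<^esub> r)"
proof -
  have cr: "expansion_coeff Q f r = 1"
    using expansion_coeff_monic[OF Q_deg(2) Q_props(1) f] .
  have "f = (\<Sum>i\<le>r. expansion_coeff Q f i * Q ^ i)"
    using f Q_deg(2) by (intro expansion) auto
  also have "\<dots> = (\<Sum>i<r. expansion_coeff Q f i * Q ^ i) + Q ^ r"
    using cr by (simp add: lessThan_Suc_atMost[symmetric])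
  finally have eq: "Q ^ r - f = - (\<Sum>i<r. expansion_coeff Q f i * Q ^ i)" by (simp add: algebra_simps)
  obtain \<gamma> where \<gamma>: "M Q = Fin \<gamma>" using Q_props(7) by (rule M.finiteE)
  then have "\<gamma> < \<tau>" using \<tau> by simp
  have "Fin (of_nat r *\<^sub>Q \<gamma>) < M (Q ^ r - f)"
    unfolding eq M.val_minus
  proof (rule M.val_sum_gr)
    fix i assume i: "i \<in> {..<r}"
    have "of_nat r *\<^sub>Q \<tau> = of_nat (r - i) *\<^sub>Q \<tau> + of_nat i *\<^sub>Q \<tau>"
      using scaleQ_of_nat_add[of "r - i" i \<tau>] i by simp
    then have "Fin (of_nat (r - i) *\<^sub>Q \<tau>) \<le> M (expansion_coeff Q f i)"
      using le[of i] by (cases "M (expansion_coeff Q f i)") auto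
    moreover have "of_nat (r - i) *\<^sub>Q \<gamma> < of_nat (r - i) *\<^sub>Q \<tau>"
      using i \<open>\<gamma> < \<tau>\<close> by (intro scaleQ_of_nat_strict_mono) auto
    ultimately have "Fin (of_nat (r - i) *\<^sub>Q \<gamma>) < M (expansion_coeff Q f i)" by (metis extval_less(2) order.strict_trans2)
    moreover have "of_nat r *\<^sub>Q \<gamma> = of_nat (r - i) *\<^sub>Q \<gamma> + of_nat i *\<^sub>Q \<gamma>"
      using scaleQ_of_nat_add[of "r - i" i \<gamma>] i by simp
    ultimately show "Fin (of_nat r *\<^sub>Q \<gamma>) < M (expansion_coeff Q f i * Q ^ i)"
      using valuation_power[OF M.valuation_axioms \<gamma>, of i]
      by (cases "M (expansion_coeff Q f i)") (auto simp: M.val_mult)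
  qed simp
  then have "M (Q ^ r) < M (Q ^ r - f)"
    using valuation_power[OF M.valuation_axioms \<gamma>, of r] by simp
  moreover have "Polynomial.degree f = Polynomial.degree (Q ^ r)"
    using f(2) monic_power_coeff(1)[OF Q_props(1)] by simp
  ultimately show ?thesis
    using rel_close[OF rel_power[OF Q] f(1)] by simp
qed

text \<open>This hands the assumption about roots on to the next stage. The residual polynomial of f
  is a power of \<psi>, so \<psi> lies in the prime ideal of t, and there values below deg Q are
  those of M.\<close>

lemma next_roots:
  assumes \<tau>: "M Q < Fin \<tau>" and f: "Polynomial.lead_coeff f = 1" "Polynomial.degree f = r * Polynomial.degree Q"
    and Mf: "augment VQ Q \<tau> f = Fin (of_nat r *\<^sub>Q \<tau>)" and t: "evac f t = 0"
    and a: "Polynomial.degree a < Polynomial.degree Q"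
  shows "w (evac a t) = VQ a"
proof -
  interpret nxa: augmentation VQ Q \<tau> by (rule next_augmentation[OF \<tau>])
  have "Fin (of_nat r *\<^sub>Q \<tau>) \<le> M (expansion_coeff Q f i) + Fin (of_nat i *\<^sub>Q \<tau>)" for i
    using nxa.M_le[of f i] Mf by (simp add: nxa.tm_def VQ_small)
  then have "rel f (r * d0) (\<psi> [^]\<^bsub>KX\<^esub> r)" by (rule Q_adic_dominant[OF \<tau> f])
  then have "dominates t" "\<psi> [^]\<^bsub>KX\<^esub> r \<in> ker_at t" using rel_root_props t by blast+
  then have "w (evac a t) = M a"
    using ker_at_pow[OF _ \<psi>(1)] a by (intro value_below_Q) auto
  then show ?thesis using a by (simp add: VQ_small)
qed

text \<open>Since g and the m-th power of Q have the same residual polynomial, their difference has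
  larger M-value. Hence its digit b at index m - 1 satisfies M b > M Q. As v(m) = 0, adding b / m
  changes Q only by larger value.\<close>

lemma tschirnhausen_step:
  assumes g: "rel g (m * d0) (\<psi> [^]\<^bsub>KX\<^esub> m)" and m: "0 < m" "v (of_nat m) = 0"
  shows "rel (Q + smult (inverse (of_nat m)) (expansion_coeff Q g (m - 1))) d0 \<psi>"
proof -
  let ?b = "expansion_coeff Q g (m - 1)"
  note g' = relD[OF g]
  have gQ: "Polynomial.degree g = m * Polynomial.degree Q" using g'(2) Q_deg by simp
  have sb: "Polynomial.degree ?b < Polynomial.degree Q" by (rule expansion_coeff_small[OF Q_deg(2)])
  obtain \<gamma> where \<gamma>: "M Q = Fin \<gamma>" using Q_props(7) by (rule M.finiteE)
  \<comment> \<open>the \<open>Q\<close>-expansion computes \<open>M\<close> also at the limit slope \<open>M Q\<close>\<close>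
  have min: "M f \<le> M (expansion_coeff Q f i) + Fin (of_nat i *\<^sub>Q \<gamma>)" for f i
  proof (induction i arbitrary: f)
    case 0
    have "M f \<le> VQ f" using dominatesD[OF \<rho>_props(1)] by (simp add: VQ_eq)
    then show ?case by (simp add: expansion_coeff_at_0[OF Q_deg(2)] VQ_def)
  next
    case (Suc i)
    have "M f \<le> M (f mod Q)" using dominatesD[OF \<rho>_props(1)] by (simp add: VQ_eq flip: VQ_def)
    then have "M f \<le> M (f - f mod Q)" by (intro M.val_diff_ge) auto
    also have "f - f mod Q = f div Q * Q" by (simp add: minus_mod_eq_div_mult)
    also have "M (f div Q * Q) = M (f div Q) + Fin \<gamma>" by (simp add: M.val_mult \<gamma>)
    also have "\<dots> \<le> M (expansion_coeff Q f (Suc i)) + Fin (of_nat i *\<^sub>Q \<gamma>) + Fin \<gamma>"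
      unfolding expansion_coeff_Suc[OF Q_deg(2)] by (intro add_right_mono Suc)
    also have "\<dots> = M (expansion_coeff Q f (Suc i)) + Fin (of_nat (Suc i) *\<^sub>Q \<gamma>)"
      by (simp add: add.assoc scaleQ_add_left scaleQ_one add.commute[of \<gamma>])
    finally show ?case .
  qed
  have MQm: "M (Q ^ m) = Fin (of_nat m *\<^sub>Q \<gamma>)" using valuation_power[OF M.valuation_axioms \<gamma>] .
  have "M (Q ^ m) < M (Q ^ m - g)"
    using rel_diff[OF rel_power[OF Q] g] .
  then have "Fin (of_nat m *\<^sub>Q \<gamma>) < M (expansion_coeff Q (Q ^ m - g) (m - 1)) + Fin (of_nat (m - 1) *\<^sub>Q \<gamma>)"
    using min[of "Q ^ m - g" "m - 1"] unfolding MQm by (rule order.strict_trans2)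
  also have "expansion_coeff Q (Q ^ m - g) (m - 1) = - ?b"
    using expansion_coeff_monomial[OF Q_deg(2), of 1 m "m - 1"] m(1) Q_deg(2)
    by (simp add: expansion_coeff_diff[OF Q_deg(2)])
  finally have "Fin (of_nat m *\<^sub>Q \<gamma>) < M ?b + Fin (of_nat (m - 1) *\<^sub>Q \<gamma>)" by simp
  moreover have "of_nat m *\<^sub>Q \<gamma> = \<gamma> + of_nat (m - 1) *\<^sub>Q \<gamma>"
    using scaleQ_of_nat_add[of 1 "m - 1" \<gamma>] m(1) by (simp add: scaleQ_one)
  ultimately have Mb: "M Q < M ?b" using \<gamma> by (cases "M ?b") auto
  let ?c = "smult (inverse (of_nat m)) ?b"
  have "v (inverse (of_nat m)) = 0"
    using field_valuation_inverse[OF v_val, of "of_nat m" 0] m(2) by simp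
  then have "M ?c = M ?b"
    using M.val_mult[of "[:inverse (of_nat m):]" ?b] M_const by simp
  then have "M Q < M (Q - (Q + ?c))" using Mb by simp
  moreover have sc: "Polynomial.degree ?c < Polynomial.degree Q" using sb degree_smult_le[of _ ?b] by (rule order.strict_trans1[rotated])
  moreover have "Polynomial.lead_coeff (Q + ?c) = 1"
    using sc Q_props(1) by (simp add: degree_add_eq_left coeff_eq_0)
  ultimately show ?thesis
    by (intro rel_close[OF Q]) (simp_all add: degree_add_eq_left)
qed

end


section \<open>Resultants\<close>

lemma monic_roots:
  fixes f :: "'a::field poly"
  assumes "Polynomial.lead_coeff f = 1"
  obtains A where "size A = Polynomial.degree f" "map_poly to_ac f = (\<Prod>x\<in>#A. [:- x, 1:])"
    "\<And>t. t \<in># A \<longleftrightarrow> evac f t = 0" "\<And>s. evac f s = (\<Prod>x\<in>#A. s - x)"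
proof -
  have nz: "map_poly to_ac f \<noteq> 0" using assms by auto
  obtain A where A: "size A = Polynomial.degree (map_poly to_ac f)"
    "map_poly to_ac f = smult (Polynomial.lead_coeff (map_poly to_ac f)) (\<Prod>x\<in>#A. [:- x, 1:])"
    using alg_closed_imp_factorization[OF nz] by blast
  have eq: "map_poly to_ac f = (\<Prod>x\<in>#A. [:- x, 1:])"
    using A(2) assms by (simp only: lead_coeff_map_poly_to_ac) simp
  have ev: "evac f s = (\<Prod>x\<in>#A. s - x)" for s
    unfolding evac_def eq by (induction A) (auto simp: algebra_simps)
  have mem: "t \<in># A \<longleftrightarrow> evac f t = 0" for t
    unfolding ev by (induction A) auto
  have "size A = Polynomial.degree f" using A(1) by simp
  from that[OF this eq mem ev] show ?thesis .
qed

lemma sum_mset_const_Fin: "(\<Sum>x\<in>#A. Fin (c :: 'g::linordered_rat_vector)) = Fin (of_nat (size A) *\<^sub>Q c)"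
  by (induction A) (auto simp: scaleQ_add_left scaleQ_one)

lemma sum_mset_strict_mono_Fin:
  assumes "A \<noteq> {#}" "\<And>x. x \<in># A \<Longrightarrow> Fin (c :: 'g::linordered_rat_vector) < h x"
  shows "Fin (of_nat (size A) *\<^sub>Q c) < (\<Sum>x\<in>#A. h x)"
  using assms
proof (induction A)
  case (add a A)
  have a: "Fin c < h a" using add.prems by simp
  show ?case
  proof (cases "A = {#}")
    case False
    then have "Fin (of_nat (size A) *\<^sub>Q c) < (\<Sum>x\<in>#A. h x)" using add by simp
    from extval_add_less_mono1[OF a less_imp_le[OF this]]
    show ?thesis by (simp add: scaleQ_add_left scaleQ_one)
  qed (use a in \<open>simp add: scaleQ_one\<close>)
qed simp

text \<open>Both sides are the value of the resultant, the product of the differences of roots of f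
  and h, taken over pairs in either order. Multisets of roots account for multiplicities.\<close>

lemma resultant_values:
  fixes w :: "'a::field alg_closure \<Rightarrow> 'g::linordered_rat_vector extval"
  assumes w: "is_valuation w" and f: "Polynomial.lead_coeff f = 1" and h: "Polynomial.lead_coeff h = 1"
    and c: "\<And>t. evac f t = 0 \<Longrightarrow> w (evac h t) = Fin c"
  shows "(\<And>s. evac h s = 0 \<Longrightarrow> w (evac f s) = Fin d) \<Longrightarrow>
      of_nat (Polynomial.degree f) *\<^sub>Q c = of_nat (Polynomial.degree h) *\<^sub>Q d"
    "(\<And>s. evac h s = 0 \<Longrightarrow> Fin d < w (evac f s)) \<Longrightarrow> 0 < Polynomial.degree h \<Longrightarrow>
      of_nat (Polynomial.degree h) *\<^sub>Q d < of_nat (Polynomial.degree f) *\<^sub>Q c"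
proof -
  interpret w: valuation w by unfold_locales fact
  obtain A where A: "size A = Polynomial.degree f" "\<And>t. t \<in># A \<longleftrightarrow> evac f t = 0" "\<And>s. evac f s = (\<Prod>x\<in>#A. s - x)"
    using monic_roots[OF f] by metis
  obtain B where B: "size B = Polynomial.degree h" "\<And>t. t \<in># B \<longleftrightarrow> evac h t = 0" "\<And>s. evac h s = (\<Prod>x\<in>#B. s - x)"
    using monic_roots[OF h] by metis
  have prod: "w (\<Prod>x\<in>#C. s - x) = (\<Sum>x\<in>#C. w (s - x))" for C s
    by (induction C) (auto simp: w.val_mult)
  have "(\<Sum>s\<in>#B. w (evac f s)) = (\<Sum>s\<in>#B. \<Sum>x\<in>#A. w (s - x))" by (simp add: A(3) prod)
  also have "\<dots> = (\<Sum>x\<in>#A. \<Sum>s\<in>#B. w (s - x))" by (rule sum_mset.swap)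
  also have "\<dots> = (\<Sum>x\<in>#A. w (evac h x))" by (simp add: B(3) prod w.val_diff_commute)
  also have "\<dots> = (\<Sum>x\<in>#A. Fin c)" using A(2) c by (intro arg_cong[where f = sum_mset] image_mset_cong) simp
  also have "\<dots> = Fin (of_nat (Polynomial.degree f) *\<^sub>Q c)" by (simp add: sum_mset_const_Fin A(1))
  finally have eq: "(\<Sum>s\<in>#B. w (evac f s)) = Fin (of_nat (Polynomial.degree f) *\<^sub>Q c)" .
  {
    assume "\<And>s. evac h s = 0 \<Longrightarrow> w (evac f s) = Fin d"
    then have "(\<Sum>s\<in>#B. w (evac f s)) = (\<Sum>s\<in>#B. Fin d)"
      using B(2) by (intro arg_cong[where f = sum_mset] image_mset_cong) simp
    then show "of_nat (Polynomial.degree f) *\<^sub>Q c = of_nat (Polynomial.degree h) *\<^sub>Q d"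
      using eq by (simp add: sum_mset_const_Fin B(1))
  }
  {
    assume less: "\<And>s. evac h s = 0 \<Longrightarrow> Fin d < w (evac f s)" and pos: "0 < Polynomial.degree h"
    have "B \<noteq> {#}" using B(1) pos by auto
    then have "Fin (of_nat (size B) *\<^sub>Q d) < (\<Sum>s\<in>#B. w (evac f s))"
      proof (rule sum_mset_strict_mono_Fin)
      fix s assume "s \<in># B"
      then have "evac h s = 0" using B(2) by blast
      then show "Fin d < w (evac f s)" by (rule less)
    qed
    then show "of_nat (Polynomial.degree h) *\<^sub>Q d < of_nat (Polynomial.degree f) *\<^sub>Q c"
      using eq by (simp add: B(1))
  }
qed


section \<open>Residual polynomials of polynomials with conjugate roots\<close>

context rooted_stage
begin

lemma KX_domain_lemmas:
  assumes "p \<in> carrier KX" "q \<in> carrier KX" "p \<noteq> []" "q \<noteq> []"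
  shows "Polynomials.lead_coeff (p \<otimes>\<^bsub>KX\<^esub> q) = Polynomials.lead_coeff p \<otimes>\<^bsub>F\<^esub> Polynomials.lead_coeff q"
    "length (p \<otimes>\<^bsub>KX\<^esub> q) = length p + length q - 1" "p \<otimes>\<^bsub>KX\<^esub> q \<noteq> []"
proof -
  note sr = subfieldE(1)[OF \<kappa>_subfield]
  show "Polynomials.lead_coeff (p \<otimes>\<^bsub>KX\<^esub> q) = Polynomials.lead_coeff p \<otimes>\<^bsub>F\<^esub> Polynomials.lead_coeff q"
    using M.F.poly_mult_lead_coeff[OF sr, of p q] assms by (simp add: univ_poly_mult univ_poly_carrier)
  show nz: "p \<otimes>\<^bsub>KX\<^esub> q \<noteq> []"
    using KX.integral[OF _ assms(1,2)] assms(3,4) by (auto simp: univ_poly_zero)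
  have "Polynomials.degree (p \<otimes>\<^bsub>KX\<^esub> q) = Polynomials.degree p + Polynomials.degree q"
    using M.F.poly_mult_degree_eq[OF sr, of p q] assms by (simp add: univ_poly_mult univ_poly_carrier)
  then show "length (p \<otimes>\<^bsub>KX\<^esub> q) = length p + length q - 1"
    using assms(3,4) nz by (cases p; cases q; cases "p \<otimes>\<^bsub>KX\<^esub> q") auto
qed

lemma monic_carrier: "q \<in> carrier KX \<Longrightarrow> set q \<subseteq> carrier F"
  using \<kappa>_subfield by (auto simp: univ_poly_carrier[symmetric] polynomial_def dest: subfieldE(3))

lemma prime_generator:
  assumes "primeideal J KX" "J \<noteq> {[]}"
  obtains \<psi> where "\<psi> \<in> carrier KX" "Polynomials.lead_coeff \<psi> = \<one>\<^bsub>F\<^esub>" "ring_irreducible\<^bsub>KX\<^esub> \<psi>" "J = PIdl\<^bsub>KX\<^esub> \<psi>" "\<psi> \<noteq> []"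
proof -
  interpret J: primeideal J KX by fact
  obtain \<psi> where \<psi>: "\<psi> \<in> carrier KX" "Polynomials.lead_coeff \<psi> = \<one>\<^bsub>F\<^esub>" "J = PIdl\<^bsub>KX\<^esub> \<psi>"
    using M.F.exists_unique_gen[OF \<kappa>_subfield J.ideal_axioms assms(2)] by blast
  have "\<psi> \<noteq> []"
  proof
    assume "\<psi> = []"
    then have "PIdl\<^bsub>KX\<^esub> \<psi> = {[]}"
      using KX.genideal_zero KX.cgenideal_eq_genideal[OF KX.zero_closed] by (simp add: univ_poly_zero)
    then show False using assms(2) \<psi> by simp
  qed
  moreover have "ring_prime\<^bsub>KX\<^esub> \<psi>"
    using KX.primeideal_iff_prime[of \<psi>] \<psi> \<open>\<psi> \<noteq> []\<close> assms(1) by (simp add: univ_poly_zero)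
  ultimately show ?thesis using that \<psi> KX.primeness_condition by blast
qed

lemma ker_at_primeideal:
  assumes "dominates t" shows "primeideal (ker_at t) KX"
  using ker_at_prime[OF assms] one_notin_ker_at[OF assms] ker_at_ideal[OF assms] KX.is_cring
  by (intro primeidealI) auto

text \<open>An irreducible factor \<open>\<chi>\<close> of the residual polynomial of \<open>g\<close> lifts to a polynomial. If \<open>\<chi>\<close> did not
  vanish at the roots of \<open>g\<close>, the two expressions for the value of the resultant would differ.\<close>

lemma irreducible_factor_in_ker_at:
  assumes g: "rel g d p" and eq: "\<And>t t' f. evac g t = 0 \<Longrightarrow> evac g t' = 0 \<Longrightarrow> w (evac f t) = w (evac f t')"
    and t: "evac g t = 0"
    and \<chi>: "\<chi> \<in> carrier KX" "Polynomials.lead_coeff \<chi> = \<one>\<^bsub>F\<^esub>" "ring_irreducible\<^bsub>KX\<^esub> \<chi>" "p \<in> PIdl\<^bsub>KX\<^esub> \<chi>"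
  shows "\<chi> \<in> ker_at t"
proof (rule ccontr)
  assume notin: "\<chi> \<notin> ker_at t"
  have deg\<chi>: "1 \<le> Polynomials.degree \<chi>" by (rule M.F.pirreducible_degree[OF \<kappa>_subfield \<chi>(1,3)])
  then have "\<chi> \<noteq> []" by auto
  obtain P where P: "rel P (length \<chi> - 1) \<chi>" using rel_lift[OF \<chi>(1) \<open>\<chi> \<noteq> []\<close> \<chi>(2)] by blast
  let ?c = "length \<chi> - 1"
  note P' = relD[OF P] and g' = relD[OF g]
  have "w (evac P t) = M P"
  proof -
    have "dominates t" by (rule rel_root_props(1)[OF g t])
    then show ?thesis using rel_root[OF P] notin dominatesD[of t P] by (metis order.order_iff_strict)
  qed
  then have "w (evac P t') = Fin (of_nat ?c *\<^sub>Q elam)" if "evac g t' = 0" for t'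
    using eq[OF that t] P'(3) by simp
  moreover have "Fin (of_nat d *\<^sub>Q elam) < w (evac g s)" if s: "evac P s = 0" for s
  proof -
    note s' = rel_root_props(1,2)[OF P s]
    interpret ideal "ker_at s" KX by (rule ker_at_ideal[OF s'(1)])
    have "PIdl\<^bsub>KX\<^esub> \<chi> \<subseteq> ker_at s" by (rule KX.cgenideal_minimal[OF ker_at_ideal[OF s'(1)] s'(2)])
    then have "p \<in> ker_at s" using \<chi>(4) by auto
    then show ?thesis using rel_root[OF g s'(1)] g'(3) by simp
  qed
  moreover have "0 < Polynomial.degree P" using P'(2) deg\<chi> e_pos deg by simp
  ultimately have "of_nat (Polynomial.degree P) *\<^sub>Q (of_nat d *\<^sub>Q elam) < of_nat (Polynomial.degree g) *\<^sub>Q (of_nat ?c *\<^sub>Q elam)"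
    by (intro resultant_values(2)[OF w.val g'(1) P'(1)])
  moreover have "of_nat (Polynomial.degree P) *\<^sub>Q (of_nat d *\<^sub>Q elam) = of_nat (Polynomial.degree P * d) *\<^sub>Q elam"
    "of_nat (Polynomial.degree g) *\<^sub>Q (of_nat ?c *\<^sub>Q elam) = of_nat (Polynomial.degree g * ?c) *\<^sub>Q elam"
    by (simp_all only: scaleQ_scaleQ of_nat_mult)
  \<comment> \<open>Both degrees are proportional to the degrees of the residual polynomials, with
    the same factor e deg \<phi>, so the strict inequality of resultants is absurd.\<close>
  moreover have "Polynomial.degree P * d = Polynomial.degree g * ?c"
    unfolding P'(2) g'(2) by (simp add: ac_simps)
  ultimately show False by simp
qed

end


context rooted_stage
begin

text \<open>Let \<psi> be the monic generator of the ideal of a root. An irreducible factor of any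
  cofactor q of p divides p, hence generates the same ideal by
  \<open>irreducible_factor_in_ker_at\<close>, so \<psi> divides q. Splitting off \<psi> repeatedly
  keeps q monic and ends at 1.\<close>

lemma residual_power:
  assumes g: "rel g d p" "length p = Suc d" "Polynomials.lead_coeff p = \<one>\<^bsub>F\<^esub>" "0 < d"
    and eq: "\<And>t t' f. evac g t = 0 \<Longrightarrow> evac g t' = 0 \<Longrightarrow> w (evac f t) = w (evac f t')"
  obtains \<psi> m where "\<psi> \<in> carrier KX" "Polynomials.lead_coeff \<psi> = \<one>\<^bsub>F\<^esub>" "ring_irreducible\<^bsub>KX\<^esub> \<psi>"
    "p = \<psi> [^]\<^bsub>KX\<^esub> (m::nat)"
proof -
  note g' = relD[OF g(1)]
  have "0 < Polynomial.degree g" using g'(2) g(4) e_pos deg by simp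
  then obtain t where t: "evac g t = 0" by (rule evac_root_exists)
  note t' = rel_root_props(1,2)[OF g(1) t]
  have "p \<noteq> []" using g(2) by auto
  then have "ker_at t \<noteq> {[]}" using t'(2) by blast
  then obtain \<psi> where \<psi>: "\<psi> \<in> carrier KX" "Polynomials.lead_coeff \<psi> = \<one>\<^bsub>F\<^esub>" "ring_irreducible\<^bsub>KX\<^esub> \<psi>"
    "ker_at t = PIdl\<^bsub>KX\<^esub> \<psi>" "\<psi> \<noteq> []"
    using prime_generator[OF ker_at_primeideal[OF t'(1)]] by blast
  have len\<psi>: "2 \<le> length \<psi>"
    using M.F.pirreducible_degree[OF \<kappa>_subfield \<psi>(1,3)] by simp
  have step: "\<exists>m::nat. q = \<psi> [^]\<^bsub>KX\<^esub> m"
    if "q \<in> carrier KX" "Polynomials.lead_coeff q = \<one>\<^bsub>F\<^esub>" "q \<noteq> []" "r \<in> carrier KX" "p = r \<otimes>\<^bsub>KX\<^esub> q" for q r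
    using that
  proof (induction "length q" arbitrary: q r rule: less_induct)
    case less
    show ?case
    proof (cases "length q = 1")
      case True
      then have "q = [\<one>\<^bsub>F\<^esub>]" using less.prems(2) by (cases q) auto
      then show ?thesis by (intro exI[of _ 0]) (simp add: univ_poly_one)
    next
      case False
      have "q \<notin> Units KX"
      proof
        assume "q \<in> Units KX"
        then obtain k where "q = [k]" unfolding M.F.univ_poly_units[OF \<kappa>_subfield] by blast
        then show False using False by simp
      qed
      moreover have "q \<in> carrier KX - {\<zero>\<^bsub>KX\<^esub>}" using less.prems(1,3) by (simp add: univ_poly_zero)
      ultimately obtain b where b: "b \<in> carrier KX" "ring_irreducible\<^bsub>KX\<^esub> b" "b divides\<^bsub>KX\<^esub> q"
        using KX.exists_irreducible_divisor by metis
      interpret mb: maximalideal "PIdl\<^bsub>KX\<^esub> b" KX by (rule KX.irreducible_imp_maximalideal[OF b(1,2)])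
      have pb: "primeideal (PIdl\<^bsub>KX\<^esub> b) KX" by (rule KX.maximalideal_prime[OF mb.maximalideal_axioms])
      have bI: "b \<in> PIdl\<^bsub>KX\<^esub> b" by (rule KX.cgenideal_self[OF b(1)])
      moreover have "b \<noteq> []" using b(2) by (auto simp: ring_irreducible_def univ_poly_zero)
      ultimately have "PIdl\<^bsub>KX\<^esub> b \<noteq> {[]}" by blast
      then obtain \<chi> where \<chi>: "\<chi> \<in> carrier KX" "Polynomials.lead_coeff \<chi> = \<one>\<^bsub>F\<^esub>" "ring_irreducible\<^bsub>KX\<^esub> \<chi>"
        "PIdl\<^bsub>KX\<^esub> b = PIdl\<^bsub>KX\<^esub> \<chi>" "\<chi> \<noteq> []"
        by (rule prime_generator[OF pb])
      obtain c where c: "c \<in> carrier KX" "q = b \<otimes>\<^bsub>KX\<^esub> c" using b(3) unfolding factor_def by blast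
      then have "q = c \<otimes>\<^bsub>KX\<^esub> b" using KX.m_comm[OF b(1) c(1)] by simp
      then have "q \<in> PIdl\<^bsub>KX\<^esub> b" unfolding cgenideal_def using c(1) by blast
      then have q\<chi>: "q \<in> PIdl\<^bsub>KX\<^esub> \<chi>" using \<chi>(4) by simp
      then have "p \<in> PIdl\<^bsub>KX\<^esub> \<chi>"
        using less.prems(4,5) ideal.I_l_closed[OF KX.cgenideal_ideal[OF \<chi>(1)]] by simp
      then have "\<chi> \<in> ker_at t" by (intro irreducible_factor_in_ker_at[OF g(1) eq t \<chi>(1-3)])
      then have "ker_at t = PIdl\<^bsub>KX\<^esub> \<chi>" by (rule ker_at_eq_PIdl[OF t'(1) \<chi>(1,3)])
      then have "q \<in> PIdl\<^bsub>KX\<^esub> \<psi>" using q\<chi> \<psi>(4) by blast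
      then obtain q' where q': "q' \<in> carrier KX" "q = q' \<otimes>\<^bsub>KX\<^esub> \<psi>" unfolding cgenideal_def by blast
      have "q' \<noteq> []"
        using q'(2) less.prems(3) KX.l_null[OF \<psi>(1)] unfolding univ_poly_zero by metis
      note qq = KX_domain_lemmas[OF q'(1) \<psi>(1) \<open>q' \<noteq> []\<close> \<psi>(5)]
      have "Polynomials.lead_coeff q' \<in> carrier F"
        using monic_carrier[OF q'(1)] \<open>q' \<noteq> []\<close> by (cases q') auto
      then have lc: "Polynomials.lead_coeff q' = \<one>\<^bsub>F\<^esub>" using qq(1) less.prems(2) q'(2) \<psi>(2) by simp
      have len: "length q' < length q" using qq(2) q'(2) len\<psi> \<open>q' \<noteq> []\<close> by (cases q') auto
      have "p = (r \<otimes>\<^bsub>KX\<^esub> \<psi>) \<otimes>\<^bsub>KX\<^esub> q'"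
        using less.prems(4,5) q' \<psi>(1) by (simp add: KX.m_assoc KX.m_comm[of q' \<psi>])
      then obtain m :: nat where "q' = \<psi> [^]\<^bsub>KX\<^esub> m"
        using less.hyps[OF len q'(1) lc \<open>q' \<noteq> []\<close> KX.m_closed[OF less.prems(4) \<psi>(1)]] by blast
      then show ?thesis using q'(2) by (intro exI[of _ "Suc m"]) simp
    qed
  qed
  note \<open>p \<noteq> []\<close>
  moreover have "p = \<one>\<^bsub>KX\<^esub> \<otimes>\<^bsub>KX\<^esub> p" using g'(4) by simp
  ultimately obtain m :: nat where "p = \<psi> [^]\<^bsub>KX\<^esub> m"
    using step[OF g'(4) g(3) _ KX.one_closed] by blast
  then show ?thesis using that \<psi> by blast
qed

end


section \<open>Conjugacy of extensions\<close>

text \<open>Closure under inverses is automatic, because everything is algebraic over K; so these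
  are the intermediate fields.\<close>

definition "intermediate_ring L \<longleftrightarrow> range to_ac \<subseteq> L \<and> (\<forall>x\<in>L. \<forall>y\<in>L. x + y \<in> L \<and> x * y \<in> L)"
  for L :: "'a::field alg_closure set"

definition "hom_on L \<sigma> \<longleftrightarrow> (\<forall>a. \<sigma> (to_ac a) = to_ac a) \<and> (\<forall>x\<in>L. \<forall>y\<in>L. \<sigma> (x + y) = \<sigma> x + \<sigma> y \<and> \<sigma> (x * y) = \<sigma> x * \<sigma> y)"
  for L :: "'a::field alg_closure set"

lemma intermediate_ringD:
  assumes "intermediate_ring L"
  shows "to_ac a \<in> L" "x \<in> L \<Longrightarrow> y \<in> L \<Longrightarrow> x + y \<in> L" "x \<in> L \<Longrightarrow> y \<in> L \<Longrightarrow> x * y \<in> L"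
    "0 \<in> L" "1 \<in> L" "x \<in> L \<Longrightarrow> - x \<in> L" "x \<in> L \<Longrightarrow> y \<in> L \<Longrightarrow> x - y \<in> L"
proof -
  show 1: "to_ac a \<in> L" for a using assms by (auto simp: intermediate_ring_def)
  show 2: "x \<in> L \<Longrightarrow> y \<in> L \<Longrightarrow> x + y \<in> L" and 3: "x \<in> L \<Longrightarrow> y \<in> L \<Longrightarrow> x * y \<in> L" for x y
    using assms by (auto simp: intermediate_ring_def)
  show "0 \<in> L" "1 \<in> L" using 1[of 0] 1[of 1] by simp_all
  show 4: "x \<in> L \<Longrightarrow> - x \<in> L" for x using 3[of "to_ac (- 1)" x] 1[of "- 1"] by simp
  show "x \<in> L \<Longrightarrow> y \<in> L \<Longrightarrow> x - y \<in> L" for x y using 2[of x "- y"] 4[of y] by simp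
qed

lemma intermediate_ring_sum: "intermediate_ring L \<Longrightarrow> (\<And>i. i \<in> I \<Longrightarrow> f i \<in> L) \<Longrightarrow> sum f I \<in> L"
  by (induction I rule: infinite_finite_induct) (auto simp: intermediate_ringD)

lemma intermediate_ring_evac: "intermediate_ring L \<Longrightarrow> x \<in> L \<Longrightarrow> evac f x \<in> L"
  by (induction f) (auto simp: evac_pCons intermediate_ringD)

text \<open>After removing factors of the variable from an annihilating polynomial its constant term
  is nonzero, and solving the relation for 1 exhibits the inverse as a polynomial in x over
  K.\<close>

lemma intermediate_ring_inverse:
  assumes "intermediate_ring L" "x \<in> L" shows "inverse x \<in> L"
proof (cases "x = 0")
  case False
  obtain p where p: "p \<noteq> 0" "evac p x = 0"
    using alg_closure_algebraic[of x] by (auto simp: evac_def)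
  have "\<exists>q. evac q x = 0 \<and> coeff q 0 \<noteq> 0"
    using p
  proof (induction p)
    case (pCons a p)
    show ?case
    proof (cases "a = 0")
      case True
      then have "evac p x = 0" "p \<noteq> 0" using pCons False by (auto simp: evac_pCons)
      then show ?thesis using pCons by blast
    next
      case False
      then show ?thesis using pCons by (intro exI[of _ "pCons a p"]) auto
    qed
  qed simp
  then obtain q where q: "evac q x = 0" "coeff q 0 \<noteq> 0" by blast
  obtain a r where qr: "q = pCons a r" by (cases q)
  then have a: "a \<noteq> 0" "to_ac a + x * evac r x = 0" using q by (auto simp: evac_pCons)
  then have "x * evac (smult (- inverse a) r) x = 1"
  proof -
    have "smult (- inverse a) r = [:- inverse a:] * r" by simp
    then have "x * evac (smult (- inverse a) r) x = to_ac (- inverse a) * (x * evac r x)"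
      by (simp only: evac_mult evac_const) (simp add: ac_simps)
    also have "x * evac r x = - to_ac a" using a(2) by (simp add: add_eq_0_iff)
    finally show ?thesis using a(1) by simp
  qed
  then have "inverse x = evac (smult (- inverse a) r) x" by (rule inverse_unique)
  then show ?thesis using intermediate_ring_evac[OF assms, of "smult (- inverse a) r"] by (simp only:)
qed (use assms intermediate_ringD in simp)

lemma hom_onD:
  assumes "hom_on L \<sigma>" "intermediate_ring L"
  shows "\<sigma> (to_ac a) = to_ac a" "x \<in> L \<Longrightarrow> y \<in> L \<Longrightarrow> \<sigma> (x + y) = \<sigma> x + \<sigma> y"
    "x \<in> L \<Longrightarrow> y \<in> L \<Longrightarrow> \<sigma> (x * y) = \<sigma> x * \<sigma> y" "\<sigma> 0 = 0" "\<sigma> 1 = 1" "x \<in> L \<Longrightarrow> \<sigma> (- x) = - \<sigma> x"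
    "x \<in> L \<Longrightarrow> \<sigma> x = 0 \<longleftrightarrow> x = 0"
proof -
  note L = intermediate_ringD[OF assms(2)]
  show 1: "\<sigma> (to_ac a) = to_ac a" for a using assms by (auto simp: hom_on_def)
  show 2: "x \<in> L \<Longrightarrow> y \<in> L \<Longrightarrow> \<sigma> (x + y) = \<sigma> x + \<sigma> y" and 3: "x \<in> L \<Longrightarrow> y \<in> L \<Longrightarrow> \<sigma> (x * y) = \<sigma> x * \<sigma> y" for x y
    using assms by (auto simp: hom_on_def)
  show 0: "\<sigma> 0 = 0" and o: "\<sigma> 1 = 1" using 1[of 0] 1[of 1] by simp_all
  show "x \<in> L \<Longrightarrow> \<sigma> (- x) = - \<sigma> x" for x
    using 2[of x "- x"] L(6)[of x] 0 by (simp add: eq_neg_iff_add_eq_0 add.commute)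
  show "\<sigma> x = 0 \<longleftrightarrow> x = 0" if "x \<in> L" for x
    using 3[OF that intermediate_ring_inverse[OF assms(2) that]] 0 o by (cases "x = 0") auto
qed

section \<open>Simple extensions and the extension of homomorphisms\<close>

definition "coeffs_in L = {p :: 'a::field alg_closure poly. \<forall>i. coeff p i \<in> L}"

lemma coeffs_inD: "p \<in> coeffs_in L \<Longrightarrow> coeff p i \<in> L"
  by (simp add: coeffs_in_def)

lemma coeffs_in_ops:
  assumes "intermediate_ring L"
  shows "p \<in> coeffs_in L \<Longrightarrow> q \<in> coeffs_in L \<Longrightarrow> p + q \<in> coeffs_in L" "p \<in> coeffs_in L \<Longrightarrow> q \<in> coeffs_in L \<Longrightarrow> p * q \<in> coeffs_in L"
    "p \<in> coeffs_in L \<Longrightarrow> - p \<in> coeffs_in L" "p \<in> coeffs_in L \<Longrightarrow> q \<in> coeffs_in L \<Longrightarrow> p - q \<in> coeffs_in L"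
    "0 \<in> coeffs_in L" "1 \<in> coeffs_in L" "c \<in> L \<Longrightarrow> p \<in> coeffs_in L \<Longrightarrow> pCons c p \<in> coeffs_in L"
    "map_poly to_ac f \<in> coeffs_in L" "c \<in> L \<Longrightarrow> p \<in> coeffs_in L \<Longrightarrow> smult c p \<in> coeffs_in L"
  using intermediate_ringD[OF assms]
  by (auto simp: coeffs_in_def coeff_mult coeff_map_poly coeff_pCons intro!: intermediate_ring_sum[OF assms] split: nat.split)

lemma coeffs_in_mod:
  assumes "intermediate_ring L" "p \<in> coeffs_in L" "q \<in> coeffs_in L" "Polynomial.lead_coeff q = 1"
  shows "p mod q \<in> coeffs_in L" "p div q \<in> coeffs_in L"
proof -
  have q0: "q \<noteq> 0" using assms(4) by auto
  have "\<exists>d r. p = d * q + r \<and> d \<in> coeffs_in L \<and> r \<in> coeffs_in L \<and> (r = 0 \<or> Polynomial.degree r < Polynomial.degree q)"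
    using assms(2)
  proof (induction p)
    case 0
    then show ?case using coeffs_in_ops[OF assms(1)] by (intro exI[of _ 0]) auto
  next
    case (pCons c p)
    have c: "c \<in> L" using coeffs_inD[OF pCons.prems, of 0] by simp
    have "p \<in> coeffs_in L" unfolding coeffs_in_def using coeffs_inD[OF pCons.prems, of "Suc _"] by simp
    then obtain d r where dr: "p = d * q + r" "d \<in> coeffs_in L" "r \<in> coeffs_in L" "r = 0 \<or> Polynomial.degree r < Polynomial.degree q"
      using pCons.IH by blast
    let ?n = "Polynomial.degree q"
    define s where "s = pCons c r"
    have s: "s \<in> coeffs_in L" "Polynomial.degree s \<le> ?n" using dr c coeffs_in_ops[OF assms(1)] by (auto simp: s_def)
    define r' where "r' = s - smult (coeff s ?n) q"
    have "r' \<in> coeffs_in L" unfolding r'_def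
      by (rule coeffs_in_ops(4)[OF assms(1) s(1) coeffs_in_ops(9)[OF assms(1) coeffs_inD[OF s(1)] assms(3)]])
    moreover have "r' = 0 \<or> Polynomial.degree r' < ?n"
    proof (rule eq_zero_or_degree_less)
      show "Polynomial.degree r' \<le> ?n" unfolding r'_def using s(2) by (intro degree_diff_le) auto
      show "coeff r' ?n = 0" unfolding r'_def using assms(4) by simp
    qed
    moreover have "pCons c p = (pCons (coeff s ?n) d) * q + r'"
      by (simp add: r'_def s_def dr(1) algebra_simps)
    moreover have "pCons (coeff s ?n) d \<in> coeffs_in L" 
      by (rule coeffs_in_ops(7)[OF assms(1) coeffs_inD[OF s(1)] dr(2)])
    ultimately show ?case by blast
  qed
  then obtain d r where dr: "p = d * q + r" "d \<in> coeffs_in L" "r \<in> coeffs_in L" "r = 0 \<or> Polynomial.degree r < Polynomial.degree q" by blast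
  have "(d * q + r) div q = d + r div q" using q0 by (simp add: div_add_self1)
  moreover have "r div q = 0" "r mod q = r" using dr(4) by (auto simp: div_poly_less mod_poly_less)
  ultimately show "p mod q \<in> coeffs_in L" "p div q \<in> coeffs_in L" using dr by auto
qed

lemma map_poly_hom:
  assumes "hom_on L \<sigma>" "intermediate_ring L" "p \<in> coeffs_in L" "q \<in> coeffs_in L"
  shows "map_poly \<sigma> (p + q) = map_poly \<sigma> p + map_poly \<sigma> q" "map_poly \<sigma> (p * q) = map_poly \<sigma> p * map_poly \<sigma> q"
proof -
  note h = hom_onD[OF assms(1,2)]
  have sum: "\<sigma> (sum f I) = (\<Sum>i\<in>I. \<sigma> (f i))" if "\<And>i. i \<in> I \<Longrightarrow> f i \<in> L" for f :: "nat \<Rightarrow> _" and I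
    using that by (induction I rule: infinite_finite_induct) (auto simp: h intermediate_ring_sum[OF assms(2)])
  show "map_poly \<sigma> (p + q) = map_poly \<sigma> p + map_poly \<sigma> q"
    using assms(3,4) by (auto simp: poly_eq_iff coeff_map_poly h coeffs_inD)
  show "map_poly \<sigma> (p * q) = map_poly \<sigma> p * map_poly \<sigma> q"
    using assms(3,4) by (auto simp: poly_eq_iff coeff_map_poly h coeffs_inD coeff_mult sum intermediate_ringD[OF assms(2)] intro!: sum.cong)
qed

definition "adjoin L \<alpha> = (\<lambda>p. poly p \<alpha>) ` coeffs_in L"

lemma adjoin_intermediate_ring:
  assumes "intermediate_ring L" shows "intermediate_ring (adjoin L \<alpha>)" "L \<subseteq> adjoin L \<alpha>" "\<alpha> \<in> adjoin L \<alpha>"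
proof -
  note o = coeffs_in_ops[OF assms]
  show L: "L \<subseteq> adjoin L \<alpha>"
  proof
    fix x assume "x \<in> L"
    then show "x \<in> adjoin L \<alpha>" unfolding adjoin_def using o(5,7) by (intro image_eqI[of _ _ "[:x:]"]) auto
  qed
  have "[:0, 1:] \<in> coeffs_in L" using o(5,7) intermediate_ringD(4,5)[OF assms] by blast
  then show "\<alpha> \<in> adjoin L \<alpha>" unfolding adjoin_def by (intro image_eqI[of _ _ "[:0, 1:]"]) auto
  show "intermediate_ring (adjoin L \<alpha>)"
    unfolding intermediate_ring_def
  proof (intro conjI ballI)
    show "range to_ac \<subseteq> adjoin L \<alpha>" using L assms by (auto simp: intermediate_ring_def)
    fix x y assume "x \<in> adjoin L \<alpha>" "y \<in> adjoin L \<alpha>"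
    then obtain p q where pq: "x = poly p \<alpha>" "y = poly q \<alpha>" "p \<in> coeffs_in L" "q \<in> coeffs_in L" by (auto simp: adjoin_def)
    then have "x + y = poly (p + q) \<alpha>" "x * y = poly (p * q) \<alpha>" "p + q \<in> coeffs_in L" "p * q \<in> coeffs_in L" using o(1,2) by auto
    then show "x + y \<in> adjoin L \<alpha>" "x * y \<in> adjoin L \<alpha>" unfolding adjoin_def by blast+
  qed
qed

definition "minimal_over L \<alpha> P \<longleftrightarrow> P \<in> coeffs_in L \<and> Polynomial.lead_coeff P = 1 \<and> poly P \<alpha> = 0 \<and>
  0 < Polynomial.degree P \<and> (\<forall>p\<in>coeffs_in L. poly p \<alpha> = 0 \<longrightarrow> (\<exists>q\<in>coeffs_in L. p = P * q))"

lemma minimal_over_exists: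
  assumes "intermediate_ring L"
  shows "\<exists>P. minimal_over L \<alpha> P"
proof -
  note o = coeffs_in_ops[OF assms]
  define Z where "Z = {p \<in> coeffs_in L. p \<noteq> 0 \<and> poly p \<alpha> = 0}"
  obtain p0 where "p0 \<noteq> 0" "poly (map_poly to_ac p0) \<alpha> = 0" using alg_closure_algebraic by blast
  then have "map_poly to_ac p0 \<in> Z" using o(8) by (simp add: Z_def)
  then obtain P0 where P0: "P0 \<in> Z" "\<And>q. q \<in> Z \<Longrightarrow> Polynomial.degree P0 \<le> Polynomial.degree q"
    using ex_has_least_nat[of "\<lambda>p. p \<in> Z" _ Polynomial.degree] by metis
  define P where "P = smult (inverse (Polynomial.lead_coeff P0)) P0"
  have P: "P \<in> coeffs_in L" unfolding P_def by (intro o(9) intermediate_ring_inverse[OF assms] coeffs_inD) (use P0(1) in \<open>auto simp: Z_def\<close>)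
  have lc: "Polynomial.lead_coeff P = 1" using P0(1) by (simp add: P_def Z_def)
  have r: "poly P \<alpha> = 0" using P0(1) by (simp add: P_def Z_def)
  have d: "0 < Polynomial.degree P"
  proof (rule ccontr)
    assume "\<not> ?thesis"
    then obtain c where "P = [:c:]" by (auto elim: degree_eq_zeroE)
    then show False using lc r by simp
  qed
  have div: "poly p \<alpha> = 0 \<longleftrightarrow> P dvd p" if p: "p \<in> coeffs_in L" for p
  proof
    assume "poly p \<alpha> = 0"
    have "poly p \<alpha> = poly (p div P * P + p mod P) \<alpha>" by (simp only: div_mult_mod_eq)
    then have "poly (p mod P) \<alpha> = 0" using r \<open>poly p \<alpha> = 0\<close> by (simp only: poly_add poly_mult mult_zero_right add_0_left)
    moreover have "p mod P \<in> coeffs_in L" by (rule coeffs_in_mod(1)[OF assms p P lc])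
    moreover have "p mod P \<noteq> 0 \<Longrightarrow> Polynomial.degree (p mod P) < Polynomial.degree P0"
      using degree_mod_less'[of P p] lc P0(1) by (auto simp: P_def Z_def)
    ultimately have "p mod P = 0" using P0(2)[of "p mod P"] by (force simp: Z_def)
    then show "P dvd p" by auto
  qed (use r in \<open>auto simp: dvd_def\<close>)
  have quo: "\<exists>q\<in>coeffs_in L. p = P * q" if "p \<in> coeffs_in L" "P dvd p" for p
    using coeffs_in_mod(2)[OF assms that(1) P lc] that(2) by (intro bexI[of _ "p div P"]) auto
  show ?thesis unfolding minimal_over_def using P lc r d div quo by blast
qed

text \<open>The value at \<open>poly p \<alpha>\<close> is computed from a chosen p. Another choice
  differs by a multiple of P, whose image vanishes at \<alpha>'.\<close>

lemma hom_extend: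
  assumes h: "hom_on L \<sigma>" and L: "intermediate_ring L" and P: "minimal_over L \<alpha> P"
    and \<alpha>': "poly (map_poly \<sigma> P) \<alpha>' = 0"
  shows "\<exists>\<sigma>'. hom_on (adjoin L \<alpha>) \<sigma>' \<and> (\<forall>x\<in>L. \<sigma>' x = \<sigma> x) \<and>
    (\<forall>p\<in>coeffs_in L. \<sigma>' (poly p \<alpha>) = poly (map_poly \<sigma> p) \<alpha>')"
proof -
  note o = coeffs_in_ops[OF L] and hD = hom_onD[OF h L]
  define \<sigma>' where "\<sigma>' x = poly (map_poly \<sigma> (SOME p. p \<in> coeffs_in L \<and> poly p \<alpha> = x)) \<alpha>'" for x
  have m0: "map_poly \<sigma> (- p) = - map_poly \<sigma> p" if "p \<in> coeffs_in L" for p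
    using that by (auto simp: poly_eq_iff coeff_map_poly hD coeffs_inD)
  have eq: "\<sigma>' (poly p \<alpha>) = poly (map_poly \<sigma> p) \<alpha>'" if p: "p \<in> coeffs_in L" for p
  proof -
    define q where "q = (SOME q. q \<in> coeffs_in L \<and> poly q \<alpha> = poly p \<alpha>)"
    have q: "q \<in> coeffs_in L \<and> poly q \<alpha> = poly p \<alpha>"
      unfolding q_def by (rule someI[of _ p]) (use p in simp)
    have pq: "p + - q \<in> coeffs_in L" using o(1,3) p q by blast
    have "poly (p + - q) \<alpha> = 0" using q by simp
    then obtain r where r: "r \<in> coeffs_in L" "p + - q = P * r" using P pq unfolding minimal_over_def by blast
    have "map_poly \<sigma> p + - map_poly \<sigma> q = map_poly \<sigma> (p + - q)"
      using map_poly_hom(1)[OF h L p o(3)] q m0 by simp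
    also have "\<dots> = map_poly \<sigma> P * map_poly \<sigma> r" unfolding r(2) by (rule map_poly_hom(2)[OF h L _ r(1)]) (use P in \<open>simp add: minimal_over_def\<close>)
    finally have "poly (map_poly \<sigma> p + - map_poly \<sigma> q) \<alpha>' = 0" using \<alpha>' by simp
    then show ?thesis unfolding \<sigma>'_def q_def[symmetric] by simp
  qed
  have ext: "\<sigma>' x = \<sigma> x" if "x \<in> L" for x
    using eq[of "[:x:]"] that o(5,7) hD(4) by (simp add: map_poly_pCons)
  have "hom_on (adjoin L \<alpha>) \<sigma>'"
    unfolding hom_on_def
  proof (intro conjI allI ballI)
    show "\<sigma>' (to_ac a) = to_ac a" for a using ext[OF intermediate_ringD(1)[OF L]] hD(1) by simp
    fix x y assume "x \<in> adjoin L \<alpha>" "y \<in> adjoin L \<alpha>"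
    then obtain p q where pq: "x = poly p \<alpha>" "y = poly q \<alpha>" "p \<in> coeffs_in L" "q \<in> coeffs_in L" by (auto simp: adjoin_def)
    show "\<sigma>' (x + y) = \<sigma>' x + \<sigma>' y"
      using eq[OF o(1)[OF pq(3,4)]] eq[OF pq(3)] eq[OF pq(4)] map_poly_hom(1)[OF h L pq(3,4)] pq by simp
    show "\<sigma>' (x * y) = \<sigma>' x * \<sigma>' y"
      using eq[OF o(2)[OF pq(3,4)]] eq[OF pq(3)] eq[OF pq(4)] map_poly_hom(2)[OF h L pq(3,4)] pq by simp
  qed
  then show ?thesis using ext eq by blast
qed


text \<open>The line of slope - \<gamma> supporting the Newton polygon of p touches it in a single
  vertex. Then no root of p has value \<gamma>.\<close>

definition unique_min :: "('b::field \<Rightarrow> 'g::linordered_rat_vector extval) \<Rightarrow> 'g \<Rightarrow> 'b poly \<Rightarrow> bool" where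
  "unique_min w \<gamma> p \<longleftrightarrow> (\<exists>k. \<forall>i. i \<noteq> k \<longrightarrow>
     w (coeff p k) + Fin (of_nat k *\<^sub>Q \<gamma>) < w (coeff p i) + Fin (of_nat i *\<^sub>Q \<gamma>))"

text \<open>A linear factor X - h keeps the vertex in its place if w h < \<gamma>, the constant term
  being dominant, and moves it by one if w h > \<gamma>.\<close>

lemma unique_min_mult_linear:
  assumes "valuation w" "unique_min w \<gamma> p" "w h \<noteq> Fin \<gamma>"
  shows "unique_min w \<gamma> ([:- h, 1:] * p)"
proof -
  interpret w: valuation w by fact
  define T where "T i = w (coeff p i) + Fin (of_nat i *\<^sub>Q \<gamma>)" for i
  define q where "q = [:- h, 1:] * p"
  obtain k where k: "\<And>i. i \<noteq> k \<Longrightarrow> T k < T i" using assms(2) by (auto simp: unique_min_def T_def)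
  have "T k < T (Suc k)" by (rule k) simp
  then have Tk: "T k \<noteq> Infty" by (cases "T k") auto
  have le: "T k \<le> T i" for i using k[of i] by (cases "i = k") auto
  define S where "S i = w (coeff (pCons 0 p) i) + Fin (of_nat i *\<^sub>Q \<gamma>)" for i
  define R where "R i = w (h * coeff p i) + Fin (of_nat i *\<^sub>Q \<gamma>)" for i
  have q: "coeff q i = coeff (pCons 0 p) i - h * coeff p i" for i
    by (simp add: q_def algebra_simps)
  have S: "S 0 = Infty" "S (Suc j) = T j + Fin \<gamma>" for j
    by (simp_all add: S_def T_def scaleQ_add_left scaleQ_one) (cases "w (coeff p j)"; simp add: add_ac)
  have R: "R i = w h + T i" for i by (simp add: R_def T_def w.val_mult add_ac)
  have gr: "c < w (coeff q i) + Fin (of_nat i *\<^sub>Q \<gamma>)" if "c < S i" "c < R i" for c i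
  proof -
    have "min (w (coeff (pCons 0 p) i)) (w (h * coeff p i)) \<le> w (coeff q i)" unfolding q by (rule w.val_diff)
    then have "w (coeff (pCons 0 p) i) \<le> w (coeff q i) \<or> w (h * coeff p i) \<le> w (coeff q i)" by (auto simp: min_def split: if_splits)
    then have "S i \<le> w (coeff q i) + Fin (of_nat i *\<^sub>Q \<gamma>) \<or> R i \<le> w (coeff q i) + Fin (of_nat i *\<^sub>Q \<gamma>)"
      unfolding S_def R_def by (blast intro: add_right_mono)
    then show ?thesis using that by auto
  qed
  show ?thesis
  proof (cases "w h < Fin \<gamma>")
    case True
    then have hf: "w h \<noteq> Infty" by auto
    let ?c = "w h + T k"
    have Sgr: "?c < S i" for i
    proof (cases i)
      case 0
      then show ?thesis using S(1) Tk hf by (cases "w h"; cases "T k") auto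
    next
      case (Suc j)
      have "w h + T k < Fin \<gamma> + T j" by (rule extval_add_less_mono1[OF True le Tk])
      then show ?thesis unfolding Suc S(2) by (simp add: add.commute)
    qed
    have Rgr: "?c < R i" if "i \<noteq> k" for i
      unfolding R by (rule extval_add_less_mono2[OF order_refl k[OF that] hf])
    have "S k \<noteq> R k" using Sgr[of k] by (simp add: R)
    have "w (h * coeff p k) < w (coeff (pCons 0 p) k)"
      using Sgr[of k] unfolding R[symmetric] S_def R_def by (simp only: add.commute[of _ "Fin _"] extval_add_left_cancel_less)
    then have "w (coeff q k) = w (h * coeff p k)"
      unfolding q w.val_diff_commute[of "coeff (pCons 0 p) k"] using w.val_add_eq[of "h * coeff p k" "- coeff (pCons 0 p) k"] by simp
    then have "w (coeff q k) + Fin (of_nat k *\<^sub>Q \<gamma>) = ?c" using R[of k] by (simp add: R_def)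
    then show ?thesis unfolding unique_min_def q_def[symmetric] using gr[OF Sgr Rgr] by (intro exI[of _ k]) simp
  next
    case False
    then have h: "Fin \<gamma> < w h" using assms(3) by auto
    let ?c = "T k + Fin \<gamma>"
    have Rgr: "?c < R i" for i
    proof -
      have "Fin \<gamma> + T k < w h + T i" by (rule extval_add_less_mono1[OF h le Tk])
      then show ?thesis by (simp add: R add.commute)
    qed
    have Sgr: "?c < S i" if "i \<noteq> Suc k" for i
    proof (cases i)
      case 0
      then show ?thesis using S(1) Tk by (cases "T k") auto
    next
      case (Suc j)
      then have "T k < T j" using that k by simp
      then show ?thesis unfolding Suc S(2) by (simp add: add.commute[of _ "Fin _"])
    qed
    have "w (coeff (pCons 0 p) (Suc k)) < w (h * coeff p (Suc k))"
      using Rgr[of "Suc k"] unfolding S(2)[symmetric] S_def R_def by (simp only: add.commute[of _ "Fin _"] extval_add_left_cancel_less)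
    then have "w (coeff q (Suc k)) = w (coeff (pCons 0 p) (Suc k))"
      unfolding q using w.val_add_eq[of "coeff (pCons 0 p) (Suc k)" "- (h * coeff p (Suc k))"] by simp
    then have "w (coeff q (Suc k)) + Fin (of_nat (Suc k) *\<^sub>Q \<gamma>) = ?c" using S(2)[of k] by (simp add: S_def)
    then show ?thesis unfolding unique_min_def q_def[symmetric] using gr[OF Sgr Rgr] by (intro exI[of _ "Suc k"]) simp
  qed
qed

text \<open>If no root of q had the value \<gamma> of c, building q from its linear factors would
  preserve \<open>unique_min\<close> at \<gamma>. That property depends only on the values of the
  coefficients, so it would hold for p, contradicting p(c) = 0. The value \<open>Infty\<close> means
  c = 0 and is read off the constant coefficients.\<close>

lemma same_root_value:
  fixes p q :: "'a::field alg_closure poly" and w :: "'a alg_closure \<Rightarrow> 'g::linordered_rat_vector extval"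
  assumes w: "is_valuation w" and eq: "\<And>i. w (coeff p i) = w (coeff q i)"
    and p: "Polynomial.lead_coeff p = 1" and q: "Polynomial.lead_coeff q = 1" and c: "poly p c = 0"
  obtains h where "poly q h = 0" "w h = w c"
proof -
  interpret w: valuation w by unfold_locales fact
  note fin = field_valuation_finite[OF w]
  have q0: "q \<noteq> 0" using q by auto
  obtain A where A: "q = smult (Polynomial.lead_coeff q) (\<Prod>x\<in>#A. [:- x, 1:])"
    using alg_closed_imp_factorization[OF q0] by blast
  then have A: "q = (\<Prod>x\<in>#A. [:- x, 1:])" using q by simp
  have root: "poly q h = 0" if "h \<in># A" for h
    using that unfolding A poly_prod_mset by (simp add: prod_mset_zero_iff)
  show ?thesis
  proof (cases "w c")
    case (Fin \<gamma>)
    have "\<exists>h\<in>#A. w h = w c"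
    proof (rule ccontr)
      assume none: "\<not> ?thesis"
      have "unique_min w \<gamma> (\<Prod>x\<in>#B. [:- x, 1:])" if "B \<subseteq># A" for B
        using that
      proof (induction B)
        case empty
        show ?case unfolding unique_min_def by (intro exI[of _ 0]) (auto simp: w.val_mult)
      next
        case (add x B)
        have "x \<in># A" "B \<subseteq># A" using mset_subset_eqD[OF add.prems] subset_mset.trans[OF _ add.prems, of B] by simp_all
        then show ?case
          using unique_min_mult_linear[OF w.valuation_axioms add.IH, of x] none Fin by (auto simp: mult.commute)
      qed
      from this[of A] have "unique_min w \<gamma> p" unfolding A[symmetric] unique_min_def eq by simp
      then obtain k where k: "\<And>i. i \<noteq> k \<Longrightarrow> w (coeff p k) + Fin (of_nat k *\<^sub>Q \<gamma>) < w (coeff p i) + Fin (of_nat i *\<^sub>Q \<gamma>)"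
        by (auto simp: unique_min_def)
      have kd: "k \<le> Polynomial.degree p"
      proof (rule ccontr)
        assume "\<not> ?thesis"
        then have "coeff p k = 0" by (simp add: coeff_eq_0)
        then show False using k[of "Suc k"] by simp
      qed
      have t: "w (coeff p i * c ^ i) = w (coeff p i) + Fin (of_nat i *\<^sub>Q \<gamma>)" for i
        using valuation_power[OF w.valuation_axioms Fin, of i] by (simp add: w.val_mult)
      have fink: "w (coeff p k) + Fin (of_nat k *\<^sub>Q \<gamma>) \<noteq> Infty" using k[of "Suc k"] by auto
      have "w (\<Sum>i\<le>Polynomial.degree p. coeff p i * c ^ i) = w (coeff p k * c ^ k)"
        by (rule w.val_sum_unique_min) (use kd k t fink in auto)
      then show False using c t[of k] fink by (simp add: poly_altdef)
    qed
    then show ?thesis using that root by blast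
  next
    case Infty
    then have "c = 0" using fin by blast
    then have "coeff p 0 = 0" using c by (simp add: poly_0_coeff_0)
    then have "coeff q 0 = 0" using eq[of 0] fin by (metis w.val_zero)
    then show ?thesis using that[of 0] Infty by (simp add: poly_0_coeff_0)
  qed
qed

lemma map_poly_linear: "\<sigma> 0 = 0 \<Longrightarrow> \<sigma> 1 = 1 \<Longrightarrow> map_poly \<sigma> [:0, 1:] = [:0, 1:]"
  by (simp add: map_poly_pCons)

lemma coeffs_in_mono: "L \<subseteq> L' \<Longrightarrow> p \<in> coeffs_in L \<Longrightarrow> p \<in> coeffs_in L'"
  by (auto simp: coeffs_in_def)

lemma map_poly_coeffs_cong: "p \<in> coeffs_in L \<Longrightarrow> (\<And>x. x \<in> L \<Longrightarrow> \<sigma> x = \<tau> x) \<Longrightarrow> map_poly \<sigma> p = map_poly \<tau> p"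
  by (intro map_poly_cong) (auto simp: coeffs_in_def coeffs_def split: if_splits)

lemma hom_on_monic:
  assumes "hom_on L \<sigma>" "intermediate_ring L" "Polynomial.lead_coeff P = 1"
  shows "Polynomial.lead_coeff (map_poly \<sigma> P) = 1" "Polynomial.degree (map_poly \<sigma> P) = Polynomial.degree P"
proof -
  note h = hom_onD[OF assms(1,2)]
  show d: "Polynomial.degree (map_poly \<sigma> P) = Polynomial.degree P"
    by (rule map_poly_degree_eq) (use assms(3) h in simp)
  show "Polynomial.lead_coeff (map_poly \<sigma> P) = 1"
    unfolding d using assms(3) h by (simp add: coeff_map_poly)
qed

text \<open>First \<sigma> is extended to L(f(\<alpha>)) by sending f(\<alpha>) to z, then further
  to \<alpha>; the minimal polynomial of \<alpha> over the larger field divides P, so the image of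
  \<alpha> is a root of the image of P.\<close>

lemma conjugate_root:
  assumes h: "hom_on L \<sigma>" and L: "intermediate_ring L" and P: "P \<in> coeffs_in L" "poly P \<alpha> = 0"
    and f: "f \<in> coeffs_in L"
    and M: "minimal_over L (poly f \<alpha>) M"
    and z: "poly (map_poly \<sigma> M) z = 0"
  obtains \<alpha>' where "poly (map_poly \<sigma> P) \<alpha>' = 0" "poly (map_poly \<sigma> f) \<alpha>' = z"
proof -
  define c where "c = poly f \<alpha>"
  obtain \<sigma>1 where \<sigma>1: "hom_on (adjoin L c) \<sigma>1" "\<forall>x\<in>L. \<sigma>1 x = \<sigma> x"
    "\<forall>p\<in>coeffs_in L. \<sigma>1 (poly p c) = poly (map_poly \<sigma> p) z"
    using hom_extend[OF h L M z] unfolding c_def by blast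
  note L1 = adjoin_intermediate_ring[OF L, of c]
  note h1 = hom_onD[OF \<sigma>1(1) L1(1)] and o1 = coeffs_in_ops[OF L1(1)] and o = coeffs_in_ops[OF L]
  have "[:0, 1:] \<in> coeffs_in L" using o(5,7) intermediate_ringD(4,5)[OF L] by blast
  then have c: "\<sigma>1 c = z" using bspec[OF \<sigma>1(3), of "[:0, 1:]"] hom_onD(4,5)[OF h L] by (simp add: map_poly_linear)
  obtain P1 where P1: "minimal_over (adjoin L c) \<alpha> P1" using minimal_over_exists[OF L1(1)] by blast
  note m1 = P1[unfolded minimal_over_def]
  have PL1: "P \<in> coeffs_in (adjoin L c)" and fL1: "f \<in> coeffs_in (adjoin L c)"
    using coeffs_in_mono[OF L1(2)] P(1) f by auto
  then obtain q where q: "q \<in> coeffs_in (adjoin L c)" "P = P1 * q" using m1 P(2) by blast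
  have "0 < Polynomial.degree (map_poly \<sigma>1 P1)" using hom_on_monic(2)[OF \<sigma>1(1) L1(1)] m1 by simp
  then obtain \<alpha>' where \<alpha>': "poly (map_poly \<sigma>1 P1) \<alpha>' = 0"
    using alg_closed_imp_poly_has_root by blast
  have "map_poly \<sigma> P = map_poly \<sigma>1 P" by (rule map_poly_coeffs_cong[OF P(1)]) (simp add: \<sigma>1(2))
  then have r: "poly (map_poly \<sigma> P) \<alpha>' = 0"
    using map_poly_hom(2)[OF \<sigma>1(1) L1(1) _ q(1)] m1 \<alpha>' by (simp add: q(2))
  obtain \<sigma>2 where \<sigma>2: "\<forall>x\<in>adjoin L c. \<sigma>2 x = \<sigma>1 x"
    "\<forall>p\<in>coeffs_in (adjoin L c). \<sigma>2 (poly p \<alpha>) = poly (map_poly \<sigma>1 p) \<alpha>'"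
    using hom_extend[OF \<sigma>1(1) L1(1) P1 \<alpha>'] by blast
  have "z = \<sigma>2 c" using \<sigma>2(1) L1(3) c by simp
  also have "\<dots> = poly (map_poly \<sigma>1 f) \<alpha>'" unfolding c_def using \<sigma>2(2) fL1 by blast
  also have "map_poly \<sigma>1 f = map_poly \<sigma> f" by (rule map_poly_coeffs_cong[OF f]) (simp add: \<sigma>1(2))
  finally show ?thesis using that[OF r] by simp
qed

text \<open>The minimal polynomial of f(\<alpha>) over L and its image under \<sigma> have
  coefficients of equal values, so by \<open>same_root_value\<close> the image has a root with the
  value of f(\<alpha>).\<close>

lemma conjugate_value:
  fixes w :: "'a::field alg_closure \<Rightarrow> 'g::linordered_rat_vector extval"
  assumes w: "is_valuation w" and h: "hom_on L \<sigma>" and L: "intermediate_ring L" and \<sigma>: "\<And>x. x \<in> L \<Longrightarrow> w (\<sigma> x) = w x"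
    and P: "P \<in> coeffs_in L" "poly P \<alpha> = 0" and f: "f \<in> coeffs_in L"
  obtains \<alpha>' where "poly (map_poly \<sigma> P) \<alpha>' = 0" "w (poly (map_poly \<sigma> f) \<alpha>') = w (poly f \<alpha>)"
proof -
  obtain M where M0: "minimal_over L (poly f \<alpha>) M" using minimal_over_exists[OF L] by blast
  then have M: "M \<in> coeffs_in L" "Polynomial.lead_coeff M = 1" "poly M (poly f \<alpha>) = 0"
    by (simp_all add: minimal_over_def)
  have "w (coeff M i) = w (coeff (map_poly \<sigma> M) i)" for i
    using \<sigma>[OF coeffs_inD[OF M(1)]] hom_onD(4)[OF h L] by (simp add: coeff_map_poly)
  then obtain z where z: "poly (map_poly \<sigma> M) z = 0" "w z = w (poly f \<alpha>)"
    using same_root_value[OF w _ M(2) hom_on_monic(1)[OF h L M(2)] M(3)] by metis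
  show ?thesis using conjugate_root[OF h L P f M0 z(1)] that z(2) by metis
qed

lemma scaleQ_eq_0_iff: "q *\<^sub>Q x = 0 \<longleftrightarrow> q = 0 \<or> x = (0 :: 'g::linordered_rat_vector)"
proof -
  have "x = (1 / q) *\<^sub>Q (q *\<^sub>Q x)" if "q \<noteq> 0" using that by (simp add: scaleQ_scaleQ scaleQ_one)
  then show ?thesis by (metis scaleQ_zero_right scaleQ_zero_left)
qed

text \<open>A product \<open>f ^ N * h\<close> separates everything that \<open>f\<close> or \<open>h\<close> separates, for all but finitely many \<open>N\<close>.\<close>

lemma simultaneous_separation:
  fixes \<nu> :: "'i \<Rightarrow> 'r::comm_ring_1 \<Rightarrow> 'g::linordered_rat_vector extval"
  assumes S: "1 \<in> S" "\<And>x y. x \<in> S \<Longrightarrow> y \<in> S \<Longrightarrow> x * y \<in> S"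
    and mult: "\<And>i x y. x \<in> S \<Longrightarrow> y \<in> S \<Longrightarrow> \<nu> i (x * y) = \<nu> i x + \<nu> i y" and one: "\<And>i. \<nu> i 1 = 0"
    and sep: "\<And>i. i \<in> I \<Longrightarrow> \<exists>f\<in>S. \<nu> j f \<noteq> Infty \<and> \<nu> i f \<noteq> \<nu> j f" and fin: "finite I"
  shows "\<exists>f\<in>S. \<nu> j f \<noteq> Infty \<and> (\<forall>i\<in>I. \<nu> i f \<noteq> \<nu> j f)"
  using fin sep
proof (induction I)
  case empty
  then show ?case using S(1) one by (intro bexI[of _ 1]) auto
next
  case (insert l I)
  then obtain f where f: "f \<in> S" "\<nu> j f \<noteq> Infty" "\<And>i. i \<in> I \<Longrightarrow> \<nu> i f \<noteq> \<nu> j f" by blast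
  obtain h where h: "h \<in> S" "\<nu> j h \<noteq> Infty" "\<nu> l h \<noteq> \<nu> j h" using insert.prems by blast
  obtain a b where ab: "\<nu> j f = Fin a" "\<nu> j h = Fin b" using f(2) h(2) by (metis extval.exhaust)
  show ?case
  proof (cases "\<nu> l f = \<nu> j f")
    case False
    then show ?thesis using f by blast
  next
    case True
    have powS: "f ^ N \<in> S" for N by (induction N) (auto simp: S f(1))
    have pow: "\<nu> i (f ^ N) = Fin (of_nat N *\<^sub>Q x)" if "\<nu> i f = Fin x" for i N x
      by (induction N) (auto simp: one mult f(1) powS that scaleQ_add_left scaleQ_one)
    \<comment> \<open>Exponents are written \<open>Suc N\<close> because the zeroth power would lose
      an infinite value.\<close>
    have pow_Infty: "\<nu> i (f ^ Suc N) = Infty" if "\<nu> i f = Infty" for i N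
      using that by (simp add: mult f(1) powS)
    define Bad where "Bad = (\<Union>i\<in>I. {N. \<nu> i (f ^ Suc N * h) = \<nu> j (f ^ Suc N * h)})"
    have "finite Bad"
      unfolding Bad_def
    proof (rule finite_UN_I[OF insert.hyps(1)])
      fix i assume i: "i \<in> I"
      show "finite {N. \<nu> i (f ^ Suc N * h) = \<nu> j (f ^ Suc N * h)}"
      proof (rule finite_subset)
        define n where "n = (THE N. \<nu> i (f ^ Suc N * h) = \<nu> j (f ^ Suc N * h))"
        have "N = N'" if N: "\<nu> i (f ^ Suc N * h) = \<nu> j (f ^ Suc N * h)" "\<nu> i (f ^ Suc N' * h) = \<nu> j (f ^ Suc N' * h)" for N N'
        proof (cases "\<nu> i f")
          case Infty
          then show ?thesis using N(1) pow[OF ab(1), of "Suc N"] ab(2) pow_Infty[OF Infty, of N] by (simp only: mult powS h(1)) simp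
        next
          case (Fin x)
          then have xa: "x \<noteq> a" using f(3)[OF i] ab(1) by simp
          obtain y where y: "\<nu> i h = Fin y"
            using N(1) pow[OF ab(1), of "Suc N"] ab(2) pow[OF Fin, of "Suc N"] by (cases "\<nu> i h") (simp_all only: mult powS h(1), simp_all)
          have e: "of_nat (Suc M) *\<^sub>Q (x - a) = b - y" if "\<nu> i (f ^ Suc M * h) = \<nu> j (f ^ Suc M * h)" for M
          proof -
            have "of_nat (Suc M) *\<^sub>Q x + y = of_nat (Suc M) *\<^sub>Q a + b"
              using that pow[OF ab(1)] pow[OF Fin] y ab(2) by (simp only: mult powS h(1) extval_add extval.inject)
            then show ?thesis unfolding scaleQ_diff_right by (simp only: diff_eq_eq diff_add_eq eq_diff_eq add.commute[of b])
          qed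
          \<comment> \<open>An index i already separated by f, with x \<noteq> a, can become
            inseparable for one exponent at most. The index l, not separated by f, is separated by h
            for every exponent.\<close>
          have "(of_nat (Suc N) - of_nat (Suc N')) *\<^sub>Q (x - a) = 0"
            unfolding scaleQ_diff_left[of _ _ "x - a"] e[OF N(1)] e[OF N(2)] by simp
          then show ?thesis using xa by (simp add: scaleQ_eq_0_iff)
        qed
        then show "{N. \<nu> i (f ^ Suc N * h) = \<nu> j (f ^ Suc N * h)} \<subseteq> {n}" unfolding n_def by (auto intro!: the_equality[symmetric])
      qed simp
    qed
    then obtain N where N: "N \<notin> Bad" using ex_new_if_finite[OF infinite_UNIV_nat] by blast
    have "\<nu> l (f ^ Suc N * h) \<noteq> \<nu> j (f ^ Suc N * h)"
    proof -
      have "\<nu> l (f ^ Suc N) = Fin (of_nat (Suc N) *\<^sub>Q a)" "\<nu> j (f ^ Suc N) = Fin (of_nat (Suc N) *\<^sub>Q a)"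
        using pow ab(1) True by metis+
      then show ?thesis using h(3) ab(2) by (cases "\<nu> l h") (simp_all only: mult powS h(1), simp_all)
    qed
    moreover have "\<nu> j (f ^ Suc N * h) \<noteq> Infty"
      using pow[OF ab(1), of "Suc N"] ab(2) by (simp only: mult powS h(1)) simp
    moreover have "f ^ Suc N * h \<in> S" by (rule S(2)[OF powS h(1)])
    ultimately show ?thesis using N unfolding Bad_def by blast
  qed
qed

text \<open>If each candidate \<alpha>' failed for some f of its own,
  \<open>simultaneous_separation\<close> would give one f failing for all of the finitely many
  conjugates at once, against \<open>conjugate_value\<close>. The index \<open>None\<close> stands
  for \<alpha>, \<open>Some x\<close> for the conjugate x.\<close>

lemma conjugate_valuation:
  fixes w :: "'a::field alg_closure \<Rightarrow> 'g::linordered_rat_vector extval"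
  assumes w: "is_valuation w" and h: "hom_on L \<sigma>" and L: "intermediate_ring L" and \<sigma>: "\<And>x. x \<in> L \<Longrightarrow> w (\<sigma> x) = w x"
  obtains \<alpha>' where "\<And>f. f \<in> coeffs_in L \<Longrightarrow> w (poly (map_poly \<sigma> f) \<alpha>') = w (poly f \<alpha>)"
proof (rule ccontr)
  assume asm: "\<not> thesis"
  note witness = that
  interpret w: valuation w by unfold_locales fact
  note o = coeffs_in_ops[OF L]
  obtain P where P0: "minimal_over L \<alpha> P" using minimal_over_exists[OF L] by blast
  then have P: "P \<in> coeffs_in L" "Polynomial.lead_coeff P = 1" "poly P \<alpha> = 0" by (simp_all add: minimal_over_def)
  have "map_poly \<sigma> P \<noteq> 0" using hom_on_monic(1)[OF h L P(2)] by auto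
  define R where "R = {x. poly (map_poly \<sigma> P) x = 0}"
  have R: "finite R" unfolding R_def by (rule poly_roots_finite) fact
  define \<nu> where "\<nu> i f = (case i of None \<Rightarrow> w (poly f \<alpha>) | Some x \<Rightarrow> w (poly (map_poly \<sigma> f) x))" for i f
  have "\<exists>f\<in>coeffs_in L. \<nu> None f \<noteq> Infty \<and> (\<forall>i\<in>Some ` R. \<nu> i f \<noteq> \<nu> None f)"
  proof (rule simultaneous_separation)
    fix i x y assume xy: "x \<in> coeffs_in L" "y \<in> coeffs_in L"
    show "\<nu> i (x * y) = \<nu> i x + \<nu> i y" using map_poly_hom(2)[OF h L xy] by (simp add: \<nu>_def w.val_mult split: option.split)
  next
    fix i show "\<nu> i 1 = 0" using hom_onD(4,5)[OF h L] by (simp add: \<nu>_def w.val_one map_poly_1' split: option.split)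
  next
    fix i assume "i \<in> Some ` R"
    then obtain x where x: "i = Some x" "poly (map_poly \<sigma> P) x = 0" by (auto simp: R_def)
    obtain f where f: "f \<in> coeffs_in L" "w (poly (map_poly \<sigma> f) x) \<noteq> w (poly f \<alpha>)" using witness asm by blast
    have "poly f \<alpha> \<noteq> 0"
    proof
      assume 0: "poly f \<alpha> = 0"
      then obtain q where "q \<in> coeffs_in L" "f = P * q" using P0 f(1) unfolding minimal_over_def by blast
      then have "poly (map_poly \<sigma> f) x = 0" using x(2) map_poly_hom(2)[OF h L P(1)] by simp
      then show False using f(2) 0 by simp
    qed
    then show "\<exists>f\<in>coeffs_in L. \<nu> None f \<noteq> Infty \<and> \<nu> i f \<noteq> \<nu> None f"
      using f x(1) field_valuation_finite[OF w] by (intro bexI[of _ f]) (auto simp: \<nu>_def)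
  qed (use o R in auto)
  then obtain f where f: "f \<in> coeffs_in L" "\<And>x. poly (map_poly \<sigma> P) x = 0 \<Longrightarrow> w (poly (map_poly \<sigma> f) x) \<noteq> w (poly f \<alpha>)"
    unfolding \<nu>_def R_def by auto
  then show False using conjugate_value[OF w h L \<sigma> P(1,3) f(1)] by metis
qed

text \<open>Partial isomorphisms preserving w are encoded as graphs, so that upper bounds of chains
  are plain unions and inverses are converses. Being single-valued is not part of the definition; it
  follows from preservation of values.\<close>

definition value_graph :: "('a::field alg_closure \<Rightarrow> 'g extval) \<Rightarrow> ('a alg_closure \<times> 'a alg_closure) set \<Rightarrow> bool" where
  "value_graph w G \<longleftrightarrow> (\<forall>a. (to_ac a, to_ac a) \<in> G) \<and>
    (\<forall>x y x' y'. (x, y) \<in> G \<longrightarrow> (x', y') \<in> G \<longrightarrow> (x + x', y + y') \<in> G \<and> (x * x', y * y') \<in> G) \<and>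
    (\<forall>x y. (x, y) \<in> G \<longrightarrow> w x = w y)"

lemma value_graphD:
  assumes "value_graph w G"
  shows "(to_ac a, to_ac a) \<in> G" "(x, y) \<in> G \<Longrightarrow> (x', y') \<in> G \<Longrightarrow> (x + x', y + y') \<in> G"
    "(x, y) \<in> G \<Longrightarrow> (x', y') \<in> G \<Longrightarrow> (x * x', y * y') \<in> G" "(x, y) \<in> G \<Longrightarrow> w x = w y"
  using assms unfolding value_graph_def by blast+

lemma value_graph_converse: "value_graph w G \<Longrightarrow> value_graph w (G\<inverse>)"
  unfolding value_graph_def by (metis converse_iff)

text \<open>The graph contains the pair (0, y - y'), and equality of values gives y - y' the value
  \<open>Infty\<close>.\<close>

lemma value_graph_unique:
  fixes w :: "'a::field alg_closure \<Rightarrow> 'g::linordered_rat_vector extval"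
  assumes w: "is_valuation w" and G: "value_graph w G" "(x, y) \<in> G" "(x, y') \<in> G"
  shows "y = y'"
proof -
  interpret w: valuation w by unfold_locales fact
  have "(to_ac (- 1) * x, to_ac (- 1) * y') \<in> G" by (rule value_graphD(3)[OF G(1) value_graphD(1)[OF G(1)] G(3)])
  from value_graphD(2)[OF G(1,2) this] have "(0, y - y') \<in> G" by simp
  then have "w (y - y') = Infty" using value_graphD(4)[OF G(1)] w.val_zero by metis
  then show ?thesis using field_valuation_finite[OF w] by simp
qed

lemma value_graph_extend:
  fixes w :: "'a::field alg_closure \<Rightarrow> 'g::linordered_rat_vector extval"
  assumes w: "is_valuation w" and G: "value_graph w G"
  obtains G' where "value_graph w G'" "G \<subseteq> G'" "\<alpha> \<in> Domain G'"
proof -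
  define L where "L = Domain G"
  define \<sigma> where "\<sigma> x = (SOME y. (x, y) \<in> G)" for x
  note g = value_graphD[OF G] and uniq = value_graph_unique[OF w G]
  have \<sigma>G: "(x, \<sigma> x) \<in> G" if "x \<in> L" for x using that unfolding L_def \<sigma>_def by (auto intro: someI)
  have \<sigma>I: "\<sigma> x = y" if "(x, y) \<in> G" for x y using uniq[OF \<sigma>G that] that by (auto simp: L_def)
  have L: "intermediate_ring L" unfolding intermediate_ring_def L_def using g by blast
  have h: "hom_on L \<sigma>" unfolding hom_on_def
    using \<sigma>I[OF g(1)] \<sigma>I[OF g(2)[OF \<sigma>G \<sigma>G]] \<sigma>I[OF g(3)[OF \<sigma>G \<sigma>G]] by simp
  have "w (\<sigma> x) = w x" if "x \<in> L" for x using g(4)[OF \<sigma>G[OF that]] by simp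
  then obtain \<alpha>' where \<alpha>': "\<And>f. f \<in> coeffs_in L \<Longrightarrow> w (poly (map_poly \<sigma> f) \<alpha>') = w (poly f \<alpha>)"
    using conjugate_valuation[OF w h L] by metis
  note o = coeffs_in_ops[OF L] and hD = hom_onD[OF h L]
  define G' where "G' = (\<lambda>p. (poly p \<alpha>, poly (map_poly \<sigma> p) \<alpha>')) ` coeffs_in L"
  have G'I: "p \<in> coeffs_in L \<Longrightarrow> (poly p \<alpha>, poly (map_poly \<sigma> p) \<alpha>') \<in> G'" for p by (auto simp: G'_def)
  have GG': "G \<subseteq> G'"
  proof (rule subrelI)
    fix x y assume xy: "(x, y) \<in> G"
    then have "[:x:] \<in> coeffs_in L" using o(5,7) by (auto simp: L_def)
    from G'I[OF this] show "(x, y) \<in> G'" using \<sigma>I[OF xy] hD(4) by (simp add: map_poly_pCons)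
  qed
  have "value_graph w G'"
    unfolding value_graph_def
  proof (intro conjI allI impI)
    show "(to_ac a, to_ac a) \<in> G'" for a using GG' g(1) by blast
    fix x y assume "(x, y) \<in> G'"
    then obtain p where p: "p \<in> coeffs_in L" "x = poly p \<alpha>" "y = poly (map_poly \<sigma> p) \<alpha>'" by (auto simp: G'_def)
    show "w x = w y" using \<alpha>'[OF p(1)] p by simp
    fix x' y' assume "(x', y') \<in> G'"
    then obtain q where q: "q \<in> coeffs_in L" "x' = poly q \<alpha>" "y' = poly (map_poly \<sigma> q) \<alpha>'" by (auto simp: G'_def)
    show "(x + x', y + y') \<in> G'" using G'I[OF o(1)[OF p(1) q(1)]] map_poly_hom(1)[OF h L p(1) q(1)] p q by simp
    show "(x * x', y * y') \<in> G'" using G'I[OF o(2)[OF p(1) q(1)]] map_poly_hom(2)[OF h L p(1) q(1)] p q by simp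
  qed
  moreover have "[:0, 1:] \<in> coeffs_in L" using o(5,7) intermediate_ringD(4,5)[OF L] by blast
  then have "\<alpha> \<in> Domain G'" using G'I[of "[:0, 1:]"] by auto
  ultimately show ?thesis using that GG' by blast
qed

text \<open>The assignment of f(\<theta>') to f(\<theta>) is such a graph, since equal values make
  it well defined. A maximal graph containing it has full domain by
  \<open>value_graph_extend\<close>, and is then an automorphism.\<close>

lemma decomposition_group_transitive:
  fixes w :: "'a::field alg_closure \<Rightarrow> 'g::linordered_rat_vector extval"
  assumes w: "is_valuation w" and eq: "\<And>f. w (evac f \<theta>) = w (evac f \<theta>')"
  obtains \<sigma> where "\<sigma> \<in> decomposition_group w" "\<sigma> \<theta> = \<theta>'"
proof -
  interpret w: valuation w by unfold_locales fact
  define G0 where "G0 = range (\<lambda>f. (evac f \<theta>, evac f \<theta>'))"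
  have G0I: "(evac f \<theta>, evac f \<theta>') \<in> G0" for f by (auto simp: G0_def)
  have G0: "value_graph w G0"
    unfolding value_graph_def
  proof (intro conjI allI impI)
    show "(to_ac a, to_ac a) \<in> G0" for a using G0I[of "[:a:]"] by simp
    fix x y assume "(x, y) \<in> G0"
    then obtain f where f: "x = evac f \<theta>" "y = evac f \<theta>'" by (auto simp: G0_def)
    show "w x = w y" using f eq by simp
    fix x' y' assume "(x', y') \<in> G0"
    then obtain h where h: "x' = evac h \<theta>" "y' = evac h \<theta>'" by (auto simp: G0_def)
    show "(x + x', y + y') \<in> G0" "(x * x', y * y') \<in> G0" using G0I[of "f + h"] G0I[of "f * h"] f h by simp_all
  qed
  have "\<exists>G\<in>{G. value_graph w G \<and> G0 \<subseteq> G}. \<forall>G'\<in>{G. value_graph w G \<and> G0 \<subseteq> G}. G \<subseteq> G' \<longrightarrow> G' = G"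
  proof (rule subset_Zorn_nonempty)
    show "{G. value_graph w G \<and> G0 \<subseteq> G} \<noteq> {}" using G0 by blast
    fix C assume C: "C \<noteq> {}" "subset.chain {G. value_graph w G \<and> G0 \<subseteq> G} C"
    have el: "value_graph w G" "G0 \<subseteq> G" if "G \<in> C" for G using C(2) that by (auto simp: subset.chain_def)
    have two: "\<exists>G\<in>C. x \<in> G \<and> y \<in> G" if "x \<in> \<Union>C" "y \<in> \<Union>C" for x y
      using C(2) that by (simp add: subset_chain_def) blast
    have "value_graph w (\<Union>C)"
      unfolding value_graph_def
    proof (intro conjI allI impI)
      show "(to_ac a, to_ac a) \<in> \<Union>C" for a using C(1) value_graphD(1)[OF el(1)] by blast
      show "w x = w y" if "(x, y) \<in> \<Union>C" for x y using that value_graphD(4)[OF el(1)] by blast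
      fix x y x' y' assume "(x, y) \<in> \<Union>C" "(x', y') \<in> \<Union>C"
      then obtain G where G: "G \<in> C" "(x, y) \<in> G" "(x', y') \<in> G" using two by blast
      show "(x + x', y + y') \<in> \<Union>C" "(x * x', y * y') \<in> \<Union>C"
        using value_graphD(2,3)[OF el(1)[OF G(1)] G(2,3)] G(1) by blast+
    qed
    then show "\<Union>C \<in> {G. value_graph w G \<and> G0 \<subseteq> G}" using C(1) el(2) by blast
  qed
  then obtain G where G: "value_graph w G" "G0 \<subseteq> G" and max: "\<And>G'. value_graph w G' \<Longrightarrow> G \<subseteq> G' \<Longrightarrow> G' = G"
    by (smt (verit) mem_Collect_eq subset_trans)
  have dom: "\<alpha> \<in> Domain G" for \<alpha>
    using value_graph_extend[OF w G(1), of \<alpha>] max by metis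
  \<comment> \<open>Surjectivity is totality of the converse, which is maximal as well.\<close>
  have ran: "\<alpha> \<in> Range G" for \<alpha>
  proof -
    obtain G' where G': "value_graph w G'" "G\<inverse> \<subseteq> G'" "\<alpha> \<in> Domain G'"
      using value_graph_extend[OF w value_graph_converse[OF G(1)], of \<alpha>] by blast
    then have "G \<subseteq> G'\<inverse>" by (metis converse_converse converse_mono)
    then have "G'\<inverse> = G" using max value_graph_converse[OF G'(1)] by blast
    then show ?thesis using G'(3) by blast
  qed
  note g = value_graphD[OF G(1)] and uniq = value_graph_unique[OF w G(1)]
  define \<sigma> where "\<sigma> x = (SOME y. (x, y) \<in> G)" for x
  have \<sigma>G: "(x, \<sigma> x) \<in> G" for x using dom[of x] unfolding \<sigma>_def by (auto intro: someI)
  have \<sigma>I: "\<sigma> x = y" if "(x, y) \<in> G" for x y using uniq[OF \<sigma>G that] .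
  have "bij \<sigma>"
  proof (rule bijI)
    show "inj \<sigma>"
    proof (rule injI)
      fix x y assume "\<sigma> x = \<sigma> y"
      then have "(\<sigma> x, x) \<in> G\<inverse>" "(\<sigma> x, y) \<in> G\<inverse>" using \<sigma>G[of x] \<sigma>G[of y] by auto
      then show "x = y" by (rule value_graph_unique[OF w value_graph_converse[OF G(1)]])
    qed
    show "surj \<sigma>" using ran \<sigma>I by (metis Range.cases surj_def)
  qed
  then have "\<sigma> \<in> decomposition_group w"
    unfolding decomposition_group_def
    using \<sigma>I[OF g(1)] \<sigma>I[OF g(2)[OF \<sigma>G \<sigma>G]] \<sigma>I[OF g(3)[OF \<sigma>G \<sigma>G]] g(4)[OF \<sigma>G] by (simp add: fun_eq_iff)
  moreover have "\<sigma> \<theta> = \<theta>'" using \<sigma>I[of \<theta> \<theta>'] G0I[of "[:0, 1:]"] G(2) by (auto simp: evac_pCons)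
  ultimately show ?thesis using that by blast
qed


section \<open>Separability\<close>

lemma degree_pderiv_le: "Polynomial.degree (pderiv p) \<le> Polynomial.degree p - 1"
proof (rule degree_le, intro allI impI)
  fix i assume "Polynomial.degree p - 1 < i"
  then have "Polynomial.degree p < Suc i" by linarith
  then show "coeff (pderiv p) i = 0" by (simp add: coeff_pderiv coeff_eq_0)
qed

text \<open>Derivations over K are used to show that elements generated by separable elements are
  separable, without counting embeddings.\<close>

definition "derivation_on L \<delta> \<longleftrightarrow> (\<forall>a. \<delta> (to_ac a) = 0) \<and>
    (\<forall>x\<in>L. \<forall>y\<in>L. \<delta> (x + y) = \<delta> x + \<delta> y \<and> \<delta> (x * y) = \<delta> x * y + x * \<delta> y)"
  for L :: "'a::field alg_closure set"

text \<open>Prescribing the value t at \<alpha> determines the derivative of every p(\<alpha>). The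
  hypothesis says that the prescription kills P(\<alpha>); by the product rule it then kills all
  multiples of P, so the choice of p is immaterial.\<close>

lemma derivation_extend:
  assumes \<delta>: "derivation_on L \<delta>" and L: "intermediate_ring L" and P: "minimal_over L \<alpha> P"
    and t: "poly (map_poly \<delta> P) \<alpha> + poly (pderiv P) \<alpha> * t = 0"
  shows "\<exists>\<delta>'. derivation_on (adjoin L \<alpha>) \<delta>' \<and> (\<forall>x\<in>L. \<delta>' x = \<delta> x) \<and> \<delta>' \<alpha> = t"
proof -
  note o = coeffs_in_ops[OF L] and Ld = intermediate_ringD[OF L]
  have d: "\<delta> (to_ac a) = 0" "x \<in> L \<Longrightarrow> y \<in> L \<Longrightarrow> \<delta> (x + y) = \<delta> x + \<delta> y"
    "x \<in> L \<Longrightarrow> y \<in> L \<Longrightarrow> \<delta> (x * y) = \<delta> x * y + x * \<delta> y" for a x y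
    using \<delta> by (auto simp: derivation_on_def)
  have d0: "\<delta> 0 = 0" "\<delta> 1 = 0" using d(1)[of 0] d(1)[of 1] by simp_all
  have sum: "\<delta> (sum f I) = (\<Sum>i\<in>I. \<delta> (f i))" if "\<And>i. i \<in> I \<Longrightarrow> f i \<in> L" for f :: "nat \<Rightarrow> _" and I
    using that by (induction I rule: infinite_finite_induct) (auto simp: d d0 intermediate_ring_sum[OF L])
  have map_add: "map_poly \<delta> (p + q) = map_poly \<delta> p + map_poly \<delta> q" if "p \<in> coeffs_in L" "q \<in> coeffs_in L" for p q
    using that by (auto simp: poly_eq_iff coeff_map_poly d d0 coeffs_inD)
  have map_mult: "map_poly \<delta> (p * q) = map_poly \<delta> p * q + p * map_poly \<delta> q" if "p \<in> coeffs_in L" "q \<in> coeffs_in L" for p q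
    using that by (auto simp: poly_eq_iff coeff_map_poly d d0 coeffs_inD coeff_mult sum Ld sum.distrib)
  define E where "E p = poly (map_poly \<delta> p) \<alpha> + poly (pderiv p) \<alpha> * t" for p
  have E_add: "E (p + q) = E p + E q" if "p \<in> coeffs_in L" "q \<in> coeffs_in L" for p q
    by (simp add: E_def map_add[OF that] pderiv_add algebra_simps)
  have E_mult: "E (p * q) = E p * poly q \<alpha> + poly p \<alpha> * E q" if "p \<in> coeffs_in L" "q \<in> coeffs_in L" for p q
    by (simp add: E_def map_mult[OF that] pderiv_mult algebra_simps)
  have E_const: "E [:x:] = \<delta> x" for x using d0 by (simp add: E_def map_poly_pCons)
  define \<delta>' where "\<delta>' x = E (SOME p. p \<in> coeffs_in L \<and> poly p \<alpha> = x)" for x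
  have eq: "\<delta>' (poly p \<alpha>) = E p" if p: "p \<in> coeffs_in L" for p
  proof -
    define q where "q = (SOME q. q \<in> coeffs_in L \<and> poly q \<alpha> = poly p \<alpha>)"
    have q: "q \<in> coeffs_in L \<and> poly q \<alpha> = poly p \<alpha>"
      unfolding q_def by (rule someI[of _ p]) (use p in simp)
    have pq: "p - q \<in> coeffs_in L" using o(4) p q by blast
    have "poly (p - q) \<alpha> = 0" using q by simp
    then obtain r where r: "r \<in> coeffs_in L" "p - q = P * r" using P pq unfolding minimal_over_def by blast
    have P': "P \<in> coeffs_in L" "poly P \<alpha> = 0" using P by (simp_all add: minimal_over_def)
    have "E (P * r) = 0" using E_mult[OF P'(1) r(1)] P'(2) t by (simp add: E_def)
    moreover have "E p = E (p - q) + E q" using E_add[OF pq, of q] q by simp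
    ultimately show ?thesis unfolding \<delta>'_def q_def[symmetric] r(2) by simp
  qed
  have ext: "\<delta>' x = \<delta> x" if "x \<in> L" for x
    using eq[of "[:x:]"] that o(5,7) by (simp add: E_const)
  have "[:0, 1:] \<in> coeffs_in L" using o(5,7) Ld(4,5) by blast
  then have \<alpha>: "\<delta>' \<alpha> = t" using eq[of "[:0, 1:]"] d0 by (simp add: E_def map_poly_pCons pderiv_pCons)
  have "derivation_on (adjoin L \<alpha>) \<delta>'"
    unfolding derivation_on_def
  proof (intro conjI allI ballI)
    show "\<delta>' (to_ac a) = 0" for a using ext[OF Ld(1)] d(1) by simp
    fix x y assume "x \<in> adjoin L \<alpha>" "y \<in> adjoin L \<alpha>"
    then obtain p q where pq: "x = poly p \<alpha>" "y = poly q \<alpha>" "p \<in> coeffs_in L" "q \<in> coeffs_in L" by (auto simp: adjoin_def)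
    show "\<delta>' (x + y) = \<delta>' x + \<delta>' y"
      using eq[OF o(1)[OF pq(3,4)]] eq[OF pq(3)] eq[OF pq(4)] E_add[OF pq(3,4)] pq by simp
    show "\<delta>' (x * y) = \<delta>' x * y + x * \<delta>' y"
      using eq[OF o(2)[OF pq(3,4)]] eq[OF pq(3)] eq[OF pq(4)] E_mult[OF pq(3,4)] pq by simp
  qed
  then show ?thesis using ext \<alpha> by blast
qed

lemma pderiv_map_to_ac: "pderiv (map_poly to_ac f) = map_poly to_ac (pderiv f)"
  by (simp add: poly_eq_iff coeff_pderiv coeff_map_poly)

text \<open>At a simple root \<theta> the derivative of the minimal polynomial is nonzero, so the
  linear condition of \<open>derivation_extend\<close> can be solved for t; this is repeated over
  the finite set.\<close>

lemma derivation_extend_separable: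
  assumes \<delta>: "derivation_on L \<delta>" and L: "intermediate_ring L" and fin: "finite \<Theta>"
    and sep: "\<And>\<theta>. \<theta> \<in> \<Theta> \<Longrightarrow> \<exists>f. evac f \<theta> = 0 \<and> evac (pderiv f) \<theta> \<noteq> 0"
  shows "\<exists>L' \<delta>'. derivation_on L' \<delta>' \<and> intermediate_ring L' \<and> L \<subseteq> L' \<and> \<Theta> \<subseteq> L' \<and> (\<forall>x\<in>L. \<delta>' x = \<delta> x)"
  using fin sep
proof (induction \<Theta>)
  case empty
  then show ?case using \<delta> L by blast
next
  case (insert \<theta> \<Theta>)
  then obtain L' \<delta>' where L': "derivation_on L' \<delta>'" "intermediate_ring L'" "L \<subseteq> L'" "\<Theta> \<subseteq> L'" "\<forall>x\<in>L. \<delta>' x = \<delta> x"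
    by blast
  obtain f where f: "evac f \<theta> = 0" "evac (pderiv f) \<theta> \<noteq> 0" using insert.prems by blast
  obtain P where P: "minimal_over L' \<theta> P" using minimal_over_exists[OF L'(2)] by blast
  obtain q where q: "map_poly to_ac f = P * q"
    using P coeffs_in_ops(8)[OF L'(2), of f] f(1) unfolding minimal_over_def evac_def by blast
  have "poly (pderiv (P * q)) \<theta> \<noteq> 0" using f(2) unfolding q[symmetric] pderiv_map_to_ac evac_def .
  then have "poly (pderiv P) \<theta> \<noteq> 0" using P by (auto simp: pderiv_mult minimal_over_def)
  then have "poly (map_poly \<delta>' P) \<theta> + poly (pderiv P) \<theta> * (- poly (map_poly \<delta>' P) \<theta> / poly (pderiv P) \<theta>) = 0"
    by simp
  from derivation_extend[OF L'(1,2) P this] obtain \<delta>'' where \<delta>'': "derivation_on (adjoin L' \<theta>) \<delta>''" "\<forall>x\<in>L'. \<delta>'' x = \<delta>' x"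
    by blast
  show ?case
    using \<delta>'' adjoin_intermediate_ring[OF L'(2), of \<theta>] L'(3,4,5)
    by (intro exI[of _ "adjoin L' \<theta>"] exI[of _ \<delta>'']) auto
qed

lemma intermediate_ring_range: "intermediate_ring (range to_ac)"
  unfolding intermediate_ring_def by (auto simp: to_ac_add[symmetric] to_ac_mult[symmetric] simp del: to_ac_add to_ac_mult)

lemma minimal_polynomial:
  fixes c :: "'a::field alg_closure"
  obtains m where "Polynomial.lead_coeff m = 1" "evac m c = 0" "0 < Polynomial.degree m"
    "\<And>f. evac f c = 0 \<Longrightarrow> m dvd f" "Factorial_Ring.irreducible m" "minimal_over (range to_ac) c (map_poly to_ac m)"
proof -
  have rep: "\<exists>f. p = map_poly to_ac f" if "p \<in> coeffs_in (range to_ac)" for p :: "'a alg_closure poly"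
    using that
  proof (induction p)
    case 0
    show ?case by (intro exI[of _ 0]) simp
  next
    case (pCons x p)
    have "x \<in> range to_ac" using coeffs_inD[OF pCons.prems, of 0] by simp
    moreover have "p \<in> coeffs_in (range to_ac)" unfolding coeffs_in_def using coeffs_inD[OF pCons.prems, of "Suc _"] by simp
    ultimately obtain a f where "x = to_ac a" "p = map_poly to_ac f" using pCons.IH by blast
    then show ?case by (intro exI[of _ "pCons a f"]) (simp add: map_poly_pCons)
  qed
  obtain P where P: "minimal_over (range to_ac) c P" using minimal_over_exists[OF intermediate_ring_range] by blast
  then obtain m where m: "P = map_poly to_ac m" using rep unfolding minimal_over_def by blast
  have 1: "Polynomial.lead_coeff m = 1" "evac m c = 0" "0 < Polynomial.degree m"
    using P unfolding minimal_over_def m evac_def by (auto simp del: lead_coeff_map_poly_to_ac simp: lead_coeff_map_poly_to_ac[unfolded coeff_map_poly] coeff_map_poly)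
  have 2: "m dvd f" if f: "evac f c = 0" for f
  proof -
    obtain q where "q \<in> coeffs_in (range to_ac)" "map_poly to_ac f = P * q"
      using P coeffs_in_ops(8)[OF intermediate_ring_range, of f] f unfolding minimal_over_def evac_def by blast
    then obtain r where "map_poly to_ac f = map_poly to_ac (m * r)" using rep m by auto
    then have "map_poly to_ac (f - m * r) = 0" by (simp only: diff_conv_add_uminus map_poly_to_ac_add map_poly_to_ac_minus) simp
    then show ?thesis by (simp only: map_poly_to_ac_eq_0) simp
  qed
  have "Factorial_Ring.irreducible m"
  proof (rule Factorial_Ring.irreducibleI)
    show nz: "m \<noteq> 0" using 1(1) by auto
    show "\<not> m dvd 1" using 1(3) by (simp add: is_unit_iff_degree[OF nz])
    fix a b assume ab: "m = a * b"
    have nz: "a \<noteq> 0" "b \<noteq> 0" using 1(1) ab by auto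
    have unit: "y dvd 1" if xy: "m = x * y" "evac x c = 0" "x \<noteq> 0" for x y
    proof -
      obtain k where "x = m * k" using 2[OF xy(2)] by blast
      then have "x * 1 = x * (y * k)" using xy(1) by (simp add: mult_ac)
      then have "1 = y * k" using xy(3) mult_left_cancel by blast
      then show ?thesis by (rule dvdI)
    qed
    have "evac a c = 0 \<or> evac b c = 0" using 1(2) ab by simp
    then show "a dvd 1 \<or> b dvd 1" using unit[of a b] unit[of b a] ab nz by (auto simp: mult.commute)
  qed
  then show ?thesis using that 1 2 P[unfolded m] by blast
qed

lemma simple_root:
  fixes p :: "'b::field poly"
  assumes "poly (pderiv p) a \<noteq> 0" shows "\<not> [:- a, 1:]\<^sup>2 dvd p"
proof
  define l where "l = [:- a, 1:]"
  assume "[:- a, 1:]\<^sup>2 dvd p"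
  then obtain q where "p = l\<^sup>2 * q" unfolding l_def by (rule dvdE)
  then have "p = l * (l * q)" by (simp add: power2_eq_square mult.assoc)
  moreover have "poly l a = 0" by (simp add: l_def)
  ultimately show False using assms by (simp add: pderiv_mult)
qed

text \<open>The last assumption says that c lies in K(\<Theta>). If the minimal polynomial of c had
  zero derivative at c, there would be a derivation with value 1 at c, extending to a field
  containing \<Theta>. Its constants form a field containing \<Theta>, by the chain rule, hence c: a
  contradiction.\<close>

lemma separable_closureI:
  assumes fin: "finite \<Theta>" and sep: "\<And>\<theta>. \<theta> \<in> \<Theta> \<Longrightarrow> \<exists>f. evac f \<theta> = 0 \<and> evac (pderiv f) \<theta> \<noteq> 0"
    and c: "\<And>L. intermediate_ring L \<Longrightarrow> \<Theta> \<subseteq> L \<Longrightarrow> c \<in> L"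
  shows "c \<in> separable_closure"
proof -
  obtain m where m: "Polynomial.lead_coeff m = 1" "evac m c = 0" "0 < Polynomial.degree m"
    "\<And>f. evac f c = 0 \<Longrightarrow> m dvd f" "Factorial_Ring.irreducible m" "minimal_over (range to_ac) c (map_poly to_ac m)"
    using minimal_polynomial by blast
  have m': "evac (pderiv m) c \<noteq> 0"
  proof
    assume 0: "evac (pderiv m) c = 0"
    have "derivation_on (range to_ac) (\<lambda>_. 0)" by (simp add: derivation_on_def)
    \<comment> \<open>With m'(c) = 0 the condition on t is void, so t = 1 is allowed.\<close>
    moreover have "poly (map_poly (\<lambda>_. 0) (map_poly to_ac m)) c + poly (pderiv (map_poly to_ac m)) c * 1 = 0"
    proof -
      have "map_poly (\<lambda>_. 0) (map_poly to_ac m) = (0 :: 'a alg_closure poly)" by (simp add: poly_eq_iff coeff_map_poly)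
      then show ?thesis using 0 by (simp add: pderiv_map_to_ac evac_def)
    qed
    ultimately obtain \<delta> where \<delta>: "derivation_on (adjoin (range to_ac) c) \<delta>" "\<delta> c = 1"
      using derivation_extend[OF _ intermediate_ring_range m(6)] by blast
    note L1 = adjoin_intermediate_ring[OF intermediate_ring_range, of c]
    obtain L \<delta>' where L: "derivation_on L \<delta>'" "intermediate_ring L" "\<Theta> \<subseteq> L" "\<forall>x\<in>adjoin (range to_ac) c. \<delta>' x = \<delta> x"
      using derivation_extend_separable[OF \<delta>(1) L1(1) fin sep] by blast
    define Z where "Z = {x \<in> L. \<delta>' x = 0}"
    have d: "\<delta>' (to_ac a) = 0" "x \<in> L \<Longrightarrow> y \<in> L \<Longrightarrow> \<delta>' (x + y) = \<delta>' x + \<delta>' y"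
      "x \<in> L \<Longrightarrow> y \<in> L \<Longrightarrow> \<delta>' (x * y) = \<delta>' x * y + x * \<delta>' y" for a x y
      using L(1) by (auto simp: derivation_on_def)
    have Z: "intermediate_ring Z"
      unfolding intermediate_ring_def Z_def using d intermediate_ringD[OF L(2)] by auto
    have chain: "\<delta>' (evac f x) = evac (pderiv f) x * \<delta>' x" if x: "x \<in> L" for f x
    proof (induction f)
      case 0
      show ?case using d(1)[of 0] by simp
    next
      case (pCons a f)
      have "evac f x \<in> L" by (rule intermediate_ring_evac[OF L(2) x])
      then show ?case using pCons.IH d x intermediate_ringD[OF L(2)]
        by (simp add: evac_pCons pderiv_pCons algebra_simps)
    qed
    have "\<Theta> \<subseteq> Z"
    proof
      fix \<theta> assume \<theta>: "\<theta> \<in> \<Theta>"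
      then obtain f where f: "evac f \<theta> = 0" "evac (pderiv f) \<theta> \<noteq> 0" using sep by blast
      have "\<theta> \<in> L" using L(3) \<theta> by blast
      from chain[OF this, of f] f have "\<delta>' \<theta> = 0" using d(1)[of 0] by simp
      then show "\<theta> \<in> Z" using \<open>\<theta> \<in> L\<close> by (simp add: Z_def)
    qed
    then have "c \<in> Z" by (rule c[OF Z])
    then show False using L(4) L1(3) \<delta>(2) by (auto simp: Z_def)
  qed
  have "rsquarefree (map_poly to_ac m)"
    unfolding rsquarefree_def
  proof (intro conjI allI)
    show nz: "map_poly to_ac m \<noteq> 0" using m(3) by auto
    fix s
    show "order s (map_poly to_ac m) = 0 \<or> order s (map_poly to_ac m) = 1"
    proof (cases "evac m s = 0")
      case False
      then show ?thesis by (auto simp: order_root evac_def)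
    next
      case True
      obtain k where k: "Polynomial.lead_coeff k = 1" "evac k s = 0" "0 < Polynomial.degree k" "\<And>f. evac f s = 0 \<Longrightarrow> k dvd f"
        using minimal_polynomial[of s] by metis
      obtain r where r: "m = k * r" using k(4)[OF True] by blast
      have "\<not> k dvd 1" using dvd_imp_degree_le[of k 1] k(3) by auto
      then have "r dvd 1" using m(5) r by (auto simp: Factorial_Ring.irreducible_def)
      \<comment> \<open>Every root s of m has m as minimal polynomial up to a unit, so a multiple
        root would make m divide its nonzero derivative.\<close>
      then have "m dvd k" using r by (simp add: mult_unit_dvd_iff)
      have "evac (pderiv m) s \<noteq> 0"
      proof
        assume "evac (pderiv m) s = 0"
        then have "m dvd pderiv m" using k(4) \<open>m dvd k\<close> dvd_trans by blast
        moreover have "pderiv m \<noteq> 0" using m' by auto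
        ultimately have "Polynomial.degree m \<le> Polynomial.degree (pderiv m)" by (rule dvd_imp_degree_le)
        then show False using m(3) degree_pderiv_le[of m] by linarith
      qed
      then have "\<not> [:- s, 1:]\<^sup>2 dvd map_poly to_ac m"
        by (intro simple_root) (simp add: pderiv_map_to_ac evac_def)
      then have "order s (map_poly to_ac m) < 2" using order_divides[of s 2 "map_poly to_ac m"] nz by simp
      then show ?thesis by linarith
    qed
  qed
  then show ?thesis unfolding separable_closure_def using m(2,5) by (auto simp: evac_def)
qed


section \<open>Irreducibility over a henselization\<close>

lemma decomposition_groupD:
  assumes "\<sigma> \<in> decomposition_group w"
  shows "bij \<sigma>" "hom_on UNIV \<sigma>" "w (\<sigma> x) = w x"
  using assms by (auto simp: decomposition_group_def hom_on_def fun_eq_iff)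

lemma intermediate_ring_UNIV: "intermediate_ring UNIV"
  by (simp add: intermediate_ring_def)

lemma decomposition_group_evac:
  assumes "\<sigma> \<in> decomposition_group w" shows "evac f (\<sigma> t) = \<sigma> (evac f t)"
  using hom_onD[OF decomposition_groupD(2)[OF assms] intermediate_ring_UNIV]
  by (induction f) (auto simp: evac_pCons)

lemma decomposition_group_poly:
  assumes "\<sigma> \<in> decomposition_group w" "\<And>i. \<sigma> (coeff p i) = coeff p i"
  shows "poly p (\<sigma> t) = \<sigma> (poly p t)"
  using assms(2)
proof (induction p)
  case (pCons a p)
  have "\<sigma> a = a" "\<And>i. \<sigma> (coeff p i) = coeff p i" using pCons.prems[of 0] pCons.prems[of "Suc _"] by simp_all
  then show ?case using pCons.IH hom_onD[OF decomposition_groupD(2)[OF assms(1)] intermediate_ring_UNIV] by simp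
qed (use hom_onD[OF decomposition_groupD(2)[OF assms(1)] intermediate_ring_UNIV] in simp)

text \<open>The coefficients lie in the field generated by the separable elements of Z, and each
  element of the decomposition group only permutes the factors.\<close>

lemma stable_product_over_henselization:
  assumes fin: "finite Z" and sep: "\<And>\<theta>. \<theta> \<in> Z \<Longrightarrow> \<exists>f. evac f \<theta> = 0 \<and> evac (pderiv f) \<theta> \<noteq> 0"
    and stable: "\<And>\<sigma>. \<sigma> \<in> decomposition_group w \<Longrightarrow> \<sigma> ` Z = Z"
  shows "coeff (\<Prod>x\<in>Z. [:- x, 1:]) i \<in> henselization w"
proof -
  have "coeff (\<Prod>x\<in>Z. [:- x, 1:]) i \<in> separable_closure"
  proof (rule separable_closureI[OF fin sep])
    fix L :: "'a alg_closure set" assume L: "intermediate_ring L" "Z \<subseteq> L"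
    note o = coeffs_in_ops[OF L(1)] and Ld = intermediate_ringD[OF L(1)]
    have "(\<Prod>x\<in>Z. [:- x, 1:]) \<in> coeffs_in L" using fin L(2)
    proof (induction Z)
      case (insert x Z)
      then have "x \<in> L" by simp
      then have "[:- x, 1:] \<in> coeffs_in L" by (intro o(5,7) Ld)
      then show ?case using insert by (simp only: prod.insert insert_subset o(2) simp_thms)
    qed (use o in simp)
    then show "coeff (\<Prod>x\<in>Z. [:- x, 1:]) i \<in> L" by (rule coeffs_inD)
  qed
  moreover have "\<sigma> (coeff (\<Prod>x\<in>Z. [:- x, 1:]) i) = coeff (\<Prod>x\<in>Z. [:- x, 1:]) i" if \<sigma>: "\<sigma> \<in> decomposition_group w" for \<sigma>
  proof -
    note h = hom_onD[OF decomposition_groupD(2)[OF \<sigma>] intermediate_ring_UNIV]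
    have m: "map_poly \<sigma> (p * q) = map_poly \<sigma> p * map_poly \<sigma> q" for p q
      by (rule map_poly_hom(2)[OF decomposition_groupD(2)[OF \<sigma>] intermediate_ring_UNIV]) (auto simp: coeffs_in_def)
    have lin: "map_poly \<sigma> [:- x, 1:] = [:- \<sigma> x, 1:]" for x using h by (simp add: map_poly_pCons)
    have "map_poly \<sigma> (\<Prod>x\<in>Y. [:- x, 1:]) = (\<Prod>x\<in>Y. [:- \<sigma> x, 1:])" for Y
    proof (induction Y rule: infinite_finite_induct)
      case (insert x Y)
      then show ?case by (simp only: prod.insert[OF insert.hyps] m lin)
    qed (use h in simp_all)
    then have "map_poly \<sigma> (\<Prod>x\<in>Z. [:- x, 1:]) = (\<Prod>x\<in>Z. [:- \<sigma> x, 1:])" .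
    also have "\<dots> = (\<Prod>x\<in>\<sigma> ` Z. [:- x, 1:])"
      using bij_is_inj[OF decomposition_groupD(1)[OF \<sigma>]] by (subst prod.reindex) (auto intro: inj_on_subset)
    also have "\<dots> = (\<Prod>x\<in>Z. [:- x, 1:])" by (simp only: stable[OF \<sigma>])
    finally show ?thesis using h(4) by (metis coeff_map_poly)
  qed
  ultimately show ?thesis by (simp add: henselization_def)
qed

lemma to_ac_in_henselization: "to_ac a \<in> henselization w"
proof -
  have "to_ac a \<in> separable_closure"
    by (rule separable_closureI[of "{}"]) (auto simp: intermediate_ringD)
  then show ?thesis by (simp add: henselization_def decomposition_group_def)
qed


lemma distinct_roots_product:
  assumes g: "Polynomial.lead_coeff g = 1" and simple: "\<And>t. evac g t = 0 \<Longrightarrow> evac (pderiv g) t \<noteq> 0"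
  shows "finite {t. evac g t = 0}" "map_poly to_ac g = (\<Prod>x\<in>{t. evac g t = 0}. [:- x, 1:])"
proof -
  obtain A where A: "map_poly to_ac g = (\<Prod>x\<in>#A. [:- x, 1:])" "\<And>t. t \<in># A \<longleftrightarrow> evac g t = 0"
    using monic_roots[OF g] by metis
  have set: "{t. evac g t = 0} = set_mset A" using A(2) by auto
  then show "finite {t. evac g t = 0}" by simp
  have le: "count A x \<le> 1" for x
  proof (rule ccontr)
    assume "\<not> ?thesis"
    then have "{#x, x#} \<subseteq># A" by (auto simp: subseteq_mset_def)
    then obtain B where "A = {#x, x#} + B" by (auto simp: subset_mset.le_iff_add)
    then have gx: "evac g x = 0" using A(2)[of x] by simp
    define l where "l y = [:- y, 1:]" for y :: "'a alg_closure"
    have "map_poly to_ac g = (l x)\<^sup>2 * (\<Prod>y\<in>#B. l y)"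
      unfolding A(1) \<open>A = _\<close> l_def[symmetric] by (simp add: power2_eq_square mult.assoc)
    then have "[:- x, 1:]\<^sup>2 dvd map_poly to_ac g" unfolding l_def by (rule dvdI)
    then show False using simple_root[of "map_poly to_ac g" x] simple[OF gx] by (simp add: pderiv_map_to_ac evac_def)
  qed
  have "count A x = count (mset_set (set_mset A)) x" for x
  proof (cases "x \<in># A")
    case True
    then have "0 < count A x" by (simp only: count_greater_zero_iff)
    then have "count A x = 1" using le[of x] by linarith
    then show ?thesis using True by simp
  next
    case False
    then have "count A x = 0" by (simp only: not_in_iff)
    then show ?thesis using False by simp
  qed
  then have "A = mset_set (set_mset A)" by (rule multiset_eqI)
  then show "map_poly to_ac g = (\<Prod>x\<in>{t. evac g t = 0}. [:- x, 1:])"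
    unfolding set A(1) by (metis prod_unfold_prod_mset)
qed

lemma degree_prod_linear: "Polynomial.degree (\<Prod>x\<in>Z. [:- x, 1 :: 'b::field:]) = card Z"
proof (induction Z rule: infinite_finite_induct)
  case (insert x Z)
  have "(\<Prod>x\<in>Z. [:- x, 1 :: 'b:]) \<noteq> 0" using insert.hyps(1) by (simp add: prod_zero_iff)
  then have "Polynomial.degree ([:- x, 1:] * (\<Prod>x\<in>Z. [:- x, 1 :: 'b:])) = Suc (card Z)"
    using insert.IH by (subst degree_mult_eq) auto
  then show ?case by (simp only: prod.insert[OF insert.hyps] card_insert_disjoint[OF insert.hyps])
qed simp_all

lemma irreducible_polys_over_iff:
  "ring_irreducible\<^bsub>polys_over H\<^esub> f \<longleftrightarrow> f \<noteq> 0 \<and> \<not> ((\<forall>i. coeff f i \<in> H) \<and> (\<exists>c. (\<forall>i. coeff c i \<in> H) \<and> f * c = 1 \<and> c * f = 1)) \<and>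
    (\<forall>b. (\<forall>i. coeff b i \<in> H) \<longrightarrow> b \<noteq> 0 \<longrightarrow> (\<exists>c. (\<forall>i. coeff c i \<in> H) \<and> c \<noteq> 0 \<and> f = b * c) \<longrightarrow>
      \<not> (\<exists>c. (\<forall>i. coeff c i \<in> H) \<and> c \<noteq> 0 \<and> b = f * c) \<longrightarrow> (\<exists>c. (\<forall>i. coeff c i \<in> H) \<and> b * c = 1 \<and> c * b = 1))"
proof -
  have ops: "carrier (polys_over H) = {p. \<forall>i. coeff p i \<in> H}" "(\<otimes>\<^bsub>polys_over H\<^esub>) = (*)" "\<one>\<^bsub>polys_over H\<^esub> = 1" "\<zero>\<^bsub>polys_over H\<^esub> = 0"
    by (simp_all add: polys_over_def ring_of_type_algebra_def)
  define C where "C = {p :: 'a poly. \<forall>i. coeff p i \<in> H}"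
  have A: "ring_irreducible\<^bsub>polys_over H\<^esub> f \<longleftrightarrow> f \<noteq> 0 \<and> \<not> (f \<in> C \<and> (\<exists>c\<in>C. c * f = 1 \<and> f * c = 1)) \<and>
      (\<forall>b\<in>C. (\<exists>c\<in>C. f = b * c) \<and> \<not> (\<exists>c\<in>C. b = f * c) \<longrightarrow> b \<in> C \<and> (\<exists>c\<in>C. c * b = 1 \<and> b * c = 1))"
    unfolding ring_irreducible_def Divisibility.irreducible_def properfactor_def factor_def Units_def ops C_def[symmetric] by auto
  show ?thesis
  proof (cases "f = 0")
    case False
    have e1: "(\<exists>c\<in>C. f = b * c) \<longleftrightarrow> b \<noteq> 0 \<and> (\<exists>c. (\<forall>i. coeff c i \<in> H) \<and> c \<noteq> 0 \<and> f = b * c)" for b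
      using False by (auto simp: C_def)
    have e2: "(\<exists>c\<in>C. b = f * c) \<longleftrightarrow> (\<exists>c. (\<forall>i. coeff c i \<in> H) \<and> c \<noteq> 0 \<and> b = f * c)" if "b \<noteq> 0" for b
      using that by (auto simp: C_def)
    have e3: "(\<exists>c\<in>C. c * b = 1 \<and> b * c = 1) \<longleftrightarrow> (\<exists>c. (\<forall>i. coeff c i \<in> H) \<and> b * c = 1 \<and> c * b = 1)" for b
      by (auto simp: C_def)
    have C: "b \<in> C \<longleftrightarrow> (\<forall>i. coeff b i \<in> H)" for b by (simp add: C_def)
    have body: "(b \<in> C \<longrightarrow> (\<exists>c\<in>C. f = b * c) \<and> \<not> (\<exists>c\<in>C. b = f * c) \<longrightarrow> b \<in> C \<and> (\<exists>c\<in>C. c * b = 1 \<and> b * c = 1)) \<longleftrightarrow>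
      ((\<forall>i. coeff b i \<in> H) \<longrightarrow> b \<noteq> 0 \<longrightarrow> (\<exists>c. (\<forall>i. coeff c i \<in> H) \<and> c \<noteq> 0 \<and> f = b * c) \<longrightarrow>
      \<not> (\<exists>c. (\<forall>i. coeff c i \<in> H) \<and> c \<noteq> 0 \<and> b = f * c) \<longrightarrow> (\<exists>c. (\<forall>i. coeff c i \<in> H) \<and> b * c = 1 \<and> c * b = 1))" for b
    proof (cases "b = 0")
      case True
      then show ?thesis unfolding e1 by blast
    next
      case b: False
      then show ?thesis unfolding e1 e2[OF b] e3 C by blast
    qed
    show ?thesis unfolding A Ball_def body unfolding e3 C by (rule refl)
  qed (use A in blast)
qed

text \<open>Either side first makes g irreducible over K, and then its roots are simple. If the nu_t
  agree, the decomposition group is transitive on the roots, so a nonconstant factor over the fixed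
  field has all of them. Conversely, the product over one orbit is a factor over the fixed field, so
  there is only one orbit.\<close>

lemma irreducible_over_henselization_iff:
  fixes w :: "'a::field alg_closure \<Rightarrow> 'g::linordered_rat_vector extval"
  assumes w: "is_valuation w" and g: "Polynomial.lead_coeff g = 1" "squarefree g" "pderiv g \<noteq> 0"
  shows "(\<forall>t t'. evac g t = 0 \<longrightarrow> evac g t' = 0 \<longrightarrow> (\<forall>f. w (evac f t) = w (evac f t'))) \<longleftrightarrow>
      ring_irreducible\<^bsub>polys_over (henselization w)\<^esub> (map_poly to_ac g)" (is "?Eq \<longleftrightarrow> ?I")
    and "ring_irreducible\<^bsub>polys_over (henselization w)\<^esub> (map_poly to_ac g) \<Longrightarrow> evac g t = 0 \<Longrightarrow> evac f t = 0 \<Longrightarrow> g dvd f"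
proof -
  interpret w: valuation w by unfold_locales fact
  let ?H = "henselization w" and ?g = "map_poly to_ac g" and ?R = "{t. evac g t = 0}"
  have deg: "0 < Polynomial.degree g"
    using g(1,3) by (cases "Polynomial.degree g = 0") (auto elim!: degree_eq_zeroE)
  have gH: "coeff (map_poly to_ac f) i \<in> ?H" for f i by (simp add: coeff_map_poly to_ac_in_henselization)
  have simple: "evac (pderiv g) t \<noteq> 0" if irr: "\<And>t f. evac g t = 0 \<Longrightarrow> evac f t = 0 \<Longrightarrow> g dvd f" and t: "evac g t = 0" for t
  proof
    assume "evac (pderiv g) t = 0"
    then have "g dvd pderiv g" by (rule irr[OF t])
    from dvd_imp_degree_le[OF this g(3)] show False using deg degree_pderiv_le[of g] by linarith
  qed
  have stab: "\<sigma> ` ?R = ?R" if \<sigma>: "\<sigma> \<in> decomposition_group w" for \<sigma>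
  proof -
    note h = hom_onD[OF decomposition_groupD(2)[OF \<sigma>] intermediate_ring_UNIV]
    have "evac g (\<sigma> t) = 0 \<longleftrightarrow> evac g t = 0" for t unfolding decomposition_group_evac[OF \<sigma>] using h by simp
    then show ?thesis using bij_is_surj[OF decomposition_groupD(1)[OF \<sigma>]] by (auto simp: image_iff) (metis surjD)
  qed
  have factor_K: "g dvd f" if prime: "\<And>m. Polynomial.lead_coeff m = 1 \<Longrightarrow> 0 < Polynomial.degree m \<Longrightarrow> evac m t = 0 \<Longrightarrow> m dvd g \<Longrightarrow> m = g"
    and t: "evac g t = 0" and f: "evac f t = 0" for t f
    using minimal_polynomial[of t] prime t f by metis
  have irr_of_Eq: "g dvd f" if Eq: ?Eq and t: "evac g t = 0" and f: "evac f t = 0" for t f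
  proof -
    note fin = field_valuation_finite[OF w]
    have m_eq: "m = g" if m: "Polynomial.lead_coeff m = 1" "0 < Polynomial.degree m" "evac m t = 0" "m dvd g" for m
    proof -
      obtain b where b: "g = m * b" using m(4) by blast
      have "Polynomial.degree b = 0"
      proof (rule ccontr)
        assume "\<not> ?thesis"
        then obtain s where s: "evac b s = 0" using evac_root_exists[of b] by blast
        obtain k where k: "0 < Polynomial.degree k" "\<And>f. evac f s = 0 \<Longrightarrow> k dvd f" using minimal_polynomial[of s] by metis
        have "evac g s = 0" using b s by simp
        \<comment> \<open>The value \<open>Infty\<close> of m at t passes to s, so s is a common
          root of m and b. Its minimal polynomial k then divides g twice, which being square-free
          excludes.\<close>
        then have "w (evac m s) = w (evac m t)" using Eq t by blast
        then have "evac m s = 0" using m(3) fin by metis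
        then have "k * k dvd m * b" using k(2) s by (intro mult_dvd_mono) auto
        then have "k dvd 1" using g(2) b by (auto simp: squarefree_def power2_eq_square)
        then show False using dvd_imp_degree_le[of k 1] k(1) by simp
      qed
      moreover have "Polynomial.lead_coeff b = 1" using g(1) m(1) b by (simp add: lead_coeff_mult)
      ultimately have "b = 1" by (metis coeff_pCons_0 degree_eq_zeroE one_pCons)
      then show ?thesis using b by simp
    qed
    show ?thesis by (rule factor_K[OF m_eq t f])
  qed
  have irr_of_I: "g dvd f" if I: ?I and t: "evac g t = 0" and f: "evac f t = 0" for t f
  proof -
    have m_eq: "m = g" if m: "Polynomial.lead_coeff m = 1" "0 < Polynomial.degree m" "m dvd g" for m
    proof -
      obtain b where b: "g = m * b" using m(3) by blast
      have nz: "m \<noteq> 0" "b \<noteq> 0" using g(1) b by auto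
      have lb: "Polynomial.lead_coeff b = 1" using g(1) m(1) b by (simp add: lead_coeff_mult)
      have "Polynomial.degree b = 0"
      proof (rule ccontr)
        assume db: "\<not> ?thesis"
        have "\<not> (\<exists>c. (\<forall>i. coeff c i \<in> ?H) \<and> c \<noteq> 0 \<and> map_poly to_ac m = ?g * c)"
        proof
          assume "\<exists>c. (\<forall>i. coeff c i \<in> ?H) \<and> c \<noteq> 0 \<and> map_poly to_ac m = ?g * c"
          then have "?g dvd map_poly to_ac m" by auto
          from dvd_imp_degree_le[OF this] nz(1) have "Polynomial.degree g \<le> Polynomial.degree m" by simp
          then show False using db nz unfolding b by (simp add: degree_mult_eq)
        qed
        moreover have "\<exists>c. (\<forall>i. coeff c i \<in> ?H) \<and> c \<noteq> 0 \<and> ?g = map_poly to_ac m * c"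
          using gH nz b by (intro exI[of _ "map_poly to_ac b"]) simp
        ultimately obtain c where "map_poly to_ac m * c = 1"
          using I gH nz(1) unfolding irreducible_polys_over_iff by (metis map_poly_to_ac_eq_0)
        then have "map_poly to_ac m dvd 1" by (metis dvd_triv_left)
        then show False using m(2) nz(1) by (simp add: is_unit_iff_degree)
      qed
      with lb have "b = 1" by (metis coeff_pCons_0 degree_eq_zeroE one_pCons)
      then show ?thesis using b by simp
    qed
    show ?thesis by (rule factor_K[OF m_eq t f])
  qed
  then show "?I \<Longrightarrow> evac g t = 0 \<Longrightarrow> evac f t = 0 \<Longrightarrow> g dvd f" .
  show "?Eq \<longleftrightarrow> ?I"
  proof
    assume Eq: ?Eq
    have simple': "evac (pderiv g) t \<noteq> 0" if "evac g t = 0" for t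
      by (rule simple[OF irr_of_Eq[OF Eq] that])
    note roots = distinct_roots_product[OF g(1) simple']
    show ?I
      unfolding irreducible_polys_over_iff
    proof (intro conjI allI impI)
      show nz: "?g \<noteq> 0" using deg by auto
      show "\<not> ((\<forall>i. coeff ?g i \<in> ?H) \<and> (\<exists>c. (\<forall>i. coeff c i \<in> ?H) \<and> ?g * c = 1 \<and> c * ?g = 1))"
      proof
        assume "(\<forall>i. coeff ?g i \<in> ?H) \<and> (\<exists>c. (\<forall>i. coeff c i \<in> ?H) \<and> ?g * c = 1 \<and> c * ?g = 1)"
        then have "?g dvd 1" by (metis dvd_triv_left)
        then show False using deg nz by (simp add: is_unit_iff_degree)
      qed
      fix b assume bH: "\<forall>i. coeff b i \<in> ?H" and b0: "b \<noteq> 0"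
        and c: "\<exists>c. (\<forall>i. coeff c i \<in> ?H) \<and> c \<noteq> 0 \<and> ?g = b * c"
        and nd: "\<not> (\<exists>c. (\<forall>i. coeff c i \<in> ?H) \<and> c \<noteq> 0 \<and> b = ?g * c)"
      obtain c where c: "\<forall>i. coeff c i \<in> ?H" "c \<noteq> 0" "?g = b * c" using c by blast
      have lc: "Polynomial.lead_coeff b * Polynomial.lead_coeff c = 1"
        using g(1) lead_coeff_map_poly_to_ac[of g] unfolding c(3) lead_coeff_mult by simp
      have const: "\<forall>i. coeff [:coeff p n:] i \<in> ?H" if "\<forall>i. coeff p i \<in> ?H" for p n
        using that to_ac_in_henselization[of 0 w] by (auto simp: coeff_pCons split: nat.split)
      show "\<exists>c. (\<forall>i. coeff c i \<in> ?H) \<and> b * c = 1 \<and> c * b = 1"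
      proof (cases "Polynomial.degree b = 0")
        case True
        then obtain \<beta> where "b = [:\<beta>:]" by (rule degree_eq_zeroE)
        then show ?thesis using const[OF c(1)] lc
          by (intro exI[of _ "[:Polynomial.lead_coeff c:]"]) (simp add: mult.commute one_pCons)
      next
        case False
        then obtain \<theta> where \<theta>: "poly b \<theta> = 0" using alg_closed_imp_poly_has_root[of b] by auto
        have g\<theta>: "evac g \<theta> = 0" unfolding evac_def c(3) using \<theta> by simp
        have "?R \<subseteq> {t. poly b t = 0}"
        proof
          fix t assume "t \<in> ?R"
          then have "w (evac f \<theta>) = w (evac f t)" for f using Eq g\<theta> by blast
          then obtain \<sigma> where \<sigma>: "\<sigma> \<in> decomposition_group w" "\<sigma> \<theta> = t"
            using decomposition_group_transitive[OF w] by metis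
          have "\<sigma> (coeff b i) = coeff b i" for i using bH \<sigma>(1) by (simp add: henselization_def)
          from decomposition_group_poly[OF \<sigma>(1) this, of \<theta>] show "t \<in> {t. poly b t = 0}"
            using \<theta> \<sigma>(2) hom_onD(4)[OF decomposition_groupD(2)[OF \<sigma>(1)] intermediate_ring_UNIV] by simp
        qed
        then have "card ?R \<le> card {t. poly b t = 0}" by (rule card_mono[OF poly_roots_finite[OF b0]])
        also have "\<dots> \<le> Polynomial.degree b" by (rule card_poly_roots_bound[OF b0])
        finally have "card ?R \<le> Polynomial.degree b" .
        moreover have "card ?R = Polynomial.degree ?g"
          using arg_cong[OF roots(2), of Polynomial.degree] by (simp only: degree_prod_linear)
        ultimately have "Polynomial.degree c = 0" using c b0 by (simp add: degree_mult_eq del: degree_map_poly_to_ac)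
        then obtain \<gamma> where \<gamma>: "c = [:\<gamma>:]" by (rule degree_eq_zeroE)
        have "b = ?g * [:Polynomial.lead_coeff b:]" unfolding c(3) \<gamma> using lc \<gamma> by (simp add: mult.commute)
        then show ?thesis using nd const[OF bH] b0 by (metis leading_coeff_0_iff pCons_eq_0_iff)
      qed
    qed
  next
    assume I: ?I
    have simple': "evac (pderiv g) t \<noteq> 0" if "evac g t = 0" for t
      by (rule simple[OF irr_of_I[OF I] that])
    note roots = distinct_roots_product[OF g(1) simple']
    obtain \<theta> where \<theta>: "evac g \<theta> = 0" using evac_root_exists[OF deg] by blast
    \<comment> \<open>The orbit of one root. Its complement among the roots is stable too, so both
      products have coefficients in the fixed field.\<close>
    define Z where "Z = {\<sigma> \<theta> | \<sigma>. \<sigma> \<in> decomposition_group w}"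
    have id: "id \<in> decomposition_group w" by (simp add: decomposition_group_def)
    have ZR: "Z \<subseteq> ?R" using stab \<theta> unfolding Z_def by blast
    have \<theta>Z: "\<theta> \<in> Z" unfolding Z_def using id by (metis (mono_tags, lifting) id_apply mem_Collect_eq)
    have comp: "\<sigma> \<circ> \<tau> \<in> decomposition_group w" if "\<sigma> \<in> decomposition_group w" "\<tau> \<in> decomposition_group w" for \<sigma> \<tau>
      using that unfolding decomposition_group_def by (auto simp: bij_comp fun_eq_iff)
    have Zs: "\<sigma> ` Z = Z" if \<sigma>: "\<sigma> \<in> decomposition_group w" for \<sigma>
    proof (rule endo_inj_surj)
      show "finite Z" using ZR roots(1) by (rule finite_subset)
      show "\<sigma> ` Z \<subseteq> Z" unfolding Z_def using comp[OF \<sigma>] by (auto, metis comp_apply)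
      show "inj_on \<sigma> Z" using bij_is_inj[OF decomposition_groupD(1)[OF \<sigma>]] by (rule inj_on_subset) simp
    qed
    have RZs: "\<sigma> ` (?R - Z) = ?R - Z" if \<sigma>: "\<sigma> \<in> decomposition_group w" for \<sigma>
      using image_set_diff[OF bij_is_inj[OF decomposition_groupD(1)[OF \<sigma>]]] stab[OF \<sigma>] Zs[OF \<sigma>] by simp
    let ?h = "\<Prod>x\<in>Z. [:- x, 1:]" and ?q = "\<Prod>x\<in>?R - Z. [:- x, 1:]"
    have hH: "coeff ?h i \<in> ?H" for i
      by (rule stable_product_over_henselization[OF finite_subset[OF ZR roots(1)] _ Zs]) (use ZR simple' in blast)+
    have qH: "coeff ?q i \<in> ?H" for i
      by (rule stable_product_over_henselization[OF finite_Diff[OF roots(1)] _ RZs]) (use simple' in blast)+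
    have "(\<Prod>x\<in>?R. [:- x, 1:]) = ?q * ?h" by (rule prod.subset_diff[OF ZR roots(1)])
    then have split: "?g = ?h * ?q" using roots(2) by (metis mult.commute)
    have nz: "?g \<noteq> 0" using deg by auto
    have deg_h: "Polynomial.degree ?h = card Z" "Polynomial.degree ?q = card (?R - Z)"
      by (rule degree_prod_linear)+
    have "?R - Z = {}"
    proof (rule ccontr)
      assume ne: "?R - Z \<noteq> {}"
      have cards: "0 < card Z" "0 < card (?R - Z)"
        using \<theta>Z ne roots(1) finite_subset[OF ZR roots(1)] by (auto simp: card_gt_0_iff)
      have nz': "?h \<noteq> 0" "?q \<noteq> 0" using nz unfolding split by auto
      have "\<not> (\<exists>c. (\<forall>i. coeff c i \<in> ?H) \<and> c \<noteq> 0 \<and> ?h = ?g * c)"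
      proof
        assume "\<exists>c. (\<forall>i. coeff c i \<in> ?H) \<and> c \<noteq> 0 \<and> ?h = ?g * c"
        then have "?g dvd ?h" by (metis dvd_triv_left)
        from dvd_imp_degree_le[OF this nz'(1)] show False
          unfolding split degree_mult_eq[OF nz'] deg_h using cards by linarith
      qed
      then obtain c where "?h * c = 1" using I hH qH nz' split unfolding irreducible_polys_over_iff by blast
      then have "?h dvd 1" by (metis dvd_triv_left)
      then have "Polynomial.degree ?h \<le> Polynomial.degree (1 :: 'a alg_closure poly)" by (rule dvd_imp_degree_le) simp
      then show False using cards(1) unfolding deg_h by simp
    qed
    then have RZ: "?R \<subseteq> Z" by blast
    have "w (evac f t) = w (evac f \<theta>)" if "evac g t = 0" for t f
    proof -
      obtain \<sigma> where "\<sigma> \<in> decomposition_group w" "t = \<sigma> \<theta>" using RZ \<open>evac g t = 0\<close> by (auto simp: Z_def)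
      then show ?thesis by (simp add: decomposition_group_evac decomposition_groupD(3))
    qed
    then show ?Eq by metis
  qed
qed


section \<open>Newton polygons\<close>

lemma hull_point: 
  fixes C :: "(rat \<times> 'g::linordered_rat_vector) set"
  assumes "p \<in> C" shows "p \<in> rat_convex_hull C"
  unfolding rat_convex_hull_def using assms
  by (auto intro!: exI[of _ "{p}"] exI[of _ "\<lambda>_. 1"] simp: scaleQ_one)

text \<open>A convex combination whose abscissa is extremal among the points has positive weights
  only on points with that abscissa.\<close>

lemma hull_extremal:
  fixes C :: "(rat \<times> 'g::linordered_rat_vector) set"
  assumes "(s, \<gamma>) \<in> rat_convex_hull C" "(\<forall>p\<in>C. s \<le> fst p) \<or> (\<forall>p\<in>C. fst p \<le> s)"
    "\<And>p. p \<in> C \<Longrightarrow> fst p = s \<Longrightarrow> snd p = c"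
  shows "\<gamma> = c" "\<exists>p\<in>C. fst p = s"
proof -
  obtain T t where T: "finite T" "T \<subseteq> C" "\<forall>p\<in>T. 0 \<le> t p" "sum t T = 1"
    "s = (\<Sum>p\<in>T. t p * fst p)" "\<gamma> = (\<Sum>p\<in>T. t p *\<^sub>Q snd p)"
    using assms(1) unfolding rat_convex_hull_def by auto
  have "(\<Sum>p\<in>T. t p * (fst p - s)) = (\<Sum>p\<in>T. t p * fst p) - (\<Sum>p\<in>T. t p) * s"
    by (simp add: right_diff_distrib sum_subtractf sum_distrib_right)
  then have 0: "(\<Sum>p\<in>T. t p * (fst p - s)) = 0" using T(4,5) by simp
  have z: "t p * (fst p - s) = 0" if "p \<in> T" for p
    using assms(2)
  proof
    assume "\<forall>p\<in>C. s \<le> fst p"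
    then have "\<And>p. p \<in> T \<Longrightarrow> 0 \<le> t p * (fst p - s)" using T(2,3) by (intro mult_nonneg_nonneg) auto
    then show ?thesis using sum_nonneg_eq_0_iff[OF T(1), of "\<lambda>p. t p * (fst p - s)"] 0 that by auto
  next
    assume "\<forall>p\<in>C. fst p \<le> s"
    then have "\<And>p. p \<in> T \<Longrightarrow> 0 \<le> t p * (s - fst p)" using T(2,3) by (intro mult_nonneg_nonneg) auto
    moreover have "(\<Sum>p\<in>T. t p * (s - fst p)) = - (\<Sum>p\<in>T. t p * (fst p - s))"
      by (simp add: sum_negf[symmetric] algebra_simps)
    ultimately show ?thesis using sum_nonneg_eq_0_iff[OF T(1), of "\<lambda>p. t p * (s - fst p)"] 0 that by auto
  qed
  have "t p *\<^sub>Q snd p = t p *\<^sub>Q c" if "p \<in> T" for p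
    using z[OF that] assms(3)[of p] T(2) that by (cases "t p = 0") auto
  then have "\<gamma> = (\<Sum>p\<in>T. t p *\<^sub>Q c)" unfolding T(6) by (intro sum.cong) auto
  also have "\<dots> = c" by (simp add: scaleQ_sum_left[symmetric] T(4) scaleQ_one)
  finally show "\<gamma> = c" .
  have "\<exists>p\<in>T. t p \<noteq> 0" using T(4) by (metis sum.neutral zero_neq_one)
  then obtain p where "p \<in> T" "t p \<noteq> 0" by blast
  then have "p \<in> C" "fst p = s" using z[of p] T(2) by auto
  then show "\<exists>p\<in>C. fst p = s" by blast
qed

lemma scaleQ_div: "0 < n \<Longrightarrow> of_nat n *\<^sub>Q ((1 / of_nat n) *\<^sub>Q x) = (x :: 'g::linordered_rat_vector)"
  by (simp add: scaleQ_scaleQ scaleQ_one)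

lemma infinite_open_interval:
  assumes "0 < (\<epsilon> :: 'g::linordered_rat_vector)"
  shows "infinite {\<tau>. lam < \<tau> \<and> \<tau> < lam + \<epsilon>}"
proof -
  \<comment> \<open>The shift by 2 keeps the weights strictly between 0 and 1, hence the points
    inside the open interval.\<close>
  define f where "f k = lam + (1 / of_nat (k + 2)) *\<^sub>Q \<epsilon>" for k :: nat
  have "inj f"
  proof (rule injI)
    fix i j assume "f i = f j"
    then have eq: "(1 / of_nat (i + 2)) *\<^sub>Q \<epsilon> = (1 / of_nat (j + 2)) *\<^sub>Q \<epsilon>" by (simp add: f_def)
    have "(1 / of_nat (i + 2) :: rat) = 1 / of_nat (j + 2)"
    proof (rule ccontr)
      assume "\<not> ?thesis"
      then consider "0 < (1 / of_nat (i + 2) :: rat) - 1 / of_nat (j + 2)" | "0 < (1 / of_nat (j + 2) :: rat) - 1 / of_nat (i + 2)" by linarith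
      then show False using scaleQ_pos[OF _ assms] eq by cases (fastforce simp: scaleQ_diff_left)+
    qed
    then show "i = j" by (simp add: field_simps)
  qed
  moreover have "range f \<subseteq> {\<tau>. lam < \<tau> \<and> \<tau> < lam + \<epsilon>}"
  proof
    fix x assume "x \<in> range f"
    then obtain k where k: "x = f k" by auto
    have "0 < (1 / of_nat (k + 2)) *\<^sub>Q \<epsilon>" by (rule scaleQ_pos[OF _ assms]) simp
    moreover have "0 < (1 - 1 / of_nat (k + 2)) *\<^sub>Q \<epsilon>" by (rule scaleQ_pos[OF _ assms]) (simp add: field_simps)
    ultimately show "x \<in> {\<tau>. lam < \<tau> \<and> \<tau> < lam + \<epsilon>}" by (simp add: k f_def scaleQ_diff_left scaleQ_one)
  qed
  ultimately show ?thesis by (metis finite_subset range_inj_infinite)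
qed

context key_stage
begin

lemma newton_polygon_points:
  "{(of_nat n, \<gamma>) | n \<gamma>. cf g n \<noteq> 0 \<and> V (cf g n) = Fin \<gamma>} = {(of_nat n, \<gamma>) | n \<gamma>. V (cf g n) = Fin \<gamma>}"
  by (auto, (metis V.val_zero extval.distinct(1)))

text \<open>All points have abscissa between 0 and n, and (n, 0) is one of them as g is monic. At
  the extremal abscissas the hull has a single ordinate, so a one-sided polygon must run from (0, n
  lam) through (n, 0), with every point on or above it.\<close>

lemma one_sided_iff:
  assumes g: "Polynomial.lead_coeff g = 1" "Polynomial.degree g = n * Polynomial.degree \<phi>" "0 < n"
  shows "one_sided (newton_polygon V \<phi> g) lam \<longleftrightarrow>
    V (cf g 0) = Fin (of_nat n *\<^sub>Q lam) \<and> (\<forall>i. Fin (of_nat n *\<^sub>Q lam) \<le> V (cf g i) + Fin (of_nat i *\<^sub>Q lam))"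
proof -
  define C where "C = {(of_nat i :: rat, \<gamma>) | i \<gamma>. V (cf g i) = Fin \<gamma>}"
  define N where "N = newton_polygon V \<phi> g"
  have N: "N = lower_convex_hull C"
    unfolding N_def newton_polygon_def newton_polygon_points C_def ..
  have cn: "cf g n = 1" by (rule expansion_coeff_monic[OF deg monic g(1,2)])
  have Cn: "(of_nat n, 0) \<in> C" using cn by (auto simp: C_def)
  have Ci: "0 \<le> fst p \<and> fst p \<le> of_nat n" if pC: "p \<in> C" for p
  proof -
    obtain i \<gamma> where p: "p = (of_nat i, \<gamma>)" "V (cf g i) = Fin \<gamma>" using pC unfolding C_def by blast
    have "i \<le> n"
    proof (rule ccontr)
      assume "\<not> i \<le> n"
      then have "Polynomial.degree g < i * Polynomial.degree \<phi>" using g(2) deg by simp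
      then show False using p(2) expansion_coeff_eq_0[OF deg] by simp
    qed
    then show ?thesis by (simp add: p(1))
  qed
  show ?thesis
  proof
    assume "one_sided (newton_polygon V \<phi> g) lam"
    then obtain \<gamma>0 len where len: "0 < len" and seg: "N = {(s, \<gamma>0 - s *\<^sub>Q lam) | s. 0 \<le> s \<and> s \<le> len}"
      unfolding one_sided_def N_def by auto
    have "(0, \<gamma>0) \<in> N" unfolding seg using len by (auto intro!: exI[of _ 0])
    then have h0: "(0, \<gamma>0) \<in> rat_convex_hull C" unfolding N lower_convex_hull_def by auto
    have 0: "V (cf g 0) = Fin \<gamma>0"
    proof -
      obtain p where p: "p \<in> C" "fst p = 0" using hull_extremal(2)[OF h0, of \<gamma>0] hull_extremal(2)[OF h0, of "snd _"] Ci
      proof -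
        have "\<forall>p\<in>C. 0 \<le> fst p" using Ci by blast
        moreover have "\<And>p. p \<in> C \<Longrightarrow> fst p = 0 \<Longrightarrow> snd p = the_fin (V (cf g 0))" by (auto simp: C_def)
        ultimately show thesis using hull_extremal(2)[OF h0, of "the_fin (V (cf g 0))"] that by blast
      qed
      then have fin: "V (cf g 0) = Fin (snd p)" by (auto simp: C_def)
      have "\<gamma>0 = snd p"
      proof (rule hull_extremal(1)[OF h0])
        show "(\<forall>p\<in>C. 0 \<le> fst p) \<or> (\<forall>p\<in>C. fst p \<le> 0)" using Ci by blast
        show "snd q = snd p" if "q \<in> C" "fst q = 0" for q using that fin by (auto simp: C_def)
      qed
      then show ?thesis using fin by simp
    qed
    have n0: "\<gamma>' = 0" if "(of_nat n, \<gamma>') \<in> rat_convex_hull C" for \<gamma>'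
    proof (rule hull_extremal(1)[OF that])
      show "(\<forall>p\<in>C. of_nat n \<le> fst p) \<or> (\<forall>p\<in>C. fst p \<le> of_nat n)" using Ci by blast
      show "snd p = 0" if "p \<in> C" "fst p = of_nat n" for p using that cn by (auto simp: C_def)
    qed
    have "(of_nat n, 0) \<in> N"
      unfolding N lower_convex_hull_def using hull_point[OF Cn] n0 by auto
    then have n: "of_nat n \<le> len" "\<gamma>0 = of_nat n *\<^sub>Q lam" unfolding seg by auto
    show "V (cf g 0) = Fin (of_nat n *\<^sub>Q lam) \<and> (\<forall>i. Fin (of_nat n *\<^sub>Q lam) \<le> V (cf g i) + Fin (of_nat i *\<^sub>Q lam))"
    proof (intro conjI allI)
      show "V (cf g 0) = Fin (of_nat n *\<^sub>Q lam)" using 0 n by simp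
      fix i
      show "Fin (of_nat n *\<^sub>Q lam) \<le> V (cf g i) + Fin (of_nat i *\<^sub>Q lam)"
      proof (cases "V (cf g i)")
        case (Fin \<gamma>)
        then have Cp: "(of_nat i, \<gamma>) \<in> C" by (auto simp: C_def)
        then have "of_nat i \<le> len" using Ci[OF Cp] n(1) by simp
        then have "(of_nat i, \<gamma>0 - of_nat i *\<^sub>Q lam) \<in> N" unfolding seg by auto
        then have "\<gamma>0 - of_nat i *\<^sub>Q lam \<le> \<gamma>"
          unfolding N lower_convex_hull_def using hull_point[OF Cp] by auto
        then show ?thesis using Fin n(2) by (simp add: diff_le_eq)
      qed simp
    qed
  next
    assume asm: "V (cf g 0) = Fin (of_nat n *\<^sub>Q lam) \<and> (\<forall>i. Fin (of_nat n *\<^sub>Q lam) \<le> V (cf g i) + Fin (of_nat i *\<^sub>Q lam))"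
    have C0: "(0, of_nat n *\<^sub>Q lam) \<in> C" using asm by (auto simp: C_def intro!: exI[of _ 0])
    have above: "of_nat n *\<^sub>Q lam - fst p *\<^sub>Q lam \<le> snd p" if pC: "p \<in> C" for p
    proof -
      obtain i \<gamma> where p: "p = (of_nat i, \<gamma>)" "V (cf g i) = Fin \<gamma>" using pC unfolding C_def by blast
      then have "Fin (of_nat n *\<^sub>Q lam) \<le> Fin \<gamma> + Fin (of_nat i *\<^sub>Q lam)" using asm by metis
      then show ?thesis using p by (simp add: diff_le_eq)
    qed
    have hull_above: "0 \<le> s \<and> s \<le> of_nat n \<and> of_nat n *\<^sub>Q lam - s *\<^sub>Q lam \<le> \<gamma>" if h: "(s, \<gamma>) \<in> rat_convex_hull C" for s \<gamma>
    proof -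
      obtain T t where T: "finite T" "T \<subseteq> C" "\<forall>p\<in>T. 0 \<le> t p" "sum t T = 1"
        "s = (\<Sum>p\<in>T. t p * fst p)" "\<gamma> = (\<Sum>p\<in>T. t p *\<^sub>Q snd p)"
        using h unfolding rat_convex_hull_def by auto
      have "0 \<le> s" unfolding T(5) using T(2,3) Ci by (intro sum_nonneg mult_nonneg_nonneg) auto
      moreover have "s \<le> (\<Sum>p\<in>T. t p * of_nat n)" unfolding T(5) using T(2,3) Ci by (intro sum_mono mult_left_mono) auto
      then have "s \<le> of_nat n" by (simp add: sum_distrib_right[symmetric] T(4))
      moreover have "(\<Sum>p\<in>T. t p *\<^sub>Q (of_nat n *\<^sub>Q lam - fst p *\<^sub>Q lam)) \<le> \<gamma>"
        unfolding T(6) using T(2,3) above by (intro sum_mono scaleQ_mono) auto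
      moreover have "(\<Sum>p\<in>T. t p *\<^sub>Q (of_nat n *\<^sub>Q lam - fst p *\<^sub>Q lam)) = of_nat n *\<^sub>Q lam - s *\<^sub>Q lam"
        by (simp add: scaleQ_diff_right sum_subtractf scaleQ_scaleQ scaleQ_sum_left[symmetric] T(5) T(4) sum_distrib_right[symmetric])
      ultimately show ?thesis by simp
    qed
    have seg: "(s, of_nat n *\<^sub>Q lam - s *\<^sub>Q lam) \<in> rat_convex_hull C" if s: "0 \<le> s" "s \<le> of_nat n" for s
    proof -
      let ?p = "(0 :: rat, of_nat n *\<^sub>Q lam)" and ?q = "(of_nat n :: rat, 0 :: 'g)"
      \<comment> \<open>The point of the segment with abscissa s as a convex combination of its two
        ends.\<close>
      define t where "t p = (if p = ?p then 1 - s / of_nat n else s / of_nat n)" for p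
      have neq: "?p \<noteq> ?q" using g(3) by simp
      have t: "t ?p = 1 - s / of_nat n" "t ?q = s / of_nat n" using neq by (auto simp: t_def)
      have "(\<Sum>p\<in>{?p, ?q}. t p * fst p) = s" using neq g(3) t by simp
      moreover have "(\<Sum>p\<in>{?p, ?q}. t p *\<^sub>Q snd p) = of_nat n *\<^sub>Q lam - s *\<^sub>Q lam"
        using neq g(3) t by (simp add: scaleQ_scaleQ left_diff_distrib scaleQ_diff_left)
      ultimately have eq: "(s, of_nat n *\<^sub>Q lam - s *\<^sub>Q lam) = ((\<Sum>p\<in>{?p, ?q}. t p * fst p), (\<Sum>p\<in>{?p, ?q}. t p *\<^sub>Q snd p))"
        by simp
      have one: "sum t {?p, ?q} = 1" using neq t by simp
      have "0 \<le> s / of_nat n" "0 \<le> 1 - s / of_nat n" using s g(3) by (simp_all add: divide_le_eq)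
      then have nonneg: "\<forall>p\<in>{?p, ?q}. 0 \<le> t p" using t by simp
      have sub: "{?p, ?q} \<subseteq> C" using C0 Cn by auto
      have fin: "finite {?p, ?q}" by simp
      show ?thesis unfolding rat_convex_hull_def by (intro CollectI exI conjI) (rule eq fin sub nonneg one)+
    qed
    have "N = {(s, of_nat n *\<^sub>Q lam - s *\<^sub>Q lam) | s. 0 \<le> s \<and> s \<le> of_nat n}"
    proof (intro subset_antisym subsetI)
      fix x assume "x \<in> N"
      then obtain s \<gamma> where x: "x = (s, \<gamma>)" "(s, \<gamma>) \<in> rat_convex_hull C" "\<forall>\<gamma>'. (s, \<gamma>') \<in> rat_convex_hull C \<longrightarrow> \<gamma> \<le> \<gamma>'"
        unfolding N lower_convex_hull_def by auto
      then have "0 \<le> s \<and> s \<le> of_nat n \<and> \<gamma> = of_nat n *\<^sub>Q lam - s *\<^sub>Q lam"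
        using hull_above[OF x(2)] seg[of s] by (auto intro: antisym)
      then show "x \<in> {(s, of_nat n *\<^sub>Q lam - s *\<^sub>Q lam) | s. 0 \<le> s \<and> s \<le> of_nat n}" using x(1) by auto
    next
      fix x assume "x \<in> {(s, of_nat n *\<^sub>Q lam - s *\<^sub>Q lam) | s. 0 \<le> s \<and> s \<le> of_nat n}"
      then obtain s where "x = (s, of_nat n *\<^sub>Q lam - s *\<^sub>Q lam)" "0 \<le> s" "s \<le> of_nat n" by auto
      then show "x \<in> N" unfolding N lower_convex_hull_def using seg[of s] hull_above by auto
    qed
    then show "one_sided (newton_polygon V \<phi> g) lam"
      unfolding one_sided_def N_def[symmetric] using g(3) by (auto intro!: exI[of _ "of_nat n *\<^sub>Q lam"] exI[of _ "of_nat n"])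
  qed
qed

end


section \<open>Stages of the procedure\<close>

text \<open>A is the set of admissible slopes: all of the value space at the start, later those
  above the M-value of the new key polynomial. It is upward closed because auxiliary slopes slightly
  above the true one are needed. \<open>A_roots\<close> supplies the knowledge about roots that a
  factorization over the henselization would give.\<close>

locale stage = key_stage V \<phi>
  for V :: "'a::field poly \<Rightarrow> 'g::linordered_rat_vector extval" and \<phi> +
  fixes v :: "'a \<Rightarrow> 'g extval" and w :: "'a alg_closure \<Rightarrow> 'g extval" and A :: "'g set"
  assumes v_val: "is_valuation v" and v_hull: "divisible_hull_of_values v" and V_const: "V [:k:] = v k"
    and w_ext: "extends_val v w"
    and A_up: "x \<in> A \<Longrightarrow> x \<le> y \<Longrightarrow> y \<in> A"
    and A_aug: "x \<in> A \<Longrightarrow> augmentation V \<phi> x"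
    and A_roots: "x \<in> A \<Longrightarrow> Polynomial.lead_coeff f = 1 \<Longrightarrow> Polynomial.degree f = r * Polynomial.degree \<phi> \<Longrightarrow>
      augment V \<phi> x f = Fin (of_nat r *\<^sub>Q x) \<Longrightarrow> evac f t = 0 \<Longrightarrow> Polynomial.degree a < Polynomial.degree \<phi> \<Longrightarrow>
      w (evac a t) = V a"
begin

sublocale w: valuation w
  using w_ext by unfold_locales (simp add: extends_val_def)

text \<open>For generic \<open>\<tau>\<close> there are polynomials \<open>\<phi> ^ N - c\<close> all of whose roots give \<open>\<phi>\<close> the value \<open>\<tau>\<close>;
  their resultant with \<open>g\<close> computes the piecewise linear function of \<open>\<tau>\<close> whose breaks are the slopes
  of the Newton polygon.\<close>

lemma augment_at_generic_slope:
  assumes \<tau>: "\<tau> \<in> A" "lam < \<tau>"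
    and generic: "\<And>i j x y. i < j \<Longrightarrow> V (cf g i) = Fin x \<Longrightarrow> V (cf g j) = Fin y \<Longrightarrow>
      x + of_nat i *\<^sub>Q \<tau> \<noteq> y + of_nat j *\<^sub>Q \<tau>"
    and g: "Polynomial.lead_coeff g = 1" "Polynomial.degree g = n * Polynomial.degree \<phi>" "0 < n"
    and slope: "\<And>t. evac g t = 0 \<Longrightarrow> w (evac \<phi> t) = Fin lam"
  shows "augment V \<phi> \<tau> g = Fin (of_nat n *\<^sub>Q lam)"
proof -
  interpret aug: augmentation V \<phi> \<tau> by (rule A_aug[OF \<tau>(1)])
  obtain N c where c: "0 < N" "c \<noteq> 0" "v c = Fin (of_nat N *\<^sub>Q \<tau>)"
    using v_hull unfolding divisible_hull_of_values_def by blast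
  \<comment> \<open>With v c = N \<tau> the polygon of f is one-sided of slope - \<tau>, so
    \<open>A_roots\<close> applies to its roots and each of them gives \<phi> the value
    \<tau>.\<close>
  define f where "f = \<phi> ^ N - [:c:]"
  have dN: "Polynomial.degree (\<phi> ^ N) = N * Polynomial.degree \<phi>" "coeff (\<phi> ^ N) (N * Polynomial.degree \<phi>) = 1"
    using monic_power_coeff[OF monic] by auto
  have Npos: "0 < N * Polynomial.degree \<phi>" using c(1) deg by simp
  have df: "Polynomial.degree f = N * Polynomial.degree \<phi>"
  proof -
    have "Polynomial.degree f = Polynomial.degree (\<phi> ^ N)"
      unfolding f_def diff_conv_add_uminus using dN(1) Npos by (intro degree_add_eq_left) simp
    then show ?thesis by (simp only: dN(1))
  qed
  have lf: "Polynomial.lead_coeff f = 1"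
    unfolding df unfolding f_def using dN(2) Npos coeff_eq_0[of "[:c:]" "N * Polynomial.degree \<phi>"] by simp
  have cfi: "cf f i = (if i = 0 then - [:c:] else if i = N then 1 else 0)" for i
  proof -
    have "cf f i = cf (1 * \<phi> ^ N) i - cf [:c:] i" by (simp add: f_def cf_simps)
    also have "cf (1 * \<phi> ^ N) i = (if i = N then 1 else 0)" using deg by (intro expansion_coeff_monomial[OF deg]) simp
    also have "cf [:c:] i = (if i = 0 then [:c:] else 0)" using deg by (intro expansion_coeff_of_small[OF deg]) simp
    finally show ?thesis using c(1) by auto
  qed
  have tmf: "aug.tm f i = (if i = 0 \<or> i = N then Fin (of_nat N *\<^sub>Q \<tau>) else Infty)" for i
    using c V_const[of c] V.val_minus[of "[:c:]"] by (auto simp: aug.tm_def cfi)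
  have Mf: "augment V \<phi> \<tau> f = Fin (of_nat N *\<^sub>Q \<tau>)"
    using aug.M_le[of f 0] tmf[of 0] by (intro antisym) (auto simp: aug.le_M tmf)
  obtain \<gamma> where \<gamma>: "augment V \<phi> \<tau> g = Fin \<gamma>"
    using g(1) aug.M_finite[of g] by (cases "augment V \<phi> \<tau> g") auto
  have "w (evac g s) = Fin \<gamma>" if s: "evac f s = 0" for s
  proof -
    have small: "w (evac a s) = V a" if "small a" for a
      using A_roots[OF \<tau>(1) lf df Mf s that] .
    have "evac \<phi> s ^ N = to_ac c" using s by (simp add: f_def)
    then have wN: "w (evac \<phi> s ^ N) = Fin (of_nat N *\<^sub>Q \<tau>)" using c(3) w_ext by (simp add: extends_val_def)
    have w\<phi>: "w (evac \<phi> s) = Fin \<tau>"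
    proof (cases "w (evac \<phi> s)")
      case (Fin x)
      then show ?thesis using wN valuation_power[OF w.valuation_axioms Fin, of N] c(1) by simp
    next
      case Infty
      then have "w (evac \<phi> s ^ N) = Infty" using c(1) by (cases N) (auto simp: w.val_mult)
      then show ?thesis using wN by simp
    qed
    obtain l where l: "l \<le> Polynomial.degree g" "augment V \<phi> \<tau> g = aug.tm g l" using aug.M_attained by blast
    have tmw: "w (evac (cf g i) s * evac \<phi> s ^ i) = aug.tm g i" for i
      using small[OF cf_small, of g i] valuation_power[OF w.valuation_axioms w\<phi>, of i] by (simp add: w.val_mult aug.tm_def)
    have "evac g s = (\<Sum>i\<le>Polynomial.degree g. evac (cf g i) s * evac \<phi> s ^ i)"
      by (subst expansion_degree[OF deg, of g]) (simp add: evac_sum)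
    also have "w \<dots> = w (evac (cf g l) s * evac \<phi> s ^ l)"
    proof (rule w.val_sum_unique_min)
      fix i assume i: "i \<noteq> l"
      \<comment> \<open>Genericity of \<tau> makes the finite terms of the expansion pairwise
        different in value, so the smallest one decides the value of g at s.\<close>
      have "aug.tm g i \<noteq> aug.tm g l"
      proof
        assume eq: "aug.tm g i = aug.tm g l"
        then obtain x y where xy: "V (cf g i) = Fin x" "V (cf g l) = Fin y"
          using l(2) \<gamma> by (cases "V (cf g i)"; cases "V (cf g l)") (auto simp: aug.tm_def)
        then show False
          using generic[of i l x y] generic[of l i y x] eq i by (cases "i < l") (auto simp: aug.tm_def)
      qed
      then show "w (evac (cf g l) s * evac \<phi> s ^ l) < w (evac (cf g i) s * evac \<phi> s ^ i)"
        unfolding tmw using aug.M_le[of g i] l(2) by (simp add: order.order_iff_strict)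
    qed (use l tmw \<gamma> in auto)
    finally show ?thesis using tmw l(2) \<gamma> by simp
  qed
  moreover have "w (evac f t) = Fin (of_nat N *\<^sub>Q lam)" if t: "evac g t = 0" for t
  proof -
    have "w (evac \<phi> t ^ N) = Fin (of_nat N *\<^sub>Q lam)"
      using valuation_power[OF w.valuation_axioms slope[OF t]] .
    moreover have "w (- to_ac c) = Fin (of_nat N *\<^sub>Q \<tau>)" using c(3) w_ext by (simp add: extends_val_def)
    ultimately show ?thesis
      using w.val_add_eq[of "evac \<phi> t ^ N" "- to_ac c"] scaleQ_of_nat_strict_mono[OF c(1) \<tau>(2)] by (simp add: f_def)
  qed
  ultimately have "of_nat (Polynomial.degree g) *\<^sub>Q (of_nat N *\<^sub>Q lam) = of_nat (Polynomial.degree f) *\<^sub>Q \<gamma>"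
    by (intro resultant_values(1)[OF w.val g(1) lf])
  also have "\<dots> = of_nat (N * Polynomial.degree \<phi>) *\<^sub>Q \<gamma>" by (simp only: df)
  also have "of_nat (Polynomial.degree g) *\<^sub>Q (of_nat N *\<^sub>Q lam) = of_nat (N * Polynomial.degree \<phi>) *\<^sub>Q (of_nat n *\<^sub>Q lam)"
    unfolding g(2) scaleQ_scaleQ of_nat_mult[symmetric] by (simp add: ac_simps)
  finally have "of_nat n *\<^sub>Q lam = \<gamma>" using Npos by (simp only: scaleQ_of_nat_inject)
  then show ?thesis using \<gamma> by simp
qed

text \<open>For all but finitely many \<tau> > lam the augmented value of g is n lam, independently
  of \<tau>. Letting \<tau> approach lam shows that no point lies below the line of slope - lam; and
  a term of positive index attaining n lam at \<tau> would lie below it at lam, so the constant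
  digit attains it.\<close>

lemma one_sided_of_constant_slope:
  assumes lam: "lam \<in> A"
    and g: "Polynomial.lead_coeff g = 1" "Polynomial.degree g = n * Polynomial.degree \<phi>" "0 < n"
    and slope: "\<And>t. evac g t = 0 \<Longrightarrow> w (evac \<phi> t) = Fin lam"
  shows "one_sided (newton_polygon V \<phi> g) lam"
proof -
  define Bad where "Bad = (\<Union>i\<le>n. \<Union>j\<le>n. {\<tau>. i < j \<and> (\<exists>x y. V (cf g i) = Fin x \<and> V (cf g j) = Fin y \<and>
      x + of_nat i *\<^sub>Q \<tau> = y + of_nat j *\<^sub>Q \<tau>)})"
  have cfn: "cf g i = 0" if "n < i" for i
    using that g(2) deg by (intro expansion_coeff_eq_0[OF deg]) simp
  have "finite Bad"
    unfolding Bad_def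
  proof (intro finite_UN_I finite_atMost)
    fix i j
    show "finite {\<tau>. i < j \<and> (\<exists>x y. V (cf g i) = Fin x \<and> V (cf g j) = Fin y \<and> x + of_nat i *\<^sub>Q \<tau> = y + of_nat j *\<^sub>Q \<tau>)}" (is "finite ?S")
    proof (rule finite_subset)
      show "?S \<subseteq> {(1 / of_nat (j - i)) *\<^sub>Q (the_fin (V (cf g i)) - the_fin (V (cf g j)))}"
      proof
        fix \<tau> assume "\<tau> \<in> ?S"
        then obtain x y where xy: "i < j" "V (cf g i) = Fin x" "V (cf g j) = Fin y" "x + of_nat i *\<^sub>Q \<tau> = y + of_nat j *\<^sub>Q \<tau>" by auto
        have "of_nat j *\<^sub>Q \<tau> = of_nat (j - i) *\<^sub>Q \<tau> + of_nat i *\<^sub>Q \<tau>"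
          using scaleQ_of_nat_add[of "j - i" i \<tau>] xy(1) by simp
        then have "x - y = of_nat (j - i) *\<^sub>Q \<tau>" using xy(4) by (simp add: algebra_simps)
        then have "(1 / of_nat (j - i)) *\<^sub>Q (x - y) = \<tau>" using xy(1) by (simp add: scaleQ_scaleQ scaleQ_one)
        then show "\<tau> \<in> {(1 / of_nat (j - i)) *\<^sub>Q (the_fin (V (cf g i)) - the_fin (V (cf g j)))}" using xy by simp
      qed
    qed simp
  qed
  have generic: "augment V \<phi> \<tau> g = Fin (of_nat n *\<^sub>Q lam)" if "lam < \<tau>" "\<tau> \<notin> Bad" for \<tau>
  proof (rule augment_at_generic_slope[OF _ that(1) _ g slope])
    show "\<tau> \<in> A" using A_up[OF lam, of \<tau>] that(1) by simp
    fix i j x y assume ij: "i < j" "V (cf g i) = Fin x" "V (cf g j) = Fin y"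
    then have "i \<le> n" "j \<le> n" using cfn[of i] cfn[of j] by (auto simp: not_less[symmetric])
    then show "x + of_nat i *\<^sub>Q \<tau> \<noteq> y + of_nat j *\<^sub>Q \<tau>" using that(2) ij unfolding Bad_def by blast
  qed
  have ex: "\<exists>\<tau>. lam < \<tau> \<and> \<tau> < lam + \<epsilon> \<and> \<tau> \<notin> Bad" if "0 < \<epsilon>" for \<epsilon>
  proof (rule ccontr)
    assume "\<not> ?thesis"
    then have "{\<tau>. lam < \<tau> \<and> \<tau> < lam + \<epsilon>} \<subseteq> Bad" by auto
    then show False using infinite_open_interval[OF that] \<open>finite Bad\<close> finite_subset by blast
  qed
  have le: "Fin (of_nat n *\<^sub>Q lam) \<le> V (cf g i) + Fin (of_nat i *\<^sub>Q lam)" for i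
  proof (rule ccontr)
    assume "\<not> ?thesis"
    then obtain x where x: "V (cf g i) = Fin x" "x + of_nat i *\<^sub>Q lam < of_nat n *\<^sub>Q lam"
      by (cases "V (cf g i)") auto
    define \<delta> where "\<delta> = of_nat n *\<^sub>Q lam - (x + of_nat i *\<^sub>Q lam)"
    have \<delta>: "0 < \<delta>" using x by (simp add: \<delta>_def)
    \<comment> \<open>A deficit \<delta> at index i survives a change of slope by less than \<delta>
      / (i + 1), since i \<epsilon> < \<delta>.\<close>
    define \<epsilon> where "\<epsilon> = (1 / of_nat (Suc i)) *\<^sub>Q \<delta>"
    have "0 < \<epsilon>" unfolding \<epsilon>_def by (rule scaleQ_pos[OF _ \<delta>]) simp
    then obtain \<tau> where \<tau>: "lam < \<tau>" "\<tau> < lam + \<epsilon>" "\<tau> \<notin> Bad" using ex by blast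
    interpret aug: augmentation V \<phi> \<tau> using A_aug A_up[OF lam, of \<tau>] \<tau>(1) by simp
    have "of_nat n *\<^sub>Q lam \<le> x + of_nat i *\<^sub>Q \<tau>"
      using aug.M_le[of g i] generic[OF \<tau>(1,3)] x(1) by (simp add: aug.tm_def)
    also have "of_nat i *\<^sub>Q \<tau> \<le> of_nat i *\<^sub>Q (lam + \<epsilon>)" using \<tau> by (intro scaleQ_of_nat_mono) simp
    also have "x + of_nat i *\<^sub>Q (lam + \<epsilon>) = x + of_nat i *\<^sub>Q lam + of_nat i *\<^sub>Q \<epsilon>" by (simp add: scaleQ_add_right add.assoc)
    also have "of_nat i *\<^sub>Q \<epsilon> < of_nat (Suc i) *\<^sub>Q \<epsilon>" using \<open>0 < \<epsilon>\<close> by (simp add: scaleQ_add_left scaleQ_one)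
    also have "of_nat (Suc i) *\<^sub>Q \<epsilon> = \<delta>" unfolding \<epsilon>_def by (rule scaleQ_div) simp
    finally show False by (simp add: \<delta>_def)
  qed
  moreover have "V (cf g 0) = Fin (of_nat n *\<^sub>Q lam)"
  proof (rule ccontr)
    assume neq: "V (cf g 0) \<noteq> Fin (of_nat n *\<^sub>Q lam)"
    show False
    proof (cases "\<exists>\<epsilon>::'g. 0 < \<epsilon>")
      case True
      then obtain \<tau> where \<tau>: "lam < \<tau>" "\<tau> \<notin> Bad" using ex by blast
      interpret aug: augmentation V \<phi> \<tau> using A_aug A_up[OF lam, of \<tau>] \<tau>(1) by simp
      obtain i where i: "aug.tm g i = Fin (of_nat n *\<^sub>Q lam)" using aug.M_attained[of g] generic[OF \<tau>] by metis
      have "i \<noteq> 0" using i neq by (intro notI) (simp add: aug.tm_def)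
      then have "of_nat i *\<^sub>Q lam < of_nat i *\<^sub>Q \<tau>" using \<tau> by (intro scaleQ_of_nat_strict_mono) auto
      then show False
        using i le[of i] by (cases "V (cf g i)") (auto simp: aug.tm_def, metis add_less_cancel_left leD)
    next
      \<comment> \<open>In a trivial value space no \<tau> > lam exists. The constant digit would
        then be zero, so \<phi> would divide g and have infinite value at one of its roots.\<close>
      case False
      then have zero: "x = 0" for x :: 'g by (metis neg_0_less_iff_less neqE)
      have "V (cf g 0) = Infty" using neq zero by (cases "V (cf g 0)") (metis extval.exhaust)+
      then have "cf g 0 = 0" using small_finite[OF cf_small] by simp
      then have "\<phi> dvd g" by (simp add: expansion_coeff_at_0[OF deg] mod_eq_0_iff_dvd)
      moreover obtain t where "evac \<phi> t = 0" using evac_root_exists[OF deg] by blast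
      ultimately show False using slope[of t] evac_dvd by fastforce
    qed
  qed
  ultimately show ?thesis using one_sided_iff[OF g] by blast
qed

end


section \<open>The procedure\<close>

lemma (in field_valuation) of_nat_nonneg: "0 \<le> v (of_nat n)"
  by (induction n) (auto simp: val_one intro: val_add_ge)

lemma (in field_valuation) residue_of_nat: "[n] \<cdot>\<^bsub>residue_field v\<^esub> \<one>\<^bsub>residue_field v\<^esub> = cls (of_nat n)"
proof -
  interpret k: field "residue_field v" unfolding residue_field_eq by (rule field_Q)
  show ?thesis
  proof (induction n)
    case 0
    show ?case using cls_eq_zero[of 0] by (simp add: residue_field_eq)
  next
    case (Suc n)
    have "[Suc n] \<cdot>\<^bsub>residue_field v\<^esub> \<one>\<^bsub>residue_field v\<^esub> = cls (of_nat n) \<oplus>\<^bsub>residue_field v\<^esub> cls 1"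
      using Suc by (simp add: k.add.nat_pow_Suc cls_one residue_field_eq)
    also have "\<dots> = cls (of_nat n + 1)"
      using of_nat_nonneg[of n] by (simp add: cls_add residue_field_eq val_one)
    finally show ?case by (simp add: add.commute)
  qed
qed

text \<open>The degree has nonzero residue, hence value 0. The values of m and of its cofactor are
  nonnegative with sum 0, so both vanish.\<close>

lemma value_of_degree:
  fixes v :: "'f::field \<Rightarrow> 'g::linordered_ab_group_add extval"
  assumes v: "is_valuation v" and n: "\<not> ring_char (residue_field v) dvd n" and m: "m dvd n"
  shows "v (of_nat m) = 0"
proof -
  interpret field_valuation v by unfold_locales fact
  have "v (of_nat n) = 0"
  proof (rule ccontr)
    assume "v (of_nat n) \<noteq> 0"
    then have "0 < v (of_nat n)" using of_nat_nonneg[of n] by simp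
    then have "[n] \<cdot>\<^bsub>residue_field v\<^esub> \<one>\<^bsub>residue_field v\<^esub> = \<zero>\<^bsub>residue_field v\<^esub>"
      unfolding residue_of_nat using cls_eq_zero[of "of_nat n"] by (simp add: residue_field_eq)
    then have "ring_char (residue_field v) dvd n" unfolding ring_char_def by (intro Gcd_dvd) simp
    then show False using n by simp
  qed
  moreover obtain k where "n = m * k" using m by blast
  ultimately have "v (of_nat m) + v (of_nat k) = 0" by (simp add: val_mult)
  then show ?thesis using of_nat_nonneg[of m] of_nat_nonneg[of k]
    by (cases "v (of_nat m)"; cases "v (of_nat k)") (auto simp: add_nonneg_eq_0_iff)
qed

context stage
begin

text \<open>The classical theorem on slopes, by comparing the term at one end with all others. It is
  stated before any augmentation by lam is known to exist, because it is what shows that lam is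
  admissible.\<close>

lemma slope_of_roots:
  assumes g: "Polynomial.lead_coeff g = 1" "Polynomial.degree g = n * Polynomial.degree \<phi>" "0 < n"
    and slope: "one_sided (newton_polygon V \<phi> g) lam" and t: "evac g t = 0"
    and small: "\<And>a. small a \<Longrightarrow> w (evac a t) = V a"
  shows "w (evac \<phi> t) = Fin lam"
proof (rule ccontr)
  assume neq: "\<not> ?thesis"
  have w: "is_valuation w" using w_ext by (simp add: extends_val_def)
  have c0: "V (cf g 0) = Fin (of_nat n *\<^sub>Q lam)"
    and ci: "\<And>i. Fin (of_nat n *\<^sub>Q lam) \<le> V (cf g i) + Fin (of_nat i *\<^sub>Q lam)"
    using slope unfolding one_sided_iff[OF g] by auto
  have cn: "cf g n = 1" by (rule expansion_coeff_monic[OF deg monic g(1,2)])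
  have "Polynomial.degree g < Suc n * Polynomial.degree \<phi>" using g(2) deg by simp
  from expansion[OF deg this] have "evac g t = (\<Sum>i\<le>n. evac (cf g i * \<phi> ^ i) t)"
    by (metis (no_types, lifting) evac_sum sum.cong)
  then have ev: "(\<Sum>i\<le>n. evac (cf g i) t * evac \<phi> t ^ i) = 0" using t by simp
  have tval: "w (evac (cf g i) t * evac \<phi> t ^ i) = V (cf g i) + w (evac \<phi> t ^ i)" for i
    by (simp add: w.val_mult small)
  consider "Fin lam < w (evac \<phi> t)" | "w (evac \<phi> t) < Fin lam" using neq by (meson neqE)
  then show False
  proof cases
    case 1
    have pow: "Fin (of_nat i *\<^sub>Q lam) < w (evac \<phi> t ^ i)" if "0 < i" for i
    proof (cases "w (evac \<phi> t)")
      case (Fin x)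
      then show ?thesis using 1 that valuation_power[OF w.valuation_axioms Fin, of i] by (simp add: scaleQ_of_nat_strict_mono)
    next
      case Infty
      then have "evac \<phi> t = 0" using field_valuation_finite[OF w] by blast
      then show ?thesis using that by (simp add: power_0_left)
    qed
    have "w (\<Sum>i\<le>n. evac (cf g i) t * evac \<phi> t ^ i) = w (evac (cf g 0) t * evac \<phi> t ^ 0)"
    proof (rule w.val_sum_unique_min)
      fix i :: nat assume "i \<noteq> 0"
      have "Fin (of_nat n *\<^sub>Q lam) < V (cf g i) + w (evac \<phi> t ^ i)"
      proof (cases "V (cf g i)")
        case (Fin y)
        have "V (cf g i) + Fin (of_nat i *\<^sub>Q lam) < V (cf g i) + w (evac \<phi> t ^ i)"
          using pow \<open>i \<noteq> 0\<close> by (intro extval_add_less_mono2) (auto simp: Fin)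
        then show ?thesis using ci[of i] by (rule order.strict_trans1[rotated])
      qed simp
      then show "w (evac (cf g 0) t * evac \<phi> t ^ 0) < w (evac (cf g i) t * evac \<phi> t ^ i)"
        unfolding tval using c0 by (simp add: w.val_one)
    qed (use c0 in \<open>simp_all add: small\<close>)
    then show False using ev c0 by (simp add: small)
  next
    case 2
    then obtain x where x: "w (evac \<phi> t) = Fin x" "x < lam" by (cases "w (evac \<phi> t)") auto
    have pow: "w (evac \<phi> t ^ i) = Fin (of_nat i *\<^sub>Q x)" for i by (rule valuation_power[OF w.valuation_axioms x(1)])
    have "w (\<Sum>i\<le>n. evac (cf g i) t * evac \<phi> t ^ i) = w (evac (cf g n) t * evac \<phi> t ^ n)"
    proof (rule w.val_sum_unique_min)
      fix i :: nat assume i: "i \<in> {..n}" "i \<noteq> n"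
      have "Fin (of_nat n *\<^sub>Q x) < V (cf g i) + Fin (of_nat i *\<^sub>Q x)"
      proof (cases "V (cf g i)")
        case (Fin y)
        have "of_nat (n - i) *\<^sub>Q x < of_nat (n - i) *\<^sub>Q lam" using i x(2) by (intro scaleQ_of_nat_strict_mono) auto
        moreover have "of_nat n *\<^sub>Q z = of_nat (n - i) *\<^sub>Q z + of_nat i *\<^sub>Q z" for z :: 'g
          using i scaleQ_of_nat_add[of "n - i" i z] by simp
        moreover have "of_nat n *\<^sub>Q lam \<le> y + of_nat i *\<^sub>Q lam" using ci[of i] Fin by simp
        ultimately show ?thesis using Fin by simp
      qed simp
      then show "w (evac (cf g n) t * evac \<phi> t ^ n) < w (evac (cf g i) t * evac \<phi> t ^ i)"
        unfolding tval pow by (simp add: cn V.val_one)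
    qed (simp_all add: pow cn)
    then show False using ev pow[of n] by (simp add: cn)
  qed
qed

lemma residual_units:
  assumes lam: "lam \<in> A" and u: "unit_choice v u"
  obtains u1 u2 where "rooted_stage V \<phi> lam v w u1 u2"
    "u (augment V \<phi> lam) \<phi> =
      graded_class (augment V \<phi> lam) (of_nat (rel_ramification (augment V \<phi> lam) \<phi>) *\<^sub>Q lam) u1"
proof -
  interpret aug: augmentation V \<phi> lam by (rule A_aug[OF lam])
  let ?\<gamma> = "of_nat (rel_ramification (augment V \<phi> lam) \<phi>) *\<^sub>Q lam"
  have M: "poly_valuation (augment V \<phi> lam)" by unfold_locales (rule aug.M_valuation)
  have "inner_node v (augment V \<phi> lam)" by (rule aug.inner_nodeI[OF V_const v_val])
  then have "u (augment V \<phi> lam) \<phi> \<in> homogeneous_units (augment V \<phi> lam) ?\<gamma>"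
    using u aug.min_key_poly unfolding unit_choice_def by (metis aug.M_phi extval.sel)
  then obtain u1 where u1: "u (augment V \<phi> lam) \<phi> = graded_class (augment V \<phi> lam) ?\<gamma> u1"
    "graded_class (augment V \<phi> lam) ?\<gamma> u1 \<in> Units (graded_algebra (augment V \<phi> lam))" "Fin ?\<gamma> \<le> augment V \<phi> lam u1"
    unfolding homogeneous_units_def by auto
  obtain u2 where u2: "augment V \<phi> lam u1 = Fin ?\<gamma>" "augment V \<phi> lam u2 = Fin (- ?\<gamma>)" "0 < augment V \<phi> lam (u1 * u2 - 1)"
    using poly_valuation.graded_class_UnitE[OF M u1(2,3)] by blast
  have "rooted_stage V \<phi> lam v w u1 u2"
    by unfold_locales (use v_val v_hull V_const w_ext u2 A_roots[OF lam] in auto)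
  then show ?thesis using that u1(1) by blast
qed

end

context rooted_stage
begin

lemma KX_eq: "kappa_polys M = KX"
  by (simp only: kappa_polys_def kappa_eq)

lemma residual_of_g:
  assumes g: "Polynomial.lead_coeff g = 1" "Polynomial.degree g = n * Polynomial.degree \<phi>" "0 < n"
    and slope: "one_sided (newton_polygon V \<phi> g) lam"
  obtains d where "n = d * e" "0 < d" "rel g d (resp g d)" "length (resp g d) = Suc d"
    "Polynomials.lead_coeff (resp g d) = \<one>\<^bsub>F\<^esub>"
    "residual_poly M \<phi> (graded_class M (of_nat e *\<^sub>Q lam) u1) g = resp g d"
    "\<And>t. evac g t = 0 \<Longrightarrow> w (evac \<phi> t) = Fin lam"
proof -
  have c0: "V (cf g 0) = Fin (of_nat n *\<^sub>Q lam)"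
    and ci: "\<And>i. Fin (of_nat n *\<^sub>Q lam) \<le> V (cf g i) + Fin (of_nat i *\<^sub>Q lam)"
    using slope unfolding one_sided_iff[OF g] by auto
  have Mg: "M g = Fin (of_nat n *\<^sub>Q lam)"
  proof (rule antisym)
    show "M g \<le> Fin (of_nat n *\<^sub>Q lam)" using M_le[of g 0] c0 by (simp add: tm_def)
    show "Fin (of_nat n *\<^sub>Q lam) \<le> M g" unfolding le_M using ci by (simp add: tm_def)
  qed
  have "e dvd n" by (rule e_dvd[OF cf_small c0])
  then obtain d where d: "n = d * e" by (metis dvd_def mult.commute)
  have d0: "0 < d" using d g(3) by simp
  have elam: "of_nat d *\<^sub>Q elam = of_nat n *\<^sub>Q lam" by (simp add: elam_def scaleQ_scaleQ d)
  have dg: "Polynomial.degree g = d * e * Polynomial.degree \<phi>" using g(2) d by simp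
  have Mg': "M g = Fin (of_nat d *\<^sub>Q elam)" using Mg elam by simp
  have lead: "cf g (e * d) = 1" using expansion_coeff_monic[OF deg monic g(1), of "e * d"] dg by (simp add: mult.commute)
  have "residual_poly M \<phi> (graded_class M (of_nat e *\<^sub>Q lam) u1) g = resp g d"
    using residual_poly_eq[OF g(1) dg Mg'] c0 Mg by (simp add: elam_def)
  moreover have "Polynomials.lead_coeff (resp g d) = \<one>\<^bsub>F\<^esub>" using lead by (simp add: resp_def M.\<beta>_one)
  moreover have "length (resp g d) = Suc d" by (simp add: resp_def)
  ultimately show ?thesis
    using that[OF d d0 rel_resp[OF g(1) dg Mg']] root_slope_eq[OF g(1,2) Mg] c0 Mg by metis
qed

text \<open>If \<psi> has the lift f0, then at a root of g the power of f0 exceeds its M-value,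
  hence so does f0; thus \<psi> is in the ideal of every root. Tschirnhausen's iteration stays among
  the lifts of \<psi> and ends at the approximate root.\<close>

lemma next_stage_of_power:
  assumes g: "Polynomial.lead_coeff g = 1" "Polynomial.degree g = n * Polynomial.degree \<phi>" "0 < n"
    and slope: "one_sided (newton_polygon V \<phi> g) lam"
    and pow: "is_irreducible_power M (residual_poly M \<phi> (graded_class M (of_nat e *\<^sub>Q lam) u1) g) m"
    and vm: "\<And>m. m dvd n \<Longrightarrow> v (of_nat m) = 0"
  obtains \<psi> t0 d0 where "n = m * (d0 * e)" "0 < m" "next_stage V \<phi> lam v w u1 u2 \<psi> t0 (approx_root m g) d0"
    "expansion_coeff (approx_root m g) g (m - 1) = 0"
    "\<And>t. evac g t = 0 \<Longrightarrow> dominates t \<and> \<psi> \<in> ker_at t \<and> w (evac \<phi> t) = Fin lam"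
proof -
  obtain d where d: "n = d * e" "0 < d" "rel g d (resp g d)" "length (resp g d) = Suc d"
    "residual_poly M \<phi> (graded_class M (of_nat e *\<^sub>Q lam) u1) g = resp g d"
    "\<And>t. evac g t = 0 \<Longrightarrow> w (evac \<phi> t) = Fin lam"
    using residual_of_g[OF g slope] by metis
  obtain \<psi> where \<psi>: "\<psi> \<in> carrier KX" "ring_irreducible\<^bsub>KX\<^esub> \<psi>" "Polynomials.lead_coeff \<psi> = \<one>\<^bsub>F\<^esub>"
    "resp g d = \<psi> [^]\<^bsub>KX\<^esub> m"
    using pow unfolding is_irreducible_power_def KX_eq d(5) by blast
  have \<psi>1: "1 \<le> length \<psi> - 1" using M.F.pirreducible_degree[OF \<kappa>_subfield \<psi>(1,2)] .
  define d0 where "d0 = length \<psi> - 1"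
  have len: "length \<psi> = Suc d0" "\<psi> \<noteq> []" using \<psi>1 by (auto simp: d0_def)
  \<comment> \<open>Coefficient lists are one longer than the degree, so this compares degrees and
    gives d = m d0.\<close>
  have "length (\<psi> [^]\<^bsub>KX\<^esub> m) - 1 = m * (length \<psi> - 1)"
    using M.F.subring_polynomial_pow_degree[OF subfieldE(1)[OF \<kappa>_subfield] \<psi>(1)] .
  then have dm: "d = m * d0" using d(4) \<psi>(4) by (simp add: d0_def)
  then have m0: "0 < m" using d(2) by simp
  have mn: "n = m * (d0 * e)" using dm d(1) by simp
  have vm: "v (of_nat m) = 0" using vm mn by simp
  then have m_nz: "of_nat m \<noteq> (0 :: 'a)" by auto
  obtain f0 where f0: "rel f0 d0 \<psi>" using rel_lift[OF \<psi>(1) len(2) \<psi>(3)] by (metis d0_def)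
  note f0' = relD[OF f0]
  have relg: "rel g (m * d0) (\<psi> [^]\<^bsub>KX\<^esub> m)" using d(3) \<psi>(4) dm by simp
  have roots: "dominates t \<and> \<psi> \<in> ker_at t \<and> w (evac \<phi> t) = Fin lam" if t: "evac g t = 0" for t
  proof -
    note t' = rel_root_props(1,2)[OF relg t]
    have less: "M (f0 ^ m) < w (evac (f0 ^ m) t)" using rel_root[OF rel_power[OF f0] t'(1)] t'(2) by simp
    have "M f0 < w (evac f0 t)"
    proof (rule ccontr)
      assume "\<not> ?thesis"
      then have "w (evac f0 t) = M f0" using dominatesD[OF t'(1), of f0] by simp
      then have "w (evac f0 t) = Fin (of_nat d0 *\<^sub>Q elam)" using f0'(3) by simp
      then show False using less valuation_power[OF M.valuation_axioms f0'(3), of m]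
          valuation_power[OF w.valuation_axioms, of "evac f0 t" _ m] by simp
    qed
    then show ?thesis using rel_root[OF f0 t'(1)] t'(1) d(6)[OF t] by simp
  qed
  have "0 < Polynomial.degree g" using g(2,3) deg by simp
  then obtain t0 where t0: "evac g t0 = 0" by (rule evac_root_exists)
  have ns: "next_stage V \<phi> lam v w u1 u2 \<psi> t0 P d0" if "rel P d0 \<psi>" for P
    by unfold_locales (use \<psi> len roots[OF t0] that in auto)
  let ?D = "d0 * e * Polynomial.degree \<phi>"
  have D: "0 < ?D" using \<psi>1 e_pos deg by (simp add: d0_def)
  have dg: "Polynomial.degree g = m * ?D" using g(2) mn by simp
  obtain Q where Q: "rel Q d0 \<psi>" "expansion_coeff Q g (m - 1) = 0"
  proof -
    have "\<exists>Q\<in>{P. rel P d0 \<psi>}. expansion_coeff Q g (m - 1) = 0"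
    proof (rule approx_root_iterate[OF _ _ _ D g(1) dg m_nz])
      show "f0 \<in> {P. rel P d0 \<psi>}" using f0 by simp
      fix P assume "P \<in> {P. rel P d0 \<psi>}"
      then have P: "rel P d0 \<psi>" by simp
      show "Polynomial.lead_coeff P = 1 \<and> Polynomial.degree P = ?D" using relD(1,2)[OF P] by simp
      show "P + smult (inverse (of_nat m)) (expansion_coeff P g (m - 1)) \<in> {P. rel P d0 \<psi>}"
        using next_stage.tschirnhausen_step[OF ns[OF P] relg m0 vm] by simp
    qed
    then show thesis using that by blast
  qed
  have "approx_root m g = Q"
    by (rule approx_root_eqI[OF relD(1,2)[OF Q(1)] Q(2) D g(1) dg m_nz])
  then show ?thesis using that[OF mn m0 _ _ roots] ns[OF Q(1)] Q(2) by simp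
qed

end


text \<open>For \<phi> = x small polynomials are constants: products carry nothing, and w extends v
  on them at any point, so every slope is admissible.\<close>

lemma stage_base:
  fixes v :: "'a::field \<Rightarrow> 'g::linordered_rat_vector extval"
  assumes v: "is_valuation v" "divisible_hull_of_values v" and w: "extends_val v w"
  shows "stage (ground v) [:0, 1:] v w UNIV"
proof -
  interpret vv: valuation v by unfold_locales fact
  have g: "is_valuation (ground v)"
    unfolding is_valuation_def ground_def using vv.val_add by (simp add: vv.val_mult vv.val_one coeff_mult_0)
  have ks: "key_stage (ground v) [:0, 1:]"
  proof
    show "is_valuation (ground v)" by (rule g)
    show "ground v f = Infty \<longleftrightarrow> [:0, 1:] dvd f" for f
      using field_valuation_finite[OF v(1), of "coeff f 0"] poly_eq_0_iff_dvd[of f 0] by (simp add: ground_def poly_0_coeff_0)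
  qed simp_all
  have small: "\<exists>k. a = [:k:]" if "Polynomial.degree a < Polynomial.degree ([:0, 1:] :: 'a poly)" for a :: "'a poly"
    using that by (auto elim: degree_eq_zeroE)
  show ?thesis
  proof (intro stage.intro[OF ks] stage_axioms.intro)
    fix x show "augmentation (ground v) [:0, 1:] x"
    proof (intro augmentation.intro[OF ks] augmentation_axioms.intro)
      fix a b :: "'a poly"
      assume ab: "Polynomial.degree a < Polynomial.degree ([:0, 1:] :: 'a poly)" "Polynomial.degree b < Polynomial.degree ([:0, 1:] :: 'a poly)" "a \<noteq> 0" "b \<noteq> 0"
      obtain k l where kl: "a = [:k:]" "b = [:l:]" using small ab(1,2) by metis
      then have "v k \<noteq> Infty" "v l \<noteq> Infty" using ab(3,4) field_valuation_finite[OF v(1)] by auto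
      moreover have "(a * b) div [:0, 1:] = 0" using kl by (intro div_poly_less) simp
      ultimately show "ground v a + ground v b < ground v ((a * b) div [:0, 1:]) + Fin x"
        by (cases "v k"; cases "v l") (auto simp: ground_def kl)
    qed
  next
    fix x :: 'g and f a :: "'a poly" and r t
    assume "Polynomial.degree a < Polynomial.degree ([:0, 1:] :: 'a poly)"
    then obtain k where "a = [:k:]" using small by blast
    then show "w (evac a t) = ground v a" using w by (simp add: ground_def extends_val_def)
  qed (use v w in \<open>auto simp: ground_def\<close>)
qed

text \<open>\<mu> is the valuation held by the procedure, V the one used to reason about it. They
  need to agree only below deg \<phi>, as augmentations and polygons read digits only. The slope
  clause is conditional, because \<phi> may vanish at a root of g.\<close>

definition loop_invariant where
  "loop_invariant v w g \<mu> \<phi> V A n \<longleftrightarrow> stage V \<phi> v w A \<and>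
    (\<forall>a. Polynomial.degree a < Polynomial.degree \<phi> \<longrightarrow> \<mu> a = V a) \<and>
    Polynomial.degree g = n * Polynomial.degree \<phi> \<and>
    (\<forall>t. evac g t = 0 \<longrightarrow> (\<forall>a. Polynomial.degree a < Polynomial.degree \<phi> \<longrightarrow> w (evac a t) = V a) \<and>
      (\<forall>lam. w (evac \<phi> t) = Fin lam \<longrightarrow> lam \<in> A)) \<and>
    (\<forall>lam\<in>A. (\<mu> = ground v \<and> \<phi> = [:0, 1:]) \<or> (\<mu> \<in> val_tree v \<and> \<phi> \<in> key_polys \<mu> \<and> \<mu> \<phi> < Fin lam))"

locale procedure =
  fixes v :: "'a::field \<Rightarrow> 'g::linordered_rat_vector extval" and w :: "'a alg_closure \<Rightarrow> 'g extval"
    and u :: "('a poly \<Rightarrow> 'g extval) \<Rightarrow> 'a poly \<Rightarrow> ('g \<Rightarrow>\<^sub>0 'a poly) set" and g :: "'a poly"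
  assumes v: "is_valuation v" "divisible_hull_of_values v" and w: "extends_val v w" and u: "unit_choice v u"
    and g: "Polynomial.lead_coeff g = 1" "squarefree g" and deg_g: "0 < Polynomial.degree g"
    and tame: "m dvd Polynomial.degree g \<Longrightarrow> v (of_nat m) = 0"
begin

definition "Eq \<longleftrightarrow> (\<forall>t t'. evac g t = 0 \<longrightarrow> evac g t' = 0 \<longrightarrow> (\<forall>f. w (evac f t) = w (evac f t')))"

lemma w_val: "is_valuation w" using w by (simp add: extends_val_def)

lemma tame_nz: "m dvd Polynomial.degree g \<Longrightarrow> of_nat m \<noteq> (0 :: 'a)"
  using tame[of m] field_valuation_finite[OF v(1), of 0] by auto

text \<open>The coefficient of index deg g - 1 of the derivative is deg g, which is nonzero in
  K.\<close>

lemma pderiv_nz: "pderiv g \<noteq> 0"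
proof
  assume "pderiv g = 0"
  then have "coeff (pderiv g) (Polynomial.degree g - 1) = 0" by simp
  then show False using deg_g g(1) tame_nz[of "Polynomial.degree g"] by (simp add: coeff_pderiv)
qed

lemmas henselian = irreducible_over_henselization_iff[OF w_val g pderiv_nz]

context
  fixes \<mu> \<phi> V A n
  assumes inv: "loop_invariant v w g \<mu> \<phi> V A n" and n: "0 < n"
begin

interpretation st: stage V \<phi> v w A using inv by (simp add: loop_invariant_def)

lemma inv_deg: "Polynomial.degree g = n * Polynomial.degree \<phi>"
  and inv_small: "Polynomial.degree a < Polynomial.degree \<phi> \<Longrightarrow> \<mu> a = V a"
  and inv_roots: "evac g t = 0 \<Longrightarrow> Polynomial.degree a < Polynomial.degree \<phi> \<Longrightarrow> w (evac a t) = V a"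
  and inv_slope: "evac g t = 0 \<Longrightarrow> w (evac \<phi> t) = Fin lam \<Longrightarrow> lam \<in> A"
  using inv by (auto simp: loop_invariant_def)

lemma inv_key: "lam \<in> A \<Longrightarrow> (\<mu> = ground v \<and> \<phi> = [:0, 1:]) \<or> (\<mu> \<in> val_tree v \<and> \<phi> \<in> key_polys \<mu> \<and> \<mu> \<phi> < Fin lam)"
  using inv unfolding loop_invariant_def by blast

lemma inv_augment: "augment \<mu> \<phi> lam = augment V \<phi> lam"
  by (intro ext) (simp add: augment_def inv_small expansion_coeff_small[OF st.deg])

lemma inv_newton: "newton_polygon \<mu> \<phi> g = newton_polygon V \<phi> g"
  by (simp add: newton_polygon_def inv_small expansion_coeff_small[OF st.deg])

lemma slope_mem:
  assumes "one_sided (newton_polygon \<mu> \<phi> g) lam" shows "lam \<in> A"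
proof -
  obtain t where t: "evac g t = 0" using evac_root_exists[OF deg_g] by blast
  show ?thesis
    using inv_slope[OF t st.slope_of_roots[OF g(1) inv_deg n _ t inv_roots[OF t]]] assms by (simp add: inv_newton)
qed

lemma augmentable:
  assumes "one_sided (newton_polygon \<mu> \<phi> g) lam" shows "augmentable v \<mu> \<phi> lam"
proof -
  have lam: "lam \<in> A" by (rule slope_mem[OF assms])
  interpret aug: augmentation V \<phi> lam by (rule st.A_aug[OF lam])
  show ?thesis
    unfolding augmentable_def inv_augment
    using inv_key[OF lam] aug.inner_nodeI[OF st.V_const v(1)] aug.min_key_poly by blast
qed

lemma Eq_if_done: "n = 1 \<Longrightarrow> Eq"
proof -
  assume "n = 1"
  then have "Polynomial.degree \<phi> = Polynomial.degree g" using inv_deg by simp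
  moreover have "Polynomial.degree (f mod g) < Polynomial.degree g" for f
    using degree_mod_less[of g f] deg_g by (cases "f mod g = 0"; cases "g = 0") auto
  ultimately have "w (evac f t) = V (f mod g)" if t: "evac g t = 0" for f t
  proof -
    have "evac f t = evac (f div g * g + f mod g) t" by (simp only: div_mult_mod_eq)
    also have "\<dots> = evac (f mod g) t" by (simp only: evac_add evac_mult t mult_zero_right add_0_left)
    finally show ?thesis using inv_roots[OF t] \<open>Polynomial.degree (f mod g) < Polynomial.degree g\<close>
        \<open>Polynomial.degree \<phi> = Polynomial.degree g\<close> by simp
  qed
  then show Eq by (simp add: Eq_def)
qed

lemma one_sided_if_Eq:
  assumes Eq "1 < n" shows "\<exists>lam. one_sided (newton_polygon \<mu> \<phi> g) lam"
proof -
  obtain t where t: "evac g t = 0" using evac_root_exists[OF deg_g] by blast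
  have I: "ring_irreducible\<^bsub>polys_over (henselization w)\<^esub> (map_poly to_ac g)"
    using henselian(1) assms(1) unfolding Eq_def by blast
  \<comment> \<open>This makes the common value of \<phi> at the roots finite, hence a possible
    slope. It uses that g is then irreducible over K, of degree larger than deg \<phi>.\<close>
  have "evac \<phi> t \<noteq> 0"
  proof
    assume "evac \<phi> t = 0"
    then have "g dvd \<phi>" by (rule henselian(2)[OF I t])
    moreover have "\<phi> \<noteq> 0" using st.deg by auto
    ultimately have "Polynomial.degree g \<le> Polynomial.degree \<phi>" by (rule dvd_imp_degree_le)
    then show False using inv_deg assms(2) st.deg by simp
  qed
  then obtain lam where lam: "w (evac \<phi> t) = Fin lam" using field_valuation_finite[OF w_val] by (cases "w (evac \<phi> t)") auto
  have "w (evac \<phi> t') = Fin lam" if "evac g t' = 0" for t' using assms(1) lam t that unfolding Eq_def by metis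
  from st.one_sided_of_constant_slope[OF inv_slope[OF t lam] g(1) inv_deg n this] show ?thesis
    unfolding inv_newton by blast
qed

lemma power_if_Eq:
  assumes Eq and lam: "one_sided (newton_polygon \<mu> \<phi> g) lam"
  shows "\<exists>m. is_irreducible_power (augment \<mu> \<phi> lam) (residual_poly (augment \<mu> \<phi> lam) \<phi> (u (augment \<mu> \<phi> lam) \<phi>) g) m"
proof -
  obtain u1 u2 where rs: "rooted_stage V \<phi> lam v w u1 u2"
    "u (augment V \<phi> lam) \<phi> = graded_class (augment V \<phi> lam) (of_nat (rel_ramification (augment V \<phi> lam) \<phi>) *\<^sub>Q lam) u1"
    using st.residual_units[OF slope_mem[OF lam] u] by blast
  interpret rs: rooted_stage V \<phi> lam v w u1 u2 by fact
  obtain d where d: "0 < d" "rs.rel g d (rs.resp g d)" "length (rs.resp g d) = Suc d"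
    "Polynomials.lead_coeff (rs.resp g d) = \<one>\<^bsub>rs.F\<^esub>"
    "residual_poly (augment V \<phi> lam) \<phi> (graded_class (augment V \<phi> lam) (of_nat rs.e *\<^sub>Q lam) u1) g = rs.resp g d"
    using rs.residual_of_g[OF g(1) inv_deg n lam[unfolded inv_newton]] by metis
  have "w (evac f t) = w (evac f t')" if "evac g t = 0" "evac g t' = 0" for t t' f
    using assms(1) that unfolding Eq_def by blast
  from rs.residual_power[OF d(2,3,4,1) this] obtain \<psi> m where
    "\<psi> \<in> carrier rs.KX" "Polynomials.lead_coeff \<psi> = \<one>\<^bsub>rs.F\<^esub>" "ring_irreducible\<^bsub>rs.KX\<^esub> \<psi>"
    "rs.resp g d = \<psi> [^]\<^bsub>rs.KX\<^esub> (m::nat)" by blast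
  then show ?thesis unfolding inv_augment rs(2) d(5) is_irreducible_power_def rs.KX_eq by blast
qed

lemma invariant_next:
  assumes lam: "one_sided (newton_polygon \<mu> \<phi> g) lam"
    and pow: "is_irreducible_power (augment \<mu> \<phi> lam) (residual_poly (augment \<mu> \<phi> lam) \<phi> (u (augment \<mu> \<phi> lam) \<phi>) g) m"
  shows "\<exists>V' A'. loop_invariant v w g (augment \<mu> \<phi> lam) (approx_root m g) V' A' m"
    "expansion_coeff (approx_root m g) g (m - 1) = 0" "0 < m" "m dvd n"
    "expansion_coeff \<phi> g (n - 1) = 0 \<Longrightarrow> m < n"
proof -
  obtain u1 u2 where rs: "rooted_stage V \<phi> lam v w u1 u2"
    "u (augment V \<phi> lam) \<phi> = graded_class (augment V \<phi> lam) (of_nat (rel_ramification (augment V \<phi> lam) \<phi>) *\<^sub>Q lam) u1"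
    using st.residual_units[OF slope_mem[OF lam] u] by blast
  interpret rs: rooted_stage V \<phi> lam v w u1 u2 by fact
  have vn: "v (of_nat k) = 0" if "k dvd n" for k using tame that inv_deg by simp
  obtain \<psi> t0 d0 where ns: "n = m * (d0 * rs.e)" "0 < m" "next_stage V \<phi> lam v w u1 u2 \<psi> t0 (approx_root m g) d0"
    "expansion_coeff (approx_root m g) g (m - 1) = 0"
    "\<And>t. evac g t = 0 \<Longrightarrow> rs.dominates t \<and> \<psi> \<in> rs.ker_at t \<and> w (evac \<phi> t) = Fin lam"
    using rs.next_stage_of_power[OF g(1) inv_deg n lam[unfolded inv_newton] pow[unfolded inv_augment rs(2)] vn] by metis
  define Q where "Q = approx_root m g"
  interpret ns: next_stage V \<phi> lam v w u1 u2 \<psi> t0 Q d0 unfolding Q_def by (rule ns(3))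
  show "expansion_coeff (approx_root m g) g (m - 1) = 0" "0 < m" "m dvd n" using ns by auto
  \<comment> \<open>Q lifts \<psi>, which lies in the ideal of every root of g. So the next slope
    exceeds the present value of Q, as the next augmentation requires.\<close>
  have above: "augment V \<phi> lam Q < w (evac Q t)" if "evac g t = 0" for t
    using rs.rel_root[OF ns.Q] ns(5)[OF that] by blast
  have dQ: "Polynomial.degree g = m * Polynomial.degree Q" using inv_deg ns(1) ns.Q_deg(1) by simp
  have "stage ns.VQ Q v w {\<tau>. augment V \<phi> lam Q < Fin \<tau>}"
  proof (intro stage.intro[OF ns.nx.key_stage_axioms] stage_axioms.intro)
    show "is_valuation v" "divisible_hull_of_values v" "extends_val v w" by (rule v w)+
    show "ns.VQ [:k:] = v k" for k by (rule ns.VQ_const)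
    show "y \<in> {\<tau>. augment V \<phi> lam Q < Fin \<tau>}" if "x \<in> {\<tau>. augment V \<phi> lam Q < Fin \<tau>}" "x \<le> y" for x y
    proof -
      have "augment V \<phi> lam Q < Fin x" "Fin x \<le> Fin y" using that by simp_all
      then have "augment V \<phi> lam Q < Fin y" by (rule order.strict_trans2)
      then show ?thesis by simp
    qed
    show "augmentation ns.VQ Q x" if "x \<in> {\<tau>. augment V \<phi> lam Q < Fin \<tau>}" for x
      using that unfolding mem_Collect_eq by (rule ns.next_augmentation)
    fix x and f a :: "'a poly" and r t
    assume x: "x \<in> {\<tau>. augment V \<phi> lam Q < Fin \<tau>}" and f: "Polynomial.lead_coeff f = 1"
      "Polynomial.degree f = r * Polynomial.degree Q" "augment ns.VQ Q x f = Fin (of_nat r *\<^sub>Q x)" "evac f t = 0"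
      "Polynomial.degree a < Polynomial.degree Q"
    from x have "augment V \<phi> lam Q < Fin x" unfolding mem_Collect_eq .
    from ns.next_roots[OF this f] show "w (evac a t) = ns.VQ a" .
  qed
  moreover have "augment V \<phi> lam \<in> val_tree v"
    using rs.M_valuation rs.M_small st.deg by (simp add: val_tree_def st.V_const)
  moreover have "w (evac a t) = ns.VQ a" if "evac g t = 0" "Polynomial.degree a < Polynomial.degree Q" for t a
    using ns.value_below_Q[of t a] ns(5)[OF that(1)] that(2) unfolding ns.VQ_small[OF that(2)] by blast
  moreover have "tau \<in> {\<tau>. augment V \<phi> lam Q < Fin \<tau>}" if "evac g t = 0" "w (evac Q t) = Fin tau" for t tau
    using above[OF that(1)] unfolding that(2) mem_Collect_eq .
  ultimately have "loop_invariant v w g (augment V \<phi> lam) Q ns.VQ {\<tau>. augment V \<phi> lam Q < Fin \<tau>} m"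
    unfolding loop_invariant_def using ns.VQ_small[symmetric] dQ ns.next_key_poly by (simp only: mem_Collect_eq) blast
  then show "\<exists>V' A'. loop_invariant v w g (augment \<mu> \<phi> lam) (approx_root m g) V' A' m"
    unfolding inv_augment Q_def by blast
  \<comment> \<open>If m = n, then Q and \<phi> are approximate roots of g of the same degree, hence
    equal. But at a root of g the value of Q exceeds the M-value of Q, whereas that of \<phi> is
    exactly lam, its M-value.\<close>
  show "m < n" if phi: "expansion_coeff \<phi> g (n - 1) = 0"
  proof (rule ccontr)
    assume "\<not> m < n"
    then have "m = n" using ns(1,2) n by (metis dvd_imp_le dvd_triv_left nat_less_le)
    then have "Polynomial.degree Q = Polynomial.degree \<phi>" using dQ inv_deg n by simp
    moreover have "expansion_coeff Q g (n - 1) = 0" using ns(4) \<open>m = n\<close> by (simp add: Q_def)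
    ultimately have "Q = \<phi>"
      using approx_root_unique[OF ns.Q_props(1) _ _ st.monic refl phi st.deg g(1) inv_deg] tame_nz[of n] inv_deg by simp
    moreover obtain t where "evac g t = 0" using evac_root_exists[OF deg_g] by blast
    ultimately show False using above[of t] ns(5)[of t] rs.M_phi by simp
  qed
qed

end

text \<open>The bound is kept as a power of two, so that the induction stays in the natural numbers;
  the logarithm is taken at the very end.\<close>

definition "outcome \<mu> \<phi> n B \<longleftrightarrow> (\<exists>s b. run v g u \<mu> \<phi> n s b) \<and>
  (\<forall>s b. run v g u \<mu> \<phi> n s b \<longrightarrow> 2 ^ s \<le> B \<and> (b \<longleftrightarrow> Eq))" for B :: nat

lemma outcome_step:
  assumes inv: "loop_invariant v w g \<mu> \<phi> V A n" and n: "0 < n"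
    and B: "n \<le> B" and next_outcome: "\<And>\<mu>' Q V' A' m. loop_invariant v w g \<mu>' Q V' A' m \<Longrightarrow> expansion_coeff Q g (m - 1) = 0 \<Longrightarrow>
      0 < m \<Longrightarrow> m dvd n \<Longrightarrow> (expansion_coeff \<phi> g (n - 1) = 0 \<Longrightarrow> m < n) \<Longrightarrow> outcome \<mu>' Q m m \<and> 2 * m \<le> B"
  shows "outcome \<mu> \<phi> n B"
proof -
  note inv' = inv n
  have iter: "outcome (augment \<mu> \<phi> lam) (approx_root m g) m m \<and> 2 * m \<le> B"
    if "one_sided (newton_polygon \<mu> \<phi> g) lam"
      "is_irreducible_power (augment \<mu> \<phi> lam) (residual_poly (augment \<mu> \<phi> lam) \<phi> (u (augment \<mu> \<phi> lam) \<phi>) g) m" for lam m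
  proof -
    note i = invariant_next[OF inv n that]
    obtain V' A' where "loop_invariant v w g (augment \<mu> \<phi> lam) (approx_root m g) V' A' m" using i(1) by blast
    then show ?thesis using i(2-5) by (intro next_outcome) auto
  qed
  have "\<exists>s b. run v g u \<mu> \<phi> n s b"
  proof (cases "1 < n")
    case False
    then show ?thesis using run.loop_end by blast
  next
    case n1: True
    show ?thesis
    proof (cases "\<exists>lam. one_sided (newton_polygon \<mu> \<phi> g) lam")
      case False
      then show ?thesis using run.not_one_sided[OF n1] by blast
    next
      case True
      then obtain lam where lam: "one_sided (newton_polygon \<mu> \<phi> g) lam" by blast
      note aug = augmentable[OF inv n lam]
      show ?thesis
      proof (cases "\<exists>m. is_irreducible_power (augment \<mu> \<phi> lam) (residual_poly (augment \<mu> \<phi> lam) \<phi> (u (augment \<mu> \<phi> lam) \<phi>) g) m")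
        case False
        then show ?thesis using run.not_irreducible_power[OF n1 lam aug refl] by blast
      next
        case True
        then obtain m where m: "is_irreducible_power (augment \<mu> \<phi> lam) (residual_poly (augment \<mu> \<phi> lam) \<phi> (u (augment \<mu> \<phi> lam) \<phi>) g) m"
          by blast
        obtain s b where "run v g u (augment \<mu> \<phi> lam) (approx_root m g) m s b"
          using iter[OF lam m] unfolding outcome_def by blast
        moreover have "m dvd Polynomial.degree g" using invariant_next(4)[OF inv n lam m] inv_deg[OF inv n] by simp
        moreover have "\<not> CHAR('a) dvd m" using tame_nz[OF \<open>m dvd Polynomial.degree g\<close>] by (simp add: of_nat_eq_0_iff_char_dvd)
        ultimately have "run v g u \<mu> \<phi> n (Suc s) b"
          by (intro run.iterate[OF n1 lam aug refl]) (use m in simp_all)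
        then show ?thesis by blast
      qed
    qed
  qed
  moreover have "2 ^ s \<le> B \<and> (b \<longleftrightarrow> Eq)" if "run v g u \<mu> \<phi> n s b" for s b
    using that
  proof (cases rule: run.cases)
    case loop_end
    then show ?thesis using Eq_if_done[OF inv n] n B by simp
  next
    case not_one_sided
    then show ?thesis using one_sided_if_Eq[OF inv n] B by auto
  next
    case (not_irreducible_power lam \<mu>')
    then show ?thesis using power_if_Eq[OF inv n] B by auto
  next
    case (iterate lam \<mu>' m s')
    then have "2 ^ s' \<le> m \<and> (b \<longleftrightarrow> Eq)" "2 * m \<le> B" using iter[of lam m] unfolding outcome_def by auto
    then show ?thesis using iterate(1) by simp
  qed
  ultimately show ?thesis unfolding outcome_def by blast
qed

lemma outcome_approx:
  "loop_invariant v w g \<mu> \<phi> V A n \<Longrightarrow> 0 < n \<Longrightarrow> expansion_coeff \<phi> g (n - 1) = 0 \<Longrightarrow> outcome \<mu> \<phi> n n"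
proof (induction n arbitrary: \<mu> \<phi> V A rule: less_induct)
  case (less n)
  show ?case
  proof (rule outcome_step[OF less.prems(1,2) order_refl])
    fix \<mu>' Q V' A' m
    assume m: "loop_invariant v w g \<mu>' Q V' A' m" "expansion_coeff Q g (m - 1) = 0" "0 < m" "m dvd n"
      "expansion_coeff \<phi> g (n - 1) = 0 \<Longrightarrow> m < n"
    then have "m < n" using less.prems(3) by simp
    \<comment> \<open>A proper divisor m of n satisfies 2m \<le> n, which pays for one pass.\<close>
    obtain k where "n = m * k" using m(4) by blast
    moreover have "k \<noteq> 0" "k \<noteq> 1" using \<open>n = m * k\<close> \<open>m < n\<close> by auto
    then have "2 \<le> k" by linarith
    ultimately have "2 * m \<le> n" by (metis mult.commute mult_le_mono1)
    then show "outcome \<mu>' Q m m \<and> 2 * m \<le> n" using less.IH[OF \<open>m < n\<close> m(1,3,2)] by simp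
  qed
qed

text \<open>Since x need not be an approximate root of g, the first pass may leave n unchanged; this
  costs the factor 2. From then on \<open>outcome_approx\<close> applies.\<close>

lemma outcome_start: "outcome (ground v) [:0, 1:] (Polynomial.degree g) (2 * Polynomial.degree g)"
proof (rule outcome_step)
  interpret stage "ground v" "[:0, 1:]" v w UNIV by (rule stage_base[OF v w])
  have small: "w (evac a t) = ground v a" if "Polynomial.degree a < Polynomial.degree ([:0, 1:] :: 'a poly)" for a t
  proof -
    have "Polynomial.degree a = 0" using that by simp
    then obtain k where "a = [:k:]" by (rule degree_eq_zeroE)
    then show ?thesis using w by (simp add: ground_def extends_val_def)
  qed
  show "loop_invariant v w g (ground v) [:0, 1:] (ground v) UNIV (Polynomial.degree g)"
    unfolding loop_invariant_def using stage_axioms small stage_base[OF v w] by simp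
  fix \<mu>' Q V' A' m
  assume m: "loop_invariant v w g \<mu>' Q V' A' m" "expansion_coeff Q g (m - 1) = 0" "0 < m" "m dvd Polynomial.degree g"
  show "outcome \<mu>' Q m m \<and> 2 * m \<le> 2 * Polynomial.degree g"
    using outcome_approx[OF m(1,3,2)] dvd_imp_le[OF m(4) deg_g] by simp
qed (use deg_g in simp_all)

end

theorem mainTheorem3:
  fixes v :: "'a::field \<Rightarrow> 'g::linordered_rat_vector extval"
    and w :: "'a alg_closure \<Rightarrow> 'g extval"
    and u :: "('a poly \<Rightarrow> 'g extval) \<Rightarrow> 'a poly \<Rightarrow> ('g \<Rightarrow>\<^sub>0 'a poly) set"
    and g :: "'a poly"
  assumes "is_valuation v" and "divisible_hull_of_values v"
    and "extends_val v w"
    and "unit_choice v u"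
    and "Polynomial.lead_coeff g = 1" and "squarefree g"
    and "\<not> ring_char (residue_field v) dvd Polynomial.degree g"
  shows "(\<exists>s b. run v g u (ground v) [:0, 1:] (Polynomial.degree g) s b) \<and>
    (\<forall>s b. run v g u (ground v) [:0, 1:] (Polynomial.degree g) s b \<longrightarrow>
       real s \<le> 1 + log 2 (real (Polynomial.degree g)) \<and>
       (b \<longleftrightarrow> ring_irreducible\<^bsub>polys_over (henselization w)\<^esub> (map_poly to_ac g)))"
proof -
  \<comment> \<open>Degree zero is excluded because every natural number divides zero.\<close>
  have deg: "0 < Polynomial.degree g" using assms(7) by (cases "Polynomial.degree g") auto
  interpret procedure v w u g
    by unfold_locales (use assms deg value_of_degree[OF assms(1,7)] in auto)
  have bound: "real s \<le> 1 + log 2 (real (Polynomial.degree g))" if "2 ^ s \<le> 2 * Polynomial.degree g" for s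
  proof -
    have "real (2 ^ s) \<le> real (2 * Polynomial.degree g)" using that by (simp only: of_nat_le_iff)
    then have "log 2 (2 ^ s) \<le> log 2 (2 * real (Polynomial.degree g))" using deg by (subst log_le_cancel_iff) auto
    then show ?thesis using deg by (simp add: log_mult log_nat_power)
  qed
  have "Eq \<longleftrightarrow> ring_irreducible\<^bsub>polys_over (henselization w)\<^esub> (map_poly to_ac g)"
    using henselian(1) unfolding Eq_def .
  then show ?thesis using outcome_start bound unfolding outcome_def by blast
qed

end
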